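(* Let $\mathfrak g=W(1,1)$ be the Witt algebra over an algebraically closed field $k$ of characteristic $p\ge 5$ and let $\chi\in\mathfrak g^*$ have height $r(\chi)=0$. Assume $0\le\lambda,\mu\le p-2$ (all equations in $\lambda,\mu$ below are read in $\mathbb F_p$). (a) For $p=5$, $$\operatorname{Ext}^1_{u(\mathfrak g,\chi)}(L(\mu),L(\lambda))\cong\begin{cases}k&\text{if }\lambda-\mu=2,3\text{ or }(\mu,\lambda)=(0,0),(1,0),(0,1),\\0&\text{otherwise.}\end{cases}$$ (b) For $p\ge 7$, $\operatorname{Ext}^1_{u(\mathfrak g,\chi)}(L(\mu),L(\lambda))\cong k$ if (i) $\lambda-\mu=2,3,4$; or (ii) $(\mu,\lambda)=(0,0),(0,1)$ or $(-5,0)$; or (iii) $2\lambda^2-10\lambda+3=0$ and $\lambda-\mu=6$. Otherwise $\operatorname{Ext}^1_{u(\mathfrak g,\chi)}(L(\mu),L(\lambda))=0$.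
   Context: $W(1,1)$ is the $p$-dimensional restricted Lie algebra over $k$ with basis $\{e_i\mid -1\le i\le p-2\}$, bracket $[e_i,e_j]=(j-i)e_{i+j}$ (with $e_{i+j}:=0$ if $i+j\notin\{-1,\dots,p-2\}$) and $p$-mapping $e_i^{[p]}=\delta_{i0}e_i$. Put $\mathfrak g_i=\operatorname{span}(e_i,\dots,e_{p-2})$ for $-1\le i\le p-2$, $\mathfrak b^+=\mathfrak g_0$, $\mathfrak n^+=\mathfrak g_1$. The height of $\chi\in\mathfrak g^*$ is $r(\chi)=\min\{i\mid -1\le i\le p-2,\ \chi|_{\mathfrak g_i}=0\}$ if $\chi(e_{p-2})=0$, and $r(\chi)=p-1$ if $\chi(e_{p-2})\ne0$. Thus $r(\chi)=0$ means $\chi\neq 0$ and $\chi(\mathfrak b^+)=0$. For a restricted Lie algebra $\mathfrak h$ and $\chi\in\mathfrak h^*$, the reduced enveloping algebra is $u(\mathfrak h,\chi)=U(\mathfrak h)/(x^p-x^{[p]}-\chi(x)^p: x\in\mathfrak h)$, and $u(\mathfrak h)=u(\mathfrak h,0)$. When $r(\chi)=0$, $u(\mathfrak b^+,\chi)=u(\mathfrak b^+)$; for $\lambda\in\mathbb F_p$ let $\lambda$ also denote the one-dimensional $u(\mathfrak b^+)$-module on which $e_0$ acts by $\lambda$ and $\mathfrak n^+$ acts by $0$, and set $L(\lambda)=u(\mathfrak g,\chi)\otimes_{u(\mathfrak b^+)}\lambda$. These are $p$-dimensional simple modules, and $L(0),\dots,L(p-2)$ is a complete set of pairwise non-isomorphic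 simple $u(\mathfrak g,\chi)$-modules (with $L(p-1)\cong L(0)$). *)

theory Defs
  imports "HOL-Computational_Algebra.Polynomial" "HOL-Number_Theory.Cong"
    "HOL-Algebra.QuotRing" "HOL-Algebra.Module" "HOL-Algebra.Generated_Groups"
    "HOL-Algebra.Free_Abelian_Groups"
begin

section \<open>Quotients and isomorphisms of modules\<close>

text \<open>
  The ground field is a type \<open>'k\<close>. A \<open>('k, 'a) module\<close> record serves both as an associative
  \<open>'k\<close>-algebra (all fields) and, for a ring \<open>A\<close> with elements of type \<open>'a\<close>, an \<open>('a, 'm) module\<close>
  record serves as a left \<open>A\<close>-module (the fields \<open>mult\<close> and \<open>one\<close> are then irrelevant). The locale
  \<open>module\<close> of the library is not used because it requires a commutative ring of scalars.
  In \<open>quot M S\<close>, \<open>S\<close> is a two-sided ideal if \<open>M\<close> is an algebra, and a submodule if \<open>M\<close> is a module.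
\<close>

definition quot :: "('r, 'm) module \<Rightarrow> 'm set \<Rightarrow> ('r, 'm set) module" where
  "quot M S = \<lparr> carrier = carrier (M Quot S), mult = mult (M Quot S), one = one (M Quot S),
     ring.zero = ring.zero (M Quot S), ring.add = ring.add (M Quot S),
     smult = (\<lambda>c X. \<Union>x\<in>X. S +>\<^bsub>M\<^esub> (c \<odot>\<^bsub>M\<^esub> x)) \<rparr>"

definition iso_to_ground_field :: "('k::field, 'm) module \<Rightarrow> bool" where
  "iso_to_ground_field V \<longleftrightarrow> (\<exists>\<phi>. bij_betw \<phi> (carrier V) (UNIV :: 'k set) \<and>
     (\<forall>x\<in>carrier V. \<forall>y\<in>carrier V. \<phi> (x \<oplus>\<^bsub>V\<^esub> y) = \<phi> x + \<phi> y) \<and>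
     (\<forall>c. \<forall>x\<in>carrier V. \<phi> (c \<odot>\<^bsub>V\<^esub> x) = c * \<phi> x))"

definition is_zero_space :: "('k::field, 'm) module \<Rightarrow> bool" where
  "is_zero_space V \<longleftrightarrow> carrier V = {\<zero>\<^bsub>V\<^esub>}"

section \<open>The first Ext group\<close>

text \<open>The free left \<open>A\<close>-module on the set \<open>X\<close>.\<close>

definition free_module :: "('k, 'a) module \<Rightarrow> 'x set \<Rightarrow> ('a, 'x \<Rightarrow> 'a) module" where
  "free_module A X = \<lparr>
     carrier = {f. (\<forall>x. f x \<in> carrier A) \<and> finite {x. f x \<noteq> \<zero>\<^bsub>A\<^esub>} \<and> {x. f x \<noteq> \<zero>\<^bsub>A\<^esub>} \<subseteq> X},
     mult = undefined, one = undefined,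
     ring.zero = (\<lambda>_. \<zero>\<^bsub>A\<^esub>), ring.add = (\<lambda>f g x. f x \<oplus>\<^bsub>A\<^esub> g x),
     smult = (\<lambda>a f x. a \<otimes>\<^bsub>A\<^esub> f x) \<rparr>"

text \<open>For \<open>X \<subseteq> carrier M\<close>, the homomorphism \<open>free_module A X \<rightarrow> M\<close> extending the inclusion of \<open>X\<close>.\<close>

definition free_eval :: "('k, 'a) module \<Rightarrow> ('a, 'm) module \<Rightarrow> ('m \<Rightarrow> 'a) \<Rightarrow> 'm" where
  "free_eval A M f = (\<Oplus>\<^bsub>M\<^esub>m\<in>{m. f m \<noteq> \<zero>\<^bsub>A\<^esub>}. f m \<odot>\<^bsub>M\<^esub> m)"

text \<open>
  The first terms of the canonical free resolution \<open>\<dots> \<rightarrow> P2 \<rightarrow> P1 \<rightarrow> P0 \<rightarrow> M \<rightarrow> 0\<close>: each module is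
  free on the underlying set of the kernel of the preceding map, and all maps (\<open>P0 \<rightarrow> M\<close>, \<open>P1 \<rightarrow> P0\<close>,
  \<open>P2 \<rightarrow> P1\<close>) are given by \<open>free_eval\<close>.
\<close>

definition res_P0 :: "('k, 'a) module \<Rightarrow> ('a, 'm) module \<Rightarrow> ('a, 'm \<Rightarrow> 'a) module" where
  "res_P0 A M = free_module A (carrier M)"

definition res_P1 ::
  "('k, 'a) module \<Rightarrow> ('a, 'm) module \<Rightarrow> ('a, ('m \<Rightarrow> 'a) \<Rightarrow> 'a) module" where
  "res_P1 A M = free_module A {f \<in> carrier (res_P0 A M). free_eval A M f = \<zero>\<^bsub>M\<^esub>}"

definition res_P2 ::
  "('k, 'a) module \<Rightarrow> ('a, 'm) module \<Rightarrow> ('a, (('m \<Rightarrow> 'a) \<Rightarrow> 'a) \<Rightarrow> 'a) module" where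
  "res_P2 A M = free_module A
     {f \<in> carrier (res_P1 A M). free_eval A (res_P0 A M) f = \<zero>\<^bsub>res_P0 A M\<^esub>}"

text \<open>
  \<open>Hom\<^sub>A(M, N)\<close> as a vector space over the ground field; a scalar \<open>c\<close> acts on \<open>N\<close> as \<open>c \<cdot> 1 \<in> A\<close>.
\<close>

definition Hom_module ::
  "('k, 'a) module \<Rightarrow> ('a, 'm) module \<Rightarrow> ('a, 'n) module \<Rightarrow> ('k, 'm \<Rightarrow> 'n) module" where
  "Hom_module A M N = \<lparr>
     carrier = {f \<in> carrier M \<rightarrow>\<^sub>E carrier N.
       (\<forall>x\<in>carrier M. \<forall>y\<in>carrier M. f (x \<oplus>\<^bsub>M\<^esub> y) = f x \<oplus>\<^bsub>N\<^esub> f y) \<and>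
       (\<forall>a\<in>carrier A. \<forall>x\<in>carrier M. f (a \<odot>\<^bsub>M\<^esub> x) = a \<odot>\<^bsub>N\<^esub> f x)},
     mult = undefined, one = undefined,
     ring.zero = (\<lambda>x\<in>carrier M. \<zero>\<^bsub>N\<^esub>), ring.add = (\<lambda>f g. \<lambda>x\<in>carrier M. f x \<oplus>\<^bsub>N\<^esub> g x),
     smult = (\<lambda>c f. \<lambda>x\<in>carrier M. (c \<odot>\<^bsub>A\<^esub> \<one>\<^bsub>A\<^esub>) \<odot>\<^bsub>N\<^esub> f x) \<rparr>"

text \<open>\<open>Ext\<^sup>1\<^sub>A(M, N)\<close> is the first cohomology of \<open>Hom\<^sub>A(P0, N) \<rightarrow> Hom\<^sub>A(P1, N) \<rightarrow> Hom\<^sub>A(P2, N)\<close>.\<close>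

definition Ext1_cocycles ::
  "('k, 'a) module \<Rightarrow> ('a, 'm) module \<Rightarrow> ('a, 'n) module \<Rightarrow> ((('m \<Rightarrow> 'a) \<Rightarrow> 'a) \<Rightarrow> 'n) set" where
  "Ext1_cocycles A M N = {f \<in> carrier (Hom_module A (res_P1 A M) N).
     \<forall>z\<in>carrier (res_P2 A M). f (free_eval A (res_P1 A M) z) = \<zero>\<^bsub>N\<^esub>}"

definition Ext1_coboundaries ::
  "('k, 'a) module \<Rightarrow> ('a, 'm) module \<Rightarrow> ('a, 'n) module \<Rightarrow> ((('m \<Rightarrow> 'a) \<Rightarrow> 'a) \<Rightarrow> 'n) set" where
  "Ext1_coboundaries A M N =
     (\<lambda>g. \<lambda>z\<in>carrier (res_P1 A M). g (free_eval A (res_P0 A M) z)) `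
       carrier (Hom_module A (res_P0 A M) N)"

definition Ext1 ::
  "('k, 'a) module \<Rightarrow> ('a, 'm) module \<Rightarrow> ('a, 'n) module \<Rightarrow>
     ('k, ((('m \<Rightarrow> 'a) \<Rightarrow> 'a) \<Rightarrow> 'n) set) module" where
  "Ext1 A M N = quot ((Hom_module A (res_P1 A M) N)\<lparr>carrier := Ext1_cocycles A M N\<rparr>)
     (Ext1_coboundaries A M N)"

section \<open>Extension of scalars\<close>

text \<open>
  \<open>tensor_module A B \<phi> V\<close> is the left \<open>A\<close>-module \<open>A \<otimes>\<^sub>B V\<close>, where \<open>A\<close> is a right \<open>B\<close>-module through
  the ring homomorphism \<open>\<phi> : B \<rightarrow> A\<close>: the free abelian group on pairs modulo the usual relations.
\<close>

definition pair_module ::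
  "('k, 'a) module \<Rightarrow> ('b, 'v) module \<Rightarrow> ('a, ('a \<times> 'v) \<Rightarrow>\<^sub>0 int) module" where
  "pair_module A V = (let F = free_Abelian_group (carrier A \<times> carrier V) in
     \<lparr> carrier = carrier F, mult = undefined, one = undefined,
       ring.zero = one F, ring.add = mult F,
       smult = (\<lambda>a. frag_extend (\<lambda>(x, v). frag_of (a \<otimes>\<^bsub>A\<^esub> x, v))) \<rparr>)"

definition tensor_relations ::
  "('k, 'a) module \<Rightarrow> ('k, 'b) module \<Rightarrow> ('b \<Rightarrow> 'a) \<Rightarrow> ('b, 'v) module \<Rightarrow> (('a \<times> 'v) \<Rightarrow>\<^sub>0 int) set"
  where
  "tensor_relations A B \<phi> V =
     {frag_of (x \<oplus>\<^bsub>A\<^esub> y, v) - frag_of (x, v) - frag_of (y, v) | x y v.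
        x \<in> carrier A \<and> y \<in> carrier A \<and> v \<in> carrier V} \<union>
     {frag_of (x, v \<oplus>\<^bsub>V\<^esub> w) - frag_of (x, v) - frag_of (x, w) | x v w.
        x \<in> carrier A \<and> v \<in> carrier V \<and> w \<in> carrier V} \<union>
     {frag_of (x \<otimes>\<^bsub>A\<^esub> \<phi> b, v) - frag_of (x, b \<odot>\<^bsub>V\<^esub> v) | x b v.
        x \<in> carrier A \<and> b \<in> carrier B \<and> v \<in> carrier V}"

definition tensor_module ::
  "('k, 'a) module \<Rightarrow> ('k, 'b) module \<Rightarrow> ('b \<Rightarrow> 'a) \<Rightarrow> ('b, 'v) module \<Rightarrow>
     ('a, (('a \<times> 'v) \<Rightarrow>\<^sub>0 int) set) module" where
  "tensor_module A B \<phi> V = quot (pair_module A V)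
     (generate (add_monoid (pair_module A V)) (tensor_relations A B \<phi> V))"

section \<open>Restricted Lie algebras and reduced enveloping algebras\<close>

text \<open>The inherited fields \<open>mult\<close> and \<open>one\<close> are irrelevant.\<close>

record ('k, 'x) restricted_lie = "('k, 'x) module" +
  bracket :: "'x \<Rightarrow> 'x \<Rightarrow> 'x"
  pmap :: "'x \<Rightarrow> 'x"

definition linear_form :: "('k::field, 'x) restricted_lie \<Rightarrow> ('x \<Rightarrow> 'k) \<Rightarrow> bool" where
  "linear_form L \<chi> \<longleftrightarrow>
     (\<forall>x\<in>carrier L. \<forall>y\<in>carrier L. \<chi> (x \<oplus>\<^bsub>L\<^esub> y) = \<chi> x + \<chi> y) \<and>
     (\<forall>c. \<forall>x\<in>carrier L. \<chi> (c \<odot>\<^bsub>L\<^esub> x) = c * \<chi> x)"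

text \<open>\<open>jacobson_coeff L x y n j\<close> is the coefficient of \<open>t\<^sup>j\<close> in \<open>ad(t x + y)\<^sup>n (x)\<close>.\<close>

primrec jacobson_coeff :: "('k, 'x) restricted_lie \<Rightarrow> 'x \<Rightarrow> 'x \<Rightarrow> nat \<Rightarrow> nat \<Rightarrow> 'x" where
  "jacobson_coeff L x y 0 = (\<lambda>j. if j = 0 then x else \<zero>\<^bsub>L\<^esub>)"
| "jacobson_coeff L x y (Suc n) = (\<lambda>j. bracket L y (jacobson_coeff L x y n j) \<oplus>\<^bsub>L\<^esub>
     (if j = 0 then \<zero>\<^bsub>L\<^esub> else bracket L x (jacobson_coeff L x y n (j - 1))))"

text \<open>
  The axioms of a \<open>p\<close>-mapping; the sum is \<open>\<Sum>\<^sub>i s\<^sub>i(x, y)\<close> with \<open>i s\<^sub>i(x, y)\<close> the coefficient of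
  \<open>t\<^sup>i\<^sup>-\<^sup>1\<close> in \<open>ad(t x + y)\<^sup>p\<^sup>-\<^sup>1 (x)\<close>.
\<close>

definition is_p_mapping :: "nat \<Rightarrow> ('k::field, 'x) restricted_lie \<Rightarrow> bool" where
  "is_p_mapping p L \<longleftrightarrow>
     (\<forall>x\<in>carrier L. pmap L x \<in> carrier L) \<and>
     (\<forall>x\<in>carrier L. \<forall>y\<in>carrier L. bracket L (pmap L x) y = (bracket L x ^^ p) y) \<and>
     (\<forall>c. \<forall>x\<in>carrier L. pmap L (c \<odot>\<^bsub>L\<^esub> x) = c ^ p \<odot>\<^bsub>L\<^esub> pmap L x) \<and>
     (\<forall>x\<in>carrier L. \<forall>y\<in>carrier L. pmap L (x \<oplus>\<^bsub>L\<^esub> y) = pmap L x \<oplus>\<^bsub>L\<^esub> pmap L y \<oplus>\<^bsub>L\<^esub>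
        (\<Oplus>\<^bsub>L\<^esub>i\<in>{1..p-1}. inverse (of_nat i) \<odot>\<^bsub>L\<^esub> jacobson_coeff L x y (p - 1) (i - 1)))"

text \<open>The free associative unital algebra on \<open>X\<close>: finitely supported functions on words in \<open>X\<close>.\<close>

definition free_algebra :: "'x set \<Rightarrow> ('k::field, 'x list \<Rightarrow> 'k) module" where
  "free_algebra X = \<lparr>
     carrier = {f. finite {w. f w \<noteq> 0} \<and> {w. f w \<noteq> 0} \<subseteq> lists X},
     mult = (\<lambda>f g w. \<Sum>i\<le>length w. f (take i w) * g (drop i w)),
     one = (\<lambda>w. if w = [] then 1 else 0),
     ring.zero = (\<lambda>_. 0), ring.add = (\<lambda>f g w. f w + g w), smult = (\<lambda>c f w. c * f w) \<rparr>"

definition gen :: "'x \<Rightarrow> 'x list \<Rightarrow> 'k::field" where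
  "gen x = (\<lambda>w. if w = [x] then 1 else 0)"

text \<open>
  The first two families present the tensor algebra of the vector space \<open>L\<close> as a quotient of the
  free algebra on the underlying set of \<open>L\<close>.
\<close>

definition env_ideal :: "('k::field, 'x) restricted_lie \<Rightarrow> ('x list \<Rightarrow> 'k) set" where
  "env_ideal L = (let F = free_algebra (carrier L) in Idl\<^bsub>F\<^esub>
     ({gen (x \<oplus>\<^bsub>L\<^esub> y) \<ominus>\<^bsub>F\<^esub> (gen x \<oplus>\<^bsub>F\<^esub> gen y) | x y. x \<in> carrier L \<and> y \<in> carrier L} \<union>
      {gen (c \<odot>\<^bsub>L\<^esub> x) \<ominus>\<^bsub>F\<^esub> c \<odot>\<^bsub>F\<^esub> gen x | c x. x \<in> carrier L} \<union>
      {(gen x \<otimes>\<^bsub>F\<^esub> gen y \<ominus>\<^bsub>F\<^esub> gen y \<otimes>\<^bsub>F\<^esub> gen x) \<ominus>\<^bsub>F\<^esub> gen (bracket L x y) | x y.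
         x \<in> carrier L \<and> y \<in> carrier L}))"

definition env_algebra :: "('k::field, 'x) restricted_lie \<Rightarrow> ('k, ('x list \<Rightarrow> 'k) set) module" where
  "env_algebra L = quot (free_algebra (carrier L)) (env_ideal L)"

definition env_class :: "('k::field, 'x) restricted_lie \<Rightarrow> ('x list \<Rightarrow> 'k) \<Rightarrow> ('x list \<Rightarrow> 'k) set" where
  "env_class L f = env_ideal L +>\<^bsub>free_algebra (carrier L)\<^esub> f"

definition red_ideal ::
  "nat \<Rightarrow> ('k::field, 'x) restricted_lie \<Rightarrow> ('x \<Rightarrow> 'k) \<Rightarrow> ('x list \<Rightarrow> 'k) set set" where
  "red_ideal p L \<chi> = (let U = env_algebra L in Idl\<^bsub>U\<^esub>
     {(env_class L (gen x) [^]\<^bsub>U\<^esub> p \<ominus>\<^bsub>U\<^esub> env_class L (gen (pmap L x))) \<ominus>\<^bsub>U\<^esub> (\<chi> x ^ p) \<odot>\<^bsub>U\<^esub> \<one>\<^bsub>U\<^esub> | x.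
        x \<in> carrier L})"

text \<open>The reduced enveloping algebra \<open>u(L, \<chi>)\<close> and the class in it of an element of the free algebra.\<close>

definition red_env_algebra ::
  "nat \<Rightarrow> ('k::field, 'x) restricted_lie \<Rightarrow> ('x \<Rightarrow> 'k) \<Rightarrow> ('k, ('x list \<Rightarrow> 'k) set set) module" where
  "red_env_algebra p L \<chi> = quot (env_algebra L) (red_ideal p L \<chi>)"

definition red_env_class ::
  "nat \<Rightarrow> ('k::field, 'x) restricted_lie \<Rightarrow> ('x \<Rightarrow> 'k) \<Rightarrow> ('x list \<Rightarrow> 'k) \<Rightarrow> ('x list \<Rightarrow> 'k) set set"
  where
  "red_env_class p L \<chi> f = red_ideal p L \<chi> +>\<^bsub>env_algebra L\<^esub> env_class L f"

text \<open>
  For a restricted subalgebra \<open>H\<close> of \<open>L\<close> on which \<open>\<chi>\<close> vanishes: the homomorphism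
  \<open>u(H) = u(H, 0) \<rightarrow> u(L, \<chi>)\<close> induced by the inclusion.
\<close>

definition red_env_incl ::
  "nat \<Rightarrow> ('k::field, 'x) restricted_lie \<Rightarrow> ('k, 'x) restricted_lie \<Rightarrow> ('x \<Rightarrow> 'k) \<Rightarrow>
     ('x list \<Rightarrow> 'k) set set \<Rightarrow> ('x list \<Rightarrow> 'k) set set" where
  "red_env_incl p H L \<chi> b = (THE a. \<exists>f\<in>carrier (free_algebra (carrier H)).
     b = red_env_class p H (\<lambda>_. 0) f \<and> a = red_env_class p L \<chi> f)"

text \<open>
  The one-dimensional \<open>u(L, \<chi>)\<close>-module on which each \<open>x \<in> L\<close> acts by the scalar \<open>\<theta> x\<close> (for those
  \<open>\<theta>\<close> for which it exists).
\<close>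

definition one_dim_module ::
  "nat \<Rightarrow> ('k::field, 'x) restricted_lie \<Rightarrow> ('x \<Rightarrow> 'k) \<Rightarrow> ('x \<Rightarrow> 'k) \<Rightarrow>
     (('x list \<Rightarrow> 'k) set set, 'k) module" where
  "one_dim_module p L \<chi> \<theta> = \<lparr> carrier = UNIV, mult = undefined, one = undefined,
     ring.zero = 0, ring.add = (+),
     smult = (\<lambda>u v. (THE s. \<exists>f\<in>carrier (free_algebra (carrier L)). u = red_env_class p L \<chi> f \<and>
        s = (\<Sum>w\<in>{w. f w \<noteq> 0}. f w * prod_list (map \<theta> w))) * v) \<rparr>"

section \<open>The Witt algebra\<close>

text \<open>
  Elements of \<open>W(1,1)\<close> are the coordinate functions \<open>x\<close> with respect to the basis \<open>(e\<^sub>i)\<close>,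
  \<open>-1 \<le> i \<le> p - 2\<close>, extended by zero to all integers. The \<open>p\<close>-mapping is a parameter.
\<close>

definition witt_subspace :: "nat \<Rightarrow> int \<Rightarrow> (int \<Rightarrow> 'k::field) set" where
  "witt_subspace p i = {x. \<forall>j. j \<notin> {i..int p - 2} \<longrightarrow> x j = 0}"

definition witt_e :: "int \<Rightarrow> int \<Rightarrow> 'k::field" where
  "witt_e i = (\<lambda>j. if j = i then 1 else 0)"

definition witt ::
  "nat \<Rightarrow> ((int \<Rightarrow> 'k) \<Rightarrow> (int \<Rightarrow> 'k)) \<Rightarrow> ('k::field, int \<Rightarrow> 'k) restricted_lie" where
  "witt p P = \<lparr> carrier = witt_subspace p (-1), mult = undefined, one = undefined,
     ring.zero = (\<lambda>_. 0), ring.add = (\<lambda>x y n. x n + y n), smult = (\<lambda>c x n. c * x n),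
     bracket = (\<lambda>x y n. if n \<in> {-1..int p - 2}
       then \<Sum>i\<in>{-1..int p - 2}. \<Sum>j\<in>{-1..int p - 2}.
              if i + j = n then of_int (j - i) * x i * y j else 0
       else 0),
     pmap = P \<rparr>"

lemma bracket_witt_e:
  assumes "i \<in> {-1..int p - 2}" "j \<in> {-1..int p - 2}"
  shows "bracket (witt p P) (witt_e i) (witt_e j) =
    (if i + j \<in> {-1..int p - 2} then of_int (j - i) \<odot>\<^bsub>witt p P\<^esub> witt_e (i + j)
     else \<zero>\<^bsub>witt p P\<^esub>)"
proof
  fix n
  have *: "(\<Sum>a\<in>{-1..int p - 2}. \<Sum>b\<in>{-1..int p - 2}.
      if a + b = n then of_int (b - a) * witt_e i a * (witt_e j b :: 'a) else 0)
    = (if i + j = n then of_int (j - i) else 0)"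
  proof -
    have "(\<Sum>a\<in>{-1..int p - 2}. \<Sum>b\<in>{-1..int p - 2}.
        if a + b = n then of_int (b - a) * witt_e i a * (witt_e j b :: 'a) else 0)
      = (\<Sum>a\<in>{-1..int p - 2}. if a = i then \<Sum>b\<in>{-1..int p - 2}.
          if b = j then (if i + j = n then of_int (j - i) else 0) else 0 else 0)"
      by (intro sum.cong refl) (auto simp: witt_e_def intro!: sum.cong sum.neutral)
    also have "\<dots> = (if i + j = n then of_int (j - i) else 0)"
      using assms by (simp add: sum.delta)
    finally show ?thesis .
  qed
  have br: "bracket (witt p P) (witt_e i) (witt_e j) n =
    (if n \<in> {-1..int p - 2} then if i + j = n then of_int (j - i) else 0 else 0)"
    unfolding *[symmetric] by (simp add: witt_def)
  show "bracket (witt p P) (witt_e i) (witt_e j) n =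
    (if i + j \<in> {-1..int p - 2} then of_int (j - i) \<odot>\<^bsub>witt p P\<^esub> witt_e (i + j)
     else \<zero>\<^bsub>witt p P\<^esub>) n"
    unfolding br by (auto simp: witt_def witt_e_def)
qed

definition witt_borel ::
  "nat \<Rightarrow> ((int \<Rightarrow> 'k) \<Rightarrow> (int \<Rightarrow> 'k)) \<Rightarrow> ('k::field, int \<Rightarrow> 'k) restricted_lie" where
  "witt_borel p P = (witt p P)\<lparr>carrier := witt_subspace p 0\<rparr>"

definition height :: "nat \<Rightarrow> ((int \<Rightarrow> 'k) \<Rightarrow> 'k::field) \<Rightarrow> int" where
  "height p \<chi> = (if \<chi> (witt_e (int p - 2)) = 0
     then Min {i \<in> {-1..int p - 2}. \<forall>x\<in>witt_subspace p i. \<chi> x = 0}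
     else int p - 1)"

text \<open>\<open>L(\<lambda>)\<close>, for \<open>\<chi>\<close> vanishing on the Borel subalgebra; \<open>x 0\<close> is the \<open>e\<^sub>0\<close>-coordinate of \<open>x\<close>.\<close>

definition witt_L ::
  "nat \<Rightarrow> ((int \<Rightarrow> 'k) \<Rightarrow> (int \<Rightarrow> 'k)) \<Rightarrow> ((int \<Rightarrow> 'k) \<Rightarrow> 'k) \<Rightarrow> nat \<Rightarrow>
     (((int \<Rightarrow> 'k) list \<Rightarrow> 'k::field) set set,
      (((((int \<Rightarrow> 'k) list \<Rightarrow> 'k) set set) \<times> 'k) \<Rightarrow>\<^sub>0 int) set) module" where
  "witt_L p P \<chi> l = tensor_module
     (red_env_algebra p (witt p P) \<chi>)
     (red_env_algebra p (witt_borel p P) (\<lambda>_. 0))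
     (red_env_incl p (witt_borel p P) (witt p P) \<chi>)
     (one_dim_module p (witt_borel p P) (\<lambda>_. 0) (\<lambda>x. of_nat l * x 0))"

definition witt_Ext1 where
  "witt_Ext1 p P \<chi> m l =
     Ext1 (red_env_algebra p (witt p P) \<chi>) (witt_L p P \<chi> m) (witt_L p P \<chi> l)"

end

theory Submission
  imports Defs "HOL-Computational_Algebra.Formal_Power_Series"
begin

text \<open>
  Write \<open>M = L(m)\<close>, \<open>N = L(l)\<close>, \<open>\<delta> = l - m\<close>, \<open>z = \<chi>(e\<^sub>-\<^sub>1)\<close>, which is nonzero, and \<open>A = u(g, \<chi>)\<close>.

  The module \<open>M\<close> is generated by \<open>w = 1 \<otimes> 1\<close>. For a cyclic module, \<open>Ext\<^sup>1(M, N)\<close> is the space of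
  \<open>A\<close>-homomorphisms \<open>J \<rightarrow> N\<close> modulo the inner ones \<open>a \<mapsto> a n\<close>, where \<open>J\<close> is the annihilator of \<open>w\<close>
  (\<open>Ext1_zero_if\<close>, \<open>Ext1_ground_field_if\<close>). As a left ideal, \<open>J\<close> is generated by \<open>e\<^sub>0 - m\<close> and
  \<open>e\<^sub>1, \<dots>, e\<^sub>p\<^sub>-\<^sub>2\<close> (\<open>annihilator_w\<close>, \<open>J_induct\<close>), so a homomorphism is known from its values there.

  The module \<open>N\<close> is the space of functions on the prime field: with the indicator functions \<open>1\<^sub>a\<close> as
  basis, \<open>e\<^sub>-\<^sub>1 1\<^sub>a = z 1\<^sub>a\<^sub>+\<^sub>1\<close>, and \<open>e\<^sub>i 1\<^sub>a = z\<^sup>-\<^sup>i wt l i a 1\<^sub>a\<^sub>-\<^sub>i\<close> with an explicit polynomial \<open>wt l i\<close>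
  (\<open>highest_weight\<close>, \<open>psi_eta\<close>, \<open>eta_surj\<close>). Here \<open>e\<^sub>0\<close> is diagonal. Up to an inner homomorphism,
  \<open>e\<^sub>0 - m\<close> may be assumed to be sent to \<open>0\<close>; the only obstruction, at the weight \<open>\<delta>\<close>, vanishes because
  \<open>e\<^sub>0\<^sup>p = e\<^sub>0\<close> (\<open>weight_obstruction\<close>). Then weights force \<open>e\<^sub>i \<mapsto> d\<^sub>i z\<^sup>-\<^sup>i 1\<^sub>\<delta>\<^sub>-\<^sub>i\<close>, and the brackets of
  the \<open>e\<^sub>i\<close> turn into linear equations for the numbers \<open>d\<^sub>1, \<dots>, d\<^sub>p\<^sub>-\<^sub>2\<close> (\<open>sol\<close>, \<open>V_hom_classify\<close>).

  Conversely every solution \<open>d\<close> comes from a homomorphism (if \<open>\<delta> \<noteq> 0\<close>, \<open>l = 0\<close> or \<open>d\<^sub>1 = 0\<close>, which covers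
  all cases that occur): \<open>d\<close> defines operators on two copies of the functions on the prime field, an
  extension of \<open>M\<close> by \<open>N\<close>, and \<open>a \<mapsto> a (0, 1\<^sub>0)\<close> is the homomorphism (\<open>V_hom_cocycle\<close>, \<open>cocycle_s\<close>). These
  operators satisfy the bracket relations, since the error satisfies a difference equation in \<open>a\<close> and
  vanishes at \<open>a = 0\<close> (\<open>defect_zero\<close>), and they respect the \<open>p\<close>-mapping on the basis (\<open>rho_pmap\<close>), hence
  everywhere by Jacobson's formula for \<open>(x + y)\<^sup>p\<close> (\<open>p_mapping_from_basis\<close>).

  So \<open>Ext\<^sup>1(M, N)\<close> is the space of solutions modulo the inner solution \<open>d\<^sub>i = wt l i \<delta>\<close>. As \<open>e\<^sub>1\<close> and \<open>e\<^sub>2\<close>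
  generate \<open>e\<^sub>3, e\<^sub>4, \<dots>\<close>, a solution is determined by \<open>d\<^sub>1\<close> and \<open>d\<^sub>2\<close> (\<open>sol_determined\<close>). If \<open>d\<^sub>1 = 0 \<noteq> d\<^sub>2\<close>, the
  two ways to reach degree \<open>5\<close> agree only if
  \<open>(\<delta> - 2) (\<delta> - 3) (\<delta> - 4) (u + 1) (u\<^sup>2 + 2 u - 3 \<delta>) = 0\<close> with \<open>u = 2 l - \<delta>\<close>, and on the last factor the two
  ways to reach degree \<open>7\<close> agree only for \<open>\<delta> \<in> {0, \<dots>, 6}\<close> or \<open>u = -1\<close> (\<open>parabola_relation\<close>). Outside
  \<open>\<delta> = 0\<close> and \<open>u = -1\<close>, which need arguments of their own, this leaves the pairs of the theorem.
\<close>


section \<open>Quotients of modules and algebras\<close>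

context abelian_subgroup
begin

lemma coset_eq_iff:
  assumes "x \<in> carrier G" "y \<in> carrier G"
  shows "H +> x = H +> y \<longleftrightarrow> x \<ominus> y \<in> H"
proof -
  have "H +> x = H +> y \<longleftrightarrow> x \<in> H +> y"
    using assms by (metis a_rcos_self a_repr_independence')
  also have "\<dots> \<longleftrightarrow> x \<ominus> y \<in> H"
    using assms a_rcos_module_minus[OF _ assms(2) assms(1)]
    by (metis a_rcos_module minus_eq)
  finally show ?thesis .
qed

end

lemma quot_simps:
  "carrier (quot M S) = a_rcosets\<^bsub>M\<^esub> S" "ring.add (quot M S) = set_add M" "ring.zero (quot M S) = S"
  "one (quot M S) = S +>\<^bsub>M\<^esub> \<one>\<^bsub>M\<^esub>" "mult (quot M S) = rcoset_mult M S"
  by (simp_all add: quot_def FactRing_def)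

locale module_quotient = abelian_subgroup S M for S and M :: "('r, 'm) module" (structure)
begin

abbreviation "Q \<equiv> quot M S"

lemma coset_in_quot: "x \<in> carrier M \<Longrightarrow> S +> x \<in> carrier Q"
  unfolding quot_simps A_RCOSETS_def' by auto

lemma quot_cases:
  assumes "X \<in> carrier Q" obtains x where "x \<in> carrier M" "X = S +> x"
  using assms unfolding quot_simps A_RCOSETS_def' by auto

lemma quot_add:
  "x \<in> carrier M \<Longrightarrow> y \<in> carrier M \<Longrightarrow> (S +> x) \<oplus>\<^bsub>Q\<^esub> (S +> y) = S +> (x \<oplus> y)"
  unfolding quot_simps by (rule a_rcos_sum)

lemma quot_zero: "\<zero>\<^bsub>Q\<^esub> = S +> \<zero>"
  unfolding quot_simps by (metis a_coset_add_zero a_subset)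

lemma quot_abelian_group: "abelian_group Q"
proof (rule abelian_groupI)
  show "\<exists>y\<in>carrier Q. y \<oplus>\<^bsub>Q\<^esub> X = \<zero>\<^bsub>Q\<^esub>" if X: "X \<in> carrier Q" for X
  proof -
    obtain x where "x \<in> carrier M" "X = S +> x" by (rule quot_cases[OF X])
    then show ?thesis
      by (intro bexI[of _ "S +> (\<ominus> x)"]) (simp_all add: quot_add l_neg quot_zero coset_in_quot)
  qed
qed (auto elim!: quot_cases simp: quot_add quot_zero coset_in_quot a_ac)

lemma quot_smult:
  assumes "\<And>h. h \<in> S \<Longrightarrow> c \<odot> h \<in> S"
    and "\<And>x. x \<in> carrier M \<Longrightarrow> c \<odot> x \<in> carrier M"
    and "\<And>x y. x \<in> carrier M \<Longrightarrow> y \<in> carrier M \<Longrightarrow> c \<odot> (x \<oplus> y) = c \<odot> x \<oplus> c \<odot> y"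
    and x: "x \<in> carrier M"
  shows "c \<odot>\<^bsub>Q\<^esub> (S +> x) = S +> (c \<odot> x)"
proof -
  have "S +> (c \<odot> y) = S +> (c \<odot> x)" if y: "y \<in> S +> x" for y
  proof -
    obtain h where h: "h \<in> S" "y = h \<oplus> x"
      using y unfolding a_r_coset_def' by auto
    have hc: "h \<in> carrier M" using h a_subset by blast
    have "c \<odot> y = c \<odot> h \<oplus> c \<odot> x" using h hc assms by simp
    then have "c \<odot> y \<in> S +> (c \<odot> x)"
      unfolding a_r_coset_def' using assms(1) h by blast
    then show ?thesis
      using a_repr_independence' assms(2)[OF x] by (metis a_repr_independence')
  qed
  moreover have "x \<in> S +> x" using x by (rule a_rcos_self)
  ultimately have "(\<Union>y\<in>S +> x. S +> (c \<odot> y)) = S +> (c \<odot> x)" by blast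
  then show ?thesis by (simp add: quot_def)
qed

end

lemma module_quotientI:
  assumes "abelian_group M" "subgroup S (add_monoid M)"
  shows "module_quotient S M"
  by (simp add: module_quotient_def abelian_subgroupI3 additive_subgroupI assms)

text \<open>
  Associative unital algebras whose scalars form a type, the format in which the enveloping algebras
  are given.
\<close>

locale algebra_over = ring A for A :: "('k::field, 'a) module" (structure) +
  assumes smult_closed [simp, intro]: "x \<in> carrier A \<Longrightarrow> c \<odot> x \<in> carrier A"
    and smult_r_distr: "x \<in> carrier A \<Longrightarrow> y \<in> carrier A \<Longrightarrow> c \<odot> (x \<oplus> y) = c \<odot> x \<oplus> c \<odot> y"
    and smult_l_distr: "x \<in> carrier A \<Longrightarrow> (c + d) \<odot> x = c \<odot> x \<oplus> d \<odot> x"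
    and smult_assoc1: "x \<in> carrier A \<Longrightarrow> (c * d) \<odot> x = c \<odot> (d \<odot> x)"
    and smult_one [simp]: "x \<in> carrier A \<Longrightarrow> 1 \<odot> x = x"
    and smult_assoc2: "x \<in> carrier A \<Longrightarrow> y \<in> carrier A \<Longrightarrow> (c \<odot> x) \<otimes> y = c \<odot> (x \<otimes> y)"
    and smult_assoc3: "x \<in> carrier A \<Longrightarrow> y \<in> carrier A \<Longrightarrow> x \<otimes> (c \<odot> y) = c \<odot> (x \<otimes> y)"
begin

lemma smult_scalar: "x \<in> carrier A \<Longrightarrow> c \<odot> x = (c \<odot> \<one>) \<otimes> x"
  by (simp add: smult_assoc2)

lemma scalar_central: "x \<in> carrier A \<Longrightarrow> x \<otimes> (c \<odot> \<one>) = (c \<odot> \<one>) \<otimes> x"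
  by (simp add: smult_assoc2 smult_assoc3)

lemma smult_zero_left [simp]: "x \<in> carrier A \<Longrightarrow> 0 \<odot> x = \<zero>"
  by (metis add.right_neutral smult_closed smult_l_distr add.r_cancel_one')

lemma smult_zero_right [simp]: "c \<odot> \<zero> = \<zero>"
  by (metis smult_scalar one_closed r_null smult_closed zero_closed)

lemma smult_minus_one: "x \<in> carrier A \<Longrightarrow> (-1) \<odot> x = \<ominus> x"
  using smult_l_distr[of x "-1" 1] by (simp add: minus_equality)

end

lemma quotient_algebra_over:
  assumes "algebra_over A" "ideal S A"
  shows "algebra_over (quot A S)" "(+>\<^bsub>A\<^esub>) S \<in> ring_hom A (quot A S)"
    "\<And>c x. x \<in> carrier A \<Longrightarrow> c \<odot>\<^bsub>quot A S\<^esub> (S +>\<^bsub>A\<^esub> x) = S +>\<^bsub>A\<^esub> (c \<odot>\<^bsub>A\<^esub> x)"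
    "\<And>X. X \<in> carrier (quot A S) \<Longrightarrow> \<exists>x\<in>carrier A. X = S +>\<^bsub>A\<^esub> x"
    "\<And>x y. x \<in> carrier A \<Longrightarrow> y \<in> carrier A \<Longrightarrow> S +>\<^bsub>A\<^esub> x = S +>\<^bsub>A\<^esub> y \<longleftrightarrow> x \<ominus>\<^bsub>A\<^esub> y \<in> S"
proof -
  interpret A: algebra_over A by fact
  interpret S: ideal S A by fact
  interpret mq: module_quotient S A
    unfolding module_quotient_def by (rule S.abelian_subgroup_axioms)
  show sm: "c \<odot>\<^bsub>quot A S\<^esub> (S +>\<^bsub>A\<^esub> x) = S +>\<^bsub>A\<^esub> (c \<odot>\<^bsub>A\<^esub> x)" if "x \<in> carrier A" for c x
  proof (rule mq.quot_smult[OF _ _ _ that])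
    show "c \<odot>\<^bsub>A\<^esub> h \<in> S" if "h \<in> S" for h
      using that S.I_l_closed[OF that] by (metis A.smult_scalar A.one_closed A.smult_closed S.a_Hcarr)
  qed (simp_all add: A.smult_r_distr)
  have mul: "(S +>\<^bsub>A\<^esub> x) \<otimes>\<^bsub>quot A S\<^esub> (S +>\<^bsub>A\<^esub> y) = S +>\<^bsub>A\<^esub> (x \<otimes>\<^bsub>A\<^esub> y)"
    if "x \<in> carrier A" "y \<in> carrier A" for x y
    using that by (simp add: quot_simps S.rcoset_mult_add)
  have one: "\<one>\<^bsub>quot A S\<^esub> = S +>\<^bsub>A\<^esub> \<one>\<^bsub>A\<^esub>" by (simp add: quot_simps)
  have r: "ring (quot A S)"
  proof (rule ringI)
    show "abelian_group (quot A S)" by (rule mq.quot_abelian_group)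
    show "Group.monoid (quot A S)"
      by (rule monoidI)
        (auto elim!: mq.quot_cases simp: mul one mq.coset_in_quot A.m_assoc)
  qed (auto elim!: mq.quot_cases simp: mul mq.quot_add mq.coset_in_quot A.l_distr A.r_distr)
  show "algebra_over (quot A S)"
    unfolding algebra_over_def algebra_over_axioms_def
    by (auto elim!: mq.quot_cases
        simp: r mul mq.quot_add mq.coset_in_quot sm A.smult_r_distr A.smult_l_distr
          A.smult_assoc1 A.smult_assoc2 A.smult_assoc3)
  show "(+>\<^bsub>A\<^esub>) S \<in> ring_hom A (quot A S)"
    by (rule ring_hom_memI) (auto simp: mul one mq.quot_add mq.coset_in_quot)
  show "\<exists>x\<in>carrier A. X = S +>\<^bsub>A\<^esub> x" if "X \<in> carrier (quot A S)" for X
    using that by (auto elim!: mq.quot_cases)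
  show "S +>\<^bsub>A\<^esub> x = S +>\<^bsub>A\<^esub> y \<longleftrightarrow> x \<ominus>\<^bsub>A\<^esub> y \<in> S" if "x \<in> carrier A" "y \<in> carrier A" for x y
    using that by (rule S.coset_eq_iff)
qed

text \<open>
  A quotient \<open>V/S\<close> is a line if \<open>S\<close> does not contain some \<open>v\<^sub>0\<close> but \<open>V = k v\<^sub>0 + S\<close>: the coefficient
  of \<open>v\<^sub>0\<close> is then well defined on classes.
\<close>

lemma iso_to_ground_field_quot:
  fixes V :: "('k::field, 'm) module"
  assumes "abelian_group V" "subgroup S (add_monoid V)"
    and sc: "\<And>c x. x \<in> carrier V \<Longrightarrow> c \<odot>\<^bsub>V\<^esub> x \<in> carrier V"
    and sd: "\<And>c x y. x \<in> carrier V \<Longrightarrow> y \<in> carrier V \<Longrightarrow>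
      c \<odot>\<^bsub>V\<^esub> (x \<oplus>\<^bsub>V\<^esub> y) = c \<odot>\<^bsub>V\<^esub> x \<oplus>\<^bsub>V\<^esub> c \<odot>\<^bsub>V\<^esub> y"
    and \<psi>_add: "\<And>x y. x \<in> carrier V \<Longrightarrow> y \<in> carrier V \<Longrightarrow> \<psi> (x \<oplus>\<^bsub>V\<^esub> y) = \<psi> x + \<psi> y"
    and \<psi>_smult: "\<And>c x. x \<in> carrier V \<Longrightarrow> \<psi> (c \<odot>\<^bsub>V\<^esub> x) = c * \<psi> x"
    and \<psi>_ker: "\<And>x. x \<in> carrier V \<Longrightarrow> \<psi> x = 0 \<longleftrightarrow> x \<in> S"
    and \<psi>_surj: "v \<in> carrier V" "\<psi> v = 1"
  shows "iso_to_ground_field (quot V S)"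
proof -
  interpret mq: module_quotient S V using assms(1,2) by (rule module_quotientI)
  have neg: "\<psi> (\<ominus>\<^bsub>V\<^esub> x) = - \<psi> x" if "x \<in> carrier V" for x
  proof -
    have "\<psi> (x \<oplus>\<^bsub>V\<^esub> (\<ominus>\<^bsub>V\<^esub> x)) = 0"
      using that \<psi>_ker[of "\<zero>\<^bsub>V\<^esub>"] by (simp add: mq.r_neg)
    then show ?thesis using that by (simp add: \<psi>_add eq_neg_iff_add_eq_0 add.commute)
  qed
  have eq: "S +>\<^bsub>V\<^esub> x = S +>\<^bsub>V\<^esub> y \<longleftrightarrow> \<psi> x = \<psi> y" if "x \<in> carrier V" "y \<in> carrier V" for x y
    using that by (simp add: mq.coset_eq_iff flip: \<psi>_ker)
      (simp add: mq.minus_eq \<psi>_add neg)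
  define \<phi> where "\<phi> X = \<psi> (SOME x. x \<in> carrier V \<and> X = S +>\<^bsub>V\<^esub> x)" for X
  have \<phi>: "\<phi> (S +>\<^bsub>V\<^esub> x) = \<psi> x" if "x \<in> carrier V" for x
  proof -
    have "(SOME y. y \<in> carrier V \<and> S +>\<^bsub>V\<^esub> x = S +>\<^bsub>V\<^esub> y) \<in> carrier V \<and>
      S +>\<^bsub>V\<^esub> x = S +>\<^bsub>V\<^esub> (SOME y. y \<in> carrier V \<and> S +>\<^bsub>V\<^esub> x = S +>\<^bsub>V\<^esub> y)"
      by (rule someI_ex) (use that in blast)
    then have "\<psi> x = \<psi> (SOME y. y \<in> carrier V \<and> S +>\<^bsub>V\<^esub> x = S +>\<^bsub>V\<^esub> y)"
      using eq[OF that] by blast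
    then show ?thesis unfolding \<phi>_def by (rule sym)
  qed
  have sm: "c \<odot>\<^bsub>quot V S\<^esub> (S +>\<^bsub>V\<^esub> x) = S +>\<^bsub>V\<^esub> (c \<odot>\<^bsub>V\<^esub> x)" if x: "x \<in> carrier V" for c x
  proof (rule mq.quot_smult)
    show "c \<odot>\<^bsub>V\<^esub> h \<in> S" if "h \<in> S" for h
    proof -
      have "h \<in> carrier V" using that mq.a_subset by blast
      then show ?thesis using that sc \<psi>_ker \<psi>_smult by (metis mult_zero_right)
    qed
  qed (use x sc sd in auto)
  have bij: "bij_betw \<phi> (carrier (quot V S)) UNIV"
  proof (rule bij_betwI')
    show "\<phi> X = \<phi> Y \<longleftrightarrow> X = Y" if X: "X \<in> carrier (quot V S)" and Y: "Y \<in> carrier (quot V S)" for X Y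
    proof -
      obtain x where x: "x \<in> carrier V" "X = S +>\<^bsub>V\<^esub> x" by (rule mq.quot_cases[OF X])
      obtain y where y: "y \<in> carrier V" "Y = S +>\<^bsub>V\<^esub> y" by (rule mq.quot_cases[OF Y])
      show ?thesis unfolding x(2) y(2) \<phi>[OF x(1)] \<phi>[OF y(1)] eq[OF x(1) y(1)] ..
    qed
    show "\<exists>X\<in>carrier (quot V S). c = \<phi> X" for c
    proof (rule bexI)
      show "c = \<phi> (S +>\<^bsub>V\<^esub> (c \<odot>\<^bsub>V\<^esub> v))"
        using \<psi>_surj by (simp add: \<phi> sc \<psi>_smult)
      show "S +>\<^bsub>V\<^esub> (c \<odot>\<^bsub>V\<^esub> v) \<in> carrier (quot V S)"
        using \<psi>_surj by (intro mq.coset_in_quot sc)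
    qed
  qed (rule UNIV_I)
  have add: "\<phi> (X \<oplus>\<^bsub>quot V S\<^esub> Y) = \<phi> X + \<phi> Y"
    if X: "X \<in> carrier (quot V S)" and Y: "Y \<in> carrier (quot V S)" for X Y
  proof -
    obtain x where x: "x \<in> carrier V" "X = S +>\<^bsub>V\<^esub> x" by (rule mq.quot_cases[OF X])
    obtain y where y: "y \<in> carrier V" "Y = S +>\<^bsub>V\<^esub> y" by (rule mq.quot_cases[OF Y])
    show ?thesis using x(1) y(1) unfolding x(2) y(2) by (simp add: mq.quot_add \<phi> \<psi>_add)
  qed
  have smul: "\<phi> (c \<odot>\<^bsub>quot V S\<^esub> X) = c * \<phi> X" if X: "X \<in> carrier (quot V S)" for c X
  proof -
    obtain x where x: "x \<in> carrier V" "X = S +>\<^bsub>V\<^esub> x" by (rule mq.quot_cases[OF X])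
    show ?thesis using x(1) unfolding x(2) by (simp add: sm \<phi> sc \<psi>_smult)
  qed
  show ?thesis
    unfolding iso_to_ground_field_def using bij add smul by blast
qed

lemma is_zero_space_quot:
  assumes "abelian_group V" "subgroup S (add_monoid V)" "carrier V \<subseteq> S"
  shows "is_zero_space (quot V S)"
proof -
  interpret mq: module_quotient S V using assms(1,2) by (rule module_quotientI)
  have "X = \<zero>\<^bsub>quot V S\<^esub>" if X: "X \<in> carrier (quot V S)" for X
  proof -
    obtain x where "x \<in> carrier V" "X = S +>\<^bsub>V\<^esub> x" by (rule mq.quot_cases[OF X])
    then show ?thesis
      using assms(3) by (auto simp: mq.quot_zero mq.coset_eq_iff)
  qed
  moreover have "\<zero>\<^bsub>quot V S\<^esub> \<in> carrier (quot V S)"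
    using mq.coset_in_quot[of "\<zero>\<^bsub>V\<^esub>"] by (simp add: mq.quot_zero)
  ultimately show ?thesis unfolding is_zero_space_def by blast
qed

section \<open>Left modules and free modules\<close>

locale left_module = A: algebra_over A + M: abelian_group M
  for A :: "('k::field, 'a) module" (structure) and M :: "('a, 'm) module" +
  assumes act_closed [simp, intro]:
      "a \<in> carrier A \<Longrightarrow> x \<in> carrier M \<Longrightarrow> a \<odot>\<^bsub>M\<^esub> x \<in> carrier M"
    and act_add: "a \<in> carrier A \<Longrightarrow> x \<in> carrier M \<Longrightarrow> y \<in> carrier M \<Longrightarrow>
      a \<odot>\<^bsub>M\<^esub> (x \<oplus>\<^bsub>M\<^esub> y) = a \<odot>\<^bsub>M\<^esub> x \<oplus>\<^bsub>M\<^esub> a \<odot>\<^bsub>M\<^esub> y"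
    and add_act: "a \<in> carrier A \<Longrightarrow> b \<in> carrier A \<Longrightarrow> x \<in> carrier M \<Longrightarrow>
      (a \<oplus> b) \<odot>\<^bsub>M\<^esub> x = a \<odot>\<^bsub>M\<^esub> x \<oplus>\<^bsub>M\<^esub> b \<odot>\<^bsub>M\<^esub> x"
    and mult_act: "a \<in> carrier A \<Longrightarrow> b \<in> carrier A \<Longrightarrow> x \<in> carrier M \<Longrightarrow>
      (a \<otimes> b) \<odot>\<^bsub>M\<^esub> x = a \<odot>\<^bsub>M\<^esub> (b \<odot>\<^bsub>M\<^esub> x)"
    and one_act [simp]: "x \<in> carrier M \<Longrightarrow> \<one> \<odot>\<^bsub>M\<^esub> x = x"
begin

lemma act_zero [simp]: "a \<in> carrier A \<Longrightarrow> a \<odot>\<^bsub>M\<^esub> \<zero>\<^bsub>M\<^esub> = \<zero>\<^bsub>M\<^esub>"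
  by (metis M.add.r_cancel_one' M.r_zero M.zero_closed act_add act_closed)

lemma zero_act [simp]: "x \<in> carrier M \<Longrightarrow> \<zero> \<odot>\<^bsub>M\<^esub> x = \<zero>\<^bsub>M\<^esub>"
  by (metis A.r_zero A.zero_closed M.add.r_cancel_one' act_closed add_act)

lemma minus_act: "a \<in> carrier A \<Longrightarrow> x \<in> carrier M \<Longrightarrow> (\<ominus> a) \<odot>\<^bsub>M\<^esub> x = \<ominus>\<^bsub>M\<^esub> (a \<odot>\<^bsub>M\<^esub> x)"
  by (metis A.a_inv_closed A.l_neg M.minus_equality act_closed add_act zero_act)

lemma act_minus: "a \<in> carrier A \<Longrightarrow> x \<in> carrier M \<Longrightarrow> a \<odot>\<^bsub>M\<^esub> (\<ominus>\<^bsub>M\<^esub> x) = \<ominus>\<^bsub>M\<^esub> (a \<odot>\<^bsub>M\<^esub> x)"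
  by (metis M.a_inv_closed M.l_neg M.minus_equality act_closed act_add act_zero)

lemma act_finsum:
  assumes "finite I" "f \<in> I \<rightarrow> carrier M" "a \<in> carrier A"
  shows "a \<odot>\<^bsub>M\<^esub> (\<Oplus>\<^bsub>M\<^esub>i\<in>I. f i) = (\<Oplus>\<^bsub>M\<^esub>i\<in>I. a \<odot>\<^bsub>M\<^esub> f i)"
  using assms
proof (induction I)
  case (insert i I)
  then have f: "f \<in> I \<rightarrow> carrier M" "f i \<in> carrier M" by auto
  then have g: "(\<lambda>i. a \<odot>\<^bsub>M\<^esub> f i) \<in> I \<rightarrow> carrier M" using insert.prems by auto
  show ?case
    using insert f g by (simp add: act_add)
qed simp

end

definition lmod_hom ::
  "('k, 'a) module \<Rightarrow> ('a, 'm) module \<Rightarrow> ('a, 'n) module \<Rightarrow> ('m \<Rightarrow> 'n) \<Rightarrow> bool" where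
  "lmod_hom A M N f \<longleftrightarrow> (\<forall>x\<in>carrier M. f x \<in> carrier N) \<and>
     (\<forall>x\<in>carrier M. \<forall>y\<in>carrier M. f (x \<oplus>\<^bsub>M\<^esub> y) = f x \<oplus>\<^bsub>N\<^esub> f y) \<and>
     (\<forall>a\<in>carrier A. \<forall>x\<in>carrier M. f (a \<odot>\<^bsub>M\<^esub> x) = a \<odot>\<^bsub>N\<^esub> f x)"

lemma Hom_module_carrier:
  "f \<in> carrier (Hom_module A M N) \<longleftrightarrow> f \<in> extensional (carrier M) \<and> lmod_hom A M N f"
  by (auto simp: Hom_module_def lmod_hom_def PiE_def)

lemma lmod_hom_restrict:
  assumes "left_module A M"
  shows "lmod_hom A M N (restrict f (carrier M)) \<longleftrightarrow> lmod_hom A M N f"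
proof -
  interpret left_module A M by fact
  show ?thesis by (auto simp: lmod_hom_def)
qed

context
  fixes A :: "('k::field, 'a) module" and M :: "('a, 'm) module" and N :: "('a, 'n) module" and h
  assumes M: "left_module A M" and N: "left_module A N" and h: "lmod_hom A M N h"
begin

interpretation M: left_module A M by (rule M)
interpretation N: left_module A N by (rule N)

lemma lmod_hom_zero: "h \<zero>\<^bsub>M\<^esub> = \<zero>\<^bsub>N\<^esub>"
  using h unfolding lmod_hom_def
  by (metis M.A.zero_closed M.M.zero_closed M.zero_act N.zero_act)

lemma lmod_hom_minus:
  assumes "x \<in> carrier M" shows "h (\<ominus>\<^bsub>M\<^esub> x) = \<ominus>\<^bsub>N\<^esub> h x"
proof -
  have "h (\<ominus>\<^bsub>M\<^esub> x) \<oplus>\<^bsub>N\<^esub> h x = h (\<ominus>\<^bsub>M\<^esub> x \<oplus>\<^bsub>M\<^esub> x)"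
    using h assms by (simp add: lmod_hom_def)
  also have "\<dots> = \<zero>\<^bsub>N\<^esub>" using assms by (simp add: M.M.l_neg lmod_hom_zero)
  finally show ?thesis
    using h assms by (intro N.M.minus_equality[symmetric]) (auto simp: lmod_hom_def)
qed

lemma lmod_hom_finsum:
  assumes "finite I" "f \<in> I \<rightarrow> carrier M"
  shows "h (\<Oplus>\<^bsub>M\<^esub>i\<in>I. f i) = (\<Oplus>\<^bsub>N\<^esub>i\<in>I. h (f i))"
  using assms
proof (induction I)
  case (insert i I)
  then have f: "f \<in> I \<rightarrow> carrier M" "f i \<in> carrier M" by auto
  moreover have "(\<lambda>i. h (f i)) \<in> I \<rightarrow> carrier N" "h (f i) \<in> carrier N"
    using f h by (auto simp: lmod_hom_def)
  ultimately show ?case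
    using insert h by (simp add: lmod_hom_def M.M.finsum_closed)
qed (simp add: lmod_hom_zero)

end

definition single :: "('k, 'a) module \<Rightarrow> 'x \<Rightarrow> 'a \<Rightarrow> 'x \<Rightarrow> 'a" where
  "single A x a = (\<lambda>y. if y = x then a else \<zero>\<^bsub>A\<^esub>)"

definition free_lift :: "('k, 'a) module \<Rightarrow> ('a, 'n) module \<Rightarrow> ('x \<Rightarrow> 'n) \<Rightarrow> ('x \<Rightarrow> 'a) \<Rightarrow> 'n" where
  "free_lift A N g f = (\<Oplus>\<^bsub>N\<^esub>x\<in>{x. f x \<noteq> \<zero>\<^bsub>A\<^esub>}. f x \<odot>\<^bsub>N\<^esub> g x)"

lemma free_eval_eq: "free_eval A M = free_lift A M (\<lambda>m. m)"
  by (simp add: free_eval_def free_lift_def fun_eq_iff)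

lemma free_module_simps [simp]:
  "ring.zero (free_module A X) = (\<lambda>_. \<zero>\<^bsub>A\<^esub>)"
  "f \<oplus>\<^bsub>free_module A X\<^esub> g = (\<lambda>x. f x \<oplus>\<^bsub>A\<^esub> g x)"
  "a \<odot>\<^bsub>free_module A X\<^esub> f = (\<lambda>x. a \<otimes>\<^bsub>A\<^esub> f x)"
  by (simp_all add: free_module_def)

lemma free_module_carrier:
  "f \<in> carrier (free_module A X) \<longleftrightarrow>
     (\<forall>x. f x \<in> carrier A) \<and> finite {x. f x \<noteq> \<zero>\<^bsub>A\<^esub>} \<and> {x. f x \<noteq> \<zero>\<^bsub>A\<^esub>} \<subseteq> X"
  by (simp add: free_module_def)

context algebra_over
begin

lemma single_closed: "x \<in> X \<Longrightarrow> a \<in> carrier A \<Longrightarrow> single A x a \<in> carrier (free_module A X)"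
  unfolding free_module_carrier single_def by (auto intro: finite_subset[of _ "{x}"])

lemma free_module_support:
  assumes "\<And>x. h x \<in> carrier A" "\<And>x. f x = \<zero> \<Longrightarrow> g x = \<zero> \<Longrightarrow> h x = \<zero>"
    and "f \<in> carrier (free_module A X)" "g \<in> carrier (free_module A X)"
  shows "h \<in> carrier (free_module A X)"
proof -
  have "{x. h x \<noteq> \<zero>} \<subseteq> {x. f x \<noteq> \<zero>} \<union> {x. g x \<noteq> \<zero>}" using assms(2) by blast
  then show ?thesis
    using assms(1,3,4) unfolding free_module_carrier
    by (meson finite_UnI finite_subset le_sup_iff order_trans sup_least)
qed

lemma free_module_left_module: "left_module A (free_module A X)"
proof -
  let ?F = "free_module A X"
  have val: "f x \<in> carrier A" if "f \<in> carrier ?F" for f x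
    using that by (simp add: free_module_carrier)
  have "abelian_group ?F"
  proof (rule abelian_groupI)
    show "\<zero>\<^bsub>?F\<^esub> \<in> carrier ?F" by (simp add: free_module_carrier)
    fix f assume f: "f \<in> carrier ?F"
    show "\<exists>g\<in>carrier ?F. g \<oplus>\<^bsub>?F\<^esub> f = \<zero>\<^bsub>?F\<^esub>"
      using f val[OF f]
      by (intro bexI[of _ "\<lambda>x. \<ominus> f x"])
        (auto simp: l_neg fun_eq_iff intro!: free_module_support[of _ f f])
    fix g assume g: "g \<in> carrier ?F"
    show "f \<oplus>\<^bsub>?F\<^esub> g \<in> carrier ?F"
      using f g val by (auto intro!: free_module_support[of _ f g])
  qed (auto simp: a_ac val fun_eq_iff)
  moreover have "a \<odot>\<^bsub>?F\<^esub> f \<in> carrier ?F" if "a \<in> carrier A" "f \<in> carrier ?F" for a f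
    using that val by (auto intro!: free_module_support[of _ f f])
  ultimately show ?thesis
    unfolding left_module_def left_module_axioms_def
    by (auto simp: algebra_over_axioms val l_distr r_distr m_assoc fun_eq_iff)
qed

lemma self_left_module:
  "left_module A \<lparr>carrier = carrier A, mult = undefined, one = undefined, ring.zero = \<zero>,
     ring.add = (\<oplus>), smult = (\<otimes>)\<rparr>"
proof -
  have "abelian_group \<lparr>carrier = carrier A, mult = undefined, one = undefined, ring.zero = \<zero>,
     ring.add = (\<oplus>), smult = (\<otimes>)\<rparr>"
    by (rule abelian_groupI) (auto simp: a_ac intro: exI[of _ "\<ominus> x" for x] l_neg)
  then show ?thesis
    unfolding left_module_def left_module_axioms_def
    by (auto simp: algebra_over_axioms l_distr r_distr m_assoc)
qed

end

context left_module
begin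

lemma free_lift_eq:
  assumes f: "f \<in> carrier (free_module A X)" and g: "g \<in> X \<rightarrow> carrier M"
    and T: "finite T" "{x. f x \<noteq> \<zero>} \<subseteq> T" "T \<subseteq> X"
  shows "free_lift A M g f = (\<Oplus>\<^bsub>M\<^esub>x\<in>T. f x \<odot>\<^bsub>M\<^esub> g x)"
  unfolding free_lift_def
proof (rule M.add.finprod_mono_neutral_cong_left)
  have "f x \<in> carrier A" "x \<in> T \<Longrightarrow> g x \<in> carrier M" for x
    using f g T by (auto simp: free_module_carrier)
  then show "(\<lambda>x. f x \<odot>\<^bsub>M\<^esub> g x) \<in> T \<rightarrow> carrier M"
    and "\<And>x. x \<in> T - {x. f x \<noteq> \<zero>} \<Longrightarrow> f x \<odot>\<^bsub>M\<^esub> g x = \<zero>\<^bsub>M\<^esub>" by auto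
qed (use T in auto)

text \<open>
  The universal property of the free module.
\<close>

lemma free_lift_hom:
  assumes g: "g \<in> X \<rightarrow> carrier M"
  shows "lmod_hom A (free_module A X) M (free_lift A M g)"
  unfolding lmod_hom_def
proof (intro conjI ballI)
  let ?F = "free_module A X"
  interpret F: left_module A ?F by (rule A.free_module_left_module)
  fix f assume f: "f \<in> carrier ?F"
  have fv: "f x \<in> carrier A" for x using f by (simp add: free_module_carrier)
  show "free_lift A M g f \<in> carrier M"
    unfolding free_lift_def using f g
    by (intro M.finsum_closed) (auto simp: free_module_carrier)
  { fix f' assume f': "f' \<in> carrier ?F"
    have f'v: "f' x \<in> carrier A" for x using f' by (simp add: free_module_carrier)
    define T where "T = {x. f x \<noteq> \<zero>} \<union> {x. f' x \<noteq> \<zero>}"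
    have T: "finite T" "T \<subseteq> X" "{x. f x \<noteq> \<zero>} \<subseteq> T" "{x. f' x \<noteq> \<zero>} \<subseteq> T"
      "{x. (f \<oplus>\<^bsub>?F\<^esub> f') x \<noteq> \<zero>} \<subseteq> T"
      using f f' by (auto simp: free_module_carrier T_def)
    have gT: "x \<in> T \<Longrightarrow> g x \<in> carrier M" for x using g T by auto
    show "free_lift A M g (f \<oplus>\<^bsub>?F\<^esub> f') = free_lift A M g f \<oplus>\<^bsub>M\<^esub> free_lift A M g f'"
    proof -
      have "(\<Oplus>\<^bsub>M\<^esub>x\<in>T. (f \<oplus>\<^bsub>?F\<^esub> f') x \<odot>\<^bsub>M\<^esub> g x)
          = (\<Oplus>\<^bsub>M\<^esub>x\<in>T. f x \<odot>\<^bsub>M\<^esub> g x \<oplus>\<^bsub>M\<^esub> f' x \<odot>\<^bsub>M\<^esub> g x)"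
        by (rule M.finsum_cong') (auto simp: fv f'v gT add_act)
      also have "\<dots> = (\<Oplus>\<^bsub>M\<^esub>x\<in>T. f x \<odot>\<^bsub>M\<^esub> g x) \<oplus>\<^bsub>M\<^esub> (\<Oplus>\<^bsub>M\<^esub>x\<in>T. f' x \<odot>\<^bsub>M\<^esub> g x)"
        by (rule M.finsum_addf) (auto simp: fv f'v gT)
      finally show ?thesis
        unfolding free_lift_eq[OF f g T(1,3,2)] free_lift_eq[OF f' g T(1,4,2)]
          free_lift_eq[OF F.M.a_closed[OF f f'] g T(1,5,2)] .
    qed }
  fix a assume a: "a \<in> carrier A"
  have T: "finite {x. f x \<noteq> \<zero>}" "{x. f x \<noteq> \<zero>} \<subseteq> X" "{x. (a \<odot>\<^bsub>?F\<^esub> f) x \<noteq> \<zero>} \<subseteq> {x. f x \<noteq> \<zero>}"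
    using f a by (auto simp: free_module_carrier)
  have gT: "f x \<noteq> \<zero> \<Longrightarrow> g x \<in> carrier M" for x using g T by auto
  show "free_lift A M g (a \<odot>\<^bsub>?F\<^esub> f) = a \<odot>\<^bsub>M\<^esub> free_lift A M g f"
    unfolding free_lift_eq[OF f g T(1) subset_refl T(2)]
      free_lift_eq[OF F.act_closed[OF a f] g T(1,3,2)]
    by (subst act_finsum) (auto simp: T a fv gT mult_act intro!: M.finsum_cong')
qed

lemma free_lift_single:
  assumes "x \<in> X" "g \<in> X \<rightarrow> carrier M" "a \<in> carrier A"
  shows "free_lift A M g (single A x a) = a \<odot>\<^bsub>M\<^esub> g x"
proof -
  have "free_lift A M g (single A x a) = (\<Oplus>\<^bsub>M\<^esub>y\<in>{x}. single A x a y \<odot>\<^bsub>M\<^esub> g y)"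
    using assms by (intro free_lift_eq[of _ X] A.single_closed) (auto simp: single_def)
  also have "\<dots> = a \<odot>\<^bsub>M\<^esub> g x"
  proof -
    have "g x \<in> carrier M" using assms by auto
    then show ?thesis using assms by (simp add: single_def)
  qed
  finally show ?thesis .
qed

lemma free_lift_zero:
  assumes "f \<in> carrier (free_module A X)" "\<And>x. x \<in> X \<Longrightarrow> g x = \<zero>\<^bsub>M\<^esub>"
  shows "free_lift A M g f = \<zero>\<^bsub>M\<^esub>"
  unfolding free_lift_def using assms
  by (intro M.add.finprod_one_eqI) (auto simp: free_module_carrier subset_iff)

end

lemma lmod_hom_free_lift:
  assumes "left_module A M" "left_module A N" "lmod_hom A M N h"
    and f: "f \<in> carrier (free_module A X)" and g: "g \<in> X \<rightarrow> carrier M"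
  shows "h (free_lift A M g f) = free_lift A N (\<lambda>x. h (g x)) f"
proof -
  interpret M: left_module A M by fact
  interpret N: left_module A N by fact
  have gx: "f x \<in> carrier A" "f x \<noteq> \<zero>\<^bsub>A\<^esub> \<Longrightarrow> g x \<in> carrier M" for x
    using f g by (auto simp: free_module_carrier)
  have "h (free_lift A M g f) = (\<Oplus>\<^bsub>N\<^esub>x\<in>{x. f x \<noteq> \<zero>\<^bsub>A\<^esub>}. h (f x \<odot>\<^bsub>M\<^esub> g x))"
    unfolding free_lift_def using f gx
    by (intro lmod_hom_finsum[OF assms(1-3)]) (auto simp: free_module_carrier)
  also have "\<dots> = free_lift A N (\<lambda>x. h (g x)) f"
    unfolding free_lift_def using assms(3) gx
    by (intro N.M.finsum_cong') (auto simp: lmod_hom_def)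
  finally show ?thesis .
qed

section \<open>The first Ext group of a cyclic module\<close>

locale cyclic_ext = M: left_module A M + N: left_module A N
  for A :: "('k::field, 'a) module" (structure) and M :: "('a, 'm) module" and N :: "('a, 'n) module" +
  fixes w :: 'm
  assumes w [simp]: "w \<in> carrier M"
    and cyclic: "\<And>m. m \<in> carrier M \<Longrightarrow> \<exists>a\<in>carrier A. m = a \<odot>\<^bsub>M\<^esub> w"
begin

definition "K0 = {f \<in> carrier (res_P0 A M). free_eval A M f = \<zero>\<^bsub>M\<^esub>}"
definition "K1 = {f \<in> carrier (res_P1 A M). free_eval A (res_P0 A M) f = \<zero>\<^bsub>res_P0 A M\<^esub>}"
definition "J = {a \<in> carrier A. a \<odot>\<^bsub>M\<^esub> w = \<zero>\<^bsub>M\<^esub>}"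

abbreviation "P0 \<equiv> res_P0 A M"
abbreviation "P1 \<equiv> res_P1 A M"
abbreviation "P2 \<equiv> res_P2 A M"

lemma P1_eq: "P1 = free_module A K0" by (simp add: res_P1_def K0_def)
lemma P2_eq: "P2 = free_module A K1" by (simp add: res_P2_def K1_def)

sublocale P0: left_module A P0
  unfolding res_P0_def by (rule M.A.free_module_left_module)
sublocale P1: left_module A P1
  unfolding res_P1_def by (rule M.A.free_module_left_module)

abbreviation "ev0 \<equiv> free_eval A M"
abbreviation "ev1 \<equiv> free_eval A P0"
abbreviation "ev2 \<equiv> free_eval A P1"

lemma ev0: "lmod_hom A P0 M ev0"
  unfolding free_eval_eq res_P0_def by (rule M.free_lift_hom) simp
lemma ev1: "lmod_hom A P1 P0 ev1"
  unfolding free_eval_eq P1_eq by (rule P0.free_lift_hom) (simp add: K0_def)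
lemma ev2: "lmod_hom A P2 P1 ev2"
  unfolding free_eval_eq P2_eq by (rule P1.free_lift_hom) (simp add: K1_def)

lemma ev0_ev1: "z \<in> carrier P1 \<Longrightarrow> ev0 (ev1 z) = \<zero>\<^bsub>M\<^esub>"
proof -
  assume z: "z \<in> carrier P1"
  have "ev0 (free_lift A P0 (\<lambda>k. k) z) = free_lift A M (\<lambda>k. ev0 k) z"
    by (rule lmod_hom_free_lift[OF P0.left_module_axioms M.left_module_axioms ev0, of _ K0])
      (use z in \<open>auto simp: P1_eq K0_def\<close>)
  also have "\<dots> = \<zero>\<^bsub>M\<^esub>"
    by (rule M.free_lift_zero[of _ K0]) (use z in \<open>auto simp: P1_eq K0_def\<close>)
  finally show ?thesis by (simp add: free_eval_eq[of A P0])
qed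

lemma ev1_K0: "z \<in> carrier P1 \<Longrightarrow> ev1 z \<in> K0"
  using ev1 ev0_ev1 by (simp add: K0_def lmod_hom_def)

lemma ev1_ev2: "z \<in> carrier P2 \<Longrightarrow> ev1 (ev2 z) = \<zero>\<^bsub>P0\<^esub>"
proof -
  assume z: "z \<in> carrier P2"
  have "ev1 (free_lift A P1 (\<lambda>k. k) z) = free_lift A P0 (\<lambda>k. ev1 k) z"
    by (rule lmod_hom_free_lift[OF P1.left_module_axioms P0.left_module_axioms ev1, of _ K1])
      (use z in \<open>auto simp: P2_eq K1_def\<close>)
  also have "\<dots> = \<zero>\<^bsub>P0\<^esub>"
    by (rule P0.free_lift_zero[of _ K1]) (use z in \<open>auto simp: P2_eq K1_def\<close>)
  finally show ?thesis by (simp add: free_eval_eq[of A P1])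
qed

lemma ev1_single: "k \<in> K0 \<Longrightarrow> single A k \<one> \<in> carrier P1" "k \<in> K0 \<Longrightarrow> ev1 (single A k \<one>) = k"
proof -
  assume k: "k \<in> K0"
  show "single A k \<one> \<in> carrier P1" unfolding P1_eq using k by (intro M.A.single_closed) auto
  have "free_lift A P0 (\<lambda>m. m) (single A k \<one>) = \<one> \<odot>\<^bsub>P0\<^esub> k"
    by (rule P0.free_lift_single[of _ K0]) (use k in \<open>auto simp: K0_def\<close>)
  also have "\<dots> = k" using k by (intro P0.one_act) (simp add: K0_def)
  finally show "ev1 (single A k \<one>) = k" by (simp add: free_eval_eq)
qed

lemma ev2_single: "z \<in> K1 \<Longrightarrow> single A z \<one> \<in> carrier P2" "z \<in> K1 \<Longrightarrow> ev2 (single A z \<one>) = z"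
proof -
  assume k: "z \<in> K1"
  show "single A z \<one> \<in> carrier P2" unfolding P2_eq using k by (intro M.A.single_closed) auto
  have "free_lift A P1 (\<lambda>m. m) (single A z \<one>) = \<one> \<odot>\<^bsub>P1\<^esub> z"
    by (rule P1.free_lift_single[of _ K1]) (use k in \<open>auto simp: K1_def\<close>)
  also have "\<dots> = z" using k by (intro P1.one_act) (simp add: K1_def)
  finally show "ev2 (single A z \<one>) = z" by (simp add: free_eval_eq)
qed

lemma K0_closed:
  "k \<in> K0 \<Longrightarrow> k \<in> carrier P0"
  "k \<in> K0 \<Longrightarrow> k' \<in> K0 \<Longrightarrow> k \<oplus>\<^bsub>P0\<^esub> k' \<in> K0"
  "k \<in> K0 \<Longrightarrow> \<ominus>\<^bsub>P0\<^esub> k \<in> K0"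
  "a \<in> carrier A \<Longrightarrow> k \<in> K0 \<Longrightarrow> a \<odot>\<^bsub>P0\<^esub> k \<in> K0"
  using ev0 lmod_hom_minus[OF P0.left_module_axioms M.left_module_axioms ev0]
  by (auto simp: K0_def lmod_hom_def)

lemma J_closed:
  "a \<in> J \<Longrightarrow> a \<in> carrier A"
  "a \<in> J \<Longrightarrow> b \<in> J \<Longrightarrow> a \<oplus> b \<in> J"
  "a \<in> carrier A \<Longrightarrow> b \<in> J \<Longrightarrow> a \<otimes> b \<in> J"
  by (auto simp: J_def M.add_act M.mult_act)

definition K0_hom :: "(('m \<Rightarrow> 'a) \<Rightarrow> 'n) \<Rightarrow> bool" where
  "K0_hom h \<longleftrightarrow> (\<forall>k\<in>K0. h k \<in> carrier N) \<and>
     (\<forall>k\<in>K0. \<forall>k'\<in>K0. h (k \<oplus>\<^bsub>P0\<^esub> k') = h k \<oplus>\<^bsub>N\<^esub> h k') \<and>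
     (\<forall>a\<in>carrier A. \<forall>k\<in>K0. h (a \<odot>\<^bsub>P0\<^esub> k) = a \<odot>\<^bsub>N\<^esub> h k)"

abbreviation "Z1 \<equiv> Ext1_cocycles A M N"
abbreviation "B1 \<equiv> Ext1_coboundaries A M N"

lemma Z1_iff: "f \<in> Z1 \<longleftrightarrow> f \<in> extensional (carrier P1) \<and> lmod_hom A P1 N f \<and>
    (\<forall>z\<in>carrier P2. f (ev2 z) = \<zero>\<^bsub>N\<^esub>)"
  by (auto simp: Ext1_cocycles_def Hom_module_carrier)

text \<open>
  A cocycle vanishes on the image of \<open>P2\<close>, which is the whole kernel of \<open>P1 \<rightarrow> P0\<close>; so it factors
  through the kernel \<open>K0\<close> of \<open>P0 \<rightarrow> M\<close>.
\<close>

lemma cocycle_factors: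
  assumes f: "f \<in> Z1"
  obtains h where "K0_hom h" "\<And>z. z \<in> carrier P1 \<Longrightarrow> f z = h (ev1 z)"
proof -
  have fh: "lmod_hom A P1 N f" using f by (simp add: Z1_iff)
  have eq: "f z = f z'" if z: "z \<in> carrier P1" "z' \<in> carrier P1" "ev1 z = ev1 z'" for z z'
  proof -
    have e1: "ev1 (\<ominus>\<^bsub>P1\<^esub> z') = \<ominus>\<^bsub>P0\<^esub> ev1 z'"
      by (rule lmod_hom_minus[OF P1.left_module_axioms P0.left_module_axioms ev1 z(2)])
    have "ev1 (z \<oplus>\<^bsub>P1\<^esub> (\<ominus>\<^bsub>P1\<^esub> z')) = ev1 z \<oplus>\<^bsub>P0\<^esub> ev1 (\<ominus>\<^bsub>P1\<^esub> z')"
      using ev1 z P1.M.a_inv_closed[of z'] unfolding lmod_hom_def by blast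
    also have "\<dots> = \<zero>\<^bsub>P0\<^esub>"
      unfolding e1 z(3) using ev1 z by (intro P0.M.r_neg) (auto simp: lmod_hom_def)
    finally have k: "z \<oplus>\<^bsub>P1\<^esub> (\<ominus>\<^bsub>P1\<^esub> z') \<in> K1" using z by (simp add: K1_def del: free_module_simps)
    have "\<zero>\<^bsub>N\<^esub> = f (z \<oplus>\<^bsub>P1\<^esub> (\<ominus>\<^bsub>P1\<^esub> z'))"
      using f ev2_single[OF k] unfolding Z1_iff by metis
    also have "\<dots> = f z \<oplus>\<^bsub>N\<^esub> (\<ominus>\<^bsub>N\<^esub> f z')"
      using fh z P1.M.a_inv_closed[of z']
        lmod_hom_minus[OF P1.left_module_axioms N.left_module_axioms fh z(2)]
      unfolding lmod_hom_def by metis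
    finally have "f z \<oplus>\<^bsub>N\<^esub> (\<ominus>\<^bsub>N\<^esub> f z') = \<zero>\<^bsub>N\<^esub>" ..
    then show ?thesis
      using fh z unfolding lmod_hom_def
      by (metis N.M.a_inv_closed N.M.minus_equality N.M.minus_minus N.M.add.m_comm)
  qed
  define h where "h k = f (single A k \<one>)" for k
  have fz: "f z = h (ev1 z)" if z: "z \<in> carrier P1" for z
    unfolding h_def using z ev1_K0[OF z] by (intro eq) (simp_all add: ev1_single)
  have "K0_hom h"
    unfolding K0_hom_def
  proof (intro conjI ballI)
    fix k assume k: "k \<in> K0"
    note s = ev1_single[OF k]
    show "h k \<in> carrier N" using fh s unfolding h_def lmod_hom_def by blast
    { fix k' assume k': "k' \<in> K0"
      note s' = ev1_single[OF k']
      have "h (k \<oplus>\<^bsub>P0\<^esub> k') = h (ev1 (single A k \<one> \<oplus>\<^bsub>P1\<^esub> single A k' \<one>))"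
        using ev1 s s' unfolding lmod_hom_def by metis
      also have "\<dots> = f (single A k \<one> \<oplus>\<^bsub>P1\<^esub> single A k' \<one>)"
        by (rule fz[symmetric], rule P1.M.a_closed[OF s(1) s'(1)])
      also have "\<dots> = h k \<oplus>\<^bsub>N\<^esub> h k'"
        using fh s s' unfolding lmod_hom_def h_def by blast
      finally show "h (k \<oplus>\<^bsub>P0\<^esub> k') = h k \<oplus>\<^bsub>N\<^esub> h k'" . }
    fix a assume a: "a \<in> carrier A"
    have "h (a \<odot>\<^bsub>P0\<^esub> k) = h (ev1 (a \<odot>\<^bsub>P1\<^esub> single A k \<one>))"
      using ev1 s a unfolding lmod_hom_def by metis
    also have "\<dots> = f (a \<odot>\<^bsub>P1\<^esub> single A k \<one>)"
      by (rule fz[symmetric], rule P1.act_closed[OF a s(1)])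
    also have "\<dots> = a \<odot>\<^bsub>N\<^esub> h k"
      using fh s a unfolding lmod_hom_def h_def by blast
    finally show "h (a \<odot>\<^bsub>P0\<^esub> k) = a \<odot>\<^bsub>N\<^esub> h k" .
  qed
  then show thesis using fz by (rule that)
qed

lemma K0_hom_cocycle:
  assumes h: "K0_hom h" shows "(\<lambda>z\<in>carrier P1. h (ev1 z)) \<in> Z1"
proof -
  have "lmod_hom A P1 N (\<lambda>z. h (ev1 z))"
    using ev1 ev1_K0 h unfolding lmod_hom_def K0_hom_def by metis
  moreover have "h (ev1 (ev2 z)) = \<zero>\<^bsub>N\<^esub>" if z: "z \<in> carrier P2" for z
  proof -
    have k: "\<zero>\<^bsub>P0\<^esub> \<in> K0"
      by (simp add: K0_def lmod_hom_zero[OF P0.left_module_axioms M.left_module_axioms ev0] del: free_module_simps)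
    have "h \<zero>\<^bsub>P0\<^esub> = h (\<zero> \<odot>\<^bsub>P0\<^esub> \<zero>\<^bsub>P0\<^esub>)" by (simp del: free_module_simps)
    also have "\<dots> = \<zero>\<^bsub>N\<^esub>" using h k unfolding K0_hom_def by (metis M.A.zero_closed N.zero_act)
    finally show ?thesis by (simp only: ev1_ev2[OF z])
  qed
  moreover have "ev2 z \<in> carrier P1" if "z \<in> carrier P2" for z
    using ev2 that by (simp add: lmod_hom_def)
  ultimately show ?thesis
    by (simp add: Z1_iff lmod_hom_restrict[OF P1.left_module_axioms])
qed

text \<open>The element \<open>a [w]\<close> of \<open>P0\<close>, and the restriction of a cocycle to \<open>J \<cong> J [w] \<subseteq> K0\<close>.\<close>

definition "at_w a = single A w a"
definition "restrict_to_J f a = f (single A (at_w a) \<one>)"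

lemma at_w:
  "a \<in> carrier A \<Longrightarrow> at_w a \<in> carrier P0" "a \<in> carrier A \<Longrightarrow> ev0 (at_w a) = a \<odot>\<^bsub>M\<^esub> w"
  "a \<in> carrier A \<Longrightarrow> b \<in> carrier A \<Longrightarrow> at_w (a \<oplus> b) = at_w a \<oplus>\<^bsub>P0\<^esub> at_w b"
  "a \<in> carrier A \<Longrightarrow> b \<in> carrier A \<Longrightarrow> at_w (a \<otimes> b) = a \<odot>\<^bsub>P0\<^esub> at_w b"
proof -
  show "a \<in> carrier A \<Longrightarrow> at_w a \<in> carrier P0"
    unfolding at_w_def res_P0_def by (intro M.A.single_closed) simp
  show "a \<in> carrier A \<Longrightarrow> ev0 (at_w a) = a \<odot>\<^bsub>M\<^esub> w"
    unfolding at_w_def free_eval_eq by (rule M.free_lift_single[of _ "carrier M"]) auto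
qed (auto simp: at_w_def res_P0_def single_def fun_eq_iff)

lemma at_w_J: "a \<in> J \<Longrightarrow> at_w a \<in> K0"
  by (simp add: K0_def J_def at_w)

definition "J_hom \<phi> \<longleftrightarrow> (\<forall>a\<in>J. \<phi> a \<in> carrier N) \<and>
     (\<forall>a\<in>J. \<forall>b\<in>J. \<phi> (a \<oplus> b) = \<phi> a \<oplus>\<^bsub>N\<^esub> \<phi> b) \<and>
     (\<forall>a\<in>carrier A. \<forall>b\<in>J. \<phi> (a \<otimes> b) = a \<odot>\<^bsub>N\<^esub> \<phi> b)"

lemma restrict_to_J_factor:
  assumes "\<And>z. z \<in> carrier P1 \<Longrightarrow> f z = h (ev1 z)" "a \<in> J"
  shows "restrict_to_J f a = h (at_w a)"
  using assms at_w_J by (simp add: restrict_to_J_def ev1_single)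

lemma restrict_to_J_hom:
  assumes "f \<in> Z1" shows "J_hom (restrict_to_J f)"
proof -
  obtain h where h: "K0_hom h" "\<And>z. z \<in> carrier P1 \<Longrightarrow> f z = h (ev1 z)"
    by (rule cocycle_factors[OF assms]) blast
  show ?thesis
    using h(1) at_w_J J_closed unfolding J_hom_def K0_hom_def
    by (simp add: restrict_to_J_factor[of f h, OF h(2)] at_w del: free_module_simps)
qed

text \<open>
  Choosing \<open>\<alpha> m\<close> with \<open>m = \<alpha> m w\<close> gives a homomorphism \<open>\<rho> : P0 \<rightarrow> A\<close> that lifts \<open>P0 \<rightarrow> M\<close> and
  sends \<open>[w]\<close> to \<open>1\<close>; it retracts \<open>K0\<close> onto \<open>J\<close>.
\<close>

lemma obtain_retraction:
  obtains \<rho> where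
    "\<And>f. f \<in> carrier P0 \<Longrightarrow> \<rho> f \<in> carrier A"
    "\<And>f g. f \<in> carrier P0 \<Longrightarrow> g \<in> carrier P0 \<Longrightarrow> \<rho> (f \<oplus>\<^bsub>P0\<^esub> g) = \<rho> f \<oplus> \<rho> g"
    "\<And>a f. a \<in> carrier A \<Longrightarrow> f \<in> carrier P0 \<Longrightarrow> \<rho> (a \<odot>\<^bsub>P0\<^esub> f) = a \<otimes> \<rho> f"
    "\<And>f. f \<in> carrier P0 \<Longrightarrow> \<rho> f \<odot>\<^bsub>M\<^esub> w = ev0 f"
    "\<And>a. a \<in> carrier A \<Longrightarrow> \<rho> (at_w a) = a"
proof -
  define S :: "('a, 'a) module" where "S = \<lparr>carrier = carrier A, mult = undefined, one = undefined, ring.zero = \<zero>,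
     ring.add = (\<oplus>), smult = (\<otimes>)\<rparr>"
  interpret S: left_module A S unfolding S_def by (rule M.A.self_left_module)
  have Ss: "carrier S = carrier A" "x \<oplus>\<^bsub>S\<^esub> y = x \<oplus> y" "x \<odot>\<^bsub>S\<^esub> y = x \<otimes> y" for x y
    by (simp_all add: S_def)
  obtain \<alpha>0 where \<alpha>0: "\<And>m. m \<in> carrier M \<Longrightarrow> \<alpha>0 m \<in> carrier A \<and> m = \<alpha>0 m \<odot>\<^bsub>M\<^esub> w"
    using cyclic by metis
  define \<alpha> where "\<alpha> m = (if m = w then \<one> else \<alpha>0 m)" for m
  have \<alpha>: "\<alpha> m \<in> carrier A" "\<alpha> m \<odot>\<^bsub>M\<^esub> w = m" if "m \<in> carrier M" for m
    using \<alpha>0[OF that] by (auto simp: \<alpha>_def)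
  define \<rho> where "\<rho> = free_lift A S \<alpha>"
  have \<rho>: "lmod_hom A P0 S \<rho>"
    unfolding \<rho>_def res_P0_def by (rule S.free_lift_hom) (auto simp: Ss \<alpha>)
  have sw: "lmod_hom A S M (\<lambda>a. a \<odot>\<^bsub>M\<^esub> w)"
    by (auto simp: lmod_hom_def Ss M.add_act M.mult_act)
  show thesis
  proof (rule that[of \<rho>])
    fix f assume f: "f \<in> carrier P0"
    have fv: "f x \<in> carrier A" "f x \<noteq> \<zero> \<Longrightarrow> x \<in> carrier M" for x
      using f by (auto simp: res_P0_def free_module_carrier)
    have "\<rho> f \<odot>\<^bsub>M\<^esub> w = free_lift A M (\<lambda>m. \<alpha> m \<odot>\<^bsub>M\<^esub> w) f"
      unfolding \<rho>_def
      by (rule lmod_hom_free_lift[OF S.left_module_axioms M.left_module_axioms sw, of _ "carrier M"])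
        (use f in \<open>auto simp: Ss \<alpha> res_P0_def\<close>)
    also have "\<dots> = ev0 f"
      unfolding free_eval_def free_lift_def
      by (rule M.M.finsum_cong') (auto simp: \<alpha> fv)
    finally show "\<rho> f \<odot>\<^bsub>M\<^esub> w = ev0 f" .
  next
    fix a assume a: "a \<in> carrier A"
    have "\<rho> (at_w a) = a \<odot>\<^bsub>S\<^esub> \<alpha> w"
      unfolding \<rho>_def at_w_def by (rule S.free_lift_single[of _ "carrier M"]) (auto simp: Ss \<alpha> a)
    then show "\<rho> (at_w a) = a" using a by (simp add: Ss \<alpha>_def)
  qed (use \<rho> in \<open>auto simp: lmod_hom_def Ss\<close>)
qed

lemma J_hom_extends:
  assumes \<phi>: "J_hom \<phi>"
  obtains f where "f \<in> Z1" "\<And>a. a \<in> J \<Longrightarrow> restrict_to_J f a = \<phi> a"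
proof -
  obtain \<rho> where \<rho>:
    "\<And>f. f \<in> carrier P0 \<Longrightarrow> \<rho> f \<in> carrier A"
    "\<And>f g. f \<in> carrier P0 \<Longrightarrow> g \<in> carrier P0 \<Longrightarrow> \<rho> (f \<oplus>\<^bsub>P0\<^esub> g) = \<rho> f \<oplus> \<rho> g"
    "\<And>a f. a \<in> carrier A \<Longrightarrow> f \<in> carrier P0 \<Longrightarrow> \<rho> (a \<odot>\<^bsub>P0\<^esub> f) = a \<otimes> \<rho> f"
    "\<And>f. f \<in> carrier P0 \<Longrightarrow> \<rho> f \<odot>\<^bsub>M\<^esub> w = ev0 f"
    "\<And>a. a \<in> carrier A \<Longrightarrow> \<rho> (at_w a) = a" using obtain_retraction by blast
  have J: "\<rho> k \<in> J" if "k \<in> K0" for k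
    using that \<rho>(1,4) by (simp add: K0_def J_def)
  have h: "K0_hom (\<lambda>k. \<phi> (\<rho> k))"
    using \<phi> J \<rho>(2,3) K0_closed(1) unfolding K0_hom_def J_hom_def by simp
  define f where "f = (\<lambda>z\<in>carrier P1. \<phi> (\<rho> (ev1 z)))"
  have "f \<in> Z1" unfolding f_def by (rule K0_hom_cocycle[OF h])
  moreover have "restrict_to_J f a = \<phi> a" if "a \<in> J" for a
    using that restrict_to_J_factor[of f "\<lambda>k. \<phi> (\<rho> k)"] \<rho>(5) J_closed(1) by (simp add: f_def)
  ultimately show thesis by (rule that)
qed

text \<open>
  A cocycle is a homomorphism \<open>h\<close> on \<open>K0\<close>. If its restriction to \<open>J\<close> is \<open>a \<mapsto> a n\<close>, then \<open>h\<close> extends to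
  \<open>P0 = A [w] + K0\<close> by \<open>[w] \<mapsto> n\<close>; the retraction \<open>\<rho>\<close> makes this extension explicit.
\<close>

lemma coboundary_iff:
  assumes f: "f \<in> Z1"
  shows "f \<in> B1 \<longleftrightarrow> (\<exists>n\<in>carrier N. \<forall>a\<in>J. restrict_to_J f a = a \<odot>\<^bsub>N\<^esub> n)"
proof
  assume "f \<in> B1"
  then obtain g where g: "lmod_hom A P0 N g" and fg: "f = (\<lambda>z\<in>carrier P1. g (ev1 z))"
    unfolding Ext1_coboundaries_def by (auto simp: Hom_module_carrier)
  have "restrict_to_J f a = a \<odot>\<^bsub>N\<^esub> g (at_w \<one>)" if a: "a \<in> J" for a
  proof -
    have "restrict_to_J f a = g (at_w (a \<otimes> \<one>))"
      using a J_closed(1) restrict_to_J_factor[of f g] by (simp add: fg)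
    also have "\<dots> = a \<odot>\<^bsub>N\<^esub> g (at_w \<one>)"
      unfolding at_w(4)[OF J_closed(1)[OF a] M.A.one_closed]
      using J_closed(1)[OF a] g at_w(1)[OF M.A.one_closed] unfolding lmod_hom_def by blast
    finally show ?thesis .
  qed
  moreover have "g (at_w \<one>) \<in> carrier N" using g at_w(1) by (simp add: lmod_hom_def)
  ultimately show "\<exists>n\<in>carrier N. \<forall>a\<in>J. restrict_to_J f a = a \<odot>\<^bsub>N\<^esub> n" by blast
next
  assume "\<exists>n\<in>carrier N. \<forall>a\<in>J. restrict_to_J f a = a \<odot>\<^bsub>N\<^esub> n"
  then obtain n where n: "n \<in> carrier N" and fn: "\<And>a. a \<in> J \<Longrightarrow> restrict_to_J f a = a \<odot>\<^bsub>N\<^esub> n" by blast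
  obtain h where h: "K0_hom h" and fh: "\<And>z. z \<in> carrier P1 \<Longrightarrow> f z = h (ev1 z)"
    by (rule cocycle_factors[OF f]) blast
  have hn: "h (at_w a) = a \<odot>\<^bsub>N\<^esub> n" if "a \<in> J" for a
    using fn[OF that] restrict_to_J_factor[of f h, OF fh that] by simp
  obtain \<rho> where \<rho>:
    "\<And>f. f \<in> carrier P0 \<Longrightarrow> \<rho> f \<in> carrier A"
    "\<And>f g. f \<in> carrier P0 \<Longrightarrow> g \<in> carrier P0 \<Longrightarrow> \<rho> (f \<oplus>\<^bsub>P0\<^esub> g) = \<rho> f \<oplus> \<rho> g"
    "\<And>a f. a \<in> carrier A \<Longrightarrow> f \<in> carrier P0 \<Longrightarrow> \<rho> (a \<odot>\<^bsub>P0\<^esub> f) = a \<otimes> \<rho> f"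
    "\<And>f. f \<in> carrier P0 \<Longrightarrow> \<rho> f \<odot>\<^bsub>M\<^esub> w = ev0 f"
    "\<And>a. a \<in> carrier A \<Longrightarrow> \<rho> (at_w a) = a" using obtain_retraction by blast
  \<comment> \<open>The projection of \<open>P0\<close> to \<open>K0\<close> along \<open>A [w]\<close>.\<close>
  define q where "q x = x \<oplus>\<^bsub>P0\<^esub> (\<ominus>\<^bsub>P0\<^esub> at_w (\<rho> x))" for x
  have qc: "q x \<in> carrier P0" if "x \<in> carrier P0" for x
    unfolding q_def using that \<rho>(1) at_w(1) by (intro P0.M.a_closed P0.M.a_inv_closed) auto
  have q: "q x \<in> K0" if x: "x \<in> carrier P0" for x
  proof -
    have r: "\<rho> x \<in> carrier A" using \<rho>(1) x .
    have "ev0 (q x) = ev0 x \<oplus>\<^bsub>M\<^esub> ev0 (\<ominus>\<^bsub>P0\<^esub> at_w (\<rho> x))"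
      unfolding q_def using ev0 x at_w(1)[OF r] P0.M.a_inv_closed unfolding lmod_hom_def by blast
    also have "\<dots> = ev0 x \<oplus>\<^bsub>M\<^esub> (\<ominus>\<^bsub>M\<^esub> ev0 x)"
      using lmod_hom_minus[OF P0.left_module_axioms M.left_module_axioms ev0 at_w(1)[OF r]] at_w(2)[OF r] \<rho>(4)[OF x]
      by simp
    also have "\<dots> = \<zero>\<^bsub>M\<^esub>" using ev0 x by (intro M.M.r_neg) (simp add: lmod_hom_def)
    finally show ?thesis using qc[OF x] by (simp add: K0_def)
  qed
  have q_add: "q (x \<oplus>\<^bsub>P0\<^esub> y) = q x \<oplus>\<^bsub>P0\<^esub> q y" if "x \<in> carrier P0" "y \<in> carrier P0" for x y
  proof -
    have c: "at_w (\<rho> x) \<in> carrier P0" "at_w (\<rho> y) \<in> carrier P0" using that \<rho>(1) at_w(1) by auto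
    have "q (x \<oplus>\<^bsub>P0\<^esub> y) = (x \<oplus>\<^bsub>P0\<^esub> y) \<oplus>\<^bsub>P0\<^esub> (\<ominus>\<^bsub>P0\<^esub> (at_w (\<rho> x) \<oplus>\<^bsub>P0\<^esub> at_w (\<rho> y)))"
      unfolding q_def using that \<rho>(1,2) at_w(3) by metis
    also have "\<dots> = (x \<oplus>\<^bsub>P0\<^esub> y) \<oplus>\<^bsub>P0\<^esub> ((\<ominus>\<^bsub>P0\<^esub> at_w (\<rho> x)) \<oplus>\<^bsub>P0\<^esub> (\<ominus>\<^bsub>P0\<^esub> at_w (\<rho> y)))"
      using P0.M.minus_add[OF c] by metis
    also have "\<dots> = q x \<oplus>\<^bsub>P0\<^esub> q y"
      unfolding q_def using that P0.M.a_inv_closed[OF c(1)] P0.M.a_inv_closed[OF c(2)]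
      by (simp add: P0.M.a_ac del: free_module_simps)
    finally show ?thesis .
  qed
  have q_act: "q (a \<odot>\<^bsub>P0\<^esub> x) = a \<odot>\<^bsub>P0\<^esub> q x" if "a \<in> carrier A" "x \<in> carrier P0" for a x
    using that \<rho>(1) at_w(1) at_w(4)[of a "\<rho> x"] \<rho>(3)[of a x]
    by (simp add: q_def P0.act_add P0.act_minus del: free_module_simps)
  define g where "g x = h (q x) \<oplus>\<^bsub>N\<^esub> (\<rho> x \<odot>\<^bsub>N\<^esub> n)" for x
  have hc: "h k \<in> carrier N" if "k \<in> K0" for k using h that by (simp add: K0_hom_def)
  have "lmod_hom A P0 N g"
    unfolding lmod_hom_def
  proof (intro conjI ballI)
    fix x assume x: "x \<in> carrier P0"
    show "g x \<in> carrier N" using hc q x \<rho>(1) n by (simp add: g_def)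
    { fix y assume y: "y \<in> carrier P0"
      have "h (q (x \<oplus>\<^bsub>P0\<^esub> y)) = h (q x) \<oplus>\<^bsub>N\<^esub> h (q y)"
        unfolding q_add[OF x y] using h q x y by (simp add: K0_hom_def)
      then show "g (x \<oplus>\<^bsub>P0\<^esub> y) = g x \<oplus>\<^bsub>N\<^esub> g y"
        unfolding g_def using \<rho>(1,2) x y n hc q by (simp add: N.add_act N.M.a_ac) }
    fix a assume a: "a \<in> carrier A"
    have "h (q (a \<odot>\<^bsub>P0\<^esub> x)) = a \<odot>\<^bsub>N\<^esub> h (q x)"
      unfolding q_act[OF a x] using h q x a by (simp add: K0_hom_def)
    then show "g (a \<odot>\<^bsub>P0\<^esub> x) = a \<odot>\<^bsub>N\<^esub> g x"
      unfolding g_def using \<rho>(1,3) x a n hc q by (simp add: N.act_add N.mult_act)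
  qed
  then have gH: "restrict g (carrier P0) \<in> carrier (Hom_module A P0 N)"
    by (simp add: Hom_module_carrier lmod_hom_restrict[OF P0.left_module_axioms])
  have "h k = g k" if k: "k \<in> K0" for k
  proof -
    have x: "k \<in> carrier P0" and r: "\<rho> k \<in> J"
      using k \<rho>(1)[of k] \<rho>(4)[of k] by (auto simp: K0_def J_def)
    have b: "at_w (\<rho> k) \<in> K0" by (rule at_w_J[OF r])
    have bc: "at_w (\<rho> k) \<in> carrier P0" using b K0_closed(1) by blast
    have "k = q k \<oplus>\<^bsub>P0\<^esub> at_w (\<rho> k)"
      unfolding q_def using x bc P0.M.a_inv_closed[OF bc]
      by (simp add: P0.M.a_assoc P0.M.l_neg del: free_module_simps)
    then have "h k = h (q k) \<oplus>\<^bsub>N\<^esub> h (at_w (\<rho> k))"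
      using h q[OF x] b unfolding K0_hom_def by metis
    then show ?thesis by (simp add: g_def hn[OF r])
  qed
  then have "f = (\<lambda>z\<in>carrier P1. restrict g (carrier P0) (ev1 z))"
    using fh f ev1_K0 K0_closed(1) unfolding Z1_iff by (auto simp: extensional_def)
  then show "f \<in> B1" unfolding Ext1_coboundaries_def using gH by blast
qed

definition "V1 = (Hom_module A P1 N)\<lparr>carrier := Z1\<rparr>"

lemma V1_simps:
  "carrier V1 = Z1" "f \<oplus>\<^bsub>V1\<^esub> g = (\<lambda>z\<in>carrier P1. f z \<oplus>\<^bsub>N\<^esub> g z)"
  "\<zero>\<^bsub>V1\<^esub> = (\<lambda>z\<in>carrier P1. \<zero>\<^bsub>N\<^esub>)" "c \<odot>\<^bsub>V1\<^esub> f = (\<lambda>z\<in>carrier P1. (c \<odot> \<one>) \<odot>\<^bsub>N\<^esub> f z)"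
  by (simp_all add: V1_def Hom_module_def)

lemma Ext1_eq: "Ext1 A M N = quot V1 B1"
  by (simp add: Ext1_def V1_def)

lemma Z1_I:
  assumes "lmod_hom A P1 N f" "\<And>z. z \<in> carrier P2 \<Longrightarrow> f (ev2 z) = \<zero>\<^bsub>N\<^esub>"
  shows "restrict f (carrier P1) \<in> Z1"
  using assms ev2 by (simp add: Z1_iff lmod_hom_restrict[OF P1.left_module_axioms] lmod_hom_def)

lemma zero_Z1: "\<zero>\<^bsub>V1\<^esub> \<in> Z1"
  unfolding V1_simps by (intro Z1_I) (auto simp: lmod_hom_def)

lemma Z1_closed:
  assumes f: "f \<in> Z1" and g: "g \<in> Z1"
  shows "f \<oplus>\<^bsub>V1\<^esub> g \<in> Z1" "(\<lambda>z\<in>carrier P1. \<ominus>\<^bsub>N\<^esub> f z) \<in> Z1" "c \<odot>\<^bsub>V1\<^esub> f \<in> Z1"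
proof -
  note fg = f[unfolded Z1_iff lmod_hom_def] g[unfolded Z1_iff lmod_hom_def]
  show "f \<oplus>\<^bsub>V1\<^esub> g \<in> Z1" unfolding V1_simps using fg
    by (intro Z1_I) (auto simp: lmod_hom_def N.act_add N.M.a_ac simp del: free_module_simps)
  show "(\<lambda>z\<in>carrier P1. \<ominus>\<^bsub>N\<^esub> f z) \<in> Z1" using fg
    by (intro Z1_I) (auto simp: lmod_hom_def N.act_minus N.M.minus_add simp del: free_module_simps)
  have "(c \<odot> \<one>) \<odot>\<^bsub>N\<^esub> (a \<odot>\<^bsub>N\<^esub> x) = a \<odot>\<^bsub>N\<^esub> ((c \<odot> \<one>) \<odot>\<^bsub>N\<^esub> x)"
    if "a \<in> carrier A" "x \<in> carrier N" for a x
    using that by (simp flip: N.mult_act add: M.A.scalar_central)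
  then show "c \<odot>\<^bsub>V1\<^esub> f \<in> Z1" unfolding V1_simps using fg
    by (intro Z1_I) (auto simp: lmod_hom_def N.act_add simp del: free_module_simps)
qed

lemma V1_abelian_group: "abelian_group V1"
proof (rule abelian_groupI)
  fix f assume f: "f \<in> carrier V1"
  then show "\<exists>g\<in>carrier V1. g \<oplus>\<^bsub>V1\<^esub> f = \<zero>\<^bsub>V1\<^esub>"
    using Z1_closed(2)[of f f]
    by (intro bexI[of _ "\<lambda>z\<in>carrier P1. \<ominus>\<^bsub>N\<^esub> f z"])
      (auto simp: V1_simps Z1_iff lmod_hom_def N.M.l_neg intro!: restrict_ext)
qed (use Z1_closed(1) zero_Z1 in \<open>auto simp: V1_simps(1)\<close>, auto simp: V1_simps Z1_iff lmod_hom_def N.M.a_ac extensional_def fun_eq_iff)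

lemma restrict_to_J_V1:
  assumes "f \<in> Z1" "g \<in> Z1" "a \<in> J"
  shows "restrict_to_J (f \<oplus>\<^bsub>V1\<^esub> g) a = restrict_to_J f a \<oplus>\<^bsub>N\<^esub> restrict_to_J g a"
    "restrict_to_J (c \<odot>\<^bsub>V1\<^esub> f) a = (c \<odot> \<one>) \<odot>\<^bsub>N\<^esub> restrict_to_J f a"
    "restrict_to_J \<zero>\<^bsub>V1\<^esub> a = \<zero>\<^bsub>N\<^esub>"
    "restrict_to_J (\<lambda>z\<in>carrier P1. \<ominus>\<^bsub>N\<^esub> f z) a = \<ominus>\<^bsub>N\<^esub> restrict_to_J f a"
  using ev1_single(1)[OF at_w_J[OF assms(3)]] by (simp_all add: V1_simps restrict_to_J_def)

lemma B1_subset: "B1 \<subseteq> Z1"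
proof
  fix f assume "f \<in> B1"
  then obtain g where g: "lmod_hom A P0 N g" and fg: "f = (\<lambda>z\<in>carrier P1. g (ev1 z))"
    unfolding Ext1_coboundaries_def by (auto simp: Hom_module_carrier)
  have "K0_hom g" using g K0_closed(1) unfolding K0_hom_def lmod_hom_def by blast
  then show "f \<in> Z1" unfolding fg by (rule K0_hom_cocycle)
qed

lemma B1_subgroup: "subgroup B1 (add_monoid V1)"
proof (rule group.subgroupI)
  interpret V1: abelian_group V1 by (rule V1_abelian_group)
  show "group (add_monoid V1)" by (rule V1.a_group)
  show "B1 \<subseteq> carrier (add_monoid V1)" using B1_subset by (simp add: V1_simps)
  have "\<zero>\<^bsub>V1\<^esub> \<in> B1"
    unfolding coboundary_iff[OF zero_Z1]
    using restrict_to_J_V1(3)[OF zero_Z1 zero_Z1] J_closed(1)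
    by (intro bexI[of _ "\<zero>\<^bsub>N\<^esub>"]) auto
  then show "B1 \<noteq> {}" by blast
  fix f assume f: "f \<in> B1"
  have fZ: "f \<in> Z1" using f B1_subset by blast
  obtain n where n: "n \<in> carrier N" "\<And>a. a \<in> J \<Longrightarrow> restrict_to_J f a = a \<odot>\<^bsub>N\<^esub> n"
    using f coboundary_iff[OF fZ] by blast
  have neg: "\<ominus>\<^bsub>V1\<^esub> f = (\<lambda>z\<in>carrier P1. \<ominus>\<^bsub>N\<^esub> f z)"
    using fZ Z1_closed(2)[OF fZ fZ]
    by (intro V1.minus_equality)
      (auto simp: V1_simps Z1_iff lmod_hom_def N.M.l_neg intro!: restrict_ext)
  have "\<ominus>\<^bsub>V1\<^esub> f \<in> B1"
    unfolding neg coboundary_iff[OF Z1_closed(2)[OF fZ fZ]]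
    using n J_closed(1) restrict_to_J_V1(4)[OF fZ fZ]
    by (intro bexI[of _ "\<ominus>\<^bsub>N\<^esub> n"]) (auto simp: N.act_minus)
  then show "inv\<^bsub>add_monoid V1\<^esub> f \<in> B1" by (simp add: a_inv_def)
  fix g assume g: "g \<in> B1"
  have gZ: "g \<in> Z1" using g B1_subset by blast
  obtain n' where n': "n' \<in> carrier N" "\<And>a. a \<in> J \<Longrightarrow> restrict_to_J g a = a \<odot>\<^bsub>N\<^esub> n'"
    using g coboundary_iff[OF gZ] by blast
  have "f \<oplus>\<^bsub>V1\<^esub> g \<in> B1"
    unfolding coboundary_iff[OF Z1_closed(1)[OF fZ gZ]]
    using n n' J_closed(1) restrict_to_J_V1(1)[OF fZ gZ]
    by (intro bexI[of _ "n \<oplus>\<^bsub>N\<^esub> n'"]) (auto simp: N.act_add)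
  then show "f \<otimes>\<^bsub>add_monoid V1\<^esub> g \<in> B1" by simp
qed

text \<open>
  \<open>Ext\<^sup>1\<close> is the space of homomorphisms \<open>J \<rightarrow> N\<close> modulo the inner ones \<open>a \<mapsto> a n\<close>.
\<close>

theorem Ext1_zero_if:
  assumes "\<And>\<phi>. J_hom \<phi> \<Longrightarrow> \<exists>n\<in>carrier N. \<forall>a\<in>J. \<phi> a = a \<odot>\<^bsub>N\<^esub> n"
  shows "is_zero_space (Ext1 A M N)"
  unfolding Ext1_eq
proof (rule is_zero_space_quot[OF V1_abelian_group B1_subgroup])
  show "carrier V1 \<subseteq> B1"
    using assms restrict_to_J_hom coboundary_iff by (auto simp: V1_simps)
qed

theorem Ext1_ground_field_if:
  assumes \<phi>0: "J_hom \<phi>0" and ninner: "\<not> (\<exists>n\<in>carrier N. \<forall>a\<in>J. \<phi>0 a = a \<odot>\<^bsub>N\<^esub> n)"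
    and gen: "\<And>\<phi>. J_hom \<phi> \<Longrightarrow>
      \<exists>c. \<exists>n\<in>carrier N. \<forall>a\<in>J. \<phi> a = (c \<odot> \<one>) \<odot>\<^bsub>N\<^esub> \<phi>0 a \<oplus>\<^bsub>N\<^esub> a \<odot>\<^bsub>N\<^esub> n"
  shows "iso_to_ground_field (Ext1 A M N)"
proof -
  define sc where "sc c x = (c \<odot> \<one>) \<odot>\<^bsub>N\<^esub> x" for c x
  have sc [simp]: "sc c x \<in> carrier N" if "x \<in> carrier N" for c x using that by (simp add: sc_def)
  have sc_add: "sc c (x \<oplus>\<^bsub>N\<^esub> y) = sc c x \<oplus>\<^bsub>N\<^esub> sc c y" if "x \<in> carrier N" "y \<in> carrier N" for c x y
    using that by (simp add: sc_def N.act_add)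
  have add_sc: "sc (c + d) x = sc c x \<oplus>\<^bsub>N\<^esub> sc d x" if "x \<in> carrier N" for c d x
    using that by (simp add: sc_def M.A.smult_l_distr N.add_act)
  have sc_sc: "sc (c * d) x = sc c (sc d x)" if "x \<in> carrier N" for c d x
    using that by (simp add: sc_def M.A.smult_assoc1 M.A.smult_assoc2 flip: N.mult_act)
  have sc_act: "sc c (a \<odot>\<^bsub>N\<^esub> x) = a \<odot>\<^bsub>N\<^esub> sc c x" if "a \<in> carrier A" "x \<in> carrier N" for c a x
    using that by (simp add: sc_def M.A.scalar_central flip: N.mult_act)
  have sc01: "sc 0 x = \<zero>\<^bsub>N\<^esub>" "sc 1 x = x" if "x \<in> carrier N" for x
    using that by (simp_all add: sc_def)
  have \<phi>0c: "\<phi>0 a \<in> carrier N" if "a \<in> J" for a using \<phi>0 that by (simp add: J_hom_def)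
  define coord where "coord f c \<longleftrightarrow>
    (\<exists>n\<in>carrier N. \<forall>a\<in>J. restrict_to_J f a = sc c (\<phi>0 a) \<oplus>\<^bsub>N\<^esub> a \<odot>\<^bsub>N\<^esub> n)" for f c
  have ex: "\<exists>c. coord f c" if "f \<in> Z1" for f
    using gen[OF restrict_to_J_hom[OF that]] unfolding coord_def sc_def .
  have coord_add: "coord (f \<oplus>\<^bsub>V1\<^esub> g) (c + d)" if f: "f \<in> Z1" "coord f c" and g: "g \<in> Z1" "coord g d" for f g c d
  proof -
    obtain n n' where n: "n \<in> carrier N" "\<And>a. a \<in> J \<Longrightarrow> restrict_to_J f a = sc c (\<phi>0 a) \<oplus>\<^bsub>N\<^esub> a \<odot>\<^bsub>N\<^esub> n"
      and n': "n' \<in> carrier N" "\<And>a. a \<in> J \<Longrightarrow> restrict_to_J g a = sc d (\<phi>0 a) \<oplus>\<^bsub>N\<^esub> a \<odot>\<^bsub>N\<^esub> n'"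
      using f g unfolding coord_def by blast
    show ?thesis
      unfolding coord_def
      using n n' J_closed(1) \<phi>0c
      by (intro bexI[of _ "n \<oplus>\<^bsub>N\<^esub> n'"])
        (auto simp: restrict_to_J_V1(1)[OF f(1) g(1)] add_sc N.act_add N.M.a_ac)
  qed
  have coord_smult: "coord (e \<odot>\<^bsub>V1\<^esub> f) (e * c)" if f: "f \<in> Z1" "coord f c" for f c e
  proof -
    obtain n where n: "n \<in> carrier N" "\<And>a. a \<in> J \<Longrightarrow> restrict_to_J f a = sc c (\<phi>0 a) \<oplus>\<^bsub>N\<^esub> a \<odot>\<^bsub>N\<^esub> n"
      using f unfolding coord_def by blast
    show ?thesis
      unfolding coord_def
      using n J_closed(1) \<phi>0c
      by (intro bexI[of _ "sc e n"])
        (auto simp: restrict_to_J_V1(2)[OF f(1) f(1)] sc_sc sc_add sc_act simp flip: sc_def)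
  qed
  have coord_zero: "coord f 0 \<longleftrightarrow> f \<in> B1" if "f \<in> Z1" for f
    unfolding coboundary_iff[OF that] coord_def using J_closed(1) \<phi>0c by (simp add: sc01)
  have uniq: "c = d" if f: "f \<in> Z1" "coord f c" "coord f d" for f c d
  proof (rule ccontr)
    assume "c \<noteq> d"
    have mf: "(-1) \<odot>\<^bsub>V1\<^esub> f \<in> Z1" "coord ((-1) \<odot>\<^bsub>V1\<^esub> f) (-1 * d)"
      by (rule Z1_closed(3)[OF f(1) f(1)], rule coord_smult[OF f(1,3)])
    define f' where "f' = f \<oplus>\<^bsub>V1\<^esub> ((-1) \<odot>\<^bsub>V1\<^esub> f)"
    have f'Z: "f' \<in> Z1" and f': "coord f' (c - d)"
      using Z1_closed(1)[OF f(1) mf(1)] coord_add[OF f(1,2) mf] unfolding f'_def by simp_all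
    have 0: "restrict_to_J f' a = \<zero>\<^bsub>N\<^esub>" if a: "a \<in> J" for a
    proof -
      have Jf: "restrict_to_J f a \<in> carrier N" using restrict_to_J_hom[OF f(1)] a by (simp add: J_hom_def)
      have "restrict_to_J f' a = sc 1 (restrict_to_J f a) \<oplus>\<^bsub>N\<^esub> sc (-1) (restrict_to_J f a)"
        using Jf by (simp add: f'_def restrict_to_J_V1(1)[OF f(1) mf(1) a] restrict_to_J_V1(2)[OF f(1) f(1) a] sc01 flip: sc_def)
      also have "\<dots> = sc (1 + -1) (restrict_to_J f a)" by (rule add_sc[OF Jf, symmetric])
      finally show ?thesis using Jf by (simp add: sc01)
    qed
    obtain n where n: "n \<in> carrier N" "\<And>a. a \<in> J \<Longrightarrow> \<zero>\<^bsub>N\<^esub> = sc (c - d) (\<phi>0 a) \<oplus>\<^bsub>N\<^esub> a \<odot>\<^bsub>N\<^esub> n"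
      using f' 0 unfolding coord_def by auto
    have "\<phi>0 a = a \<odot>\<^bsub>N\<^esub> sc (inverse (c - d)) (\<ominus>\<^bsub>N\<^esub> n)" if a: "a \<in> J" for a
    proof -
      have aA: "a \<in> carrier A" using J_closed(1) a .
      have "sc (c - d) (\<phi>0 a) = \<ominus>\<^bsub>N\<^esub> (a \<odot>\<^bsub>N\<^esub> n)"
        by (rule N.M.minus_equality[symmetric]) (use n(2)[OF a] \<phi>0c[OF a] aA n(1) in auto)
      then have "sc (c - d) (\<phi>0 a) = a \<odot>\<^bsub>N\<^esub> (\<ominus>\<^bsub>N\<^esub> n)" using aA n(1) by (simp add: N.act_minus)
      then have "sc (inverse (c - d)) (sc (c - d) (\<phi>0 a)) = a \<odot>\<^bsub>N\<^esub> sc (inverse (c - d)) (\<ominus>\<^bsub>N\<^esub> n)"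
        using aA n(1) by (simp add: sc_act)
      then show ?thesis using \<open>c \<noteq> d\<close> \<phi>0c[OF a] by (simp add: sc01 flip: sc_sc)
    qed
    then show False using ninner n(1) by (meson N.M.a_inv_closed sc)
  qed
  define \<psi> where "\<psi> f = (THE c. coord f c)" for f
  have \<psi>: "\<psi> f = c" if "f \<in> Z1" "coord f c" for f c
    unfolding \<psi>_def using that uniq by blast
  have \<psi>c: "coord f (\<psi> f)" if "f \<in> Z1" for f
    using ex[OF that] \<psi>[OF that] by blast
  obtain v where v: "v \<in> Z1" "\<And>a. a \<in> J \<Longrightarrow> restrict_to_J v a = \<phi>0 a"
    using J_hom_extends[OF \<phi>0] by blast
  have "coord v 1"
    unfolding coord_def using v J_closed(1) \<phi>0c by (intro bexI[of _ "\<zero>\<^bsub>N\<^esub>"]) (auto simp: sc01)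
  show ?thesis
    unfolding Ext1_eq
  proof (rule iso_to_ground_field_quot[OF V1_abelian_group B1_subgroup, where \<psi> = \<psi> and v = v])
    fix f assume f: "f \<in> carrier V1"
    then have fZ: "f \<in> Z1" by (simp add: V1_simps)
    show "c \<odot>\<^bsub>V1\<^esub> f \<in> carrier V1" for c using Z1_closed(3)[OF fZ fZ] by (simp add: V1_simps(1))
    show "\<psi> (c \<odot>\<^bsub>V1\<^esub> f) = c * \<psi> f" for c
      using Z1_closed(3)[OF fZ fZ] coord_smult[OF fZ \<psi>c[OF fZ]] by (rule \<psi>)
    show "\<psi> f = 0 \<longleftrightarrow> f \<in> B1" using coord_zero[OF fZ] \<psi>[OF fZ] \<psi>c[OF fZ] by metis
    fix g assume "g \<in> carrier V1"
    then have gZ: "g \<in> Z1" by (simp add: V1_simps)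
    show "\<psi> (f \<oplus>\<^bsub>V1\<^esub> g) = \<psi> f + \<psi> g"
      using Z1_closed(1)[OF fZ gZ] coord_add[OF fZ \<psi>c[OF fZ] gZ \<psi>c[OF gZ]] by (rule \<psi>)
    show "c \<odot>\<^bsub>V1\<^esub> (f \<oplus>\<^bsub>V1\<^esub> g) = c \<odot>\<^bsub>V1\<^esub> f \<oplus>\<^bsub>V1\<^esub> c \<odot>\<^bsub>V1\<^esub> g" for c
      using fZ gZ by (auto simp: V1_simps Z1_iff lmod_hom_def N.act_add intro!: restrict_ext)
  next
    show "v \<in> carrier V1" using v by (simp add: V1_simps)
    show "\<psi> v = 1" using v(1) \<open>coord v 1\<close> by (rule \<psi>)
  qed
qed

end

section \<open>The free algebra and the universal property of the reduced enveloping algebra\<close>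

lemma free_algebra_simps [simp]:
  "ring.zero (free_algebra X) = (\<lambda>_. 0)"
  "one (free_algebra X) = (\<lambda>w. if w = [] then 1 else 0)"
  "f \<oplus>\<^bsub>free_algebra X\<^esub> g = (\<lambda>w. f w + g w)"
  "f \<otimes>\<^bsub>free_algebra X\<^esub> g = (\<lambda>w. \<Sum>i\<le>length w. f (take i w) * g (drop i w))"
  "c \<odot>\<^bsub>free_algebra X\<^esub> f = (\<lambda>w. c * f w)"
  by (simp_all add: free_algebra_def)

lemma free_algebra_carrier:
  "f \<in> carrier (free_algebra X) \<longleftrightarrow> finite {w. f w \<noteq> 0} \<and> {w. f w \<noteq> 0} \<subseteq> lists X"
  by (simp add: free_algebra_def)

lemma free_algebra_carrierI:
  assumes "finite W" "W \<subseteq> lists X" "\<And>w. w \<notin> W \<Longrightarrow> f w = 0"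
  shows "f \<in> carrier (free_algebra X)"
proof -
  have "{w. f w \<noteq> 0} \<subseteq> W" using assms(3) by auto
  then show ?thesis unfolding free_algebra_carrier using assms(1,2) by (meson finite_subset order_trans)
qed

lemma conv_support:
  fixes f g :: "'x list \<Rightarrow> 'k::field"
  assumes "w \<notin> (\<lambda>(u, v). u @ v) ` ({w. f w \<noteq> 0} \<times> {w. g w \<noteq> 0})"
  shows "(\<Sum>i\<le>length w. f (take i w) * g (drop i w)) = 0"
proof (rule sum.neutral, rule ballI)
  fix i assume "i \<in> {..length w}"
  have "f (take i w) = 0 \<or> g (drop i w) = 0"
  proof (rule ccontr)
    assume "\<not> ?thesis"
    then have "(take i w, drop i w) \<in> {w. f w \<noteq> 0} \<times> {w. g w \<noteq> 0}" by auto
    then have "take i w @ drop i w \<in> (\<lambda>(u, v). u @ v) ` ({w. f w \<noteq> 0} \<times> {w. g w \<noteq> 0})"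
      by (rule image_eqI[rotated]) simp
    then show False using assms by simp
  qed
  then show "f (take i w) * g (drop i w) = 0" by auto
qed

lemma conv_assoc:
  fixes f g h :: "'x list \<Rightarrow> 'k::field"
  shows "(\<Sum>i\<le>length w. (\<Sum>j\<le>length (take i w). f (take j (take i w)) * g (drop j (take i w))) * h (drop i w))
    = (\<Sum>j\<le>length w. f (take j w) * (\<Sum>i\<le>length (drop j w). g (take i (drop j w)) * h (drop i (drop j w))))"
proof -
  define F where "F a b c = f (take a w) * g (take b (drop a w)) * h (drop (a + b) w)" for a b c :: nat
  have "(\<Sum>i\<le>length w. (\<Sum>j\<le>length (take i w). f (take j (take i w)) * g (drop j (take i w))) * h (drop i w))
    = (\<Sum>i=0..length w. \<Sum>j=0..i. F j (i - j) (0 - i))"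
    unfolding sum_distrib_right atLeast0AtMost
    by (intro sum.cong refl) (auto simp: F_def drop_take min_def)
  also have "\<dots> = (\<Sum>j=0..length w. \<Sum>i=0..length w - j. F j i (0 - j - i))"
    by (rule fps_mult_assoc_lemma)
  also have "\<dots> = (\<Sum>j\<le>length w. f (take j w) * (\<Sum>i\<le>length (drop j w). g (take i (drop j w)) * h (drop i (drop j w))))"
    unfolding sum_distrib_left atLeast0AtMost
    by (intro sum.cong refl) (auto simp: F_def mult.assoc add.commute)
  finally show ?thesis .
qed

lemma free_algebra_mult_closed:
  assumes f: "f \<in> carrier (free_algebra X)" and g: "g \<in> carrier (free_algebra X)"
  shows "f \<otimes>\<^bsub>free_algebra X\<^esub> g \<in> carrier (free_algebra X)"
proof (rule free_algebra_carrierI)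
  let ?W = "(\<lambda>(u, v). u @ v) ` ({w. f w \<noteq> 0} \<times> {w. g w \<noteq> 0})"
  show "finite ?W" using f g by (auto simp: free_algebra_carrier)
  show "?W \<subseteq> lists X" using f g by (fastforce simp: free_algebra_carrier)
  show "\<And>w. w \<notin> ?W \<Longrightarrow> (f \<otimes>\<^bsub>free_algebra X\<^esub> g) w = 0" by (simp add: conv_support)
qed

lemma free_algebra_add_closed:
  assumes f: "f \<in> carrier (free_algebra X)" and g: "g \<in> carrier (free_algebra X)"
  shows "f \<oplus>\<^bsub>free_algebra X\<^esub> g \<in> carrier (free_algebra X)"
  by (rule free_algebra_carrierI[of "{w. f w \<noteq> 0} \<union> {w. g w \<noteq> 0}"])
    (use f g in \<open>auto simp: free_algebra_carrier\<close>)

lemma free_algebra_smult_closed: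
  assumes f: "f \<in> carrier (free_algebra X)"
  shows "c \<odot>\<^bsub>free_algebra X\<^esub> f \<in> carrier (free_algebra X)"
  by (rule free_algebra_carrierI[of "{w. f w \<noteq> 0}"]) (use f in \<open>auto simp: free_algebra_carrier\<close>)

lemma free_algebra_one_closed: "\<one>\<^bsub>free_algebra X\<^esub> \<in> carrier (free_algebra X)"
  by (rule free_algebra_carrierI[of "{[]}"]) auto

lemma gen_closed: "x \<in> X \<Longrightarrow> gen x \<in> carrier (free_algebra X)"
  by (rule free_algebra_carrierI[of "{[x]}"]) (auto simp: gen_def)

lemma conv_one_left: "(\<Sum>i\<le>length w. (if take i w = [] then 1 else 0) * f (drop i w)) = (f w :: 'k::field)"
proof -
  have "(\<Sum>i\<le>length w. (if take i w = [] then 1 else 0) * f (drop i w))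
      = (\<Sum>i\<le>length w. if i = 0 then f w else 0)"
    by (intro sum.cong refl) auto
  then show ?thesis by simp
qed

lemma conv_one_right: "(\<Sum>i\<le>length w. f (take i w) * (if drop i w = [] then 1 else 0)) = (f w :: 'k::field)"
proof -
  have "(\<Sum>i\<le>length w. f (take i w) * (if drop i w = [] then 1 else 0))
      = (\<Sum>i\<le>length w. if i = length w then f w else 0)"
    by (intro sum.cong refl) auto
  then show ?thesis by simp
qed

lemma free_algebra_algebra_over: "algebra_over (free_algebra X :: ('k::field, _) module)"
proof -
  let ?F = "free_algebra X :: ('k, _) module"
  have ag: "abelian_group ?F"
  proof (rule abelian_groupI)
    show "\<zero>\<^bsub>?F\<^esub> \<in> carrier ?F" by (simp add: free_algebra_carrier)
    fix f assume f: "f \<in> carrier ?F"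
    show "\<exists>g\<in>carrier ?F. g \<oplus>\<^bsub>?F\<^esub> f = \<zero>\<^bsub>?F\<^esub>"
      using free_algebra_smult_closed[OF f, of "-1"] by (intro bexI[of _ "-1 \<odot>\<^bsub>?F\<^esub> f"]) auto
    fix g assume g: "g \<in> carrier ?F"
    show "f \<oplus>\<^bsub>?F\<^esub> g \<in> carrier ?F" by (rule free_algebra_add_closed[OF f g])
  qed (auto simp: algebra_simps)
  have mon: "Group.monoid ?F"
  proof (rule monoidI)
    fix f g h assume fgh: "f \<in> carrier ?F" "g \<in> carrier ?F" "h \<in> carrier ?F"
    show "f \<otimes>\<^bsub>?F\<^esub> g \<in> carrier ?F" by (rule free_algebra_mult_closed[OF fgh(1,2)])
    show "f \<otimes>\<^bsub>?F\<^esub> g \<otimes>\<^bsub>?F\<^esub> h = f \<otimes>\<^bsub>?F\<^esub> (g \<otimes>\<^bsub>?F\<^esub> h)"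
      unfolding free_algebra_simps fun_eq_iff using conv_assoc by blast
  next
    fix f assume f: "f \<in> carrier ?F"
    show "\<one>\<^bsub>?F\<^esub> \<otimes>\<^bsub>?F\<^esub> f = f" by (simp only: free_algebra_simps conv_one_left)
    show "f \<otimes>\<^bsub>?F\<^esub> \<one>\<^bsub>?F\<^esub> = f" by (simp only: free_algebra_simps conv_one_right)
  qed (rule free_algebra_one_closed)
  have "ring ?F"
    by (rule ringI[OF ag mon]) (auto simp: algebra_simps sum.distrib)
  then show ?thesis
    unfolding algebra_over_def algebra_over_axioms_def
    using free_algebra_smult_closed by (auto simp: algebra_simps sum_distrib_left)
qed

text \<open>Lets a ring of operators that is a type serve as the target of ring homomorphisms.\<close>

definition class_ring :: "'t::ring_1 itself \<Rightarrow> 't ring" where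
  "class_ring _ = \<lparr>carrier = UNIV, mult = (*), one = 1, ring.zero = 0, ring.add = (+)\<rparr>"

lemma class_ring_simps [simp]:
  "carrier (class_ring TYPE('t::ring_1)) = UNIV" "x \<otimes>\<^bsub>class_ring TYPE('t)\<^esub> y = x * y"
  "\<one>\<^bsub>class_ring TYPE('t)\<^esub> = 1" "\<zero>\<^bsub>class_ring TYPE('t)\<^esub> = 0" "x \<oplus>\<^bsub>class_ring TYPE('t)\<^esub> y = x + y"
  by (simp_all add: class_ring_def)

lemma class_ring_ring: "ring (class_ring TYPE('t::ring_1))"
proof (rule ringI)
  show "abelian_group (class_ring TYPE('t))"
    by (rule abelian_groupI) (auto simp: algebra_simps intro: exI[of _ "- x" for x])
  show "Group.monoid (class_ring TYPE('t))" by (rule monoidI) (auto simp: algebra_simps)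
qed (auto simp: algebra_simps)

lemma class_ring_pow [simp]: "x [^]\<^bsub>class_ring TYPE('t::ring_1)\<^esub> (n::nat) = x ^ n"
proof -
  interpret ring "class_ring TYPE('t)" by (rule class_ring_ring)
  show ?thesis by (induction n) (simp_all add: power_commutes)
qed

text \<open>
  The scalars \<open>\<iota> c\<close> are only assumed to commute with the values \<open>\<rho> x\<close>; this suffices for the
  evaluation of noncommutative polynomials to be multiplicative.
\<close>

definition word_eval :: "('k::field \<Rightarrow> 't::ring_1) \<Rightarrow> ('x \<Rightarrow> 't) \<Rightarrow> ('x list \<Rightarrow> 'k) \<Rightarrow> 't" where
  "word_eval \<iota> \<rho> f = (\<Sum>w\<in>{w. f w \<noteq> 0}. \<iota> (f w) * prod_list (map \<rho> w))"

locale central_scalars =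
  fixes \<iota> :: "'k::field \<Rightarrow> 't::ring_1" and X :: "'x set" and \<rho> :: "'x \<Rightarrow> 't"
  assumes \<iota>_add: "\<iota> (a + b) = \<iota> a + \<iota> b" and \<iota>_mult: "\<iota> (a * b) = \<iota> a * \<iota> b"
    and \<iota>_one [simp]: "\<iota> 1 = 1"
    and \<iota>_central: "x \<in> X \<Longrightarrow> \<iota> c * \<rho> x = \<rho> x * \<iota> c"
begin

lemma \<iota>_zero [simp]: "\<iota> 0 = 0"
  using \<iota>_add[of 0 0] by simp

lemma \<iota>_sum: "\<iota> (sum f I) = (\<Sum>i\<in>I. \<iota> (f i))"
  by (induction I rule: infinite_finite_induct) (auto simp: \<iota>_add)

lemma \<iota>_prod_list: "w \<in> lists X \<Longrightarrow> \<iota> c * prod_list (map \<rho> w) = prod_list (map \<rho> w) * \<iota> c"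
  by (induction w) (auto simp: \<iota>_central mult.assoc, metis \<iota>_central mult.assoc)

lemma word_eval_superset:
  assumes "finite W" "{w. f w \<noteq> 0} \<subseteq> W"
  shows "word_eval \<iota> \<rho> f = (\<Sum>w\<in>W. \<iota> (f w) * prod_list (map \<rho> w))"
  unfolding word_eval_def using assms by (intro sum.mono_neutral_left) auto

lemma word_eval_mult:
  assumes f: "f \<in> carrier (free_algebra X)" and g: "g \<in> carrier (free_algebra X)"
  shows "word_eval \<iota> \<rho> (f \<otimes>\<^bsub>free_algebra X\<^esub> g) = word_eval \<iota> \<rho> f * word_eval \<iota> \<rho> g"
proof -
  let ?S = "{w. f w \<noteq> 0} \<times> {w. g w \<noteq> 0}"
  let ?P = "\<lambda>w. prod_list (map \<rho> w)"
  let ?G = "\<lambda>(u, v). \<iota> (f u) * \<iota> (g v) * ?P (u @ v)"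
  define W where "W = (\<lambda>(u, v). u @ v) ` ?S"
  have finS: "finite ?S" using f g by (auto simp: free_algebra_carrier)
  then have finW: "finite W" by (simp add: W_def)
  have "word_eval \<iota> \<rho> (f \<otimes>\<^bsub>free_algebra X\<^esub> g)
      = (\<Sum>w\<in>W. \<iota> ((f \<otimes>\<^bsub>free_algebra X\<^esub> g) w) * ?P w)"
    by (rule word_eval_superset[OF finW]) (use conv_support in \<open>auto simp: W_def\<close>)
  also have "\<dots> = (\<Sum>w\<in>W. \<Sum>i\<le>length w. ?G (take i w, drop i w))"
    by (simp add: \<iota>_sum \<iota>_mult sum_distrib_right del: map_append)
  also have "\<dots> = (\<Sum>(w, i)\<in>Sigma W (\<lambda>w. {..length w}). ?G (take i w, drop i w))"
    using finW by (subst sum.Sigma) auto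
  also have "\<dots> = (\<Sum>uv\<in>{(u, v). u @ v \<in> W}. ?G uv)"
    by (rule sum.reindex_bij_witness[where j = "\<lambda>(w, i). (take i w, drop i w)"
          and i = "\<lambda>(u, v). (u @ v, length u)"]) (auto simp: min_def)
  also have "\<dots> = (\<Sum>uv\<in>?S. ?G uv)"
  proof (rule sum.mono_neutral_right)
    have "{(u, v). u @ v \<in> W} \<subseteq> (\<lambda>(w, i). (take i w, drop i w)) ` Sigma W (\<lambda>w. {..length w})"
    proof
      fix uv assume "uv \<in> {(u, v). u @ v \<in> W}"
      then show "uv \<in> (\<lambda>(w, i). (take i w, drop i w)) ` Sigma W (\<lambda>w. {..length w})"
        by (intro image_eqI[of _ _ "(fst uv @ snd uv, length (fst uv))"]) auto
    qed
    then show "finite {(u, v). u @ v \<in> W}" by (rule finite_subset) (use finW in simp)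
  qed (auto simp: W_def)
  also have "\<dots> = (\<Sum>(u, v)\<in>?S. (\<iota> (f u) * ?P u) * (\<iota> (g v) * ?P v))"
  proof (rule sum.cong[OF refl], clarify)
    fix u v assume "f u \<noteq> 0"
    then have "u \<in> lists X" using f by (auto simp: free_algebra_carrier)
    from \<iota>_prod_list[OF this, of "g v"] show "\<iota> (f u) * \<iota> (g v) * ?P (u @ v) = (\<iota> (f u) * ?P u) * (\<iota> (g v) * ?P v)"
      by (simp add: mult.assoc) (simp flip: mult.assoc)
  qed
  also have "\<dots> = word_eval \<iota> \<rho> f * word_eval \<iota> \<rho> g"
    unfolding word_eval_def sum_product by (simp add: sum.cartesian_product)
  finally show ?thesis .
qed

lemma word_eval_add:
  assumes f: "f \<in> carrier (free_algebra X)" and g: "g \<in> carrier (free_algebra X)"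
  shows "word_eval \<iota> \<rho> (f \<oplus>\<^bsub>free_algebra X\<^esub> g) = word_eval \<iota> \<rho> f + word_eval \<iota> \<rho> g"
proof -
  define W where "W = {w. f w \<noteq> 0} \<union> {w. g w \<noteq> 0}"
  have W: "finite W" "{w. f w \<noteq> 0} \<subseteq> W" "{w. g w \<noteq> 0} \<subseteq> W" "{w. (f \<oplus>\<^bsub>free_algebra X\<^esub> g) w \<noteq> 0} \<subseteq> W"
    using f g by (auto simp: free_algebra_carrier W_def)
  show ?thesis
    unfolding word_eval_superset[OF W(1,2)] word_eval_superset[OF W(1,3)] word_eval_superset[OF W(1,4)]
    by (simp add: \<iota>_add algebra_simps sum.distrib)
qed

lemma word_eval_smult:
  assumes f: "f \<in> carrier (free_algebra X)"
  shows "word_eval \<iota> \<rho> (c \<odot>\<^bsub>free_algebra X\<^esub> f) = \<iota> c * word_eval \<iota> \<rho> f"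
proof -
  have W: "finite {w. f w \<noteq> 0}" "{w. (c \<odot>\<^bsub>free_algebra X\<^esub> f) w \<noteq> 0} \<subseteq> {w. f w \<noteq> 0}"
    using f by (auto simp: free_algebra_carrier)
  show ?thesis
    unfolding word_eval_superset[OF W] word_eval_superset[OF W(1) subset_refl]
    by (simp add: \<iota>_mult sum_distrib_left mult.assoc)
qed

lemma word_eval_gen [simp]: "word_eval \<iota> \<rho> (gen x) = \<rho> x"
proof -
  have "word_eval \<iota> \<rho> (gen x) = (\<Sum>w\<in>{[x]}. \<iota> (gen x w) * prod_list (map \<rho> w))"
    by (rule word_eval_superset) (auto simp: gen_def)
  then show ?thesis by (simp add: gen_def)
qed

lemma word_eval_one: "word_eval \<iota> \<rho> \<one>\<^bsub>free_algebra X\<^esub> = 1"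
proof -
  have "word_eval \<iota> \<rho> \<one>\<^bsub>free_algebra X\<^esub> = (\<Sum>w\<in>{[]}. \<iota> (\<one>\<^bsub>free_algebra X\<^esub> w) * prod_list (map \<rho> w))"
    by (rule word_eval_superset) auto
  then show ?thesis by simp
qed

lemma word_eval_ring_hom: "word_eval \<iota> \<rho> \<in> ring_hom (free_algebra X) (class_ring TYPE('t))"
  using word_eval_one
  by (intro ring_hom_memI) (simp_all add: word_eval_mult word_eval_add del: free_algebra_simps)

end

lemma (in abelian_group) minus_eq_zero_iff:
  assumes "x \<in> carrier G" "y \<in> carrier G" shows "x \<ominus> y = \<zero> \<longleftrightarrow> x = y"
  using assms by (metis a_inv_closed minus_equality minus_eq minus_minus r_neg)

lemma (in abelian_group) minus_minus_zero_iff: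
  assumes "x \<in> carrier G" "y \<in> carrier G" "z \<in> carrier G"
  shows "x \<ominus> y \<ominus> z = \<zero> \<longleftrightarrow> x = y \<oplus> z"
proof -
  have "x \<ominus> y \<ominus> z = x \<ominus> (y \<oplus> z)"
    using assms by (simp add: minus_eq minus_add a_assoc)
  then show ?thesis using assms minus_eq_zero_iff[of x "y \<oplus> z"] by simp
qed

lemma ring_hom_nat_pow:
  assumes "ring R" "ring S" "h \<in> ring_hom R S" "x \<in> carrier R"
  shows "h (x [^]\<^bsub>R\<^esub> (n::nat)) = h x [^]\<^bsub>S\<^esub> n"
proof -
  interpret ring_hom_ring R S h using assms by (intro ring_hom_ringI2)
  show ?thesis using assms(4) by (induction n) simp_all
qed

lemma ring_hom_minus:
  assumes "ring R" "ring S" "h \<in> ring_hom R S" "x \<in> carrier R" "y \<in> carrier R"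
  shows "h (x \<ominus>\<^bsub>R\<^esub> y) = h x \<ominus>\<^bsub>S\<^esub> h y"
proof -
  interpret ring_hom_ring R S h using assms by (intro ring_hom_ringI2)
  show ?thesis using assms(4,5) by (simp add: R.minus_eq S.minus_eq)
qed

lemma factor_through_quot:
  assumes A: "algebra_over A" and S: "ideal S A" and R: "ring R" and h: "h \<in> ring_hom A R"
    and ker: "\<And>x. x \<in> S \<Longrightarrow> h x = \<zero>\<^bsub>R\<^esub>"
  obtains h' where "h' \<in> ring_hom (quot A S) R" "\<And>x. x \<in> carrier A \<Longrightarrow> h' (S +>\<^bsub>A\<^esub> x) = h x"
proof -
  interpret A: algebra_over A by fact
  interpret R: ring R by fact
  interpret h: ring_hom_ring A R h
    by (intro ring_hom_ringI2 A.ring_axioms R h)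
  note q = quotient_algebra_over[OF A S]
  have eq: "h x = h y" if xy: "x \<in> carrier A" "y \<in> carrier A" "S +>\<^bsub>A\<^esub> x = S +>\<^bsub>A\<^esub> y" for x y
  proof -
    have "h (x \<ominus>\<^bsub>A\<^esub> y) = \<zero>\<^bsub>R\<^esub>" using ker q(5) xy by blast
    then have "h x \<ominus>\<^bsub>R\<^esub> h y = \<zero>\<^bsub>R\<^esub>" using xy(1,2) by (simp add: A.minus_eq R.minus_eq)
    then show ?thesis using xy(1,2) by (simp add: R.minus_eq_zero_iff)
  qed
  define h' where "h' X = h (SOME x. x \<in> carrier A \<and> X = S +>\<^bsub>A\<^esub> x)" for X
  have h': "h' (S +>\<^bsub>A\<^esub> x) = h x" if x: "x \<in> carrier A" for x
  proof -
    have "(SOME y. y \<in> carrier A \<and> S +>\<^bsub>A\<^esub> x = S +>\<^bsub>A\<^esub> y) \<in> carrier A \<and>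
      S +>\<^bsub>A\<^esub> x = S +>\<^bsub>A\<^esub> (SOME y. y \<in> carrier A \<and> S +>\<^bsub>A\<^esub> x = S +>\<^bsub>A\<^esub> y)"
      by (rule someI_ex) (use x in blast)
    then show ?thesis unfolding h'_def using eq[OF x] by metis
  qed
  have "h' \<in> ring_hom (quot A S) R"
  proof (rule ring_hom_memI)
    fix X assume X: "X \<in> carrier (quot A S)"
    obtain x where x: "x \<in> carrier A" "X = S +>\<^bsub>A\<^esub> x" using q(4)[OF X] by blast
    show "h' X \<in> carrier R" using x by (simp add: h')
    fix Y assume Y: "Y \<in> carrier (quot A S)"
    obtain y where y: "y \<in> carrier A" "Y = S +>\<^bsub>A\<^esub> y" using q(4)[OF Y] by blast
    have "X \<otimes>\<^bsub>quot A S\<^esub> Y = S +>\<^bsub>A\<^esub> (x \<otimes>\<^bsub>A\<^esub> y)" "X \<oplus>\<^bsub>quot A S\<^esub> Y = S +>\<^bsub>A\<^esub> (x \<oplus>\<^bsub>A\<^esub> y)"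
      using ring_hom_mult[OF q(2)] ring_hom_add[OF q(2)] x y by simp_all
    then show "h' (X \<otimes>\<^bsub>quot A S\<^esub> Y) = h' X \<otimes>\<^bsub>R\<^esub> h' Y" "h' (X \<oplus>\<^bsub>quot A S\<^esub> Y) = h' X \<oplus>\<^bsub>R\<^esub> h' Y"
      using x y by (simp_all add: h')
  next
    show "h' \<one>\<^bsub>quot A S\<^esub> = \<one>\<^bsub>R\<^esub>"
      using ring_hom_one[OF q(2)] h'[of "\<one>\<^bsub>A\<^esub>"] by simp
  qed
  then show thesis using h' by (rule that)
qed

locale restricted_lie_ops =
  fixes p :: nat and L :: "('k::field, 'x) restricted_lie" and \<chi> :: "'x \<Rightarrow> 'k"
  assumes add_closed: "x \<in> carrier L \<Longrightarrow> y \<in> carrier L \<Longrightarrow> x \<oplus>\<^bsub>L\<^esub> y \<in> carrier L"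
    and smult_closed: "x \<in> carrier L \<Longrightarrow> c \<odot>\<^bsub>L\<^esub> x \<in> carrier L"
    and bracket_closed: "x \<in> carrier L \<Longrightarrow> y \<in> carrier L \<Longrightarrow> bracket L x y \<in> carrier L"
    and pmap_closed: "x \<in> carrier L \<Longrightarrow> pmap L x \<in> carrier L"
begin

abbreviation "F \<equiv> free_algebra (carrier L) :: ('k, 'x list \<Rightarrow> 'k) module"
abbreviation "U \<equiv> env_algebra L"
abbreviation "A \<equiv> red_env_algebra p L \<chi>"
abbreviation "cls \<equiv> red_env_class p L \<chi>"

sublocale F: algebra_over F by (rule free_algebra_algebra_over)

definition "env_gens =
     {gen (x \<oplus>\<^bsub>L\<^esub> y) \<ominus>\<^bsub>F\<^esub> (gen x \<oplus>\<^bsub>F\<^esub> gen y) | x y. x \<in> carrier L \<and> y \<in> carrier L} \<union>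
      {gen (c \<odot>\<^bsub>L\<^esub> x) \<ominus>\<^bsub>F\<^esub> c \<odot>\<^bsub>F\<^esub> gen x | c x. x \<in> carrier L} \<union>
      {(gen x \<otimes>\<^bsub>F\<^esub> gen y \<ominus>\<^bsub>F\<^esub> gen y \<otimes>\<^bsub>F\<^esub> gen x) \<ominus>\<^bsub>F\<^esub> gen (bracket L x y) | x y.
         x \<in> carrier L \<and> y \<in> carrier L}"

lemma gen_in [simp]: "x \<in> carrier L \<Longrightarrow> gen x \<in> carrier F" by (rule gen_closed)

lemma env_gens_subset: "env_gens \<subseteq> carrier F"
proof
  fix z assume "z \<in> env_gens"
  then show "z \<in> carrier F"
    unfolding env_gens_def
    by (elim UnE CollectE exE conjE)
      (simp_all add: add_closed smult_closed bracket_closed del: free_algebra_simps)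
qed

lemma env_ideal_eq: "env_ideal L = Idl\<^bsub>F\<^esub> env_gens"
  by (simp add: env_ideal_def env_gens_def Let_def)

lemma env_ideal: "ideal (env_ideal L) F"
  unfolding env_ideal_eq by (rule F.genideal_ideal[OF env_gens_subset])

lemmas env_quot = quotient_algebra_over[OF free_algebra_algebra_over env_ideal, folded env_algebra_def env_class_def]

sublocale U: algebra_over U by (rule env_quot(1))

lemma env_class_hom: "env_class L \<in> ring_hom F U"
proof -
  have "env_class L = (+>\<^bsub>F\<^esub>) (env_ideal L)" by (simp add: fun_eq_iff env_class_def)
  then show ?thesis using env_quot(2) by simp
qed

definition "red_gens =
     {(env_class L (gen x) [^]\<^bsub>U\<^esub> p \<ominus>\<^bsub>U\<^esub> env_class L (gen (pmap L x))) \<ominus>\<^bsub>U\<^esub> (\<chi> x ^ p) \<odot>\<^bsub>U\<^esub> \<one>\<^bsub>U\<^esub> | x.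
        x \<in> carrier L}"

lemma env_class_in [simp]: "f \<in> carrier F \<Longrightarrow> env_class L f \<in> carrier U"
  using env_class_hom by (rule ring_hom_closed)

lemma red_gens_subset: "red_gens \<subseteq> carrier U"
proof
  fix z assume "z \<in> red_gens"
  then show "z \<in> carrier U"
    unfolding red_gens_def
    by (elim CollectE exE conjE) (simp add: pmap_closed)
qed

lemma red_ideal_eq: "red_ideal p L \<chi> = Idl\<^bsub>U\<^esub> red_gens"
  by (simp add: red_ideal_def red_gens_def Let_def)

lemma red_ideal: "ideal (red_ideal p L \<chi>) U"
  unfolding red_ideal_eq by (rule U.genideal_ideal[OF red_gens_subset])

lemmas red_quot = quotient_algebra_over[OF env_quot(1) red_ideal, folded red_env_algebra_def]

sublocale A: algebra_over A by (rule red_quot(1))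

lemma cls_hom: "cls \<in> ring_hom F A"
proof -
  have "cls = (+>\<^bsub>U\<^esub>) (red_ideal p L \<chi>) \<circ> env_class L"
    by (simp add: fun_eq_iff red_env_class_def)
  then show ?thesis using ring_hom_trans[OF env_class_hom red_quot(2)] by simp
qed

lemma cls_in [simp, intro]: "f \<in> carrier F \<Longrightarrow> cls f \<in> carrier A"
  using cls_hom by (rule ring_hom_closed)

lemma cls_smult: "f \<in> carrier F \<Longrightarrow> cls (c \<odot>\<^bsub>F\<^esub> f) = c \<odot>\<^bsub>A\<^esub> cls f"
  unfolding red_env_class_def by (simp add: red_quot(3) env_quot(3) del: free_algebra_simps)

lemmas cls_simps = ring_hom_add[OF cls_hom] ring_hom_mult[OF cls_hom] ring_hom_one[OF cls_hom] cls_smult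

lemma cls_surj: assumes "a \<in> carrier A" obtains f where "f \<in> carrier F" "a = cls f"
proof -
  obtain u where u: "u \<in> carrier U" "a = red_ideal p L \<chi> +>\<^bsub>U\<^esub> u" using red_quot(4)[OF assms] by blast
  obtain f where "f \<in> carrier F" "u = env_class L f" using env_quot(4)[OF u(1)] by blast
  then show thesis using u that by (simp add: red_env_class_def)
qed

lemma env_gens_zero: "z \<in> env_gens \<Longrightarrow> cls z = \<zero>\<^bsub>A\<^esub>"
proof -
  assume z: "z \<in> env_gens"
  have "z \<in> env_ideal L" unfolding env_ideal_eq using F.genideal_self[OF env_gens_subset] z by blast
  then have "z \<ominus>\<^bsub>F\<^esub> \<zero>\<^bsub>F\<^esub> \<in> env_ideal L" using z env_gens_subset by (auto simp: F.minus_eq simp del: free_algebra_simps)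
  then have "env_class L z = env_class L \<zero>\<^bsub>F\<^esub>"
    using z env_gens_subset env_quot(5)[of z "\<zero>\<^bsub>F\<^esub>"] by (auto simp del: free_algebra_simps)
  then have "cls z = cls \<zero>\<^bsub>F\<^esub>" by (simp add: red_env_class_def)
  also have "\<dots> = \<zero>\<^bsub>A\<^esub>" by (rule ring_hom_zero[OF cls_hom F.ring_axioms A.ring_axioms])
  finally show ?thesis .
qed

lemma eq_of_minus_zero: "a \<in> carrier A \<Longrightarrow> b \<in> carrier A \<Longrightarrow> a \<ominus>\<^bsub>A\<^esub> b = \<zero>\<^bsub>A\<^esub> \<Longrightarrow> a = b"
  by (simp add: A.minus_eq_zero_iff)

lemma cls_minus: "f \<in> carrier F \<Longrightarrow> g \<in> carrier F \<Longrightarrow> cls (f \<ominus>\<^bsub>F\<^esub> g) = cls f \<ominus>\<^bsub>A\<^esub> cls g"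
  by (rule ring_hom_minus[OF F.ring_axioms A.ring_axioms cls_hom])

definition "ge x = cls (gen x)"

lemma ge_in [simp, intro]: "x \<in> carrier L \<Longrightarrow> ge x \<in> carrier A" by (simp add: ge_def)

lemma env_gens_memb:
  assumes "x \<in> carrier L"
  shows "y \<in> carrier L \<Longrightarrow> gen (x \<oplus>\<^bsub>L\<^esub> y) \<ominus>\<^bsub>F\<^esub> (gen x \<oplus>\<^bsub>F\<^esub> gen y) \<in> env_gens"
    "gen (c \<odot>\<^bsub>L\<^esub> x) \<ominus>\<^bsub>F\<^esub> c \<odot>\<^bsub>F\<^esub> gen x \<in> env_gens"
    "y \<in> carrier L \<Longrightarrow>
      (gen x \<otimes>\<^bsub>F\<^esub> gen y \<ominus>\<^bsub>F\<^esub> gen y \<otimes>\<^bsub>F\<^esub> gen x) \<ominus>\<^bsub>F\<^esub> gen (bracket L x y) \<in> env_gens"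
proof -
  show "gen (x \<oplus>\<^bsub>L\<^esub> y) \<ominus>\<^bsub>F\<^esub> (gen x \<oplus>\<^bsub>F\<^esub> gen y) \<in> env_gens" if "y \<in> carrier L"
    unfolding env_gens_def
    by (rule UnI1, rule UnI1, intro CollectI exI conjI, rule refl, rule assms, rule that)
  show "gen (c \<odot>\<^bsub>L\<^esub> x) \<ominus>\<^bsub>F\<^esub> c \<odot>\<^bsub>F\<^esub> gen x \<in> env_gens"
    unfolding env_gens_def
    by (rule UnI1, rule UnI2, intro CollectI exI conjI, rule refl, rule assms)
  show "(gen x \<otimes>\<^bsub>F\<^esub> gen y \<ominus>\<^bsub>F\<^esub> gen y \<otimes>\<^bsub>F\<^esub> gen x) \<ominus>\<^bsub>F\<^esub> gen (bracket L x y) \<in> env_gens"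
    if "y \<in> carrier L"
    unfolding env_gens_def
    by (rule UnI2, intro CollectI exI conjI, rule refl, rule assms, rule that)
qed

lemma ge_add:
  assumes x: "x \<in> carrier L" and y: "y \<in> carrier L" shows "ge (x \<oplus>\<^bsub>L\<^esub> y) = ge x \<oplus>\<^bsub>A\<^esub> ge y"
proof (rule eq_of_minus_zero)
  note c = gen_in[OF add_closed[OF x y]] F.a_closed[OF gen_in[OF x] gen_in[OF y]]
  show "ge (x \<oplus>\<^bsub>L\<^esub> y) \<ominus>\<^bsub>A\<^esub> (ge x \<oplus>\<^bsub>A\<^esub> ge y) = \<zero>\<^bsub>A\<^esub>"
    using env_gens_zero[OF env_gens_memb(1)[OF x y]]
    by (simp only: ge_def cls_minus[OF c] cls_simps(1)[OF gen_in[OF x] gen_in[OF y]])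
qed (use ge_in add_closed x y in auto)

lemma ge_smult:
  assumes x: "x \<in> carrier L" shows "ge (c \<odot>\<^bsub>L\<^esub> x) = c \<odot>\<^bsub>A\<^esub> ge x"
proof (rule eq_of_minus_zero)
  note c = gen_in[OF smult_closed[OF x, of c]] F.smult_closed[OF gen_in[OF x], of c]
  show "ge (c \<odot>\<^bsub>L\<^esub> x) \<ominus>\<^bsub>A\<^esub> (c \<odot>\<^bsub>A\<^esub> ge x) = \<zero>\<^bsub>A\<^esub>"
    using env_gens_zero[OF env_gens_memb(2)[OF x, of c]]
    by (simp only: ge_def cls_minus[OF c] cls_smult[OF gen_in[OF x]])
qed (use ge_in smult_closed x in auto)

lemma ge_bracket:
  assumes x: "x \<in> carrier L" and y: "y \<in> carrier L"
  shows "ge x \<otimes>\<^bsub>A\<^esub> ge y \<ominus>\<^bsub>A\<^esub> ge y \<otimes>\<^bsub>A\<^esub> ge x = ge (bracket L x y)"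
proof (rule eq_of_minus_zero)
  note g = gen_in[OF x] gen_in[OF y] gen_in[OF bracket_closed[OF x y]]
  note m = F.m_closed[OF g(1,2)] F.m_closed[OF g(2,1)]
  show "ge x \<otimes>\<^bsub>A\<^esub> ge y \<ominus>\<^bsub>A\<^esub> ge y \<otimes>\<^bsub>A\<^esub> ge x \<ominus>\<^bsub>A\<^esub> ge (bracket L x y) = \<zero>\<^bsub>A\<^esub>"
    using env_gens_zero[OF env_gens_memb(3)[OF x y]]
    by (simp only: ge_def cls_minus[OF F.minus_closed[OF m] g(3)] cls_minus[OF m]
        cls_simps(2)[OF g(1,2)] cls_simps(2)[OF g(2,1)])
qed (use ge_in bracket_closed x y in auto)

lemma ge_pow: assumes x: "x \<in> carrier L"
  shows "ge x [^]\<^bsub>A\<^esub> p = ge (pmap L x) \<oplus>\<^bsub>A\<^esub> (\<chi> x ^ p) \<odot>\<^bsub>A\<^esub> \<one>\<^bsub>A\<^esub>"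
proof -
  let ?I = "red_ideal p L \<chi>"
  have hom: "(+>\<^bsub>U\<^esub>) ?I \<in> ring_hom U A" by (rule red_quot(2))
  let ?z = "(env_class L (gen x) [^]\<^bsub>U\<^esub> p \<ominus>\<^bsub>U\<^esub> env_class L (gen (pmap L x))) \<ominus>\<^bsub>U\<^esub> (\<chi> x ^ p) \<odot>\<^bsub>U\<^esub> \<one>\<^bsub>U\<^esub>"
  have "?z \<in> red_gens"
    unfolding red_gens_def by (intro CollectI exI conjI, rule refl, rule x)
  then have zI: "?z \<in> ?I" "?z \<in> carrier U"
    unfolding red_ideal_eq using U.genideal_self[OF red_gens_subset] red_gens_subset by auto
  have "?I +>\<^bsub>U\<^esub> ?z = \<zero>\<^bsub>A\<^esub>"
  proof -
    have "?z \<ominus>\<^bsub>U\<^esub> \<zero>\<^bsub>U\<^esub> = ?z" using zI(2) by (simp add: U.minus_eq)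
    then have "?I +>\<^bsub>U\<^esub> ?z = ?I +>\<^bsub>U\<^esub> \<zero>\<^bsub>U\<^esub>" using zI red_quot(5)[OF zI(2) U.zero_closed] by simp
    then show ?thesis using ring_hom_zero[OF hom U.ring_axioms A.ring_axioms] by simp
  qed
  note minus = ring_hom_minus[OF U.ring_axioms A.ring_axioms hom]
  note pow = ring_hom_nat_pow[OF U.ring_axioms A.ring_axioms hom]
  have c: "env_class L (gen x) \<in> carrier U" "env_class L (gen (pmap L x)) \<in> carrier U"
    using x pmap_closed[OF x] by simp_all
  have "?I +>\<^bsub>U\<^esub> ?z = ge x [^]\<^bsub>A\<^esub> p \<ominus>\<^bsub>A\<^esub> ge (pmap L x) \<ominus>\<^bsub>A\<^esub> (\<chi> x ^ p) \<odot>\<^bsub>A\<^esub> \<one>\<^bsub>A\<^esub>"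
    using c red_quot(3)[OF U.one_closed, of "\<chi> x ^ p"] ring_hom_one[OF hom]
    by (simp add: minus pow ge_def red_env_class_def)
  with \<open>?I +>\<^bsub>U\<^esub> ?z = \<zero>\<^bsub>A\<^esub>\<close> have "ge x [^]\<^bsub>A\<^esub> p \<ominus>\<^bsub>A\<^esub> ge (pmap L x) \<ominus>\<^bsub>A\<^esub> (\<chi> x ^ p) \<odot>\<^bsub>A\<^esub> \<one>\<^bsub>A\<^esub> = \<zero>\<^bsub>A\<^esub>"
    by simp
  then show ?thesis
    using x pmap_closed[OF x] by (subst (asm) A.minus_minus_zero_iff) auto
qed

text \<open>
  The universal property of \<open>u(L, \<chi>)\<close>, obtained by factoring first through \<open>U(L)\<close> and then through
  its reduced quotient.
\<close>

theorem red_env_universal: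
  assumes R: "ring R" and h: "h \<in> ring_hom F R"
    and add: "\<And>x y. x \<in> carrier L \<Longrightarrow> y \<in> carrier L \<Longrightarrow> h (gen (x \<oplus>\<^bsub>L\<^esub> y)) = h (gen x) \<oplus>\<^bsub>R\<^esub> h (gen y)"
    and smult: "\<And>c x. x \<in> carrier L \<Longrightarrow> h (gen (c \<odot>\<^bsub>L\<^esub> x)) = h (c \<odot>\<^bsub>F\<^esub> gen x)"
    and brk: "\<And>x y. x \<in> carrier L \<Longrightarrow> y \<in> carrier L \<Longrightarrow>
      h (gen x) \<otimes>\<^bsub>R\<^esub> h (gen y) = h (gen y) \<otimes>\<^bsub>R\<^esub> h (gen x) \<oplus>\<^bsub>R\<^esub> h (gen (bracket L x y))"
    and pow: "\<And>x. x \<in> carrier L \<Longrightarrow>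
      h (gen x) [^]\<^bsub>R\<^esub> p = h (gen (pmap L x)) \<oplus>\<^bsub>R\<^esub> h ((\<chi> x ^ p) \<odot>\<^bsub>F\<^esub> \<one>\<^bsub>F\<^esub>)"
  obtains h' where "h' \<in> ring_hom A R" "\<And>f. f \<in> carrier F \<Longrightarrow> h' (cls f) = h f"
proof -
  interpret R: ring R by fact
  interpret h: ring_hom_ring F R h by (intro ring_hom_ringI2 F.ring_axioms R h)
  have "env_gens \<subseteq> a_kernel F R h"
  proof
    fix z assume z: "z \<in> env_gens"
    have "h z = \<zero>\<^bsub>R\<^esub>"
      using z unfolding env_gens_def
    proof (elim UnE CollectE exE conjE)
      fix x y assume z: "z = gen (x \<oplus>\<^bsub>L\<^esub> y) \<ominus>\<^bsub>F\<^esub> (gen x \<oplus>\<^bsub>F\<^esub> gen y)" and xy: "x \<in> carrier L" "y \<in> carrier L"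
      show ?thesis unfolding z using xy
        by (simp add: F.minus_eq add add_closed R.r_neg del: free_algebra_simps)
    next
      fix c x assume z: "z = gen (c \<odot>\<^bsub>L\<^esub> x) \<ominus>\<^bsub>F\<^esub> c \<odot>\<^bsub>F\<^esub> gen x" and x: "x \<in> carrier L"
      show ?thesis unfolding z using x
        by (simp add: F.minus_eq smult smult_closed R.r_neg del: free_algebra_simps)
    next
      fix x y assume z: "z = (gen x \<otimes>\<^bsub>F\<^esub> gen y \<ominus>\<^bsub>F\<^esub> gen y \<otimes>\<^bsub>F\<^esub> gen x) \<ominus>\<^bsub>F\<^esub> gen (bracket L x y)"
        and xy: "x \<in> carrier L" "y \<in> carrier L"
      have c: "h (gen x) \<in> carrier R" "h (gen y) \<in> carrier R" "h (gen (bracket L x y)) \<in> carrier R"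
        using xy by (simp_all add: bracket_closed)
      have "h z = h (gen x) \<otimes>\<^bsub>R\<^esub> h (gen y) \<ominus>\<^bsub>R\<^esub> h (gen y) \<otimes>\<^bsub>R\<^esub> h (gen x) \<ominus>\<^bsub>R\<^esub> h (gen (bracket L x y))"
        unfolding z using xy by (simp add: F.minus_eq R.minus_eq bracket_closed del: free_algebra_simps)
      also have "\<dots> = \<zero>\<^bsub>R\<^esub>" using c brk[OF xy] by (subst R.minus_minus_zero_iff) auto
      finally show ?thesis .
    qed
    moreover have "z \<in> carrier F" using z env_gens_subset by blast
    ultimately show "z \<in> a_kernel F R h" unfolding a_kernel_def' by blast
  qed
  then have "env_ideal L \<subseteq> a_kernel F R h"
    unfolding env_ideal_eq by (rule F.genideal_minimal[OF h.kernel_is_ideal])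
  then have "h z = \<zero>\<^bsub>R\<^esub>" if "z \<in> env_ideal L" for z using that unfolding a_kernel_def' by blast
  from factor_through_quot[OF free_algebra_algebra_over env_ideal R h this, folded env_algebra_def env_class_def]
  obtain h1 where h1: "h1 \<in> ring_hom U R" "\<And>f. f \<in> carrier F \<Longrightarrow> h1 (env_class L f) = h f"
    by blast
  interpret h1: ring_hom_ring U R h1 by (intro ring_hom_ringI2 U.ring_axioms R h1)
  have "red_gens \<subseteq> a_kernel U R h1"
  proof
    fix z assume "z \<in> red_gens"
    then obtain x where x: "x \<in> carrier L" and
      z: "z = (env_class L (gen x) [^]\<^bsub>U\<^esub> p \<ominus>\<^bsub>U\<^esub> env_class L (gen (pmap L x))) \<ominus>\<^bsub>U\<^esub> (\<chi> x ^ p) \<odot>\<^bsub>U\<^esub> \<one>\<^bsub>U\<^esub>"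
      unfolding red_gens_def by blast
    have e: "(\<chi> x ^ p) \<odot>\<^bsub>U\<^esub> \<one>\<^bsub>U\<^esub> = env_class L ((\<chi> x ^ p) \<odot>\<^bsub>F\<^esub> \<one>\<^bsub>F\<^esub>)"
      using env_quot(3)[OF F.one_closed] ring_hom_one[OF env_class_hom] by simp
    have c: "h (gen (pmap L x)) \<in> carrier R" "h ((\<chi> x ^ p) \<odot>\<^bsub>F\<^esub> \<one>\<^bsub>F\<^esub>) \<in> carrier R"
      by (rule h.hom_closed, use x pmap_closed in simp) (rule h.hom_closed, rule F.smult_closed, rule F.one_closed)
    have cU: "env_class L (gen x) \<in> carrier U" "env_class L (gen (pmap L x)) \<in> carrier U"
      "env_class L ((\<chi> x ^ p) \<odot>\<^bsub>F\<^esub> \<one>\<^bsub>F\<^esub>) \<in> carrier U"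
      using env_class_in[OF gen_in[OF x]] env_class_in[OF gen_in[OF pmap_closed[OF x]]]
        env_class_in[OF F.smult_closed[OF F.one_closed]] by blast+
    have "h1 z = h (gen x) [^]\<^bsub>R\<^esub> p \<ominus>\<^bsub>R\<^esub> h (gen (pmap L x)) \<ominus>\<^bsub>R\<^esub> h ((\<chi> x ^ p) \<odot>\<^bsub>F\<^esub> \<one>\<^bsub>F\<^esub>)"
      unfolding z e ring_hom_minus[OF U.ring_axioms R h1(1) U.minus_closed[OF U.nat_pow_closed[OF cU(1)] cU(2)] cU(3)]
        ring_hom_minus[OF U.ring_axioms R h1(1) U.nat_pow_closed[OF cU(1)] cU(2)]
        ring_hom_nat_pow[OF U.ring_axioms R h1(1) cU(1)]
        h1(2)[OF gen_in[OF x]] h1(2)[OF gen_in[OF pmap_closed[OF x]]] h1(2)[OF F.smult_closed[OF F.one_closed]] ..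
    also have "\<dots> = \<zero>\<^bsub>R\<^esub>"
      using R.minus_minus_zero_iff[OF R.nat_pow_closed[OF h.hom_closed[OF gen_in[OF x]]] c] pow[OF x] by blast
    finally show "z \<in> a_kernel U R h1"
      using \<open>z \<in> red_gens\<close> red_gens_subset unfolding a_kernel_def' by blast
  qed
  then have "red_ideal p L \<chi> \<subseteq> a_kernel U R h1"
    unfolding red_ideal_eq by (rule U.genideal_minimal[OF h1.kernel_is_ideal])
  then have "h1 z = \<zero>\<^bsub>R\<^esub>" if "z \<in> red_ideal p L \<chi>" for z using that unfolding a_kernel_def' by blast
  from factor_through_quot[OF env_quot(1) red_ideal R h1(1) this, folded red_env_algebra_def]
  obtain h2 where h2: "h2 \<in> ring_hom A R" "\<And>u. u \<in> carrier U \<Longrightarrow> h2 (red_ideal p L \<chi> +>\<^bsub>U\<^esub> u) = h1 u"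
    by blast
  show thesis
    by (rule that[OF h2(1)]) (simp add: red_env_class_def h2(2) h1(2))
qed

end

section \<open>Induced one-dimensional modules\<close>

lemma free_algebra_mono: "X \<subseteq> Y \<Longrightarrow> carrier (free_algebra X) \<subseteq> carrier (free_algebra Y)"
  by (rule subsetI, unfold free_algebra_carrier) (use lists_mono[of X Y] in blast)

lemma conv_gen: "(\<Sum>i\<le>length w. gen x (take i w) * f (drop i w)) =
    (if w \<noteq> [] \<and> hd w = x then f (tl w) else (0 :: 'k::field))"
proof (cases w)
  case (Cons y v)
  have "(\<Sum>i\<le>length w. gen x (take i w) * f (drop i w)) = (\<Sum>i\<le>length w. if i = 1 then (if y = x then f v else 0) else 0)"
  proof (rule sum.cong[OF refl])
    fix i assume "i \<in> {..length w}"
    show "gen x (take i w) * f (drop i w) = (if i = 1 then (if y = x then f v else 0) else 0)"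
      using \<open>i \<in> {..length w}\<close> by (cases i) (auto simp: Cons gen_def take_eq_Nil)
  qed
  also have "\<dots> = (if 1 \<in> {..length w} then (if y = x then f v else 0) else 0)"
    by (rule sum.delta) simp
  finally show ?thesis by (simp add: Cons)
qed (simp add: gen_def)

text \<open>
  Induction over words built up by left multiplication, the form that fits left modules.
\<close>

lemma free_algebra_induct [consumes 1, case_names one gen add smult]:
  assumes f: "f \<in> carrier (free_algebra X)"
    and one: "P \<one>\<^bsub>free_algebra X\<^esub>"
    and gen: "\<And>x f. x \<in> X \<Longrightarrow> f \<in> carrier (free_algebra X) \<Longrightarrow> P f \<Longrightarrow> P (gen x \<otimes>\<^bsub>free_algebra X\<^esub> f)"
    and add: "\<And>f g. f \<in> carrier (free_algebra X) \<Longrightarrow> g \<in> carrier (free_algebra X) \<Longrightarrow> P f \<Longrightarrow> P g \<Longrightarrow>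
      P (f \<oplus>\<^bsub>free_algebra X\<^esub> g)"
    and smult: "\<And>c f. f \<in> carrier (free_algebra X) \<Longrightarrow> P f \<Longrightarrow> P (c \<odot>\<^bsub>free_algebra X\<^esub> f)"
  shows "P (f :: 'x list \<Rightarrow> 'k::field)"
proof -
  define mono where "mono w = (\<lambda>u. if u = w then 1 else 0 :: 'k)" for w :: "'x list"
  have monoc: "mono w \<in> carrier (free_algebra X)" if "w \<in> lists X" for w
    by (rule free_algebra_carrierI[of "{w}"]) (use that in \<open>auto simp: mono_def\<close>)
  have mono: "P (mono w)" if "w \<in> lists X" for w
    using that
  proof (induction w)
    case Nil
    have "mono [] = \<one>\<^bsub>free_algebra X\<^esub>" by (simp add: mono_def)
    then show ?case using one by metis
  next
    case (Cons x w)
    have "mono (x # w) = gen x \<otimes>\<^bsub>free_algebra X\<^esub> mono w"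
    proof
      fix u show "mono (x # w) u = (gen x \<otimes>\<^bsub>free_algebra X\<^esub> mono w) u"
        unfolding free_algebra_simps conv_gen by (cases u) (auto simp: mono_def)
    qed
    then show ?case using gen[OF Cons.hyps(1) monoc[OF Cons.hyps(2)] Cons.IH] by metis
  qed
  have zero: "P (\<lambda>_. 0)"
    using smult[OF monoc[of "[]"] mono[of "[]"], of 0] by simp
  have "P f" if "finite W" "f \<in> carrier (free_algebra X)" "{w. f w \<noteq> 0} = W" for W f
    using that
  proof (induction W arbitrary: f)
    case empty
    then have "f = (\<lambda>_. 0)" by auto
    then show ?case using zero by simp
  next
    case (insert w W)
    have w: "w \<in> lists X" using insert.prems by (auto simp: free_algebra_carrier)
    define g where "g u = (if u = w then 0 else f u)" for u
    have gW: "{u. g u \<noteq> 0} = W" using insert by (auto simp: g_def)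
    have g: "g \<in> carrier (free_algebra X)"
      unfolding free_algebra_carrier gW using insert by (auto simp: free_algebra_carrier)
    have fe: "f = (f w \<odot>\<^bsub>free_algebra X\<^esub> mono w) \<oplus>\<^bsub>free_algebra X\<^esub> g"
      by (auto simp: fun_eq_iff g_def mono_def)
    have "P ((f w \<odot>\<^bsub>free_algebra X\<^esub> mono w) \<oplus>\<^bsub>free_algebra X\<^esub> g)"
      by (rule add[OF free_algebra_smult_closed[OF monoc[OF w]] g smult[OF monoc[OF w] mono[OF w]]
            insert.IH[OF g gW]])
    then show ?case using fe by metis
  qed
  then show ?thesis using f by (auto simp: free_algebra_carrier)
qed

inductive_set left_ideal :: "('k, 'a) module \<Rightarrow> 'a set \<Rightarrow> 'a set" for A G where
  zero: "\<zero>\<^bsub>A\<^esub> \<in> left_ideal A G"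
| mult: "a \<in> carrier A \<Longrightarrow> g \<in> G \<Longrightarrow> a \<otimes>\<^bsub>A\<^esub> g \<in> left_ideal A G"
| add: "x \<in> left_ideal A G \<Longrightarrow> y \<in> left_ideal A G \<Longrightarrow> x \<oplus>\<^bsub>A\<^esub> y \<in> left_ideal A G"

context algebra_over
begin

lemma left_ideal_carrier: "G \<subseteq> carrier A \<Longrightarrow> x \<in> left_ideal A G \<Longrightarrow> x \<in> carrier A"
  by (rotate_tac, induction rule: left_ideal.induct) auto

lemma left_ideal_gen: "G \<subseteq> carrier A \<Longrightarrow> g \<in> G \<Longrightarrow> g \<in> left_ideal A G"
  using left_ideal.mult[OF one_closed, of g G] by auto

lemma left_ideal_mult:
  assumes "G \<subseteq> carrier A" "x \<in> left_ideal A G" "a \<in> carrier A"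
  shows "a \<otimes> x \<in> left_ideal A G"
  using assms(2)
proof induction
  case (mult b g)
  then show ?case using assms left_ideal.mult[of "a \<otimes> b" A g G] by (auto simp: m_assoc)
next
  case (add x y)
  then show ?case using assms left_ideal_carrier[OF assms(1)]
    by (simp add: r_distr left_ideal.add)
qed (use assms left_ideal.zero in auto)

lemma left_ideal_smult:
  assumes "G \<subseteq> carrier A" "x \<in> left_ideal A G" shows "c \<odot> x \<in> left_ideal A G"
  using left_ideal_mult[OF assms smult_closed[OF one_closed], of c] left_ideal_carrier[OF assms]
  by (simp add: smult_assoc2)

lemma left_ideal_neg:
  assumes "G \<subseteq> carrier A" "x \<in> left_ideal A G" shows "\<ominus> x \<in> left_ideal A G"
  using left_ideal_smult[OF assms, of "-1"] left_ideal_carrier[OF assms] by (simp add: smult_minus_one)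

lemma left_ideal_minus:
  assumes "G \<subseteq> carrier A" "x \<in> left_ideal A G" "y \<in> left_ideal A G" shows "x \<ominus> y \<in> left_ideal A G"
  unfolding minus_eq by (intro left_ideal.add left_ideal_neg assms)

end

text \<open>
  A restricted subalgebra \<open>H0\<close> on which \<open>\<chi>\<close> vanishes and a character \<open>\<theta>\<close> of it: the data of the induced
  module \<open>T = u(L, \<chi>) \<otimes> \<theta>\<close>.
\<close>

locale induced_module =
  L: restricted_lie_ops p L \<chi> + H: restricted_lie_ops p "L\<lparr>carrier := H0\<rparr>" "\<lambda>_. 0"
  for p :: nat and L :: "('k::field, 'x) restricted_lie" and \<chi> :: "'x \<Rightarrow> 'k" and H0 :: "'x set" +
  fixes \<theta> :: "'x \<Rightarrow> 'k"
  assumes H0: "H0 \<subseteq> carrier L" and p: "p > 0"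
    and \<chi>_H0: "x \<in> H0 \<Longrightarrow> \<chi> x = 0"
    and \<theta>_add: "x \<in> H0 \<Longrightarrow> y \<in> H0 \<Longrightarrow> \<theta> (x \<oplus>\<^bsub>L\<^esub> y) = \<theta> x + \<theta> y"
    and \<theta>_smult: "x \<in> H0 \<Longrightarrow> \<theta> (c \<odot>\<^bsub>L\<^esub> x) = c * \<theta> x"
    and \<theta>_bracket: "x \<in> H0 \<Longrightarrow> y \<in> H0 \<Longrightarrow> \<theta> (bracket L x y) = 0"
    and \<theta>_pmap: "x \<in> H0 \<Longrightarrow> \<theta> (pmap L x) = \<theta> x ^ p"
begin

abbreviation "H \<equiv> L\<lparr>carrier := H0\<rparr>"
abbreviation "A \<equiv> L.A"
abbreviation "B \<equiv> H.A"
abbreviation "\<phi> \<equiv> red_env_incl p H L \<chi>"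
abbreviation "V \<equiv> one_dim_module p H (\<lambda>_. 0) \<theta>"
abbreviation "T \<equiv> tensor_module A B \<phi> V"

lemma incl_hom: "\<exists>h. h \<in> ring_hom B A \<and> (\<forall>f\<in>carrier H.F. h (H.cls f) = L.cls f)"
proof -
  have sub: "carrier H.F \<subseteq> carrier L.F"
    using free_algebra_mono[OF H0] by simp
  have c: "f \<in> carrier L.F" if "f \<in> carrier H.F" for f using sub that by blast
  have hom: "L.cls \<in> ring_hom H.F A"
  proof (rule ring_hom_memI)
    fix f g assume fg: "f \<in> carrier H.F" "g \<in> carrier H.F"
    show "L.cls f \<in> carrier A" using c fg by blast
    show "L.cls (f \<otimes>\<^bsub>H.F\<^esub> g) = L.cls f \<otimes>\<^bsub>A\<^esub> L.cls g"
      using L.cls_simps(2)[OF c c, OF fg] by simp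
    show "L.cls (f \<oplus>\<^bsub>H.F\<^esub> g) = L.cls f \<oplus>\<^bsub>A\<^esub> L.cls g"
      using L.cls_simps(1)[OF c c, OF fg] by simp
  next
    show "L.cls \<one>\<^bsub>H.F\<^esub> = \<one>\<^bsub>A\<^esub>" using L.cls_simps(3) by simp
  qed
  have L: "x \<in> carrier L" if "x \<in> carrier H" for x using H0 that by auto
  obtain h where "h \<in> ring_hom B A" "\<And>f. f \<in> carrier H.F \<Longrightarrow> h (H.cls f) = L.cls f"
  proof (rule H.red_env_universal[OF L.A.ring_axioms hom])
    fix x y assume x: "x \<in> carrier H" and y: "y \<in> carrier H"
    show "L.cls (gen (x \<oplus>\<^bsub>H\<^esub> y)) = L.cls (gen x) \<oplus>\<^bsub>A\<^esub> L.cls (gen y)"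
      using L.ge_add[OF L[OF x] L[OF y]] by (simp add: L.ge_def)
    note g = L.ge_in[OF L[OF x]] L.ge_in[OF L[OF y]] L.ge_in[OF L.bracket_closed[OF L[OF x] L[OF y]]]
    have "L.ge x \<otimes>\<^bsub>A\<^esub> L.ge y \<ominus>\<^bsub>A\<^esub> L.ge y \<otimes>\<^bsub>A\<^esub> L.ge x \<ominus>\<^bsub>A\<^esub> L.ge (bracket L x y) = \<zero>\<^bsub>A\<^esub>"
      unfolding L.ge_bracket[OF L[OF x] L[OF y]] using g(3) by (simp add: L.A.minus_eq L.A.r_neg)
    then have "L.ge x \<otimes>\<^bsub>A\<^esub> L.ge y = L.ge y \<otimes>\<^bsub>A\<^esub> L.ge x \<oplus>\<^bsub>A\<^esub> L.ge (bracket L x y)"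
      using g by (subst (asm) L.A.minus_minus_zero_iff) auto
    then show "L.cls (gen x) \<otimes>\<^bsub>A\<^esub> L.cls (gen y) = L.cls (gen y) \<otimes>\<^bsub>A\<^esub> L.cls (gen x) \<oplus>\<^bsub>A\<^esub> L.cls (gen (bracket H x y))"
      by (simp add: L.ge_def)
  next
    fix x c assume x: "x \<in> carrier H"
    show "L.cls (gen (c \<odot>\<^bsub>H\<^esub> x)) = L.cls (c \<odot>\<^bsub>H.F\<^esub> gen x)"
      using L.ge_smult[OF L[OF x], of c] L.cls_smult[OF L.gen_in[OF L[OF x]], of c] by (simp add: L.ge_def)
    have "\<chi> x = 0" using x \<chi>_H0 by simp
    then show "L.cls (gen x) [^]\<^bsub>A\<^esub> p = L.cls (gen (pmap H x)) \<oplus>\<^bsub>A\<^esub> L.cls (0 ^ p \<odot>\<^bsub>H.F\<^esub> \<one>\<^bsub>H.F\<^esub>)"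
      using L.ge_pow[OF L[OF x]] L.cls_smult[OF L.F.one_closed, of "0 ^ p"] L.cls_simps(3)
      by (simp add: L.ge_def)
  qed (use that in blast)
  then show ?thesis by blast
qed

lemma incl_cls: "f \<in> carrier H.F \<Longrightarrow> \<phi> (H.cls f) = L.cls f"
proof -
  assume f: "f \<in> carrier H.F"
  obtain h where h: "\<And>f. f \<in> carrier H.F \<Longrightarrow> h (H.cls f) = L.cls f" using incl_hom by blast
  have "(THE a. \<exists>f'\<in>carrier H.F. H.cls f = H.cls f' \<and> a = L.cls f') = L.cls f"
  proof (rule the_equality)
    fix a assume "\<exists>f'\<in>carrier H.F. H.cls f = H.cls f' \<and> a = L.cls f'"
    then show "a = L.cls f" using h f by metis
  qed (use f in blast)
  then show ?thesis by (simp add: red_env_incl_def)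
qed

lemma central: "central_scalars (\<lambda>c. c) H0 \<theta>"
  by unfold_locales (auto simp: mult.commute)

definition "\<theta>F = word_eval (\<lambda>c::'k. c) \<theta>"

lemma \<theta>F_simps:
  "\<theta>F \<one>\<^bsub>H.F\<^esub> = 1" "\<theta>F (gen x) = \<theta> x"
  "f \<in> carrier H.F \<Longrightarrow> g \<in> carrier H.F \<Longrightarrow> \<theta>F (f \<oplus>\<^bsub>H.F\<^esub> g) = \<theta>F f + \<theta>F g"
  "f \<in> carrier H.F \<Longrightarrow> g \<in> carrier H.F \<Longrightarrow> \<theta>F (f \<otimes>\<^bsub>H.F\<^esub> g) = \<theta>F f * \<theta>F g"
  "f \<in> carrier H.F \<Longrightarrow> \<theta>F (c \<odot>\<^bsub>H.F\<^esub> f) = c * \<theta>F f"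
  using central_scalars.word_eval_one[OF central] central_scalars.word_eval_gen[OF central, of x]
    central_scalars.word_eval_add[OF central, of f g] central_scalars.word_eval_mult[OF central, of f g]
    central_scalars.word_eval_smult[OF central, of f c]
  by (simp_all add: \<theta>F_def)

lemma \<theta>_hom: "\<exists>h. h \<in> ring_hom B (class_ring TYPE('k)) \<and> (\<forall>f\<in>carrier H.F. h (H.cls f) = \<theta>F f)"
proof -
  have hom: "\<theta>F \<in> ring_hom H.F (class_ring TYPE('k))"
    using central_scalars.word_eval_ring_hom[OF central] by (simp add: \<theta>F_def)
  have add: "\<theta>F (gen (x \<oplus>\<^bsub>H\<^esub> y)) = \<theta>F (gen x) \<oplus>\<^bsub>class_ring TYPE('k)\<^esub> \<theta>F (gen y)"
    and brk: "\<theta>F (gen x) \<otimes>\<^bsub>class_ring TYPE('k)\<^esub> \<theta>F (gen y) =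
        \<theta>F (gen y) \<otimes>\<^bsub>class_ring TYPE('k)\<^esub> \<theta>F (gen x) \<oplus>\<^bsub>class_ring TYPE('k)\<^esub> \<theta>F (gen (bracket H x y))"
    if "x \<in> carrier H" "y \<in> carrier H" for x y
  proof -
    have "\<theta> (x \<oplus>\<^bsub>H\<^esub> y) = \<theta> x + \<theta> y" "\<theta> (bracket H x y) = 0" using that by (simp_all add: \<theta>_add \<theta>_bracket)
    then show "\<theta>F (gen (x \<oplus>\<^bsub>H\<^esub> y)) = \<theta>F (gen x) \<oplus>\<^bsub>class_ring TYPE('k)\<^esub> \<theta>F (gen y)"
      "\<theta>F (gen x) \<otimes>\<^bsub>class_ring TYPE('k)\<^esub> \<theta>F (gen y) =
        \<theta>F (gen y) \<otimes>\<^bsub>class_ring TYPE('k)\<^esub> \<theta>F (gen x) \<oplus>\<^bsub>class_ring TYPE('k)\<^esub> \<theta>F (gen (bracket H x y))"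
      by (simp_all only: \<theta>F_simps(2) class_ring_simps add_0_right mult.commute)
  qed
  have smult: "\<theta>F (gen (c \<odot>\<^bsub>H\<^esub> x)) = \<theta>F (c \<odot>\<^bsub>H.F\<^esub> gen x)" if x: "x \<in> carrier H" for x c
  proof -
    have "\<theta> (c \<odot>\<^bsub>H\<^esub> x) = c * \<theta> x" using x by (simp add: \<theta>_smult)
    then show ?thesis by (simp only: \<theta>F_simps(5)[OF H.gen_in[OF x]] \<theta>F_simps(2))
  qed
  have pow: "\<theta>F (gen x) [^]\<^bsub>class_ring TYPE('k)\<^esub> p = \<theta>F (gen (pmap H x)) \<oplus>\<^bsub>class_ring TYPE('k)\<^esub> \<theta>F (0 ^ p \<odot>\<^bsub>H.F\<^esub> \<one>\<^bsub>H.F\<^esub>)"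
    if x: "x \<in> carrier H" for x
  proof -
    have "\<theta>F (0 ^ p \<odot>\<^bsub>H.F\<^esub> \<one>\<^bsub>H.F\<^esub>) = 0"
      unfolding \<theta>F_simps(5)[OF H.F.one_closed] using p by (simp only: zero_power mult_zero_left)
    moreover have "\<theta> (pmap H x) = \<theta> x ^ p" using x \<theta>_pmap by simp
    ultimately show ?thesis
      by (simp only: \<theta>F_simps(2) class_ring_pow class_ring_simps add_0_right)
  qed
  show ?thesis
    by (rule H.red_env_universal[OF class_ring_ring hom add smult brk pow]) blast+
qed

lemma V_act: "f \<in> carrier H.F \<Longrightarrow> H.cls f \<odot>\<^bsub>V\<^esub> v = \<theta>F f * v"
proof -
  assume f: "f \<in> carrier H.F"
  obtain h where h: "\<And>f. f \<in> carrier H.F \<Longrightarrow> h (H.cls f) = \<theta>F f" using \<theta>_hom by blast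
  have "(THE s. \<exists>f'\<in>carrier H.F. H.cls f = H.cls f' \<and> s = \<theta>F f') = \<theta>F f"
  proof (rule the_equality)
    fix a assume "\<exists>f'\<in>carrier H.F. H.cls f = H.cls f' \<and> a = \<theta>F f'"
    then show "a = \<theta>F f" using h f by metis
  qed (use f in blast)
  then show ?thesis by (simp add: one_dim_module_def \<theta>F_def word_eval_def)
qed

lemma V_simps: "carrier V = UNIV" "v \<oplus>\<^bsub>V\<^esub> w = v + w"
  by (simp_all add: one_dim_module_def)

abbreviation "PM \<equiv> pair_module A V"
abbreviation "R \<equiv> tensor_relations A B \<phi> V"

lemma PM_simps:
  "z \<in> carrier PM \<longleftrightarrow> Poly_Mapping.keys z \<subseteq> carrier A \<times> UNIV"
  "y \<oplus>\<^bsub>PM\<^esub> z = y + z" "\<zero>\<^bsub>PM\<^esub> = 0"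
  "a \<odot>\<^bsub>PM\<^esub> z = frag_extend (\<lambda>(x, v). frag_of (a \<otimes>\<^bsub>A\<^esub> x, v)) z"
  by (simp_all add: pair_module_def Let_def V_simps)

lemma PM_diff: "y \<in> carrier PM \<Longrightarrow> z \<in> carrier PM \<Longrightarrow> y - z \<in> carrier PM"
  using keys_diff[of y z] by (auto simp: PM_simps(1))

lemma PM_of: "x \<in> carrier A \<Longrightarrow> frag_of (x, v) \<in> carrier PM"
  by (simp add: PM_simps(1))

lemma PM_add: "y \<in> carrier PM \<Longrightarrow> z \<in> carrier PM \<Longrightarrow> y + z \<in> carrier PM"
  using keys_add[of y z] by (auto simp: PM_simps(1))

lemma PM_neg: "y \<in> carrier PM \<Longrightarrow> - y \<in> carrier PM"
  by (simp add: PM_simps(1))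

lemma PM_abelian_group: "abelian_group PM"
proof (rule abelian_groupI)
  show "\<exists>y\<in>carrier PM. y \<oplus>\<^bsub>PM\<^esub> z = \<zero>\<^bsub>PM\<^esub>" if "z \<in> carrier PM" for z
    using that PM_neg by (intro bexI[of _ "- z"]) (auto simp: PM_simps(2,3))
qed (use PM_add in \<open>auto simp: PM_simps(2,3)\<close>, simp add: PM_simps(1))

lemma PM_minus: "z \<in> carrier PM \<Longrightarrow> \<ominus>\<^bsub>PM\<^esub> z = - z"
proof -
  interpret PM: abelian_group PM by (rule PM_abelian_group)
  show "z \<in> carrier PM \<Longrightarrow> \<ominus>\<^bsub>PM\<^esub> z = - z"
    by (rule PM.minus_equality) (auto simp: PM_simps(2,3) PM_neg)
qed

lemma PM_induct [consumes 1, case_names zero of diff]: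
  assumes "z \<in> carrier PM" "Q 0" "\<And>x v. x \<in> carrier A \<Longrightarrow> Q (frag_of (x, v))"
    "\<And>y z. y \<in> carrier PM \<Longrightarrow> z \<in> carrier PM \<Longrightarrow> Q y \<Longrightarrow> Q z \<Longrightarrow> Q (y - z)"
  shows "Q z"
proof -
  have "z \<in> carrier PM \<and> Q z"
    using assms(1)[unfolded PM_simps(1)]
  proof (induction rule: frag_induction)
    case zero then show ?case using assms(2) by (simp add: PM_simps(1))
  next
    case (one x) then show ?case using assms(3) PM_of by (cases x) auto
  next
    case (diff a b) then show ?case using assms(4) PM_diff by blast
  qed
  then show ?thesis ..
qed

lemma PM_act_diff: "a \<odot>\<^bsub>PM\<^esub> (y - z) = a \<odot>\<^bsub>PM\<^esub> y - a \<odot>\<^bsub>PM\<^esub> z"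
  by (simp add: PM_simps(4) frag_extend_diff)

lemma PM_act_add: "a \<odot>\<^bsub>PM\<^esub> (y + z) = a \<odot>\<^bsub>PM\<^esub> y + a \<odot>\<^bsub>PM\<^esub> z"
  by (simp add: PM_simps(4) frag_extend_add)

lemma PM_act_of [simp]: "a \<odot>\<^bsub>PM\<^esub> frag_of (x, v) = frag_of (a \<otimes>\<^bsub>A\<^esub> x, v)"
  by (simp add: PM_simps(4))

lemma PM_act_closed: "a \<in> carrier A \<Longrightarrow> z \<in> carrier PM \<Longrightarrow> a \<odot>\<^bsub>PM\<^esub> z \<in> carrier PM"
  by (rotate_tac, induction rule: PM_induct)
    (auto simp: PM_act_diff PM_of intro: PM_diff, simp add: PM_simps)

lemma incl_closed: "b \<in> carrier B \<Longrightarrow> \<phi> b \<in> carrier A"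
proof -
  assume "b \<in> carrier B"
  then obtain f where f: "f \<in> carrier H.F" "b = H.cls f" by (rule H.cls_surj)
  have "f \<in> carrier L.F" using f free_algebra_mono[OF H0] by auto
  then show ?thesis using f by (simp add: incl_cls)
qed

lemma R_subset: "R \<subseteq> carrier PM"
proof
  fix z assume "z \<in> R"
  then show "z \<in> carrier PM"
    unfolding tensor_relations_def
    by (elim UnE CollectE exE conjE) (simp_all add: PM_diff PM_of incl_closed V_simps)
qed

abbreviation "S \<equiv> generate (add_monoid PM) R"

sublocale PM: abelian_group PM by (rule PM_abelian_group)

lemma S_subgroup: "subgroup S (add_monoid PM)"
  by (rule PM.add.generate_is_subgroup) (use R_subset in simp)

sublocale Q: module_quotient S PM
  by (rule module_quotientI[OF PM_abelian_group S_subgroup])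

lemma T_eq: "T = quot PM S"
  by (simp add: tensor_module_def)

definition "\<kappa> z = S +>\<^bsub>PM\<^esub> z"

lemma \<kappa>_closed: "z \<in> carrier PM \<Longrightarrow> \<kappa> z \<in> carrier T"
  unfolding \<kappa>_def T_eq by (rule Q.coset_in_quot)

lemma \<kappa>_cases: "t \<in> carrier T \<Longrightarrow> \<exists>z\<in>carrier PM. t = \<kappa> z"
  unfolding \<kappa>_def T_eq by (erule Q.quot_cases) blast

lemma \<kappa>_eq: "y \<in> carrier PM \<Longrightarrow> z \<in> carrier PM \<Longrightarrow> \<kappa> y = \<kappa> z \<longleftrightarrow> y - z \<in> S"
  unfolding \<kappa>_def by (subst Q.coset_eq_iff) (auto simp: PM.minus_eq PM_minus PM_simps(2))

lemma \<kappa>_add: "y \<in> carrier PM \<Longrightarrow> z \<in> carrier PM \<Longrightarrow> \<kappa> y \<oplus>\<^bsub>T\<^esub> \<kappa> z = \<kappa> (y + z)"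
  unfolding \<kappa>_def T_eq by (simp add: Q.quot_add PM_simps(2))

lemma \<kappa>_zero: "\<zero>\<^bsub>T\<^esub> = \<kappa> 0"
  unfolding \<kappa>_def T_eq using Q.quot_zero by (simp add: PM_simps(3))

lemma R_memb:
  assumes "x \<in> carrier A"
  shows "y \<in> carrier A \<Longrightarrow> frag_of (x \<oplus>\<^bsub>A\<^esub> y, v) - frag_of (x, v) - frag_of (y, v) \<in> R"
    "frag_of (x, v \<oplus>\<^bsub>V\<^esub> w) - frag_of (x, v) - frag_of (x, w) \<in> R"
    "b \<in> carrier B \<Longrightarrow> frag_of (x \<otimes>\<^bsub>A\<^esub> \<phi> b, v) - frag_of (x, b \<odot>\<^bsub>V\<^esub> v) \<in> R"
proof -
  have V: "v \<in> carrier V" for v by (simp add: V_simps)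
  show "frag_of (x \<oplus>\<^bsub>A\<^esub> y, v) - frag_of (x, v) - frag_of (y, v) \<in> R" if "y \<in> carrier A"
    unfolding tensor_relations_def
    by (rule UnI1, rule UnI1, intro CollectI exI conjI, rule refl, rule assms, rule that, rule V)
  show "frag_of (x, v \<oplus>\<^bsub>V\<^esub> w) - frag_of (x, v) - frag_of (x, w) \<in> R"
    unfolding tensor_relations_def
    by (rule UnI1, rule UnI2, intro CollectI exI conjI, rule refl, rule assms, rule V, rule V)
  show "frag_of (x \<otimes>\<^bsub>A\<^esub> \<phi> b, v) - frag_of (x, b \<odot>\<^bsub>V\<^esub> v) \<in> R" if "b \<in> carrier B"
    unfolding tensor_relations_def
    by (rule UnI2, intro CollectI exI conjI, rule refl, rule assms, rule that, rule V)
qed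

lemma R_act: assumes a: "a \<in> carrier A" and z: "z \<in> R" shows "a \<odot>\<^bsub>PM\<^esub> z \<in> R"
  using z[unfolded tensor_relations_def]
proof (elim UnE CollectE exE conjE, goal_cases)
  case (1 x y v)
  have "a \<odot>\<^bsub>PM\<^esub> z = frag_of (a \<otimes>\<^bsub>A\<^esub> x \<oplus>\<^bsub>A\<^esub> a \<otimes>\<^bsub>A\<^esub> y, v) - frag_of (a \<otimes>\<^bsub>A\<^esub> x, v) - frag_of (a \<otimes>\<^bsub>A\<^esub> y, v)"
    using 1 a by (simp add: PM_act_diff L.A.r_distr)
  then show ?case using R_memb(1)[of "a \<otimes>\<^bsub>A\<^esub> x" "a \<otimes>\<^bsub>A\<^esub> y" v] 1 a by simp
next
  case (2 x v w)
  have "a \<odot>\<^bsub>PM\<^esub> z = frag_of (a \<otimes>\<^bsub>A\<^esub> x, v \<oplus>\<^bsub>V\<^esub> w) - frag_of (a \<otimes>\<^bsub>A\<^esub> x, v) - frag_of (a \<otimes>\<^bsub>A\<^esub> x, w)"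
    using 2 a by (simp add: PM_act_diff)
  then show ?case using R_memb(2)[of "a \<otimes>\<^bsub>A\<^esub> x" v w] 2 a by simp
next
  case (3 x b v)
  have "a \<odot>\<^bsub>PM\<^esub> z = frag_of ((a \<otimes>\<^bsub>A\<^esub> x) \<otimes>\<^bsub>A\<^esub> \<phi> b, v) - frag_of (a \<otimes>\<^bsub>A\<^esub> x, b \<odot>\<^bsub>V\<^esub> v)"
    using 3 a by (simp add: PM_act_diff L.A.m_assoc incl_closed)
  then show ?case using R_memb(3)[of "a \<otimes>\<^bsub>A\<^esub> x" b v] 3 a by simp
qed

lemma S_act: assumes a: "a \<in> carrier A" and z: "z \<in> S" shows "a \<odot>\<^bsub>PM\<^esub> z \<in> S"
  using z
proof induction
  case one
  have "a \<odot>\<^bsub>PM\<^esub> 0 = 0" by (simp add: PM_simps(4))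
  then show ?case using generate.one[of "add_monoid PM" R] by (simp add: PM_simps(3))
next
  case (incl h)
  then show ?case by (intro generate.incl R_act a)
next
  case (inv h)
  have h: "h \<in> carrier PM" using inv R_subset by blast
  have "a \<odot>\<^bsub>PM\<^esub> (- h) = - (a \<odot>\<^bsub>PM\<^esub> h)" by (simp add: PM_simps(4) frag_extend_minus)
  then have "a \<odot>\<^bsub>PM\<^esub> (inv\<^bsub>add_monoid PM\<^esub> h) = inv\<^bsub>add_monoid PM\<^esub> (a \<odot>\<^bsub>PM\<^esub> h)"
    using h PM_act_closed[OF a h] by (simp add: PM_minus flip: a_inv_def)
  then show ?case using R_act[OF a inv] generate.inv by metis
next
  case (eng h1 h2)
  have "h1 \<otimes>\<^bsub>add_monoid PM\<^esub> h2 = h1 + h2"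
    "(a \<odot>\<^bsub>PM\<^esub> h1) \<otimes>\<^bsub>add_monoid PM\<^esub> (a \<odot>\<^bsub>PM\<^esub> h2) = a \<odot>\<^bsub>PM\<^esub> h1 + a \<odot>\<^bsub>PM\<^esub> h2"
    by (simp_all add: PM_simps(2))
  then show ?case using generate.eng[OF eng.IH] PM_act_add by metis
qed

lemma \<kappa>_act: "a \<in> carrier A \<Longrightarrow> z \<in> carrier PM \<Longrightarrow> a \<odot>\<^bsub>T\<^esub> \<kappa> z = \<kappa> (a \<odot>\<^bsub>PM\<^esub> z)"
  unfolding \<kappa>_def T_eq
  by (rule Q.quot_smult) (auto simp: S_act PM_act_closed PM_simps(2) PM_act_add)

lemma \<kappa>_rel:
  "x \<in> carrier A \<Longrightarrow> y \<in> carrier A \<Longrightarrow> \<kappa> (frag_of (x \<oplus>\<^bsub>A\<^esub> y, v)) = \<kappa> (frag_of (x, v) + frag_of (y, v))"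
  "x \<in> carrier A \<Longrightarrow> b \<in> carrier B \<Longrightarrow> \<kappa> (frag_of (x \<otimes>\<^bsub>A\<^esub> \<phi> b, v)) = \<kappa> (frag_of (x, b \<odot>\<^bsub>V\<^esub> v))"
proof -
  assume x: "x \<in> carrier A"
  { assume y: "y \<in> carrier A"
    have "frag_of (x \<oplus>\<^bsub>A\<^esub> y, v) - frag_of (x, v) - frag_of (y, v) \<in> S"
      by (intro generate.incl R_memb x y)
    then show "\<kappa> (frag_of (x \<oplus>\<^bsub>A\<^esub> y, v)) = \<kappa> (frag_of (x, v) + frag_of (y, v))"
      using x y by (subst \<kappa>_eq) (auto simp: PM_of PM_add algebra_simps) }
  assume b: "b \<in> carrier B"
  have "frag_of (x \<otimes>\<^bsub>A\<^esub> \<phi> b, v) - frag_of (x, b \<odot>\<^bsub>V\<^esub> v) \<in> S"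
    by (intro generate.incl R_memb x b)
  then show "\<kappa> (frag_of (x \<otimes>\<^bsub>A\<^esub> \<phi> b, v)) = \<kappa> (frag_of (x, b \<odot>\<^bsub>V\<^esub> v))"
    using x b by (subst \<kappa>_eq) (auto simp: PM_of incl_closed)
qed

lemma \<kappa>_add_act:
  assumes a: "a \<in> carrier A" "b \<in> carrier A" and z: "z \<in> carrier PM"
  shows "\<kappa> ((a \<oplus>\<^bsub>A\<^esub> b) \<odot>\<^bsub>PM\<^esub> z) = \<kappa> (a \<odot>\<^bsub>PM\<^esub> z + b \<odot>\<^bsub>PM\<^esub> z)"
  using z
proof (induction rule: PM_induct)
  case zero show ?case by (simp add: PM_simps(4))
next
  case (of x v)
  then show ?case using a \<kappa>_rel(1)[of "a \<otimes>\<^bsub>A\<^esub> x" "b \<otimes>\<^bsub>A\<^esub> x" v] by (simp add: L.A.l_distr)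
next
  case (diff y z)
  note c = PM_act_closed[OF a(1)] PM_act_closed[OF a(2)] PM_act_closed[OF L.A.a_closed[OF a]] PM_add PM_diff
  let ?d = "\<lambda>u. (a \<oplus>\<^bsub>A\<^esub> b) \<odot>\<^bsub>PM\<^esub> u - (a \<odot>\<^bsub>PM\<^esub> u + b \<odot>\<^bsub>PM\<^esub> u)"
  have "?d y \<in> S" "?d z \<in> S"
    using diff.IH diff.hyps c by (simp_all flip: \<kappa>_eq)
  moreover have "u - v \<in> S" if "u \<in> S" "v \<in> S" for u v
  proof -
    have "u \<in> carrier PM" "v \<in> carrier PM" using that Q.a_subset by auto
    moreover have "u \<oplus>\<^bsub>PM\<^esub> (\<ominus>\<^bsub>PM\<^esub> v) \<in> S" using that by (intro Q.a_closed Q.a_inv_closed)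
    ultimately show ?thesis by (simp add: PM_minus PM_simps(2))
  qed
  ultimately have "?d y - ?d z \<in> S" by blast
  then have "?d (y - z) \<in> S" by (simp add: PM_act_diff algebra_simps)
  then show ?case using diff.hyps c by (subst \<kappa>_eq) auto
qed

lemma PM_mult_act:
  assumes "a \<in> carrier A" "b \<in> carrier A" and z: "z \<in> carrier PM"
  shows "(a \<otimes>\<^bsub>A\<^esub> b) \<odot>\<^bsub>PM\<^esub> z = a \<odot>\<^bsub>PM\<^esub> (b \<odot>\<^bsub>PM\<^esub> z)"
  using z
proof (induction rule: PM_induct)
  case zero show ?case by (simp add: PM_simps(4))
qed (use assms in \<open>auto simp: PM_act_diff L.A.m_assoc\<close>)

lemma PM_one_act: "z \<in> carrier PM \<Longrightarrow> \<one>\<^bsub>A\<^esub> \<odot>\<^bsub>PM\<^esub> z = z"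
proof (induction rule: PM_induct)
  case zero show ?case by (simp add: PM_simps(4))
qed (auto simp: PM_act_diff)

lemma T_abelian_group: "abelian_group T"
  unfolding T_eq by (rule Q.quot_abelian_group)

lemma T_left_module: "left_module A T"
proof -
  have "left_module_axioms A T"
  proof
    fix a x assume a: "a \<in> carrier A" and x: "x \<in> carrier T"
    obtain z where z: "z \<in> carrier PM" "x = \<kappa> z" using \<kappa>_cases[OF x] by blast
    note c = PM_act_closed[OF a]
    show "a \<odot>\<^bsub>T\<^esub> x \<in> carrier T" using z c a by (simp add: \<kappa>_act \<kappa>_closed)
    { fix y assume y: "y \<in> carrier T"
      obtain z' where z': "z' \<in> carrier PM" "y = \<kappa> z'" using \<kappa>_cases[OF y] by blast
      show "a \<odot>\<^bsub>T\<^esub> (x \<oplus>\<^bsub>T\<^esub> y) = a \<odot>\<^bsub>T\<^esub> x \<oplus>\<^bsub>T\<^esub> a \<odot>\<^bsub>T\<^esub> y"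
        using z z' a c by (simp add: \<kappa>_add \<kappa>_act PM_add PM_act_add) }
    fix b assume b: "b \<in> carrier A"
    show "(a \<oplus>\<^bsub>A\<^esub> b) \<odot>\<^bsub>T\<^esub> x = a \<odot>\<^bsub>T\<^esub> x \<oplus>\<^bsub>T\<^esub> b \<odot>\<^bsub>T\<^esub> x"
      using z a b by (simp add: \<kappa>_act \<kappa>_add \<kappa>_add_act PM_act_closed)
    show "(a \<otimes>\<^bsub>A\<^esub> b) \<odot>\<^bsub>T\<^esub> x = a \<odot>\<^bsub>T\<^esub> (b \<odot>\<^bsub>T\<^esub> x)"
      using z a b by (simp add: \<kappa>_act PM_mult_act PM_act_closed)
  next
    fix x assume x: "x \<in> carrier T"
    obtain z where z: "z \<in> carrier PM" "x = \<kappa> z" using \<kappa>_cases[OF x] by blast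
    show "\<one>\<^bsub>A\<^esub> \<odot>\<^bsub>T\<^esub> x = x" using z by (simp add: \<kappa>_act PM_one_act)
  qed
  then show ?thesis by (simp add: left_module_def L.A.algebra_over_axioms T_abelian_group)
qed

sublocale T: left_module A T by (rule T_left_module)

definition "w = \<kappa> (frag_of (\<one>\<^bsub>A\<^esub>, 1))"

lemma w_in [simp]: "w \<in> carrier T"
  unfolding w_def by (intro \<kappa>_closed PM_of) simp

lemma \<kappa>_of: "x \<in> carrier A \<Longrightarrow> \<kappa> (frag_of (x, v)) = (v \<odot>\<^bsub>A\<^esub> x) \<odot>\<^bsub>T\<^esub> w"
proof -
  assume x: "x \<in> carrier A"
  have b: "v \<odot>\<^bsub>B\<^esub> \<one>\<^bsub>B\<^esub> = H.cls (v \<odot>\<^bsub>H.F\<^esub> \<one>\<^bsub>H.F\<^esub>)"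
    using H.cls_smult[OF H.F.one_closed] H.cls_simps(3) by simp
  have vc: "v \<odot>\<^bsub>H.F\<^esub> \<one>\<^bsub>H.F\<^esub> \<in> carrier H.F" by (intro H.F.smult_closed H.F.one_closed)
  have "\<phi> (v \<odot>\<^bsub>B\<^esub> \<one>\<^bsub>B\<^esub>) = L.cls (v \<odot>\<^bsub>L.F\<^esub> \<one>\<^bsub>L.F\<^esub>)"
    unfolding b by (subst incl_cls[OF vc]) simp
  also have "\<dots> = v \<odot>\<^bsub>A\<^esub> \<one>\<^bsub>A\<^esub>" using L.cls_smult[OF L.F.one_closed] L.cls_simps(3) by simp
  finally have \<phi>v: "\<phi> (v \<odot>\<^bsub>B\<^esub> \<one>\<^bsub>B\<^esub>) = v \<odot>\<^bsub>A\<^esub> \<one>\<^bsub>A\<^esub>" .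
  have vv: "(v \<odot>\<^bsub>B\<^esub> \<one>\<^bsub>B\<^esub>) \<odot>\<^bsub>V\<^esub> 1 = v"
    unfolding b V_act[OF vc] by (simp only: \<theta>F_simps(5)[OF H.F.one_closed] \<theta>F_simps(1) mult_1_right)
  have "\<kappa> (frag_of (x, v)) = \<kappa> (frag_of (x \<otimes>\<^bsub>A\<^esub> (v \<odot>\<^bsub>A\<^esub> \<one>\<^bsub>A\<^esub>), 1))"
    using \<kappa>_rel(2)[OF x, of "v \<odot>\<^bsub>B\<^esub> \<one>\<^bsub>B\<^esub>" 1] unfolding \<phi>v vv by simp
  also have "\<dots> = (v \<odot>\<^bsub>A\<^esub> x) \<odot>\<^bsub>T\<^esub> w"
    using x by (simp add: w_def \<kappa>_act PM_of L.A.smult_assoc3)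
  finally show ?thesis .
qed

lemma w_generates: assumes "t \<in> carrier T" shows "\<exists>a\<in>carrier A. t = a \<odot>\<^bsub>T\<^esub> w"
proof -
  obtain z where z: "z \<in> carrier PM" "t = \<kappa> z" using \<kappa>_cases[OF assms] by blast
  have "\<exists>a\<in>carrier A. \<kappa> z = a \<odot>\<^bsub>T\<^esub> w"
    using z(1)
  proof (induction rule: PM_induct)
    case zero
    then show ?case by (intro bexI[of _ "\<zero>\<^bsub>A\<^esub>"]) (auto simp flip: \<kappa>_zero)
  next
    case (of x v)
    then show ?case by (intro bexI[of _ "v \<odot>\<^bsub>A\<^esub> x"]) (auto simp: \<kappa>_of)
  next
    case (diff y z)
    obtain a b where ab: "a \<in> carrier A" "\<kappa> y = a \<odot>\<^bsub>T\<^esub> w" "b \<in> carrier A" "\<kappa> z = b \<odot>\<^bsub>T\<^esub> w"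
      using diff.IH by blast
    have "\<kappa> (y - z) \<oplus>\<^bsub>T\<^esub> \<kappa> z = \<kappa> y" using diff.hyps by (simp add: \<kappa>_add PM_diff)
    then have "\<kappa> (y - z) = \<kappa> y \<oplus>\<^bsub>T\<^esub> (\<ominus>\<^bsub>T\<^esub> \<kappa> z)"
      using diff.hyps \<kappa>_closed PM_diff by (metis T.M.a_inv_closed T.M.add.m_assoc T.M.r_neg T.M.r_zero)
    then show ?case
      using ab by (intro bexI[of _ "a \<oplus>\<^bsub>A\<^esub> (\<ominus>\<^bsub>A\<^esub> b)"]) (auto simp: T.add_act T.minus_act)
  qed
  then show ?thesis using z by simp
qed

definition "ann_gens = (\<lambda>x. L.ge x \<ominus>\<^bsub>A\<^esub> \<theta> x \<odot>\<^bsub>A\<^esub> \<one>\<^bsub>A\<^esub>) ` H0"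

lemma ge_H0 [simp]: "x \<in> H0 \<Longrightarrow> L.ge x \<in> carrier A" using H0 by auto

lemma ann_gens_subset: "ann_gens \<subseteq> carrier A"
  by (auto simp: ann_gens_def)

lemma ge_w: assumes x: "x \<in> H0" shows "L.ge x \<odot>\<^bsub>T\<^esub> w = (\<theta> x \<odot>\<^bsub>A\<^esub> \<one>\<^bsub>A\<^esub>) \<odot>\<^bsub>T\<^esub> w"
proof -
  have xc: "x \<in> carrier H" using x by simp
  have "L.ge x \<odot>\<^bsub>T\<^esub> w = \<kappa> (frag_of (\<one>\<^bsub>A\<^esub> \<otimes>\<^bsub>A\<^esub> \<phi> (H.ge x), 1))"
  proof -
    have "\<phi> (H.ge x) = L.ge x" by (simp only: H.ge_def incl_cls[OF H.gen_in[OF xc]] L.ge_def)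
    then show ?thesis using x by (simp add: w_def \<kappa>_act PM_of)
  qed
  also have "\<dots> = \<kappa> (frag_of (\<one>\<^bsub>A\<^esub>, H.ge x \<odot>\<^bsub>V\<^esub> 1))"
    by (rule \<kappa>_rel(2)) (use xc in auto)
  also have "\<dots> = \<kappa> (frag_of (\<one>\<^bsub>A\<^esub>, \<theta> x))"
    by (simp add: H.ge_def V_act[OF H.gen_in[OF xc]] \<theta>F_simps(2))
  also have "\<dots> = (\<theta> x \<odot>\<^bsub>A\<^esub> \<one>\<^bsub>A\<^esub>) \<odot>\<^bsub>T\<^esub> w" by (simp add: \<kappa>_of)
  finally show ?thesis .
qed

text \<open>
  Modulo the left ideal, every element of \<open>u(H)\<close> is the scalar by which it acts on \<open>\<theta>\<close>, by induction on
  words.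
\<close>

lemma cls_minus_\<theta>F: "f \<in> carrier H.F \<Longrightarrow> L.cls f \<ominus>\<^bsub>A\<^esub> \<theta>F f \<odot>\<^bsub>A\<^esub> \<one>\<^bsub>A\<^esub> \<in> left_ideal A ann_gens"
proof -
  let ?I = "left_ideal A ann_gens"
  note I = L.A.left_ideal_mult[OF ann_gens_subset] L.A.left_ideal_smult[OF ann_gens_subset]
  have FL: "f \<in> carrier L.F" if "f \<in> carrier H.F" for f using that free_algebra_mono[OF H0] by auto
  show "f \<in> carrier H.F \<Longrightarrow> L.cls f \<ominus>\<^bsub>A\<^esub> \<theta>F f \<odot>\<^bsub>A\<^esub> \<one>\<^bsub>A\<^esub> \<in> ?I"
  proof (induction rule: free_algebra_induct)
    case one
    have "L.cls \<one>\<^bsub>H.F\<^esub> = \<one>\<^bsub>A\<^esub>" using L.cls_simps(3) by simp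
    then have "L.cls \<one>\<^bsub>H.F\<^esub> \<ominus>\<^bsub>A\<^esub> \<theta>F \<one>\<^bsub>H.F\<^esub> \<odot>\<^bsub>A\<^esub> \<one>\<^bsub>A\<^esub> = \<one>\<^bsub>A\<^esub> \<ominus>\<^bsub>A\<^esub> 1 \<odot>\<^bsub>A\<^esub> \<one>\<^bsub>A\<^esub>"
      by (simp only: \<theta>F_simps(1))
    also have "\<dots> = \<zero>\<^bsub>A\<^esub>" by (simp add: L.A.minus_eq L.A.r_neg)
    finally show ?case using left_ideal.zero[of A ann_gens] by metis
  next
    case (gen x f)
    have x: "x \<in> H0" and xH: "x \<in> carrier H" and xL: "x \<in> carrier L" using gen H0 by auto
    have e1: "L.cls (gen x \<otimes>\<^bsub>H.F\<^esub> f) = L.ge x \<otimes>\<^bsub>A\<^esub> L.cls f"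
      using L.cls_simps(2)[OF L.gen_in[OF xL] FL[OF gen.hyps(2)]] by (simp add: L.ge_def)
    have e2: "\<theta>F (gen x \<otimes>\<^bsub>H.F\<^esub> f) = \<theta> x * \<theta>F f"
      by (simp only: \<theta>F_simps(4)[OF H.gen_in[OF xH] gen.hyps(2)] \<theta>F_simps(2))
    let ?c = "L.cls f" and ?t = "\<theta>F f"
    have c: "?c \<in> carrier A" "L.ge x \<in> carrier A" using FL[OF gen.hyps(2)] x by auto
    have "L.ge x \<otimes>\<^bsub>A\<^esub> (?c \<ominus>\<^bsub>A\<^esub> ?t \<odot>\<^bsub>A\<^esub> \<one>\<^bsub>A\<^esub>) \<in> ?I" by (rule I(1)[OF gen.IH c(2)])
    moreover have "?t \<odot>\<^bsub>A\<^esub> (L.ge x \<ominus>\<^bsub>A\<^esub> \<theta> x \<odot>\<^bsub>A\<^esub> \<one>\<^bsub>A\<^esub>) \<in> ?I"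
      by (intro I(2) L.A.left_ideal_gen[OF ann_gens_subset]) (use x in \<open>auto simp: ann_gens_def\<close>)
    ultimately have "L.ge x \<otimes>\<^bsub>A\<^esub> (?c \<ominus>\<^bsub>A\<^esub> ?t \<odot>\<^bsub>A\<^esub> \<one>\<^bsub>A\<^esub>) \<oplus>\<^bsub>A\<^esub> ?t \<odot>\<^bsub>A\<^esub> (L.ge x \<ominus>\<^bsub>A\<^esub> \<theta> x \<odot>\<^bsub>A\<^esub> \<one>\<^bsub>A\<^esub>) \<in> ?I"
      by (rule left_ideal.add)
    also have "L.ge x \<otimes>\<^bsub>A\<^esub> (?c \<ominus>\<^bsub>A\<^esub> ?t \<odot>\<^bsub>A\<^esub> \<one>\<^bsub>A\<^esub>) \<oplus>\<^bsub>A\<^esub> ?t \<odot>\<^bsub>A\<^esub> (L.ge x \<ominus>\<^bsub>A\<^esub> \<theta> x \<odot>\<^bsub>A\<^esub> \<one>\<^bsub>A\<^esub>)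
        = L.ge x \<otimes>\<^bsub>A\<^esub> ?c \<ominus>\<^bsub>A\<^esub> (\<theta> x * ?t) \<odot>\<^bsub>A\<^esub> \<one>\<^bsub>A\<^esub>"
    proof -
      have 1: "L.ge x \<otimes>\<^bsub>A\<^esub> (?c \<ominus>\<^bsub>A\<^esub> ?t \<odot>\<^bsub>A\<^esub> \<one>\<^bsub>A\<^esub>) = L.ge x \<otimes>\<^bsub>A\<^esub> ?c \<ominus>\<^bsub>A\<^esub> ?t \<odot>\<^bsub>A\<^esub> L.ge x"
        using c by (simp add: L.A.minus_eq L.A.r_distr L.A.r_minus L.A.smult_assoc3)
      have 2: "?t \<odot>\<^bsub>A\<^esub> (L.ge x \<ominus>\<^bsub>A\<^esub> \<theta> x \<odot>\<^bsub>A\<^esub> \<one>\<^bsub>A\<^esub>) = ?t \<odot>\<^bsub>A\<^esub> L.ge x \<ominus>\<^bsub>A\<^esub> (\<theta> x * ?t) \<odot>\<^bsub>A\<^esub> \<one>\<^bsub>A\<^esub>"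
      proof -
        have "?t \<odot>\<^bsub>A\<^esub> (\<ominus>\<^bsub>A\<^esub> (\<theta> x \<odot>\<^bsub>A\<^esub> \<one>\<^bsub>A\<^esub>)) = \<ominus>\<^bsub>A\<^esub> ((\<theta> x * ?t) \<odot>\<^bsub>A\<^esub> \<one>\<^bsub>A\<^esub>)"
          by (simp flip: L.A.smult_minus_one L.A.smult_assoc1 add: mult.commute)
        then show ?thesis using c by (simp add: L.A.minus_eq L.A.smult_r_distr)
      qed
      show ?thesis unfolding 1 2
        using L.A.m_closed[OF c(2,1)] L.A.smult_closed[OF c(2), of ?t] L.A.smult_closed[OF L.A.one_closed, of "\<theta> x * ?t"]
        by (simp add: L.A.minus_eq L.A.a_assoc) (simp add: L.A.r_neg1 L.A.l_neg flip: L.A.a_assoc)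
    qed
    finally show ?case unfolding e1 e2 .
  next
    case (add f g)
    have e: "L.cls (f \<oplus>\<^bsub>H.F\<^esub> g) = L.cls f \<oplus>\<^bsub>A\<^esub> L.cls g"
      using L.cls_simps(1)[OF FL FL, OF add.hyps] by simp
    have c: "L.cls f \<in> carrier A" "L.cls g \<in> carrier A" using FL add.hyps by auto
    have "L.cls (f \<oplus>\<^bsub>H.F\<^esub> g) \<ominus>\<^bsub>A\<^esub> \<theta>F (f \<oplus>\<^bsub>H.F\<^esub> g) \<odot>\<^bsub>A\<^esub> \<one>\<^bsub>A\<^esub>
      = (L.cls f \<ominus>\<^bsub>A\<^esub> \<theta>F f \<odot>\<^bsub>A\<^esub> \<one>\<^bsub>A\<^esub>) \<oplus>\<^bsub>A\<^esub> (L.cls g \<ominus>\<^bsub>A\<^esub> \<theta>F g \<odot>\<^bsub>A\<^esub> \<one>\<^bsub>A\<^esub>)"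
      unfolding e \<theta>F_simps(3)[OF add.hyps] using c
      by (simp add: L.A.minus_eq L.A.smult_l_distr L.A.minus_add L.A.a_ac)
    then show ?case using left_ideal.add[OF add.IH] by metis
  next
    case (smult c f)
    have e: "L.cls (c \<odot>\<^bsub>H.F\<^esub> f) = c \<odot>\<^bsub>A\<^esub> L.cls f"
      using L.cls_smult[OF FL[OF smult.hyps], of c] by simp
    have cc: "L.cls f \<in> carrier A" using FL smult.hyps by auto
    have "L.cls (c \<odot>\<^bsub>H.F\<^esub> f) \<ominus>\<^bsub>A\<^esub> \<theta>F (c \<odot>\<^bsub>H.F\<^esub> f) \<odot>\<^bsub>A\<^esub> \<one>\<^bsub>A\<^esub> = c \<odot>\<^bsub>A\<^esub> (L.cls f \<ominus>\<^bsub>A\<^esub> \<theta>F f \<odot>\<^bsub>A\<^esub> \<one>\<^bsub>A\<^esub>)"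
    proof -
      have "c \<odot>\<^bsub>A\<^esub> (\<ominus>\<^bsub>A\<^esub> (\<theta>F f \<odot>\<^bsub>A\<^esub> \<one>\<^bsub>A\<^esub>)) = \<ominus>\<^bsub>A\<^esub> ((c * \<theta>F f) \<odot>\<^bsub>A\<^esub> \<one>\<^bsub>A\<^esub>)"
        by (simp flip: L.A.smult_minus_one L.A.smult_assoc1 add: mult.commute mult.left_commute)
      then show ?thesis
        unfolding e \<theta>F_simps(5)[OF smult.hyps] using cc by (simp add: L.A.minus_eq L.A.smult_r_distr)
    qed
    then show ?case using I(2)[OF smult.IH, of c] by metis
  qed
qed

text \<open>
  The map \<open>a \<otimes> v \<mapsto> v a\<close> from \<open>T\<close> to the quotient of \<open>A\<close> by the left ideal is well defined by the
  previous lemma; so \<open>a (1 \<otimes> 1) = 0\<close> puts \<open>a\<close> into the left ideal.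
\<close>

theorem annihilator_w:
  assumes a: "a \<in> carrier A"
  shows "a \<odot>\<^bsub>T\<^esub> w = \<zero>\<^bsub>T\<^esub> \<longleftrightarrow> a \<in> left_ideal A ann_gens"
proof
  assume "a \<in> left_ideal A ann_gens"
  then have "a \<in> carrier A \<and> a \<odot>\<^bsub>T\<^esub> w = \<zero>\<^bsub>T\<^esub>"
  proof induction
    case (mult b g)
    obtain x where x: "x \<in> H0" "g = L.ge x \<ominus>\<^bsub>A\<^esub> \<theta> x \<odot>\<^bsub>A\<^esub> \<one>\<^bsub>A\<^esub>" using mult by (auto simp: ann_gens_def)
    have "g \<odot>\<^bsub>T\<^esub> w = \<zero>\<^bsub>T\<^esub>"
      using x(1) ge_w[OF x(1)] by (simp add: x(2) L.A.minus_eq T.add_act T.minus_act T.M.r_neg)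
    then show ?case using mult ann_gens_subset by (auto simp: T.mult_act)
  qed (auto simp: T.add_act)
  then show "a \<odot>\<^bsub>T\<^esub> w = \<zero>\<^bsub>T\<^esub>" ..
next
  let ?I = "left_ideal A ann_gens"
  note I = L.A.left_ideal_mult[OF ann_gens_subset] L.A.left_ideal_smult[OF ann_gens_subset]
    L.A.left_ideal_minus[OF ann_gens_subset]
  assume "a \<odot>\<^bsub>T\<^esub> w = \<zero>\<^bsub>T\<^esub>"
  then have "\<kappa> (frag_of (a, 1)) = \<kappa> 0" using a by (simp add: \<kappa>_of \<kappa>_zero)
  then have aS: "frag_of (a, 1) \<in> S" using a by (subst (asm) \<kappa>_eq) (auto simp: PM_of PM_simps(1))
  have img: "(\<lambda>x. snd x \<odot>\<^bsub>A\<^esub> fst x) ` (carrier A \<times> UNIV) \<subseteq> carrier (add_monoid A)" by auto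
  obtain h where h: "h \<in> hom (free_Abelian_group (carrier A \<times> (UNIV :: 'k set))) (add_monoid A)"
    "\<And>x. x \<in> carrier A \<times> UNIV \<Longrightarrow> h (frag_of x) = snd x \<odot>\<^bsub>A\<^esub> fst x"
    by (rule comm_group.free_Abelian_group_universal[OF L.A.a_comm_group img]) blast
  have hc: "h z \<in> carrier A" and hadd: "y \<in> carrier PM \<Longrightarrow> h (z + y) = h z \<oplus>\<^bsub>A\<^esub> h y" if "z \<in> carrier PM" for y z
    using h(1) that by (auto simp: hom_def PM_simps(1))
  have hof: "h (frag_of (x, v)) = v \<odot>\<^bsub>A\<^esub> x" if "x \<in> carrier A" for x v using h(2) that by auto
  have hdiff: "h (y - z) = h y \<ominus>\<^bsub>A\<^esub> h z" if "y \<in> carrier PM" "z \<in> carrier PM" for y z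
  proof -
    have "h (y - z) \<oplus>\<^bsub>A\<^esub> h z = h y" using hadd[OF PM_diff[OF that] that(2)] by simp
    then show ?thesis
      using hc that PM_diff[OF that]
      by (metis L.A.a_inv_closed L.A.add.m_assoc L.A.minus_eq L.A.r_neg L.A.r_zero)
  qed
  define K where "K = {z \<in> carrier PM. h z \<in> ?I}"
  have h0: "h 0 = \<zero>\<^bsub>A\<^esub>" using hadd[of 0 0] hc[of 0] by (simp add: PM_simps(1))
  have "subgroup K (add_monoid PM)"
  proof (rule PM.add.subgroupI)
    show "K \<noteq> {}" using h0 left_ideal.zero[of A] by (auto simp: K_def PM_simps(1) intro!: exI[of _ 0])
    fix y assume y: "y \<in> K"
    have "h (0 - y) \<in> ?I" using y h0 I(3)[OF left_ideal.zero] by (subst hdiff) (auto simp: K_def PM_simps(1))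
    then show "\<ominus>\<^bsub>PM\<^esub> y \<in> K" using y by (auto simp: K_def PM_minus PM_neg)
    fix z assume z: "z \<in> K"
    show "y \<oplus>\<^bsub>PM\<^esub> z \<in> K" using y z left_ideal.add by (auto simp: K_def PM_simps(2) hadd PM_add)
  qed (auto simp: K_def)
  moreover have "R \<subseteq> K"
  proof
    fix z assume "z \<in> R"
    then have "h z \<in> ?I"
      unfolding tensor_relations_def
    proof (elim UnE CollectE exE conjE, goal_cases)
      case (1 x y v)
      have "h z = \<zero>\<^bsub>A\<^esub>"
        using 1 by (simp add: hdiff hof PM_of PM_diff L.A.smult_r_distr)
          (simp add: L.A.minus_minus_zero_iff)
      then show ?case by (simp add: left_ideal.zero)
    next
      case (2 x v w)
      have "h z = \<zero>\<^bsub>A\<^esub>"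
        using 2 by (simp add: hdiff hof PM_of PM_diff V_simps L.A.smult_l_distr)
          (simp add: L.A.minus_minus_zero_iff)
      then show ?case by (simp add: left_ideal.zero)
    next
      case (3 x b v)
      obtain f where f: "f \<in> carrier H.F" "b = H.cls f" using H.cls_surj[OF 3(3)] by blast
      have \<phi>b: "\<phi> b = L.cls f" "b \<odot>\<^bsub>V\<^esub> v = \<theta>F f * v" using f by (simp_all add: incl_cls V_act)
      have Lf: "L.cls f \<in> carrier A" using incl_closed[OF 3(3)] \<phi>b by simp
      have "h z = v \<odot>\<^bsub>A\<^esub> (x \<otimes>\<^bsub>A\<^esub> L.cls f) \<ominus>\<^bsub>A\<^esub> (\<theta>F f * v) \<odot>\<^bsub>A\<^esub> x"
        using 3 Lf by (simp add: hdiff hof PM_of \<phi>b)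
      also have "\<dots> = (v \<odot>\<^bsub>A\<^esub> x) \<otimes>\<^bsub>A\<^esub> (L.cls f \<ominus>\<^bsub>A\<^esub> \<theta>F f \<odot>\<^bsub>A\<^esub> \<one>\<^bsub>A\<^esub>)"
        using 3 Lf by (simp add: L.A.minus_eq L.A.r_distr L.A.r_minus L.A.smult_assoc2 L.A.smult_assoc3
            flip: L.A.smult_assoc1) 
      also have "\<dots> \<in> ?I" using 3 by (intro I(1) cls_minus_\<theta>F f) auto
      finally show ?case .
    qed
    then show "z \<in> K" using \<open>z \<in> R\<close> R_subset by (auto simp: K_def)
  qed
  ultimately have "S \<subseteq> K" by (intro PM.add.generate_subgroup_incl)
  then have "h (frag_of (a, 1)) \<in> ?I" using aS by (auto simp: K_def)
  then show "a \<in> ?I" using a by (simp add: hof)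
qed

end

section \<open>The linear system for the weights of a cocycle\<close>

definition falling :: "'k::field \<Rightarrow> nat \<Rightarrow> 'k" where
  "falling a i = (\<Prod>k<i. a - of_nat k)"

text \<open>
  The coefficient of \<open>e\<^sub>i 1\<^sub>a\<close> in \<open>L(lam)\<close>, without the power of \<open>\<chi>(e\<^sub>-\<^sub>1)\<close>. It comes from moving \<open>e\<^sub>i\<close> to the
  right in \<open>e\<^sub>i e\<^sub>-\<^sub>1\<^sup>a w\<close>, where \<open>w\<close> is the generator of \<open>L(lam)\<close>.
\<close>

definition wt :: "'k::field \<Rightarrow> nat \<Rightarrow> 'k \<Rightarrow> 'k" where
  "wt lam i a = (-1) ^ i * falling a i * ((of_nat i + 1) * lam - a + of_nat i)"

lemma falling_0 [simp]: "falling a 0 = 1" by (simp add: falling_def)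
lemma falling_Suc: "falling a (Suc i) = falling a i * (a - of_nat i)" by (simp add: falling_def)

lemma falling_add: "falling a (i + j) = falling a j * falling (a - of_nat j) i"
  by (induction i) (simp_all add: falling_Suc algebra_simps)

lemma falling_Suc_left: "falling a (Suc i) = a * falling (a - 1) i"
  using falling_add[of a i 1] by (simp add: falling_Suc)

lemma falling_shift: "falling (a + 1) (Suc i) - falling a (Suc i) = of_nat (Suc i) * falling a i"
  using falling_Suc_left[of "a + 1" i] by (simp add: falling_Suc algebra_simps)

lemma falling_of_nat_zero: "n < i \<Longrightarrow> falling (of_nat n) i = 0"
  unfolding falling_def by (rule prod_zero) auto

lemma falling_minus_fact:
  "(-1) ^ i * falling (- of_nat (Suc j)) i * of_nat (fact j) = (of_nat (fact (i + j)) :: 'k::field)"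
proof (induction i)
  case (Suc i)
  have "(-1) ^ Suc i * falling (- of_nat (Suc j)) (Suc i) * of_nat (fact j)
      = ((-1) ^ i * falling (- of_nat (Suc j)) i * of_nat (fact j)) * (of_nat (Suc (i + j)) :: 'k)"
    by (simp add: falling_Suc algebra_simps)
  also have "\<dots> = of_nat (fact (Suc i + j))"
    unfolding Suc.IH by (simp del: of_nat_Suc flip: of_nat_mult add: mult.commute)
  finally show ?case .
qed simp

lemma wt_0 [simp]: "wt lam 0 a = lam - a" by (simp add: wt_def)

lemma wt_of_nat_zero: "n < i \<Longrightarrow> wt lam i (of_nat n) = 0"
  by (simp add: wt_def falling_of_nat_zero)

text \<open>This is the bracket relation \<open>[e\<^sub>i, e\<^sub>j] = (j - i) e\<^sub>i\<^sub>+\<^sub>j\<close> on \<open>1\<^sub>a\<close>.\<close>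

lemma wt_bracket:
  "wt lam j a * wt lam i (a - of_nat j) - wt lam i a * wt lam j (a - of_nat i)
    = (of_nat j - of_nat i) * wt lam (i + j) a"
proof -
  have 1: "falling a (i + j) = falling a j * falling (a - of_nat j) i" by (rule falling_add)
  have 2: "falling a (i + j) = falling a i * falling (a - of_nat i) j" using falling_add[of a j i] by (simp add: add.commute)
  have e1: "wt lam j a * wt lam i (a - of_nat j) = (-1) ^ (i + j) * falling a (i + j) *
      (((of_nat j + 1) * lam - a + of_nat j) * ((of_nat i + 1) * lam - a + of_nat j + of_nat i))"
    unfolding 1 by (simp add: wt_def power_add algebra_simps)
  have e2: "wt lam i a * wt lam j (a - of_nat i) = (-1) ^ (i + j) * falling a (i + j) *
      (((of_nat i + 1) * lam - a + of_nat i) * ((of_nat j + 1) * lam - a + of_nat j + of_nat i))"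
    unfolding 2 by (simp add: wt_def power_add algebra_simps)
  have e3: "((of_nat j + 1) * lam - a + of_nat j) * ((of_nat i + 1) * lam - a + of_nat j + of_nat i)
      - ((of_nat i + 1) * lam - a + of_nat i) * ((of_nat j + 1) * lam - a + of_nat j + of_nat i)
      = (of_nat j - of_nat i) * ((of_nat (i + j) + 1) * lam - a + of_nat (i + j))"
    by (simp add: algebra_simps)
  show ?thesis unfolding e1 e2 right_diff_distrib[symmetric] e3 by (simp add: wt_def)
qed

locale witt_char =
  fixes p :: nat and k_type :: "'k::field itself"
  assumes CHAR_p: "CHAR('k) = p" and p5: "5 \<le> p"
begin

lemma prime_p: "prime p"
  using prime_CHAR_semidom[where 'a = 'k] CHAR_p p5 by simp

lemma of_nat_zero_iff: "(of_nat n :: 'k) = 0 \<longleftrightarrow> p dvd n"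
  using of_nat_eq_0_iff_char_dvd[where 'a = 'k] CHAR_p by simp

lemma of_nat_p [simp]: "(of_nat p :: 'k) = 0" by (simp add: of_nat_zero_iff)

lemma of_nat_nonzero: "0 < n \<Longrightarrow> n < p \<Longrightarrow> (of_nat n :: 'k) \<noteq> 0"
  using of_nat_zero_iff nat_dvd_not_less by blast

lemma numeral_zero_iff: "(numeral n :: 'k) = 0 \<longleftrightarrow> p dvd numeral n"
  using of_nat_zero_iff[of "numeral n"] by simp

lemma of_nat_inj: "i < p \<Longrightarrow> j < p \<Longrightarrow> (of_nat i :: 'k) = of_nat j \<Longrightarrow> i = j"
proof (induction i j rule: linorder_wlog)
  case (le i j)
  then have "(of_nat (j - i) :: 'k) = 0" by (simp add: of_nat_diff)
  then show ?case using le of_nat_nonzero[of "j - i"] by force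
qed auto

lemma nat_diff_nonzero: "i < j \<Longrightarrow> j < p \<Longrightarrow> (of_nat j - of_nat i :: 'k) \<noteq> 0"
  using of_nat_inj[of i j] by auto

definition "prime_field = (range of_int :: 'k set)"

lemma prime_field_cases:
  assumes "a \<in> prime_field" obtains n where "n < p" "a = of_nat n"
proof -
  obtain z where z: "a = of_int z" using assms by (auto simp: prime_field_def)
  have "int p > 0" using p5 by simp
  have "(of_int z :: 'k) = of_int (z mod int p)"
    using of_int_eq_iff_cong_CHAR[where 'a = 'k, of z "z mod int p"] CHAR_p by (simp add: cong_def)
  also have "\<dots> = of_nat (nat (z mod int p))"
    using \<open>int p > 0\<close> by (metis of_int_of_nat_eq nat_0_le pos_mod_sign)
  finally have "a = of_nat (nat (z mod int p))" using z by simp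
  moreover have "nat (z mod int p) < p" using \<open>int p > 0\<close> by (simp add: nat_less_iff)
  ultimately show thesis using that by blast
qed

lemma prime_field_closed:
  "of_int z \<in> prime_field" "of_nat n \<in> prime_field" "0 \<in> prime_field" "1 \<in> prime_field"
  "a \<in> prime_field \<Longrightarrow> b \<in> prime_field \<Longrightarrow> a + b \<in> prime_field"
  "a \<in> prime_field \<Longrightarrow> b \<in> prime_field \<Longrightarrow> a - b \<in> prime_field"
proof -
  show "of_int z \<in> prime_field" for z by (simp add: prime_field_def)
  from this[of "int n"] this[of 0] this[of 1]
  show "of_nat n \<in> prime_field" "0 \<in> prime_field" "1 \<in> prime_field" by simp_all
  assume "a \<in> prime_field" "b \<in> prime_field"
  then obtain y z where "a = of_int y" "b = of_int z" unfolding prime_field_def by blast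
  then have "a + b = of_int (y + z)" "a - b = of_int (y - z)" by simp_all
  then show "a + b \<in> prime_field" "a - b \<in> prime_field" unfolding prime_field_def by blast+
qed

lemma falling_ge_p: assumes "a \<in> prime_field" "p \<le> i" shows "falling a i = 0"
proof -
  obtain n where "n < p" "a = of_nat n" using assms(1) by (rule prime_field_cases)
  then show ?thesis using falling_of_nat_zero[of n i] assms(2) by simp
qed

text \<open>
  The weights of \<open>e\<^sub>p\<^sub>-\<^sub>1, e\<^sub>p, \<dots>\<close> vanish on the prime field, so that the bracket relations also hold where
  the Witt algebra is cut off. For \<open>i \<ge> p\<close> the falling factorial vanishes; for \<open>i = p - 1\<close> the linear factor is
  \<open>-(a + 1)\<close> and completes it to a falling factorial of length \<open>p\<close>.
\<close>

lemma wt_ge: assumes a: "a \<in> prime_field" and i: "p - 1 \<le> i" shows "wt lam i a = 0"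
proof (cases "i = p - 1")
  case True
  have "of_nat i = (-1 :: 'k)" using True p5 by (simp add: of_nat_diff)
  have "falling (a + 1) (Suc i) = 0"
    using a True by (intro falling_ge_p prime_field_closed) auto
  then have 0: "(a + 1) * falling a i = 0" by (simp add: falling_Suc_left)
  have "wt lam i a = (-1) ^ i * falling a i * ((-1 + 1) * lam - a + -1)"
    using \<open>of_nat i = -1\<close> by (simp add: wt_def)
  also have "\<dots> = - ((-1) ^ i * ((a + 1) * falling a i))" by (simp add: algebra_simps)
  finally have "wt lam i a = - ((-1) ^ i * ((a + 1) * falling a i))" .
  then show ?thesis using 0 by simp
next
  case False
  then show ?thesis using a i by (simp add: wt_def falling_ge_p)
qed

text \<open>
  The relations that a homomorphism \<open>e\<^sub>0 - m \<mapsto> 0\<close>, \<open>e\<^sub>i \<mapsto> d i 1\<^sub>\<delta>\<^sub>-\<^sub>i\<close> satisfies because of the brackets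
  \<open>[e\<^sub>i, e\<^sub>j]\<close>; \<open>lam = l\<close>, \<open>de = \<delta> = l - m\<close>, and powers of \<open>\<chi>(e\<^sub>-\<^sub>1)\<close> are left out. Values of \<open>d\<close> outside \<open>{1..p-2}\<close> are set to \<open>0\<close>, as \<open>e\<^sub>p\<^sub>-\<^sub>1 = 0\<close>.
\<close>

definition sol :: "'k \<Rightarrow> 'k \<Rightarrow> (nat \<Rightarrow> 'k) \<Rightarrow> bool" where
  "sol lam de d \<longleftrightarrow> (\<forall>n. n \<notin> {1..p-2} \<longrightarrow> d n = 0) \<and>
     (\<forall>i j. 1 \<le> i \<longrightarrow> i < j \<longrightarrow> j \<le> p - 2 \<longrightarrow>
        (of_nat j - of_nat i) * d (i + j) = d j * wt lam i (de - of_nat j) - d i * wt lam j (de - of_nat i))"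

text \<open>
  The solution that belongs to the inner homomorphism \<open>a \<mapsto> a 1\<^sub>\<delta>\<close>.
\<close>

definition inn :: "'k \<Rightarrow> 'k \<Rightarrow> nat \<Rightarrow> 'k" where
  "inn lam de n = (if n \<in> {1..p-2} then wt lam n de else 0)"

lemma sol_supp: "sol lam de d \<Longrightarrow> n \<notin> {1..p-2} \<Longrightarrow> d n = 0"
  by (simp add: sol_def)

lemma sol_rel:
  assumes "sol lam de d" "1 \<le> i" "i < j" "j \<le> p - 2"
  shows "(of_nat j - of_nat i) * d (i + j) = d j * wt lam i (de - of_nat j) - d i * wt lam j (de - of_nat i)"
  using assms by (simp add: sol_def)

lemma sol_inn: assumes "de \<in> prime_field" shows "sol lam de (inn lam de)"
proof -
  have "wt lam n de = inn lam de n" if "1 \<le> n" for n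
    using wt_ge[OF assms, of n lam] that by (auto simp: inn_def)
  then show ?thesis
    using wt_bracket[of lam _ de] by (auto simp: sol_def inn_def)
qed

lemma sol_comb:
  assumes "sol lam de d" "sol lam de e"
  shows "sol lam de (\<lambda>n. a * d n + b * e n)"
  unfolding sol_def
proof (intro conjI allI impI)
  fix i j assume ij: "(1::nat) \<le> i" "i < j" "j \<le> p - 2"
  have "(of_nat j - of_nat i) * (a * d (i + j) + b * e (i + j))
    = a * ((of_nat j - of_nat i) * d (i + j)) + b * ((of_nat j - of_nat i) * e (i + j))"
    by (simp add: algebra_simps)
  then show "(of_nat j - of_nat i) * (a * d (i + j) + b * e (i + j)) =
      (a * d j + b * e j) * wt lam i (de - of_nat j) - (a * d i + b * e i) * wt lam j (de - of_nat i)"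
    unfolding sol_rel[OF assms(1) ij] sol_rel[OF assms(2) ij] by (simp add: algebra_simps)
qed (use assms in \<open>auto simp: sol_def\<close>)

text \<open>Since \<open>e\<^sub>1\<close> and \<open>e\<^sub>2\<close> generate, a solution is determined by its first two values.\<close>

lemma sol_determined_aux:
  assumes "\<And>n. 3 \<le> n \<Longrightarrow> n \<le> p - 2 \<Longrightarrow>
      (of_nat (n - 1) - of_nat 1) * d n = d (n - 1) * wt lam 1 (de - of_nat (n - 1)) - d 1 * wt lam (n - 1) (de - of_nat 1)"
    and 12: "d 1 = 0" "d 2 = 0" and n: "1 \<le> n" "n \<le> p - 2"
  shows "d n = (0 :: 'k)"
  using n
proof (induction n rule: less_induct)
  case (less n)
  consider "n = 1" | "n = 2" | "3 \<le> n" using less.prems by linarith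
  then show ?case
  proof cases
    case 3
    have "d (n - 1) = 0" using less 3 by (intro less.IH) auto
    then have "(of_nat (n - 1) - of_nat 1) * d n = 0"
      using assms(1)[OF 3] less.prems 12 by simp
    moreover have "(of_nat (n - 1) - of_nat 1 :: 'k) \<noteq> 0"
      by (rule nat_diff_nonzero) (use 3 less.prems p5 in auto)
    ultimately show ?thesis by simp
  qed (use 12 in auto)
qed

lemma sol_determined:
  assumes d: "sol lam de d" and 12: "d 1 = 0" "d 2 = 0"
  shows "d n = 0"
proof (cases "n \<in> {1..p-2}")
  case True
  show ?thesis
  proof (rule sol_determined_aux[OF _ 12])
    fix n assume n: "3 \<le> n" "n \<le> p - 2"
    show "(of_nat (n - 1) - of_nat 1) * d n = d (n - 1) * wt lam 1 (de - of_nat (n - 1)) - d 1 * wt lam (n - 1) (de - of_nat 1)"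
      using sol_rel[OF d, of 1 "n - 1"] n by simp
  qed (use True in auto)
qed (use sol_supp[OF d] in auto)

lemma sol_eqI:
  assumes d: "sol lam de d" and e: "sol lam de e" "d 1 = e 1" "d 2 = e 2"
  shows "d n = e n"
  using sol_determined[OF sol_comb[OF d e(1), of 1 "-1"]] e(2,3) by simp

text \<open>
  The two cases for the space of solutions modulo the inner one: it is zero, or it is a line.
\<close>

definition "rigid lam de \<longleftrightarrow> (\<forall>d. sol lam de d \<longrightarrow> (\<exists>c. \<forall>n. d n = c * inn lam de n))"

definition "flexible lam de \<longleftrightarrow> (\<exists>d0. sol lam de d0 \<and> (\<nexists>c. \<forall>n. d0 n = c * inn lam de n) \<and>
   (\<forall>d. sol lam de d \<longrightarrow> (\<exists>b c. \<forall>n. d n = b * d0 n + c * inn lam de n)))"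

text \<open>
  The pairs \<open>(d 1, d 2)\<close> form a space of dimension at most two; two independent solutions span it.
\<close>

lemma flexibleI:
  assumes de: "de \<in> prime_field" and d0: "sol lam de d0"
    and det: "d0 1 * inn lam de 2 \<noteq> d0 2 * inn lam de 1"
  shows "flexible lam de"
  unfolding flexible_def
proof (intro exI[of _ d0] conjI allI impI)
  show "\<nexists>c. \<forall>n. d0 n = c * inn lam de n"
  proof
    assume "\<exists>c. \<forall>n. d0 n = c * inn lam de n"
    then obtain c where "\<And>n. d0 n = c * inn lam de n" by blast
    then show False using det by simp
  qed
  fix d assume d: "sol lam de d"
  define D where "D = d0 1 * inn lam de 2 - d0 2 * inn lam de 1"
  have D: "D \<noteq> 0" using det by (simp add: D_def)
  define b where "b = (d 1 * inn lam de 2 - d 2 * inn lam de 1) / D"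
  define c where "c = (d0 1 * d 2 - d0 2 * d 1) / D"
  have "d n = b * d0 n + c * inn lam de n" for n
  proof (rule sol_eqI[OF d sol_comb[OF d0 sol_inn[OF de]]])
    show "d 1 = b * d0 1 + c * inn lam de 1" "d 2 = b * d0 2 + c * inn lam de 2"
      using D unfolding b_def c_def by (simp_all add: field_simps) (simp_all add: D_def algebra_simps)
  qed
  then show "\<exists>b c. \<forall>n. d n = b * d0 n + c * inn lam de n" by blast
qed (rule d0)

lemma wt_explicit:
  "wt lam 1 a = - a * (2 * lam - a + 1)"
  "wt lam 2 a = a * (a - 1) * (3 * lam - a + 2)"
  "wt lam 3 a = - a * (a - 1) * (a - 2) * (4 * lam - a + 3)"
  "wt lam 4 a = a * (a - 1) * (a - 2) * (a - 3) * (5 * lam - a + 4)"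
  "wt lam 5 a = - a * (a - 1) * (a - 2) * (a - 3) * (a - 4) * (6 * lam - a + 5)"
  "wt lam 6 a = a * (a - 1) * (a - 2) * (a - 3) * (a - 4) * (a - 5) * (7 * lam - a + 6)"
  by (simp_all add: wt_def falling_def eval_nat_numeral)

lemma wt_Suc_0: "wt lam (Suc 0) a = - a * (2 * lam - a + 1)"
  using wt_explicit(1) by simp

lemma inn_12: "inn lam de (Suc 0) = wt lam (Suc 0) de" "inn lam de 2 = wt lam 2 de"
  using p5 by (simp_all add: inn_def)

lemma two_nonzero: "(2::'k) \<noteq> 0" and three_nonzero: "(3::'k) \<noteq> 0"
proof -
  show "(2::'k) \<noteq> 0" using of_nat_nonzero[of 2] p5 by simp
  show "(3::'k) \<noteq> 0" using of_nat_nonzero[of 3] p5 by simp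
qed

lemma four_nonzero: "(4::'k) \<noteq> 0"
  using of_nat_nonzero[of 4] p5 by simp

text \<open>
  \<open>lam\<close> and \<open>lam - \<delta>\<close> are different from \<open>-1\<close> because \<open>0 \<le> l, m \<le> p - 2\<close>. Only for \<open>\<delta> = 0\<close> does the inner
  solution vanish.
\<close>

lemma inn_nonzero:
  fixes lam de :: 'k
  assumes "de \<noteq> 0" "lam \<noteq> -1" "lam - de \<noteq> -1"
  shows "wt lam 1 de \<noteq> 0 \<or> wt lam 2 de \<noteq> 0"
proof (rule ccontr)
  assume "\<not> ?thesis"
  then have 1: "2 * lam - de + 1 = 0" and 2: "(de - 1) * (3 * lam - de + 2) = 0"
    using assms(1) by (auto simp: wt_explicit wt_Suc_0)
  have de: "de = 2 * lam + 1" using 1 by (simp add: algebra_simps)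
  have "lam \<noteq> 0" using assms(3) de by auto
  moreover have "2 * lam * (lam + 1) = 0" using 2 unfolding de by (simp add: algebra_simps)
  ultimately show False using assms(2) two_nonzero by (auto simp: add_eq_0_iff2)
qed

section \<open>Weights with a non-inner solution\<close>

text \<open>
  If \<open>\<delta> = s \<le> p - 2\<close> is a natural number, then \<open>wt lam i (\<delta> - j)\<close> vanishes for \<open>i + j > s\<close>, so for a sequence
  supported on \<open>{1..s}\<close> the relations of degree above \<open>s\<close> are trivial.
\<close>

lemma sol_supportedI:
  assumes s: "s \<le> p - 2" and supp: "\<And>n. n \<notin> {1..s} \<Longrightarrow> d n = 0"
    and rel: "\<And>i j. 1 \<le> i \<Longrightarrow> i < j \<Longrightarrow> i + j \<le> s \<Longrightarrow>
      (of_nat j - of_nat i) * d (i + j) = d j * wt lam i (of_nat s - of_nat j) - d i * wt lam j (of_nat s - of_nat i)"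
  shows "sol lam (of_nat s) d"
  unfolding sol_def
proof (intro conjI allI impI)
  fix i j assume ij: "(1::nat) \<le> i" "i < j" "j \<le> p - 2"
  show "(of_nat j - of_nat i) * d (i + j) = d j * wt lam i (of_nat s - of_nat j) - d i * wt lam j (of_nat s - of_nat i)"
  proof (cases "i + j \<le> s")
    case True then show ?thesis using rel ij by simp
  next
    case False
    have 1: "d j * wt lam i (of_nat s - of_nat j) = 0"
    proof (cases "j \<le> s")
      case True
      then have "s - j < i" using False by linarith
      then show ?thesis using True wt_of_nat_zero[of "s - j" i lam] by (simp add: of_nat_diff)
    qed (simp add: supp)
    have 2: "d i * wt lam j (of_nat s - of_nat i) = 0"
    proof (cases "i \<le> s")
      case True
      then have "s - i < j" using False by linarith
      then show ?thesis using True wt_of_nat_zero[of "s - i" j lam] by (simp add: of_nat_diff)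
    qed (simp add: supp)
    show ?thesis unfolding 1 2 using False supp by simp
  qed
qed (use s supp in auto)

lemma flexible_if_free:
  assumes de: "de \<in> prime_field" "de \<noteq> 0" "lam \<noteq> -1" "lam - de \<noteq> -1"
    and free: "\<And>x y. \<exists>d. sol lam de d \<and> d 1 = x \<and> d 2 = y"
  shows "flexible lam de"
proof (cases "wt lam 1 de = 0")
  case True
  then have 2: "wt lam 2 de \<noteq> 0" using inn_nonzero[OF de(2-)] by blast
  obtain d where "sol lam de d" "d 1 = 1" "d 2 = 0" using free by blast
  then show ?thesis using 2 by (intro flexibleI[OF de(1)]) (auto simp: inn_12)
next
  case False
  obtain d where "sol lam de d" "d 1 = 0" "d 2 = 1" using free by blast
  then show ?thesis using False by (intro flexibleI[OF de(1)]) (auto simp: inn_12)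
qed

text \<open>The solution with \<open>d 1 = x\<close>, \<open>d 2 = y\<close>, continued by the relations for \<open>[e\<^sub>1, e\<^sub>n]\<close>, up to degree \<open>s\<close>.\<close>

fun cont :: "'k \<Rightarrow> 'k \<Rightarrow> 'k \<Rightarrow> 'k \<Rightarrow> nat \<Rightarrow> 'k" where
  "cont lam de x y 0 = 0"
| "cont lam de x y (Suc 0) = x"
| "cont lam de x y (Suc (Suc 0)) = y"
| "cont lam de x y (Suc (Suc (Suc n))) =
     (cont lam de x y (Suc (Suc n)) * wt lam 1 (de - of_nat (Suc (Suc n))) - x * wt lam (Suc (Suc n)) (de - 1)) / of_nat (Suc n)"

lemma free_if_continuation:
  assumes s: "2 \<le> s" "s \<le> p - 2"
    and rel: "\<And>x y i j. 2 \<le> i \<Longrightarrow> i < j \<Longrightarrow> i + j \<le> s \<Longrightarrow> (of_nat j - of_nat i) * cont lam (of_nat s) x y (i + j) =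
      cont lam (of_nat s) x y j * wt lam i (of_nat s - of_nat j) - cont lam (of_nat s) x y i * wt lam j (of_nat s - of_nat i)"
  shows "\<exists>d. sol lam (of_nat s) d \<and> d 1 = x \<and> d 2 = y"
proof (intro exI conjI)
  let ?c = "cont lam (of_nat s) x y"
  let ?d = "\<lambda>n. if n \<le> s then ?c n else 0"
  show "?d 1 = x" "?d 2 = y" using s by (simp_all add: eval_nat_numeral)
  show "sol lam (of_nat s) ?d"
  proof (rule sol_supportedI[OF s(2)])
    fix n assume "n \<notin> {1..s}"
    then show "?d n = 0" by (cases n) auto
  next
    fix i j assume ij: "(1::nat) \<le> i" "i < j" "i + j \<le> s"
    show "(of_nat j - of_nat i) * ?d (i + j) = ?d j * wt lam i (of_nat s - of_nat j) - ?d i * wt lam j (of_nat s - of_nat i)"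
    proof (cases "i = 1")
      case True
      define n where "n = j - 2"
      have j: "j = Suc (Suc n)" using ij True by (simp add: n_def)
      have "(of_nat (Suc n) :: 'k) \<noteq> 0" by (rule of_nat_nonzero) (use ij s j in auto)
      then show ?thesis using ij True by (simp add: j)
    next
      case False
      then show ?thesis using rel[of i j x y] ij by simp
    qed
  qed
qed

text \<open>
  In degrees up to \<open>4\<close> the only relations are those for \<open>[e\<^sub>1, e\<^sub>n]\<close>, which define \<open>d 3\<close> and \<open>d 4\<close>.
\<close>

lemma flexible_234:
  assumes s: "s \<in> {2, 3, 4}" "s \<le> p - 2" and lam: "lam \<noteq> -1" "lam - of_nat s \<noteq> -1"
  shows "flexible lam (of_nat s)"
proof (rule flexible_if_free[OF prime_field_closed(2) _ lam])
  show "(of_nat s :: 'k) \<noteq> 0" using s p5 by (intro of_nat_nonzero) auto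
  show "\<exists>d. sol lam (of_nat s) d \<and> d 1 = x \<and> d 2 = y" for x y
    by (rule free_if_continuation) (use s in auto)
qed

lemma cont_explicit:
  "cont lam de x y 1 = x" "cont lam de x y 2 = y"
  "cont lam de x y 3 = y * wt lam 1 (de - 2) - x * wt lam 2 (de - 1)"
  "cont lam de x y 4 = (cont lam de x y 3 * wt lam 1 (de - 3) - x * wt lam 3 (de - 1)) / 2"
  "cont lam de x y 5 = (cont lam de x y 4 * wt lam 1 (de - 4) - x * wt lam 4 (de - 1)) / 3"
  "cont lam de x y 6 = (cont lam de x y 5 * wt lam 1 (de - 5) - x * wt lam 5 (de - 1)) / 4"
  by (simp_all add: eval_nat_numeral)

text \<open>
  The relation for \<open>[e\<^sub>2, e\<^sub>3]\<close> is a further condition; it holds identically for \<open>\<delta> = 5\<close>, \<open>lam = 0\<close>.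
\<close>

lemma flexible_5:
  assumes p: "7 \<le> p" shows "flexible (0::'k) 5"
proof -
  have "flexible (0::'k) (of_nat 5)"
  proof (rule flexible_if_free[OF prime_field_closed(2)])
    show "(of_nat 5 :: 'k) \<noteq> 0" using p by (intro of_nat_nonzero) auto
    have "(4 :: 'k) \<noteq> 0" using of_nat_nonzero[of 4] p by simp
    then show "0 - of_nat 5 \<noteq> (-1 :: 'k)" by (simp add: eq_neg_iff_add_eq_0)
    show "\<exists>d. sol (0::'k) (of_nat 5) d \<and> d 1 = x \<and> d 2 = y" for x y
    proof (rule free_if_continuation)
      fix x y :: 'k and i j :: nat assume "2 \<le> i" "i < j" "i + j \<le> 5"
      then have ij: "i = 2" "j = 3" by linarith+
      have s: "2 + 3 = (5::nat)" "of_nat 5 = (5::'k)" "of_nat 3 = (3::'k)" "of_nat 2 = (2::'k)" by simp_all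
      show "(of_nat j - of_nat i) * cont 0 (of_nat 5) x y (i + j) =
        cont 0 (of_nat 5) x y j * wt 0 i (of_nat 5 - of_nat j) - cont 0 (of_nat 5) x y i * wt 0 j (of_nat 5 - of_nat i)"
        unfolding ij s cont_explicit wt_explicit using two_nonzero three_nonzero
        by (simp add: field_simps)
    qed (use p in auto)
  qed auto
  then show ?thesis by simp
qed

text \<open>
  Here \<open>[e\<^sub>2, e\<^sub>3]\<close> and \<open>[e\<^sub>2, e\<^sub>4]\<close> are further conditions, which follow from the quadratic equation
  for \<open>lam\<close>.
\<close>

lemma flexible_6:
  fixes lam :: 'k
  assumes p: "8 \<le> p" and q: "2 * lam\<^sup>2 - 10 * lam + 3 = 0" and lam: "lam \<noteq> -1" "lam - 6 \<noteq> -1"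
  shows "flexible lam 6"
proof -
  have "flexible lam (of_nat 6)"
  proof (rule flexible_if_free[OF prime_field_closed(2)])
    show "(of_nat 6 :: 'k) \<noteq> 0" using p by (intro of_nat_nonzero) auto
    show "lam - of_nat 6 \<noteq> -1" "lam \<noteq> -1" using lam by simp_all
    have six: "(4::'k) \<noteq> 0" "(6::'k) \<noteq> 0" using of_nat_nonzero[of 4] of_nat_nonzero[of 6] p by simp_all
    have "(24::'k) = 4 * 6" by simp
    then have nz: "(4::'k) \<noteq> 0" "(6::'k) \<noteq> 0" "(24::'k) \<noteq> 0" using six by (metis mult_eq_0_iff)+
    have "(48::'k) = 2 * 24" by simp
    then have nz48: "(48::'k) \<noteq> 0" using nz two_nonzero by (metis mult_eq_0_iff)
    show "\<exists>d. sol lam (of_nat 6) d \<and> d 1 = x \<and> d 2 = y" for x y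
    proof (rule free_if_continuation)
      fix x y :: 'k and i j :: nat assume "2 \<le> i" "i < j" "i + j \<le> 6"
      then have "i = 2" "j = 3 \<or> j = 4" by linarith+
      then show "(of_nat j - of_nat i) * cont lam (of_nat 6) x y (i + j) =
        cont lam (of_nat 6) x y j * wt lam i (of_nat 6 - of_nat j) - cont lam (of_nat 6) x y i * wt lam j (of_nat 6 - of_nat i)"
      proof (elim disjE)
        assume ij: "i = 2" "j = 3"
        have s: "2 + 3 = (5::nat)" "of_nat 6 = (6::'k)" "of_nat 3 = (3::'k)" "of_nat 2 = (2::'k)" by simp_all
        have "(of_nat j - of_nat i) * cont lam (of_nat 6) x y (i + j) -
          (cont lam (of_nat 6) x y j * wt lam i (of_nat 6 - of_nat j) - cont lam (of_nat 6) x y i * wt lam j (of_nat 6 - of_nat i))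
          = (2 * lam\<^sup>2 - 10 * lam + 3) * ((160 - 120 * lam) * x + (40 - 16 * lam) * y)"
          unfolding ij s cont_explicit wt_explicit using two_nonzero three_nonzero nz nz48
          by (simp add: field_simps power2_eq_square)
        then show ?thesis using q by simp
      next
        assume ij: "i = 2" "j = 4"
        have s: "2 + 4 = (6::nat)" "of_nat 6 = (6::'k)" "of_nat 4 = (4::'k)" "of_nat 2 = (2::'k)" by simp_all
        have "(of_nat j - of_nat i) * cont lam (of_nat 6) x y (i + j) -
          (cont lam (of_nat 6) x y j * wt lam i (of_nat 6 - of_nat j) - cont lam (of_nat 6) x y i * wt lam j (of_nat 6 - of_nat i))
          = (2 * lam\<^sup>2 - 10 * lam + 3) * ((120 * lam\<^sup>2 - 160 * lam) * x + (16 * lam\<^sup>2 - 40 * lam) * y)"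
          unfolding ij s cont_explicit wt_explicit using two_nonzero three_nonzero nz nz48
          by (simp add: field_simps power2_eq_square)
        then show ?thesis using q by simp
      qed
    qed (use p in auto)
  qed
  then show ?thesis by simp
qed

text \<open>
  For \<open>(\<delta>, lam) = (0, 0)\<close> and \<open>(1, 1)\<close> the sequence \<open>d n = (n + 1)!\<close> satisfies the relations in all degrees,
  and it may be cut off after \<open>p - 2\<close> because \<open>p!\<close> vanishes in \<open>k\<close>.
\<close>

definition "fact_k n = (of_nat (fact n) :: 'k)"

lemma fact_k_Suc: "fact_k (Suc n) = of_nat (Suc n) * fact_k n" by (simp add: fact_k_def algebra_simps)
lemma fact_k_ge_p: "p \<le> n \<Longrightarrow> fact_k n = 0"
  using prime_dvd_fact_iff[OF prime_p] by (simp add: fact_k_def of_nat_zero_iff)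
lemma fact_k_less_p: "n < p \<Longrightarrow> fact_k n \<noteq> 0"
  using prime_dvd_fact_iff[OF prime_p, of n] by (simp add: fact_k_def of_nat_zero_iff)

lemma falling_minus_fk: "(-1) ^ i * falling (- of_nat (Suc j)) i * fact_k j = fact_k (i + j)"
  unfolding fact_k_def by (rule falling_minus_fact)

lemma wt_minus: "fact_k j * wt lam i (- of_nat (Suc j)) = fact_k (i + j) * ((of_nat i + 1) * lam + of_nat (Suc j) + of_nat i)"
  unfolding wt_def falling_minus_fk[symmetric] by (simp add: algebra_simps)

text \<open>\<open>D\<close> is, up to sign, the derivative of the inner solution with respect to \<open>\<delta>\<close> at \<open>\<delta> = 0\<close>.\<close>

lemma dual_inner_rel:
  fixes lam :: 'k
  defines "D \<equiv> \<lambda>n. fact_k (n - 1) * ((of_nat n + 1) * lam + of_nat n)"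
  shows "(of_nat (Suc j) - of_nat (Suc i)) * D (Suc i + Suc j) =
    D (Suc j) * wt lam (Suc i) (- of_nat (Suc j)) - D (Suc i) * wt lam (Suc j) (- of_nat (Suc i))"
proof -
  define F where "F = fact_k (Suc (i + j))"
  have 1: "fact_k j * wt lam (Suc i) (- of_nat (Suc j)) = F * ((of_nat (Suc i) + 1) * lam + of_nat (Suc j) + of_nat (Suc i))"
    using wt_minus[of j lam "Suc i"] by (simp add: F_def)
  have 2: "fact_k i * wt lam (Suc j) (- of_nat (Suc i)) = F * ((of_nat (Suc j) + 1) * lam + of_nat (Suc i) + of_nat (Suc j))"
    using wt_minus[of i lam "Suc j"] by (simp add: F_def add.commute)
  have "D (Suc j) * wt lam (Suc i) (- of_nat (Suc j)) - D (Suc i) * wt lam (Suc j) (- of_nat (Suc i))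
    = (fact_k j * wt lam (Suc i) (- of_nat (Suc j))) * ((of_nat (Suc j) + 1) * lam + of_nat (Suc j))
      - (fact_k i * wt lam (Suc j) (- of_nat (Suc i))) * ((of_nat (Suc i) + 1) * lam + of_nat (Suc i))"
    by (simp add: D_def)
  also have "\<dots> = (of_nat (Suc j) - of_nat (Suc i)) * (F * ((of_nat (Suc i + Suc j) + 1) * lam + of_nat (Suc i + Suc j)))"
    unfolding 1 2 by (simp add: algebra_simps)
  also have "F * ((of_nat (Suc i + Suc j) + 1) * lam + of_nat (Suc i + Suc j)) = D (Suc i + Suc j)"
    by (simp add: D_def F_def)
  finally show ?thesis ..
qed

lemma affine_fact_relation:
  "(of_nat (Suc j) - of_nat (Suc i)) * (a + b * of_nat (Suc i + Suc j)) * fact_k (Suc i + Suc j) =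
    (a + b * of_nat (Suc j)) * fact_k (Suc j) * wt 0 (Suc i) (- of_nat (Suc j))
    - (a + b * of_nat (Suc i)) * fact_k (Suc i) * wt 0 (Suc j) (- of_nat (Suc i))"
proof -
  define F where "F = fact_k (Suc (i + j))"
  have 1: "fact_k j * wt 0 (Suc i) (- of_nat (Suc j)) = F * (of_nat (Suc j) + of_nat (Suc i))"
    using wt_minus[of j 0 "Suc i"] by (simp add: F_def)
  have 2: "fact_k i * wt 0 (Suc j) (- of_nat (Suc i)) = F * (of_nat (Suc i) + of_nat (Suc j))"
    using wt_minus[of i 0 "Suc j"] by (simp add: F_def add.commute)
  have "(a + b * of_nat (Suc j)) * fact_k (Suc j) * wt 0 (Suc i) (- of_nat (Suc j))
    - (a + b * of_nat (Suc i)) * fact_k (Suc i) * wt 0 (Suc j) (- of_nat (Suc i))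
    = (a + b * of_nat (Suc j)) * of_nat (Suc j) * (fact_k j * wt 0 (Suc i) (- of_nat (Suc j)))
    - (a + b * of_nat (Suc i)) * of_nat (Suc i) * (fact_k i * wt 0 (Suc j) (- of_nat (Suc i)))"
    by (simp add: fact_k_Suc)
  also have "\<dots> = (of_nat (Suc j) - of_nat (Suc i)) * (a + b * of_nat (Suc i + Suc j)) * ((of_nat (Suc i) + of_nat (Suc j)) * F)"
    unfolding 1 2 by (simp add: algebra_simps)
  also have "(of_nat (Suc i) + of_nat (Suc j)) * F = fact_k (Suc i + Suc j)"
    by (simp add: F_def fact_k_Suc algebra_simps)
  finally show ?thesis ..
qed

lemma of_nat_top: "of_nat (p - 1) = (-1 :: 'k)" "of_nat (p - 2) = (-2 :: 'k)"
  using p5 by (simp_all add: of_nat_diff)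

lemma sol_factorial_00: "sol 0 0 (\<lambda>n. if n \<in> {1..p-2} then fact_k (Suc n) else 0)"
  unfolding sol_def
proof (intro conjI allI impI)
  fix i j assume ij: "(1::nat) \<le> i" "i < j" "j \<le> p - 2"
  define i' j' where "i' = i - 1" and "j' = j - 1"
  have S: "i = Suc i'" "j = Suc j'" using ij by (simp_all add: i'_def j'_def)
  have z: "fact_k (Suc n) = 0" if "n \<notin> {1..p-2}" "1 \<le> n" for n using that p5 by (intro fact_k_ge_p) auto
  have f: "fact_k (Suc n) = (1 + 1 * of_nat n) * fact_k n" for n by (simp add: fact_k_Suc)
  have "(of_nat j - of_nat i) * fact_k (Suc (i + j)) = fact_k (Suc j) * wt 0 i (0 - of_nat j) - fact_k (Suc i) * wt 0 j (0 - of_nat i)"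
    unfolding f[of j] f[of i] f[of "i + j"] diff_0
    using affine_fact_relation[of j' i' 1 1, folded S] by (simp only: mult.assoc)
  then show "(of_nat j - of_nat i) * (if i + j \<in> {1..p-2} then fact_k (Suc (i + j)) else 0) =
     (if j \<in> {1..p-2} then fact_k (Suc j) else 0) * wt 0 i (0 - of_nat j)
     - (if i \<in> {1..p-2} then fact_k (Suc i) else 0) * wt 0 j (0 - of_nat i)"
    using ij z[of "i + j"] by auto
qed auto

text \<open>
  For \<open>\<delta> = lam = 0\<close> the inner solution is zero. Up to degree \<open>p - 2\<close>, the relations are solved by
  \<open>d n = n! (a + b n)\<close> with arbitrary \<open>a, b\<close>, which fit any values of \<open>d 1\<close> and \<open>d 2\<close>. The relation for
  \<open>[e\<^sub>1, e\<^sub>p\<^sub>-\<^sub>2] = 0\<close> requires \<open>a + b (p - 1) = 0\<close>, that is \<open>a = b\<close>.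
\<close>

lemma flexible_00: "flexible 0 0"
proof -
  let ?d = "\<lambda>n. if n \<in> {1..p-2} then fact_k (Suc n) else 0"
  have inn0: "inn 0 0 n = 0" for n using wt_of_nat_zero[of 0 n 0] by (auto simp: inn_def)
  show ?thesis
    unfolding flexible_def
  proof (intro exI[of _ ?d] conjI allI impI)
    have "?d 1 \<noteq> 0" using p5 fact_k_less_p[of "Suc 1"] by simp
    then show "\<nexists>c. \<forall>n. ?d n = c * inn 0 0 n" unfolding inn0 by (metis mult_zero_right)
    fix d assume d: "sol 0 0 d"
    define b where "b = d 2 / 2 - d 1"
    define a where "a = d 1 - b"
    define e where "e n = d n - (a + b * of_nat n) * fact_k n" for n
    have e0: "e n = 0" if n: "1 \<le> n" "n \<le> p - 2" for n
    proof (rule sol_determined_aux[where de = 0 and lam = 0])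
      have "fact_k 1 = 1" "fact_k 2 = 2" by (simp_all add: fact_k_def eval_nat_numeral)
      then show "e 1 = 0" "e 2 = 0"
        using two_nonzero four_nonzero by (simp_all add: e_def a_def b_def field_simps)
      fix n assume n: "3 \<le> n" "n \<le> p - 2"
      define m where "m = n - 2"
      have m: "n = Suc (Suc m)" using n by (simp add: m_def)
      have dr: "(of_nat (n - 1) - of_nat 1) * d n = d (n - 1) * wt 0 1 (0 - of_nat (n - 1)) - d 1 * wt 0 (n - 1) (0 - of_nat 1)"
        using sol_rel[OF d, of 1 "n - 1"] n by simp
      show "(of_nat (n - 1) - of_nat 1) * e n = e (n - 1) * wt 0 1 (0 - of_nat (n - 1)) - e 1 * wt 0 (n - 1) (0 - of_nat 1)"
        using dr affine_fact_relation[of m 0 a b] unfolding e_def right_diff_distrib left_diff_distrib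
        by (simp add: m mult.assoc)
    qed (use n in auto)
    have dn: "d n = (a + b * of_nat n) * fact_k n" if "1 \<le> n" "n \<le> p - 2" for n
      using e0[OF that] by (simp add: e_def)
    define m where "m = p - 3"
    have m: "p - 2 = Suc m" "p - 1 = Suc (Suc m)" using p5 by (simp_all add: m_def)
    have "0 = (a + b * of_nat (p - 1)) * fact_k (p - 1)"
    proof -
      have "(of_nat (p - 2) - of_nat 1) * d (1 + (p - 2)) = d (p - 2) * wt 0 1 (0 - of_nat (p - 2)) - d 1 * wt 0 (p - 2) (0 - of_nat 1)"
        by (rule sol_rel[OF d]) (use p5 in auto)
      moreover have "d (1 + (p - 2)) = 0" using sol_supp[OF d] p5 by auto
      ultimately have "0 = d (p - 2) * wt 0 1 (0 - of_nat (p - 2)) - d 1 * wt 0 (p - 2) (0 - of_nat 1)" by simp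
      also have "\<dots> = (a + b * of_nat (p - 2)) * fact_k (p - 2) * wt 0 1 (0 - of_nat (p - 2)) - (a + b * of_nat 1) * fact_k 1 * wt 0 (p - 2) (0 - of_nat 1)"
        using p5 by (simp add: dn)
      also have "\<dots> = (of_nat (p - 2) - of_nat 1) * (a + b * of_nat (p - 1)) * fact_k (p - 1)"
        using affine_fact_relation[of m 0 a b] unfolding m by simp
      finally have "(of_nat (p - 2) - of_nat 1) * ((a + b * of_nat (p - 1)) * fact_k (p - 1)) = 0" by (simp add: mult.assoc)
      moreover have "(of_nat (p - 2) - of_nat 1 :: 'k) \<noteq> 0" by (rule nat_diff_nonzero) (use p5 in auto)
      ultimately show ?thesis by simp
    qed
    then have ab: "a = b" using fact_k_less_p[of "p - 1"] p5 of_nat_top by simp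
    have "d n = b * ?d n + 0 * inn 0 0 n" for n
    proof (cases "n \<in> {1..p-2}")
      case True
      then show ?thesis using dn[of n] by (simp add: ab fact_k_Suc algebra_simps)
    next
      case False
      then show ?thesis using sol_supp[OF d] by auto
    qed
    then show "\<exists>b c. \<forall>n. d n = b * ?d n + c * inn 0 0 n" by blast
  qed (rule sol_factorial_00)
qed

lemma sol_factorial_11: "sol 1 1 (\<lambda>n. if n \<in> {1..p-2} then fact_k (Suc n) else 0)"
  unfolding sol_def
proof (intro conjI allI impI)
  fix i j assume ij: "(1::nat) \<le> i" "i < j" "j \<le> p - 2"
  define i' j' where "i' = i - 1" and "j' = j - 2"
  have j: "j = Suc (Suc j')" and i: "i = Suc i'" using ij by (simp_all add: i'_def j'_def)
  have z: "fact_k (Suc n) = 0" if "n \<notin> {1..p-2}" "1 \<le> n" for n using that p5 by (intro fact_k_ge_p) auto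
  define F where "F = fact_k (i + j')"
  have d1: "1 - of_nat j = (- of_nat (Suc j') :: 'k)" by (simp add: j)
  have 1: "fact_k j' * wt 1 i (1 - of_nat j) = F * (2 * of_nat i + of_nat j)"
    unfolding d1 wt_minus by (simp add: F_def j algebra_simps)
  have fj: "fact_k (Suc j) = (of_nat j + 1) * of_nat j * (of_nat j - 1) * fact_k j'"
    by (simp add: j fact_k_Suc algebra_simps)
  have 2: "fact_k (Suc i) * wt 1 j (1 - of_nat i) = (of_nat i + 1) * of_nat i * (of_nat i - 1) * F * (2 * of_nat j + of_nat i)"
  proof (cases i')
    case 0
    then have "wt 1 j (1 - of_nat i :: 'k) = 0" using wt_of_nat_zero[of 0 j "1::'k"] by (simp add: i j)
    then show ?thesis by (simp add: i 0)
  next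
    case (Suc i'')
    have d2: "1 - of_nat i = (- of_nat (Suc i'') :: 'k)" by (simp add: i Suc)
    have "fact_k i'' * wt 1 j (1 - of_nat i) = F * (2 * of_nat j + of_nat i)"
      unfolding d2 wt_minus by (simp add: F_def i j Suc algebra_simps)
    moreover have "fact_k (Suc i) = (of_nat i + 1) * of_nat i * (of_nat i - 1) * fact_k i''"
      by (simp add: i Suc fact_k_Suc algebra_simps)
    ultimately show ?thesis by (simp add: mult.assoc)
  qed
  have fij: "fact_k (Suc (i + j)) = (of_nat i + of_nat j + 1) * (of_nat i + of_nat j) * (of_nat i + of_nat j - 1) * F"
    by (simp add: j F_def fact_k_Suc algebra_simps)
  have "fact_k (Suc j) * wt 1 i (1 - of_nat j) - fact_k (Suc i) * wt 1 j (1 - of_nat i)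
    = (of_nat j + 1) * of_nat j * (of_nat j - 1) * (fact_k j' * wt 1 i (1 - of_nat j))
      - (of_nat i + 1) * of_nat i * (of_nat i - 1) * F * (2 * of_nat j + of_nat i)"
    unfolding 2 fj by (simp add: mult.assoc)
  also have "\<dots> = (of_nat j - of_nat i) * fact_k (Suc (i + j))"
    unfolding 1 fij by (simp add: algebra_simps)
  finally show "(of_nat j - of_nat i) * (if i + j \<in> {1..p-2} then fact_k (Suc (i + j)) else 0) =
     (if j \<in> {1..p-2} then fact_k (Suc j) else 0) * wt 1 i (1 - of_nat j)
     - (if i \<in> {1..p-2} then fact_k (Suc i) else 0) * wt 1 j (1 - of_nat i)"
    using ij z[of "i + j"] by auto
qed auto

lemma flexible_11: "flexible 1 1"
proof (rule flexibleI[OF prime_field_closed(4) sol_factorial_11])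
  have i: "inn 1 1 1 = (-2::'k)" "inn 1 1 2 = (0::'k)" using inn_12[of 1 1] by (simp_all add: wt_explicit wt_Suc_0)
  have m: "1 \<in> {1..p-2}" "2 \<in> {1..p-2}" using p5 by auto
  have "fact_k (Suc 2) \<noteq> 0" using fact_k_less_p[of "Suc 2"] p5 by simp
  then show "(if 1 \<in> {1..p-2} then fact_k (Suc 1) else 0) * inn 1 1 2 \<noteq> (if 2 \<in> {1..p-2} then fact_k (Suc 2) else 0) * inn 1 1 1"
    unfolding i if_P[OF m(1)] if_P[OF m(2)] using two_nonzero by (metis mult_zero_right mult_eq_0_iff neg_equal_0_iff_equal)
qed

(* The relations are used with explicit indices; the index 1 is to stay a numeral in them. *)
declare One_nat_def [simp del]

lemma inn_1: "inn lam de 1 = wt lam 1 de"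
  using inn_12 by (simp add: One_nat_def)

section \<open>Weights with inner solutions only\<close>

text \<open>
  If the inner solution has a nonzero first value, a multiple of it can be subtracted so that \<open>d 1\<close>
  vanishes, and otherwise so that \<open>d 2\<close> vanishes; then only one free value remains to be excluded.
\<close>

lemma rigidI_1:
  assumes de: "de \<in> prime_field" and a1: "wt lam 1 de \<noteq> 0"
    and *: "\<And>d. sol lam de d \<Longrightarrow> d 1 = 0 \<Longrightarrow> d 2 = 0"
  shows "rigid lam de"
  unfolding rigid_def
proof (intro allI impI)
  fix d assume d: "sol lam de d"
  define c where "c = d 1 / inn lam de 1"
  have n1: "inn lam de 1 \<noteq> 0" using a1 inn_1 by simp
  have s: "sol lam de (\<lambda>n. 1 * d n + (- c) * inn lam de n)" by (rule sol_comb[OF d sol_inn[OF de]])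
  have 1: "1 * d 1 + (- c) * inn lam de 1 = 0" using n1 by (simp add: c_def)
  have 2: "1 * d 2 + (- c) * inn lam de 2 = 0" by (rule *[OF s 1])
  have "1 * d n + (- c) * inn lam de n = 0" for n by (rule sol_determined[OF s 1 2])
  then show "\<exists>c. \<forall>n. d n = c * inn lam de n" by (intro exI[of _ c]) simp
qed

lemma rigidI_2:
  assumes de: "de \<in> prime_field" and a: "wt lam 1 de = 0" "wt lam 2 de \<noteq> 0"
    and *: "\<And>d. sol lam de d \<Longrightarrow> d 2 = 0 \<Longrightarrow> d 1 = 0"
  shows "rigid lam de"
  unfolding rigid_def
proof (intro allI impI)
  fix d assume d: "sol lam de d"
  define c where "c = d 2 / inn lam de 2"
  have n2: "inn lam de 2 \<noteq> 0" using a inn_12 by simp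
  have s: "sol lam de (\<lambda>n. 1 * d n + (- c) * inn lam de n)" by (rule sol_comb[OF d sol_inn[OF de]])
  have 2: "1 * d 2 + (- c) * inn lam de 2 = 0" using n2 by (simp add: c_def)
  have 1: "1 * d 1 + (- c) * inn lam de 1 = 0" by (rule *[OF s 2])
  have "1 * d n + (- c) * inn lam de n = 0" for n by (rule sol_determined[OF s 1 2])
  then show "\<exists>c. \<forall>n. d n = c * inn lam de n" by (intro exI[of _ c]) simp
qed

lemma sol_rel_small:
  assumes d: "sol lam de d" and p: "7 \<le> p"
  shows "d 3 = d 2 * wt lam 1 (de - 2) - d 1 * wt lam 2 (de - 1)"
    "2 * d 4 = d 3 * wt lam 1 (de - 3) - d 1 * wt lam 3 (de - 1)"
    "3 * d 5 = d 4 * wt lam 1 (de - 4) - d 1 * wt lam 4 (de - 1)"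
    "4 * d 6 = d 5 * wt lam 1 (de - 5) - d 1 * wt lam 5 (de - 1)"
    "d 5 = d 3 * wt lam 2 (de - 3) - d 2 * wt lam 3 (de - 2)"
    "3 * d 7 = d 5 * wt lam 2 (de - 5) - d 2 * wt lam 5 (de - 2)"
    "11 \<le> p \<Longrightarrow> 5 * d 7 = d 6 * wt lam 1 (de - 6) - d 1 * wt lam 6 (de - 1)"
proof -
  show "d 3 = d 2 * wt lam 1 (de - 2) - d 1 * wt lam 2 (de - 1)" using sol_rel[OF d, of 1 2] p by simp
  show "2 * d 4 = d 3 * wt lam 1 (de - 3) - d 1 * wt lam 3 (de - 1)" using sol_rel[OF d, of 1 3] p by simp
  show "3 * d 5 = d 4 * wt lam 1 (de - 4) - d 1 * wt lam 4 (de - 1)" using sol_rel[OF d, of 1 4] p by simp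
  show "4 * d 6 = d 5 * wt lam 1 (de - 5) - d 1 * wt lam 5 (de - 1)" using sol_rel[OF d, of 1 5] p by simp
  show "d 5 = d 3 * wt lam 2 (de - 3) - d 2 * wt lam 3 (de - 2)" using sol_rel[OF d, of 2 3] p by simp
  show "3 * d 7 = d 5 * wt lam 2 (de - 5) - d 2 * wt lam 5 (de - 2)" using sol_rel[OF d, of 2 5] p by simp
  show "5 * d 7 = d 6 * wt lam 1 (de - 6) - d 1 * wt lam 6 (de - 1)" if "11 \<le> p"
    using sol_rel[OF d, of 1 6] that by simp
qed

lemma prime_cases_7: assumes "7 \<le> p" shows "p = 7 \<or> 11 \<le> p"
proof (rule ccontr)
  assume "\<not> ?thesis"
  then have "p = 8 \<or> p = 9 \<or> p = 10" using assms by linarith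
  moreover have "\<not> prime (8::nat)" "\<not> prime (9::nat)" "\<not> prime (10::nat)" by simp_all
  ultimately show False using prime_p by auto
qed

lemma five_nonzero: "7 \<le> p \<Longrightarrow> (5::'k) \<noteq> 0" "7 \<le> p \<Longrightarrow> (6::'k) \<noteq> 0"
  using of_nat_nonzero[of 5] of_nat_nonzero[of 6] by simp_all

text \<open>
  With \<open>d 1 = 0\<close>, the relations for \<open>[e\<^sub>1, e\<^sub>2]\<close>, \<open>[e\<^sub>1, e\<^sub>3]\<close>, \<open>[e\<^sub>1, e\<^sub>4]\<close> and the relation for \<open>[e\<^sub>2, e\<^sub>3]\<close> both give
  \<open>6 d 5\<close> as a multiple of \<open>d 2\<close>; the left side is the difference of the two factors.
\<close>

lemma relation_2_3_identity:
  fixes lam de :: 'k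
  shows "wt lam 1 (de - 2) * wt lam 1 (de - 3) * wt lam 1 (de - 4)
      - 6 * (wt lam 1 (de - 2) * wt lam 2 (de - 3) - wt lam 3 (de - 2))
    = - ((de - 2) * (de - 3) * (de - 4) * (2 * lam - de + 1) * ((2 * lam - de)\<^sup>2 + 2 * (2 * lam - de) - 3 * de))"
  unfolding wt_explicit by (simp add: algebra_simps power2_eq_square)

text \<open>
  The same comparison for \<open>360 d 7\<close>, reached through \<open>[e\<^sub>1, e\<^sub>6]\<close> and through \<open>[e\<^sub>2, e\<^sub>5]\<close>, when
  \<open>u\<^sup>2 + 2 u = 3 \<delta>\<close> for \<open>u = 2 lam - \<delta>\<close>.
\<close>

lemma relation_2_5_identity:
  fixes lam de :: 'k
  assumes par: "(2 * lam - de)\<^sup>2 + 2 * (2 * lam - de) - 3 * de = 0"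
  shows "3 * wt lam 1 (de - 2) * wt lam 1 (de - 3) * wt lam 1 (de - 4) * wt lam 1 (de - 5) * wt lam 1 (de - 6)
      - 20 * wt lam 1 (de - 2) * wt lam 1 (de - 3) * wt lam 1 (de - 4) * wt lam 2 (de - 5) + 120 * wt lam 5 (de - 2)
    = 3 * ((de - 2) * (de - 3) * (de - 4) * (de - 5) * (de - 6) * (2 * lam - de + 1) * de * (de - 1))"
proof -
  define P where "P = (2 * lam - de)\<^sup>2 + 2 * (2 * lam - de) - 3 * de"
  define Pi where "Pi = (de - 2) * (de - 3) * (de - 4) * (de - 5) * (de - 6)"
  define c where "c k = 2 * lam - de + of_nat k + 1" for k :: nat
  have w: "wt lam 1 (de - 2) = - (de - 2) * (2 * lam - de + 3)" "wt lam 1 (de - 3) = - (de - 3) * (2 * lam - de + 4)"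
    "wt lam 1 (de - 4) = - (de - 4) * (2 * lam - de + 5)" "wt lam 1 (de - 5) = - (de - 5) * (2 * lam - de + 6)"
    "wt lam 1 (de - 6) = - (de - 6) * (2 * lam - de + 7)"
    "wt lam 2 (de - 5) = (de - 5) * (de - 6) * (3 * lam - de + 7)"
    "wt lam 5 (de - 2) = - (de - 2) * (de - 3) * (de - 4) * (de - 5) * (de - 6) * (6 * lam - de + 7)"
    unfolding wt_explicit by (simp_all add: algebra_simps)
  have 1: "3 * wt lam 1 (de - 2) * wt lam 1 (de - 3) * wt lam 1 (de - 4) * wt lam 1 (de - 5) * wt lam 1 (de - 6)
    = Pi * (- 3 * ((2 * lam - de + 3) * (2 * lam - de + 4) * (2 * lam - de + 5) * (2 * lam - de + 6) * (2 * lam - de + 7)))"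
    unfolding w Pi_def by (simp only: mult_minus_left mult_minus_right minus_minus mult_ac)
  have 2: "20 * wt lam 1 (de - 2) * wt lam 1 (de - 3) * wt lam 1 (de - 4) * wt lam 2 (de - 5)
    = Pi * (- 20 * ((2 * lam - de + 3) * (2 * lam - de + 4) * (2 * lam - de + 5) * (3 * lam - de + 7)))"
    unfolding w Pi_def by (simp only: mult_minus_left mult_minus_right minus_minus mult_ac)
  have 3: "120 * wt lam 5 (de - 2) = Pi * (- 120 * (6 * lam - de + 7))"
    unfolding w Pi_def by (simp only: mult_minus_left mult_minus_right minus_minus mult_ac)
  have 4: "- 3 * ((2 * lam - de + 3) * (2 * lam - de + 4) * (2 * lam - de + 5) * (2 * lam - de + 6) * (2 * lam - de + 7))
     - - 20 * ((2 * lam - de + 3) * (2 * lam - de + 4) * (2 * lam - de + 5) * (3 * lam - de + 7)) + - 120 * (6 * lam - de + 7)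
    = (2 * lam - de + 1) * ((- 3 * (2 * lam - de)\<^sup>2 - 36 * (2 * lam - de) + de - 121) * P + 3 * de * (de - 1))"
    unfolding P_def by (simp add: algebra_simps power2_eq_square)
  have "P = 0" unfolding P_def by (rule par)
  then show ?thesis
    unfolding 1 2 3 right_diff_distrib[symmetric] distrib_left[symmetric] 4
    by (simp only: Pi_def mult_zero_right mult_zero_left add_0_left mult_ac)
qed

text \<open>
  Where the conditions in degrees \<open>5\<close> and \<open>7\<close> can both be met with \<open>d 1 = 0 \<noteq> d 2\<close>.
\<close>

lemma parabola_relation:
  assumes d: "sol lam de d" and p: "7 \<le> p" and d1: "d 1 = 0" and d2: "d 2 \<noteq> 0"
    and de: "de \<notin> {0, 2, 3, 4}" and u: "2 * lam - de + 1 \<noteq> 0"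
  shows "(2 * lam - de)\<^sup>2 + 2 * (2 * lam - de) - 3 * de = 0" "de \<in> {1, 5, 6}"
proof -
  note r = sol_rel_small(1-6)[OF d p, unfolded d1 mult_zero_left diff_zero]
  define A where "A k = wt lam 1 (de - k)" for k
  have A: "wt lam 1 (de - k) = A k" for k by (simp add: A_def)
  have d3: "d 3 = d 2 * A 2" using r(1) by (simp add: A)
  have d4: "2 * d 4 = d 2 * A 2 * A 3" using r(2) by (simp add: A d3)
  have d5: "6 * d 5 = d 2 * A 2 * A 3 * A 4"
  proof -
    have "6 * d 5 = 2 * (3 * d 5)" by simp
    also have "\<dots> = (2 * d 4) * A 4" using r(3) by (simp add: A)
    finally show ?thesis by (simp add: d4)
  qed
  have d5': "6 * d 5 = d 2 * (6 * (A 2 * wt lam 2 (de - 3) - wt lam 3 (de - 2)))"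
  proof -
    have "6 * d 5 = 6 * (d 2 * A 2 * wt lam 2 (de - 3) - d 2 * wt lam 3 (de - 2))" using r(5) by (simp only: d3)
    then show ?thesis by (simp add: algebra_simps)
  qed
  have "d 2 * (A 2 * A 3 * A 4 - 6 * (A 2 * wt lam 2 (de - 3) - wt lam 3 (de - 2))) = 6 * d 5 - 6 * d 5"
    unfolding right_diff_distrib[of "d 2"] d5'[symmetric] by (simp add: d5 mult.assoc)
  then have "d 2 * - ((de - 2) * (de - 3) * (de - 4) * (2 * lam - de + 1) * ((2 * lam - de)\<^sup>2 + 2 * (2 * lam - de) - 3 * de)) = 0"
    unfolding relation_2_3_identity[symmetric] A by simp
  then show par: "(2 * lam - de)\<^sup>2 + 2 * (2 * lam - de) - 3 * de = 0"
    using d2 de u by (simp del: power2_diff)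
  have d6: "24 * d 6 = d 2 * A 2 * A 3 * A 4 * A 5"
  proof -
    have "24 * d 6 = 6 * (4 * d 6)" by simp
    also have "\<dots> = (6 * d 5) * A 5" using r(4) by (simp add: A)
    finally show ?thesis by (simp add: d5)
  qed
  \<comment> \<open>For \<open>p = 7\<close> there is no \<open>e\<^sub>6\<close> and no such relation, but \<open>d 6 = d 7 = 0\<close>.\<close>
  have 57: "5 * d 7 = d 6 * A 6"
  proof (cases "11 \<le> p")
    case True
    then show ?thesis using sol_rel_small(7)[OF d p] d1 by (simp add: A)
  next
    case False
    then have "p = 7" using prime_cases_7[OF p] by simp
    then show ?thesis using sol_supp[OF d, of 6] sol_supp[OF d, of 7] by simp
  qed
  have "120 * d 7 = 24 * (5 * d 7)" by simp
  also have "\<dots> = (24 * d 6) * A 6" by (simp add: 57)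
  finally have d7: "120 * d 7 = d 2 * A 2 * A 3 * A 4 * A 5 * A 6" by (simp add: d6)
  have "120 * (3 * d 7) = 20 * (6 * d 5) * wt lam 2 (de - 5) - 120 * d 2 * wt lam 5 (de - 2)"
    unfolding r(6) by (simp add: algebra_simps)
  then have "3 * (120 * d 7) = 20 * (6 * d 5) * wt lam 2 (de - 5) - 120 * d 2 * wt lam 5 (de - 2)" by simp
  then have "d 2 * (3 * A 2 * A 3 * A 4 * A 5 * A 6 - 20 * A 2 * A 3 * A 4 * wt lam 2 (de - 5) + 120 * wt lam 5 (de - 2)) = 0"
    unfolding d7 d5 by (simp add: algebra_simps)
  then have "d 2 * (3 * ((de - 2) * (de - 3) * (de - 4) * (de - 5) * (de - 6) * (2 * lam - de + 1) * de * (de - 1))) = 0"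
    unfolding relation_2_5_identity[OF par, symmetric] A .
  then show "de \<in> {1, 5, 6}" using d2 de u three_nonzero by auto
qed

text \<open>
  On the parabola of the previous lemma, \<open>\<delta> = 1, 5, 6\<close> give \<open>lam \<in> {1, -1}\<close>, \<open>lam \<in> {0, 4}\<close> and the quadratic
  condition; \<open>lam = -1\<close> is excluded, and so is \<open>lam = 4\<close>, as \<open>lam - \<delta> \<noteq> -1\<close>.
\<close>

lemma rigid_generic:
  assumes p: "7 \<le> p" and de: "de \<in> prime_field" "de \<notin> {0, 2, 3, 4}" and u: "2 * lam - de + 1 \<noteq> 0"
    and lam: "lam \<noteq> -1" "lam - de \<noteq> -1"
    and ne: "\<not> (de = 1 \<and> lam = 1)" "\<not> (de = 5 \<and> lam = 0)" "\<not> (de = 6 \<and> 2 * lam\<^sup>2 - 10 * lam + 3 = 0)"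
  shows "rigid lam de"
proof (rule rigidI_1[OF de(1)])
  show "wt lam 1 de \<noteq> 0" using de(2) u by (simp add: wt_explicit(1))
  fix d assume d: "sol lam de d" "d 1 = 0"
  show "d 2 = 0"
  proof (rule ccontr)
    assume d2: "d 2 \<noteq> 0"
    note g = parabola_relation[OF d(1) p d(2) d2 de(2) u]
    consider "de = 1" | "de = 5" | "de = 6" using g(2) by blast
    then show False
    proof cases
      case 1
      have "4 * ((lam - 1) * (lam + 1)) = 0" using g(1) by (simp add: 1 algebra_simps power2_eq_square)
      then show False using ne(1) lam(1) four_nonzero 1 by (auto simp: add_eq_0_iff2)
    next
      case 2
      have "4 * (lam * (lam - 4)) = 0" using g(1) by (simp add: 2 algebra_simps power2_eq_square)
      then have "lam = 0 \<or> lam = 4" using four_nonzero by auto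
      then show False using ne(2) lam(2) 2 by auto
    next
      case 3
      have "2 * (2 * lam\<^sup>2 - 10 * lam + 3) = 0" using g(1) by (simp add: 3 algebra_simps power2_eq_square)
      then have "2 * lam\<^sup>2 - 10 * lam + 3 = 0" using two_nonzero by (metis mult_eq_0_iff)
      then show False using ne(3) 3 by blast
    qed
  qed
qed

text \<open>
  For \<open>\<delta> = 2 lam + 1\<close> the inner solution starts with \<open>0\<close>, so \<open>d 2 = 0\<close> may be assumed. Degree \<open>5\<close> then leaves
  only \<open>lam = -2/3\<close>, and degree \<open>7\<close> leaves only \<open>p = 19\<close>, where \<open>(\<delta>, lam)\<close> satisfies the exceptional conditions.
\<close>

lemma rigid_special:
  assumes p: "7 \<le> p" and de: "de \<in> prime_field" "de \<notin> {0, 2, 3, 4}" and u: "de = 2 * lam + 1"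
    and lam: "lam \<noteq> -1" "lam - de \<noteq> -1" and ne: "\<not> (de = 6 \<and> 2 * lam\<^sup>2 - 10 * lam + 3 = 0)"
  shows "rigid lam de"
proof (rule rigidI_2[OF de(1)])
  show a1: "wt lam 1 de = 0" by (simp add: wt_explicit(1) u)
  show "wt lam 2 de \<noteq> 0" using inn_nonzero[OF _ lam] a1 de(2) by auto
  fix d assume d: "sol lam de d" "d 2 = 0"
  note r = sol_rel_small(1-6)[OF d(1) p, unfolded d(2) mult_zero_left diff_zero]
  have lam0: "lam \<noteq> 0" using lam(2) u by auto
  have lam1: "lam + 1 \<noteq> 0" using lam(1) by (simp add: add_eq_0_iff2)
  have "de \<noteq> 3" "de \<noteq> 2" "de \<noteq> 4" using de(2) by auto
  then have l: "lam - 1 \<noteq> 0" "2 * lam - 1 \<noteq> 0" "2 * lam - 3 \<noteq> 0"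
    unfolding u by (auto simp: algebra_simps)
  note nz = lam0 lam1 l
  have w: "wt lam 2 (de - 1) = 2 * lam * (2 * lam - 1) * (lam + 2)" "wt lam 1 (de - 3) = - (2 * lam - 2) * 3"
    "wt lam 3 (de - 1) = - (2 * lam) * (2 * lam - 1) * (2 * lam - 2) * (2 * lam + 3)" "wt lam 1 (de - 4) = - (2 * lam - 3) * 4"
    "wt lam 4 (de - 1) = 2 * lam * (2 * lam - 1) * (2 * lam - 2) * (2 * lam - 3) * (3 * lam + 4)"
    "wt lam 2 (de - 3) = (2 * lam - 2) * (2 * lam - 3) * (lam + 4)"
    unfolding wt_explicit u by (simp_all add: algebra_simps)
  define s where "s = d 1"
  have d3: "d 3 = - s * (2 * lam * (2 * lam - 1) * (lam + 2))" using r(1) d(2) by (simp add: s_def w)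
  have d4: "d 4 = s * (2 * lam * (2 * lam - 1) * (2 * lam - 2)) * (5 * lam + 9) / 2"
    using r(2) two_nonzero unfolding d3 w by (simp add: s_def field_simps)
  have five1: "6 * d 5 = - s * (2 * lam * (2 * lam - 1) * (2 * lam - 2) * (2 * lam - 3)) * (26 * lam + 44)"
  proof -
    have "6 * d 5 = 2 * (3 * d 5)" by simp
    also have "\<dots> = - s * (2 * lam * (2 * lam - 1) * (2 * lam - 2) * (2 * lam - 3)) * (26 * lam + 44)"
      unfolding r(3) d4 w using two_nonzero by (simp add: s_def field_simps)
    finally show ?thesis .
  qed
  have five2: "6 * d 5 = - s * (2 * lam * (2 * lam - 1) * (2 * lam - 2) * (2 * lam - 3)) * (6 * (lam + 2) * (lam + 4))"
    unfolding r(5) d3 w using d(2) by (simp add: algebra_simps)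
  have "s * (2 * lam * (2 * lam - 1) * (2 * lam - 2) * (2 * lam - 3)) * (2 * (lam + 1) * (3 * lam + 2)) = 0"
  proof -
    have "(26 * lam + 44) - 6 * (lam + 2) * (lam + 4) = - (2 * (lam + 1) * (3 * lam + 2))"
      by (simp add: algebra_simps)
    then have "s * (2 * lam * (2 * lam - 1) * (2 * lam - 2) * (2 * lam - 3)) * - (2 * (lam + 1) * (3 * lam + 2)) = 0"
      using five1 five2 by (simp add: algebra_simps)
    then show ?thesis by simp
  qed
  moreover have "2 * lam - 2 \<noteq> 0" using l(1) two_nonzero by (simp add: right_diff_distrib[symmetric, of 2 _ 1, simplified])
  moreover have "2 * lam + 2 \<noteq> 0"
  proof -
    have "2 * lam + 2 = 2 * (lam + 1)" by simp
    then show ?thesis using lam1 two_nonzero by (metis mult_eq_0_iff)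
  qed
  ultimately have "s = 0 \<or> 3 * lam + 2 = 0" using nz two_nonzero by simp
  moreover have "s = 0" if 3: "3 * lam + 2 = 0"
  proof (rule ccontr)
    assume s0: "s \<noteq> 0"
    have e: "6 * lam = -4" "3 * de = -1" "9 * lam = -6" "18 * lam = -12" "21 * lam = -14"
    proof -
      have t: "3 * lam = -2" using 3 by (simp add: eq_neg_iff_add_eq_0)
      have "6 * lam = 2 * (3 * lam)" "9 * lam = 3 * (3 * lam)" "18 * lam = 6 * (3 * lam)" "21 * lam = 7 * (3 * lam)"
        by simp_all
      then show "6 * lam = -4" "9 * lam = -6" "18 * lam = -12" "21 * lam = -14" unfolding t by simp_all
      then show "3 * de = -1" unfolding u by (simp add: distrib_left)
    qed
    have c: "(3::'k) * (de - 2) = -7" "3 * (de - 4) = (-13::'k)" "3 * (de - 6) = (-19::'k)"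
      using e(2) by (simp_all add: right_diff_distrib)
    have z: "de = x" if "3 * (de - x) = 0" for x
      using that three_nonzero by (metis mult_eq_0_iff eq_iff_diff_eq_0)
    \<comment> \<open>\<open>\<delta> = -1/3\<close> is \<open>2\<close> modulo \<open>7\<close>, \<open>4\<close> modulo \<open>13\<close> and \<open>6\<close> modulo \<open>19\<close>.\<close>
    have p7: "p \<noteq> 7"
    proof
      assume "p = 7"
      then have "(7::'k) = 0" using of_nat_p by simp
      then have "3 * (de - 2) = 0" unfolding c by simp
      then show False using z de(2) by blast
    qed
    have p13: "p \<noteq> 13"
    proof
      assume "p = 13"
      then have "(13::'k) = 0" using of_nat_p by simp
      then have "3 * (de - 4) = 0" unfolding c by simp
      then show False using z de(2) by blast
    qed
    have p19: "de = 6" if "p = 19"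
    proof -
      have "(19::'k) = 0" using that of_nat_p by simp
      then have "3 * (de - 6) = 0" unfolding c by simp
      then show ?thesis by (rule z)
    qed
    have p11: "11 \<le> p" using prime_cases_7[OF p] p7 by simp
    \<comment> \<open>Powers of \<open>3\<close> clear the denominators of \<open>lam = -2/3\<close> and \<open>\<delta> = -1/3\<close>.\<close>
    have W: "9 * wt lam 1 (de - 5) = - (3 * de - 15) * (6 * lam - 3 * de + 18)"
      "9 * wt lam 1 (de - 6) = - (3 * de - 18) * (6 * lam - 3 * de + 21)"
      "27 * wt lam 2 (de - 5) = (3 * de - 15) * (3 * de - 18) * (9 * lam - 3 * de + 21)"
      "729 * wt lam 5 (de - 1) = - (3 * de - 3) * (3 * de - 6) * (3 * de - 9) * (3 * de - 12) * (3 * de - 15) * (18 * lam - 3 * de + 18)"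
      "2187 * wt lam 6 (de - 1) = (3 * de - 3) * (3 * de - 6) * (3 * de - 9) * (3 * de - 12) * (3 * de - 15) * (3 * de - 18) * (21 * lam - 3 * de + 21)"
      unfolding wt_explicit by (simp_all add: algebra_simps)
    have W': "9 * wt lam 1 (de - 5) = 240" "9 * wt lam 1 (de - 6) = 342" "27 * wt lam 2 (de - 5) = 4864"
      "729 * wt lam 5 (de - 1) = 407680" "2187 * wt lam 6 (de - 1) = 8852480"
      unfolding W e by simp_all
    have d5: "729 * d 5 = - 145600 * s"
    proof -
      have "729 * d 5 = - s * ((6 * lam) * (6 * lam - 3) * (6 * lam - 6) * (6 * lam - 9) * (3 * lam + 6) * (3 * lam + 12))"
        unfolding r(5) d3 w using d(2) by (simp add: algebra_simps)
      also have "3 * lam + 12 = (3 * lam + 2) + 10" by simp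
      also have "3 * lam + 6 = (3 * lam + 2) + 4" by simp
      finally show ?thesis unfolding e 3 by simp
    qed
    have d6: "26244 * d 6 = - 38613120 * s"
    proof -
      have "26244 * d 6 = 6561 * (4 * d 6)" by simp
      also have "\<dots> = (729 * d 5) * (9 * wt lam 1 (de - 5)) - 9 * s * (729 * wt lam 5 (de - 1))"
        unfolding r(4) by (simp add: s_def algebra_simps)
      finally show ?thesis unfolding W' d5 by simp
    qed
    have d7: "1180980 * d 7 = - 14161754880 * s"
    proof -
      have "1180980 * d 7 = 236196 * (5 * d 7)" by simp
      also have "\<dots> = (26244 * d 6) * (9 * wt lam 1 (de - 6)) - 108 * s * (2187 * wt lam 6 (de - 1))"
        unfolding sol_rel_small(7)[OF d(1) p p11] by (simp add: s_def algebra_simps)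
      finally show ?thesis unfolding W' d6 by simp
    qed
    have d7b: "1180980 * d 7 = - 14163968000 * s"
    proof -
      have "1180980 * d 7 = 20 * 19683 * (3 * d 7)" by simp
      also have "\<dots> = 20 * ((729 * d 5) * (27 * wt lam 2 (de - 5)))"
        unfolding r(6) using d(2) by simp
      finally show ?thesis unfolding W' d5 by simp
    qed
    \<comment> \<open>The values of \<open>d 7\<close> from \<open>[e\<^sub>1, e\<^sub>6]\<close> and from \<open>[e\<^sub>2, e\<^sub>5]\<close> must agree.\<close>
    have "2213120 * s = - 14161754880 * s - - 14163968000 * s"
      unfolding left_diff_distrib[symmetric] by simp
    also have "\<dots> = 0" unfolding d7[symmetric] d7b[symmetric] by (rule diff_self)
    finally have "2213120 * s = 0" .
    then have "p dvd 2213120" using s0 numeral_zero_iff by (metis mult_eq_0_iff)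
    moreover have "(2213120::nat) = 2 ^ 8 * 5 * 7 * 13 * 19" by simp
    ultimately have "p dvd 2 ^ 8 * 5 * 7 * 13 * 19" by metis
    then have "p dvd 2 \<or> p dvd 5 \<or> p dvd 7 \<or> p dvd 13 \<or> p dvd 19"
      using prime_p by (metis prime_dvd_mult_iff prime_dvd_power)
    moreover have "p dvd q \<Longrightarrow> p = q" if "prime q" for q :: nat
      using that prime_p primes_dvd_imp_eq by blast
    moreover have "prime (13::nat)" "prime (19::nat)" by simp_all
    ultimately have "p = 19" using p11 p13 dvd_imp_le[of p 2] dvd_imp_le[of p 5] dvd_imp_le[of p 7] by auto
    then have de6: "de = 6" by (rule p19)
    have "9 * (2 * lam\<^sup>2 - 10 * lam + 3) = 2 * (3 * lam) * (3 * lam) - 30 * (3 * lam) + 27"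
      by (simp add: algebra_simps power2_eq_square)
    also have "3 * lam = -2" using 3 by (simp add: eq_neg_iff_add_eq_0)
    also have "2 * -2 * -2 - 30 * -2 + 27 = (5 * 19 :: 'k)" by simp
    also have "(19::'k) = 0" using \<open>p = 19\<close> of_nat_p by simp
    finally have "9 * (2 * lam\<^sup>2 - 10 * lam + 3) = 0" by simp
    moreover have "(9::'k) = 3 * 3" by simp
    ultimately have "2 * lam\<^sup>2 - 10 * lam + 3 = 0" using three_nonzero by (metis mult_eq_0_iff)
    then show False using ne de6 by blast
  qed
  ultimately show "d 1 = 0" by (auto simp: s_def)
qed

text \<open>
  For \<open>\<delta> = 0\<close> and \<open>lam \<noteq> 0, -1\<close>, degree \<open>5\<close> fixes the ratio of \<open>d 1\<close> and \<open>d 2\<close>, so that \<open>d\<close> is a multiple of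
  the sequence \<open>D\<close> of \<open>dual_inner_rel\<close>. The relation for \<open>[e\<^sub>1, e\<^sub>p\<^sub>-\<^sub>2] = 0\<close> would require \<open>D (p - 1) = 0\<close>, but
  \<open>D (p - 1) = -(p - 2)!\<close>.
\<close>

lemma rigid_0:
  assumes p: "7 \<le> p" and lam: "lam \<noteq> 0" "lam \<noteq> -1" shows "rigid (lam::'k) 0"
  unfolding rigid_def
proof (intro allI impI)
  fix d assume d: "sol lam 0 d"
  note r = sol_rel_small(1-6)[OF d p]
  define D where "D n = fact_k (n - 1) * ((of_nat n + 1) * lam + of_nat n)" for n
  have key: "(2 * lam + 1) * d 2 = (3 * lam + 2) * d 1"
  proof -
    define x y where "x = d 1" and "y = d 2"
    have w: "wt lam 1 (0 - 2) = 2 * (2 * lam + 3)" "wt lam 2 (0 - 1) = 2 * (3 * lam + 3)"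
      "wt lam 1 (0 - 3) = 3 * (2 * lam + 4)" "wt lam 3 (0 - 1) = 6 * (4 * lam + 4)"
      "wt lam 1 (0 - 4) = 4 * (2 * lam + 5)" "wt lam 4 (0 - 1) = 24 * (5 * lam + 5)"
      "wt lam 2 (0 - 3) = 12 * (3 * lam + 5)" "wt lam 3 (0 - 2) = 24 * (4 * lam + 5)"
      unfolding wt_explicit by (simp_all add: algebra_simps)
    have d3: "d 3 = y * (2 * (2 * lam + 3)) - x * (2 * (3 * lam + 3))" using r(1) by (simp only: w x_def y_def)
    have "6 * d 5 = 2 * (3 * d 5)" by simp
    also have "\<dots> = (2 * d 4) * (4 * (2 * lam + 5)) - 2 * x * (24 * (5 * lam + 5))"
      unfolding r(3) w by (simp add: x_def algebra_simps)
    also have "\<dots> = (d 3 * (3 * (2 * lam + 4)) - x * (6 * (4 * lam + 4))) * (4 * (2 * lam + 5)) - 2 * x * (24 * (5 * lam + 5))"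
      unfolding r(2) w by (simp add: x_def)
    finally have 1: "6 * d 5 = \<dots>" .
    have 2: "d 5 = d 3 * (12 * (3 * lam + 5)) - y * (24 * (4 * lam + 5))" using r(5) by (simp only: w y_def)
    have "(6 * 16) * (lam * (lam + 1)) * ((2 * lam + 1) * y - (3 * lam + 2) * x) = 0"
      using 1 unfolding 2 d3 by (simp add: algebra_simps)
    moreover have "lam + 1 \<noteq> 0" using lam(2) by (simp add: add_eq_0_iff2)
    moreover have "(96::'k) = 4 * 4 * 6" by simp
    then have "(96::'k) \<noteq> 0" using four_nonzero five_nonzero(2)[OF p] by (metis mult_eq_0_iff)
    ultimately show ?thesis using lam(1) by (simp add: x_def y_def)
  qed
  obtain t where t: "d 1 = t * D 1" "d 2 = t * D 2"
  proof (cases "2 * lam + 1 = 0")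
    case True
    have "3 * lam + 2 \<noteq> 0"
    proof
      assume "3 * lam + 2 = 0"
      then have "2 * (3 * lam + 2) - 3 * (2 * lam + 1) = 0" using True by simp
      then show False by (simp add: algebra_simps)
    qed
    then have "d 1 = 0" using key True by simp
    then show thesis using that[of "d 2 / (3 * lam + 2)"] \<open>3 * lam + 2 \<noteq> 0\<close> True
      by (simp add: D_def fact_k_def)
  next
    case False
    then show thesis using that[of "d 1 / (2 * lam + 1)"] key by (simp add: D_def fact_k_def field_simps)
  qed
  define e where "e n = d n - t * D n" for n
  have rel: "(of_nat (Suc j) - of_nat (Suc i)) * (t * D (Suc i + Suc j)) =
    t * D (Suc j) * wt lam (Suc i) (- of_nat (Suc j)) - t * D (Suc i) * wt lam (Suc j) (- of_nat (Suc i))" for i j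
    using arg_cong[OF dual_inner_rel[of j i lam], of "\<lambda>x. t * x"] unfolding D_def
    by (simp only: right_diff_distrib mult.assoc mult.left_commute)
  have e0: "e n = 0" if n: "1 \<le> n" "n \<le> p - 2" for n
  proof (rule sol_determined_aux[where de = 0 and lam = lam])
    show "e 1 = 0" "e 2 = 0" using t by (simp_all add: e_def)
    fix n assume n: "3 \<le> n" "n \<le> p - 2"
    define m where "m = n - 2"
    have m: "n = Suc (Suc m)" using n by (simp add: m_def)
    have dr: "(of_nat (n - 1) - of_nat 1) * d n = d (n - 1) * wt lam 1 (0 - of_nat (n - 1)) - d 1 * wt lam (n - 1) (0 - of_nat 1)"
      using sol_rel[OF d, of 1 "n - 1"] n by simp
    show "(of_nat (n - 1) - of_nat 1) * e n = e (n - 1) * wt lam 1 (0 - of_nat (n - 1)) - e 1 * wt lam (n - 1) (0 - of_nat 1)"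
      using dr rel[of m 0, folded One_nat_def] unfolding e_def right_diff_distrib left_diff_distrib
      by (simp add: m mult.assoc plus_1_eq_Suc)
  qed (use n in auto)
  have dn: "d n = t * D n" if "1 \<le> n" "n \<le> p - 2" for n using e0[OF that] by (simp add: e_def)
  define m where "m = p - 3"
  have m: "p - 2 = Suc m" "p - 1 = Suc (Suc m)" using p5 by (simp_all add: m_def)
  have "(of_nat (p - 2) - of_nat 1) * d (1 + (p - 2)) = d (p - 2) * wt lam 1 (0 - of_nat (p - 2)) - d 1 * wt lam (p - 2) (0 - of_nat 1)"
    by (rule sol_rel[OF d]) (use p5 in auto)
  moreover have "1 + (p - 2) \<notin> {1..p-2}" by simp
  then have "d (1 + (p - 2)) = 0" by (rule sol_supp[OF d])
  ultimately have "0 = d (p - 2) * wt lam 1 (0 - of_nat (p - 2)) - d 1 * wt lam (p - 2) (0 - of_nat 1)" by simp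
  also have "\<dots> = t * D (p - 2) * wt lam 1 (0 - of_nat (p - 2)) - t * D 1 * wt lam (p - 2) (0 - of_nat 1)"
    using p5 by (simp add: dn)
  also have "\<dots> = (of_nat (p - 2) - of_nat 1) * (t * D (p - 1))"
    using rel[of m 0, folded One_nat_def] unfolding m by (simp add: plus_1_eq_Suc)
  finally have "t * D (p - 1) = 0" using nat_diff_nonzero[of 1 "p - 2"] p5 by simp
  moreover have "D (p - 1) = - fact_k (p - 1 - 1)" unfolding D_def of_nat_top by simp
  ultimately have "t = 0" using fact_k_less_p[of "p - 1 - 1"] p5 by simp
  then have "d n = 0 * inn lam 0 n" for n
    using dn[of n] sol_supp[OF d, of n] by (cases "n \<in> {1..p-2}") auto
  then show "\<exists>c. \<forall>n. d n = c * inn lam 0 n" by blast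
qed

lemma of_nat_not_minus_one: "l \<le> p - 2 \<Longrightarrow> of_nat l \<noteq> (-1 :: 'k)"
  using of_nat_nonzero[of "Suc l"] p5 by (auto simp: eq_neg_iff_add_eq_0 add.commute)

section \<open>The list of weights\<close>

text \<open>
  For \<open>p = 5\<close> the unknowns are \<open>d 1, d 2, d 3\<close>, and the second and third relation have degrees \<open>4\<close> and \<open>5\<close>,
  where \<open>d\<close> is zero; these are finitely many explicit linear systems.
\<close>

lemma sol_rel_5:
  assumes p: "p = 5" and d: "sol lam de d"
  shows "d 3 = d 2 * wt lam 1 (de - 2) - d 1 * wt lam 2 (de - 1)"
    "0 = d 3 * wt lam 1 (de - 3) - d 1 * wt lam 3 (de - 1)"
    "0 = d 3 * wt lam 2 (de - 3) - d 2 * wt lam 3 (de - 2)"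
proof -
  have "d 4 = 0" "d 5 = 0" using sol_supp[OF d] p by auto
  then show "d 3 = d 2 * wt lam 1 (de - 2) - d 1 * wt lam 2 (de - 1)"
    "0 = d 3 * wt lam 1 (de - 3) - d 1 * wt lam 3 (de - 1)"
    "0 = d 3 * wt lam 2 (de - 3) - d 2 * wt lam 3 (de - 2)"
    using sol_rel[OF d, of 1 2] sol_rel[OF d, of 1 3] sol_rel[OF d, of 2 3] p by simp_all
qed

lemma rigid_5_I:
  assumes p: "p = 5" and de: "de \<in> prime_field" and a1: "wt lam 1 de \<noteq> 0"
    and c: "wt lam 1 (de - 2) * wt lam 1 (de - 3) \<noteq> 0"
  shows "rigid lam de"
proof (rule rigidI_1[OF de a1])
  fix d assume d: "sol lam de d" "d 1 = 0"
  then have "d 2 * (wt lam 1 (de - 2) * wt lam 1 (de - 3)) = 0"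
    using sol_rel_5(1,2)[OF p d(1)] by (simp add: mult.assoc)
  then show "d 2 = 0" using c by (metis mult_eq_0_iff)
qed

lemma rigid_5_0:
  assumes p: "p = 5"
    and c: "- wt lam 2 (-1) * wt lam 1 (-3) - wt lam 3 (-1) = \<alpha>" "wt lam 1 (-2) * wt lam 1 (-3) = \<beta>"
      "- wt lam 2 (-1) * wt lam 2 (-3) = \<gamma>" "wt lam 1 (-2) * wt lam 2 (-3) - wt lam 3 (-2) = \<epsilon>"
    and \<alpha>: "\<alpha> \<noteq> 0" and det: "\<alpha> * \<epsilon> - \<beta> * \<gamma> \<noteq> 0"
  shows "rigid lam 0"
  unfolding rigid_def
proof (intro allI impI)
  fix d assume d: "sol lam 0 d"
  note r = sol_rel_5[OF p d, unfolded diff_0]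
  have 1: "\<alpha> * d 1 + \<beta> * d 2 = 0" using r(2)[unfolded r(1)] unfolding c[symmetric] by (simp add: algebra_simps)
  have 2: "\<gamma> * d 1 + \<epsilon> * d 2 = 0" using r(3)[unfolded r(1)] unfolding c[symmetric] by (simp add: algebra_simps)
  have "(\<alpha> * \<epsilon> - \<beta> * \<gamma>) * d 2 = \<alpha> * (\<gamma> * d 1 + \<epsilon> * d 2) - \<gamma> * (\<alpha> * d 1 + \<beta> * d 2)"
    by (simp add: algebra_simps)
  then have d2: "d 2 = 0" unfolding 1 2 using det by simp
  then have "d 1 = 0" using 1 \<alpha> by simp
  then have "d n = 0" for n using sol_determined[OF d _ d2] by blast
  then have "\<forall>n. d n = 0 * inn lam 0 n" by simp
  then show "\<exists>c. \<forall>n. d n = c * inn lam 0 n" ..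
qed

lemma flexible_5_m1:
  assumes p: "p = 5" shows "flexible (0::'k) (-1)"
proof (rule flexible_if_free)
  show "(-1::'k) \<in> prime_field" using prime_field_closed(1)[of "-1"] by simp
  show "0 - (-1) \<noteq> (-1::'k)" using two_nonzero by (simp add: eq_neg_iff_add_eq_0)
  have five: "(20::'k) = 0" "(120::'k) = 0" "(360::'k) = 0" using numeral_zero_iff p by simp_all
  show "\<exists>d. sol 0 (-1) d \<and> d 1 = x \<and> d 2 = y" for x y :: 'k
  proof (intro exI conjI)
    define z where "z = y * wt 0 1 (-1 - 2) - x * wt 0 2 (-1 - 1)"
    let ?d = "\<lambda>n::nat. if n = 1 then x else if n = 2 then y else if n = 3 then z else 0"
    show "sol 0 (-1) ?d"
      unfolding sol_def
    proof (intro conjI allI impI)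
      fix i j assume "(1::nat) \<le> i" "i < j" "j \<le> p - 2"
      then have "(i = 1 \<and> j = 2) \<or> (i = 1 \<and> j = 3) \<or> (i = 2 \<and> j = 3)" using p by auto
      then show "(of_nat j - of_nat i) * ?d (i + j) = ?d j * wt 0 i (-1 - of_nat j) - ?d i * wt 0 j (-1 - of_nat i)"
        by (elim disjE) (auto simp: z_def, auto simp: wt_explicit five)
    qed (use p in auto)
  qed simp_all
qed simp_all

theorem classification_5:
  fixes l m :: nat
  defines "lam \<equiv> of_nat l :: 'k" and "de \<equiv> of_nat l - of_nat m :: 'k"
  assumes p: "p = 5" and l: "l \<le> p - 2" and m: "m \<le> p - 2"
  shows "de = 2 \<or> de = 3 \<or> (m, l) \<in> {(0, 0), (1, 0), (0, 1)} \<Longrightarrow> flexible lam de"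
    "\<not> (de = 2 \<or> de = 3 \<or> (m, l) \<in> {(0, 0), (1, 0), (0, 1)}) \<Longrightarrow> rigid lam de"
proof -
  have lam: "lam \<noteq> -1" "lam - de \<noteq> -1"
    using of_nat_not_minus_one[OF l] of_nat_not_minus_one[OF m] by (simp_all add: lam_def de_def)
  show "flexible lam de" if "de = 2 \<or> de = 3 \<or> (m, l) \<in> {(0, 0), (1, 0), (0, 1)}"
    using that
  proof (elim disjE)
    assume "de = 2" then show ?thesis using flexible_234[of 2 lam] lam p by simp
  next
    assume "de = 3" then show ?thesis using flexible_234[of 3 lam] lam p by simp
  next
    assume "(m, l) \<in> {(0, 0), (1, 0), (0, 1)}"
    then show ?thesis using flexible_00 flexible_11 flexible_5_m1[OF p] by (auto simp: lam_def de_def)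
  qed
  assume ne: "\<not> (de = 2 \<or> de = 3 \<or> (m, l) \<in> {(0, 0), (1, 0), (0, 1)})"
  have five: "(5::'k) = 0" using numeral_zero_iff p by simp
  have m23: "(-2::'k) = 3" "(-3::'k) = 2" using five by (simp_all add: neg_eq_iff_add_eq_0)
  have pf: "de \<in> prime_field" by (simp add: de_def prime_field_closed)
  have "l \<in> {0, 1, 2, 3}" "m \<in> {0, 1, 2, 3}" using l m p by auto
  then have "(m, l) \<in> {(1, 1), (2, 2), (3, 3), (1, 2), (2, 3), (2, 1), (3, 2)}"
    using ne m23 by (auto simp: de_def)
  then consider "l = 1" "m = 1" | "l = 2" "m = 2" | "l = 3" "m = 3" | "l = 2" "m = 1" | "l = 3" "m = 2"
    | "l = 1" "m = 2" | "l = 2" "m = 3" by auto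
  then show "rigid lam de"
  proof cases
    case 1
    then have "rigid lam 0"
      by (intro rigid_5_0[OF p, where \<alpha> = "-264" and \<beta> = 180 and \<gamma> = "-1152" and \<epsilon> = 744])
        (simp_all add: lam_def wt_explicit numeral_zero_iff p)
    then show ?thesis using 1 by (simp add: de_def)
  next
    case 2
    then have "rigid lam 0"
      by (intro rigid_5_0[OF p, where \<alpha> = "-504" and \<beta> = 336 and \<gamma> = "-2376" and \<epsilon> = 1536])
        (simp_all add: lam_def wt_explicit numeral_zero_iff p)
    then show ?thesis using 2 by (simp add: de_def)
  next
    case 3
    then have "rigid lam 0"
      by (intro rigid_5_0[OF p, where \<alpha> = "-816" and \<beta> = 540 and \<gamma> = "-4032" and \<epsilon> = 2616])
        (simp_all add: lam_def wt_explicit numeral_zero_iff p)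
    then show ?thesis using 3 by (simp add: de_def)
  qed (rule rigid_5_I[OF p pf]; simp add: lam_def de_def wt_explicit numeral_zero_iff p)+
qed

theorem classification_7:
  fixes l m :: nat
  defines "lam \<equiv> of_nat l :: 'k" and "de \<equiv> of_nat l - of_nat m :: 'k"
  assumes p: "7 \<le> p" and l: "l \<le> p - 2" and m: "m \<le> p - 2"
  defines "exc \<equiv> de = 2 \<or> de = 3 \<or> de = 4 \<or> (m = 0 \<and> l = 0) \<or> (m = 0 \<and> l = 1) \<or>
    (of_nat m = (-5 :: 'k) \<and> l = 0) \<or> (2 * lam\<^sup>2 - 10 * lam + 3 = 0 \<and> de = 6)"
  shows "exc \<Longrightarrow> flexible lam de" "\<not> exc \<Longrightarrow> rigid lam de"
proof -
  have lam: "lam \<noteq> -1" "lam - de \<noteq> -1"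
    using of_nat_not_minus_one[OF l] of_nat_not_minus_one[OF m] by (simp_all add: lam_def de_def)
  have pf: "de \<in> prime_field" by (simp add: de_def prime_field_closed)
  have inj: "(of_nat l :: 'k) = of_nat n \<longleftrightarrow> l = n" "(of_nat m :: 'k) = of_nat n \<longleftrightarrow> m = n" if "n < p" for n
  proof -
    have "l < p" "m < p" using l m p by auto
    then show "(of_nat l :: 'k) = of_nat n \<longleftrightarrow> l = n" "(of_nat m :: 'k) = of_nat n \<longleftrightarrow> m = n"
      using of_nat_inj that by blast+
  qed
  show "flexible lam de" if exc
    using that unfolding exc_def
  proof (elim disjE)
    assume "de = 2" then show ?thesis using flexible_234[of 2 lam] lam p by simp
  next
    assume "de = 3" then show ?thesis using flexible_234[of 3 lam] lam p by simp
  next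
    assume "de = 4" then show ?thesis using flexible_234[of 4 lam] lam p by simp
  next
    assume "m = 0 \<and> l = 0" then show ?thesis using flexible_00 by (simp add: lam_def de_def)
  next
    assume "m = 0 \<and> l = 1" then show ?thesis using flexible_11 by (simp add: lam_def de_def)
  next
    assume "of_nat m = (-5 :: 'k) \<and> l = 0" then show ?thesis using flexible_5[OF p] by (simp add: lam_def de_def)
  next
    assume q: "2 * lam\<^sup>2 - 10 * lam + 3 = 0 \<and> de = 6"
    have "p \<noteq> 7"
    proof
      assume p7: "p = 7"
      have "l \<in> {0, 1, 2, 3, 4, 5}" using l p7 by auto
      moreover have "(3::'k) \<noteq> 0" "(5::'k) \<noteq> 0" "(9::'k) \<noteq> 0" using numeral_zero_iff p7 by simp_all
      ultimately show False using q by (auto simp: lam_def)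
    qed
    then show ?thesis using flexible_6[of lam] q lam p by simp
  qed
  assume ne: "\<not> exc"
  show "rigid lam de"
  proof (cases "de = 0")
    case True
    then have "l = m" using of_nat_inj[of l m] l m p by (simp add: de_def)
    then have "lam \<noteq> 0" using ne inj(1)[of 0] p by (auto simp: exc_def lam_def)
    then show ?thesis using rigid_0[OF p _ lam(1)] True by simp
  next
    case False
    have de: "de \<notin> {0, 2, 3, 4}" and ne6: "\<not> (de = 6 \<and> 2 * lam\<^sup>2 - 10 * lam + 3 = 0)"
      using ne False by (auto simp: exc_def)
    show ?thesis
    proof (cases "de = 2 * lam + 1")
      case True
      then show ?thesis by (rule rigid_special[OF p pf de _ lam ne6])
    next
      case u: False
      have "\<not> (de = 1 \<and> lam = 1)"
      proof
        assume "de = 1 \<and> lam = 1"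
        then have "of_nat l = (of_nat 1 :: 'k)" "of_nat m = (of_nat 0 :: 'k)" by (auto simp: lam_def de_def)
        moreover have "1 < p" "0 < p" using p by auto
        ultimately have "l = 1" "m = 0" using inj(1)[of 1] inj(2)[of 0] by blast+
        then show False using ne by (simp add: exc_def)
      qed
      moreover have "\<not> (de = 5 \<and> lam = 0)"
      proof
        assume a: "de = 5 \<and> lam = 0"
        then have "of_nat l = (of_nat 0 :: 'k)" by (auto simp: lam_def)
        then have "l = 0" using inj(1)[of 0] p by simp
        moreover have "of_nat m = (-5 :: 'k)" using a \<open>l = 0\<close> by (simp add: de_def) (metis minus_minus)
        ultimately show False using ne by (simp add: exc_def)
      qed
      moreover have "2 * lam - de + 1 \<noteq> 0" using u by (auto simp: algebra_simps)
      ultimately show ?thesis by (intro rigid_generic[OF p pf de _ lam _ _ ne6])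
    qed
  qed
qed

end

declare One_nat_def [simp]

section \<open>Jacobson's formula for the p-th power of a sum\<close>

definition ad :: "'r::ring \<Rightarrow> 'r \<Rightarrow> 'r" where "ad x y = x * y - y * x"

text \<open>
  Left and right multiplication by \<open>x\<close> commute, so this is the binomial theorem for their difference.
\<close>

lemma ad_pow:
  fixes x y :: "'r::ring_1"
  shows "(ad x ^^ n) y = (\<Sum>k\<le>n. of_int ((-1) ^ k * int (n choose k)) * (x ^ (n - k) * y * x ^ k))"
proof (induction n)
  case (Suc n)
  define c where "c n k = (-1) ^ k * int (n choose k)" for n k
  define T where "T n k = x ^ (n - k) * y * x ^ k" for n k
  have cc: "c n (Suc k) - c n k = c (Suc n) (Suc k)" for k by (simp add: c_def algebra_simps)
  have L: "x * (of_int z * T n k) = of_int z * T (Suc n) k" if "k \<le> n" for z k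
  proof -
    have "x * (of_int z * T n k) = of_int z * (x * T n k)"
      by (metis mult.assoc mult_of_int_commute)
    then show ?thesis using that by (simp add: T_def Suc_diff_le mult.assoc)
  qed
  have R: "(of_int z * T n k) * x = of_int z * T (Suc n) (Suc k)" for z k
    by (simp add: T_def mult.assoc power_commutes)
  have "(ad x ^^ Suc n) y = x * (\<Sum>k\<le>n. of_int (c n k) * T n k) - (\<Sum>k\<le>n. of_int (c n k) * T n k) * x"
    by (simp add: Suc ad_def c_def T_def)
  also have "x * (\<Sum>k\<le>n. of_int (c n k) * T n k) = (\<Sum>k\<le>n. of_int (c n k) * T (Suc n) k)"
    unfolding sum_distrib_left by (intro sum.cong refl L) auto
  also have "\<dots> = (\<Sum>k\<le>Suc n. of_int (c n k) * T (Suc n) k)"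
    by (simp add: c_def binomial_eq_0)
  also have "\<dots> = T (Suc n) 0 + (\<Sum>k\<le>n. of_int (c n (Suc k)) * T (Suc n) (Suc k))"
    by (subst sum.atMost_Suc_shift) (simp add: c_def)
  also have "(\<Sum>k\<le>n. of_int (c n k) * T n k) * x = (\<Sum>k\<le>n. of_int (c n k) * T (Suc n) (Suc k))"
    unfolding sum_distrib_right R ..
  also have "T (Suc n) 0 + (\<Sum>k\<le>n. of_int (c n (Suc k)) * T (Suc n) (Suc k)) - \<dots>
      = T (Suc n) 0 + (\<Sum>k\<le>n. of_int (c (Suc n) (Suc k)) * T (Suc n) (Suc k))"
    unfolding add_diff_eq[symmetric] sum_subtractf[symmetric] left_diff_distrib[symmetric]
      of_int_diff[symmetric] cc ..
  also have "\<dots> = (\<Sum>k\<le>Suc n. of_int (c (Suc n) k) * T (Suc n) k)"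
    by (subst sum.atMost_Suc_shift) (simp add: c_def)
  finally show ?case by (simp only: c_def T_def)
qed simp

lemma of_nat_dvd_zero: "(of_nat p :: 'r::ring_1) = 0 \<Longrightarrow> p dvd n \<Longrightarrow> (of_nat n :: 'r) = 0"
  by (auto elim!: dvdE)

text \<open>
  \<open>(p - 1) choose k\<close> is \<open>(-1)\<^sup>k\<close> modulo \<open>p\<close>, by Pascal's rule, as \<open>p\<close> divides \<open>p choose (k + 1)\<close>.
\<close>

lemma choose_prime_minus_one:
  assumes p: "prime p" "(of_nat p :: 'r::ring_1) = 0" and "k \<le> p - 1"
  shows "(of_int ((-1) ^ k * int ((p - 1) choose k)) :: 'r) = 1"
  using assms(3)
proof (induction k)
  case (Suc k)
  have "p > 0" using p prime_gt_0_nat by blast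
  have "p dvd (p choose Suc k)" using Suc.prems \<open>p > 0\<close> by (intro dvd_choose_prime p(1)) auto
  moreover have "p choose Suc k = (p - 1 choose k) + (p - 1 choose Suc k)"
    using \<open>p > 0\<close> by (cases p) auto
  ultimately have "(of_nat ((p - 1 choose k) + (p - 1 choose Suc k)) :: 'r) = 0"
    by (intro of_nat_dvd_zero[OF p(2)]) (simp only:)
  then have "(of_nat (p - 1 choose Suc k) :: 'r) = - of_nat (p - 1 choose k)"
    unfolding of_nat_add by (simp only: eq_neg_iff_add_eq_0 add.commute)
  then show ?case using Suc by simp
qed simp

lemma ad_pow_prime:
  fixes x y :: "'r::ring_1"
  assumes p: "prime p" "(of_nat p :: 'r) = 0"
  shows "(ad x ^^ p) y = ad (x ^ p) y"
    "(ad x ^^ (p - 1)) y = (\<Sum>k<p. x ^ (p - 1 - k) * y * x ^ k)"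
proof -
  have p0: "p > 0" using p prime_gt_0_nat by blast
  then have "{..p - 1} = {..<p}" by auto
  then show 1: "(ad x ^^ (p - 1)) y = (\<Sum>k<p. x ^ (p - 1 - k) * y * x ^ k)"
    unfolding ad_pow using choose_prime_minus_one[OF p] by (auto intro!: sum.cong)
  have *: "(\<Sum>k<p. x ^ (p - k) * y * x ^ k - x ^ (p - Suc k) * y * x ^ Suc k) = x ^ p * y - y * x ^ p"
    using sum_lessThan_telescope'[of "\<lambda>k. x ^ (p - k) * y * x ^ k" p] by simp
  have "(ad x ^^ p) y = ad x ((ad x ^^ (p - 1)) y)"
    using p0 by (cases p) auto
  also have "\<dots> = (\<Sum>k<p. x ^ (p - k) * y * x ^ k - x ^ (p - Suc k) * y * x ^ Suc k)"
    unfolding 1 ad_def sum_distrib_left sum_distrib_right sum_subtractf[symmetric]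
  proof (intro sum.cong refl)
    fix k assume "k \<in> {..<p}"
    then obtain r where "p = Suc (k + r)" by (auto dest: less_imp_Suc_add)
    then show "x * (x ^ (p - 1 - k) * y * x ^ k) - x ^ (p - 1 - k) * y * x ^ k * x
        = x ^ (p - k) * y * x ^ k - x ^ (p - Suc k) * y * x ^ Suc k"
      by (simp add: mult.assoc power_commutes)
  qed
  finally show "(ad x ^^ p) y = ad (x ^ p) y" using * by (simp add: ad_def)
qed

text \<open>The counterpart of \<open>jacobson_coeff\<close> in an associative ring.\<close>

primrec ad_coeff :: "'r::ring \<Rightarrow> 'r \<Rightarrow> nat \<Rightarrow> nat \<Rightarrow> 'r" where
  "ad_coeff x y 0 = (\<lambda>j. if j = 0 then x else 0)"
| "ad_coeff x y (Suc n) = (\<lambda>j. ad y (ad_coeff x y n j) + (if j = 0 then 0 else ad x (ad_coeff x y n (j - 1))))"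

lemma fps_deriv_pow:
  fixes f :: "'r::ring_1 fps"
  shows "fps_deriv (f ^ n) = (\<Sum>k<n. f ^ (n - 1 - k) * fps_deriv f * f ^ k)"
proof (induction n)
  case (Suc n)
  have "f * (\<Sum>k<n. f ^ (n - 1 - k) * fps_deriv f * f ^ k) = (\<Sum>k<n. f ^ (n - k) * fps_deriv f * f ^ k)"
    unfolding sum_distrib_left
  proof (intro sum.cong refl)
    fix k assume "k \<in> {..<n}"
    then have "n - k = Suc (n - 1 - k)" by auto
    then show "f * (f ^ (n - 1 - k) * fps_deriv f * f ^ k) = f ^ (n - k) * fps_deriv f * f ^ k"
      by (simp add: mult.assoc)
  qed
  then show ?case using Suc by (simp add: add.commute)
qed simp

lemma pencil_nth:
  fixes x y :: "'r::ring_1"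
  defines "f \<equiv> fps_const x * fps_X + fps_const y"
  shows "fps_nth (f * g) j = y * fps_nth g j + (if j = 0 then 0 else x * fps_nth g (j - 1))"
    "fps_nth (g * f) j = fps_nth g j * y + (if j = 0 then 0 else fps_nth g (j - 1) * x)"
proof -
  have 1: "f * g = fps_const x * (fps_X * g) + fps_const y * g"
    by (simp add: f_def algebra_simps)
  have "g * (fps_const x * fps_X) = fps_X * (g * fps_const x)"
    by (metis fps_mult_fps_X_commute mult.assoc)
  then have 2: "g * f = fps_X * (g * fps_const x) + g * fps_const y"
    by (simp add: f_def algebra_simps)
  show "fps_nth (f * g) j = y * fps_nth g j + (if j = 0 then 0 else x * fps_nth g (j - 1))"
    unfolding 1 by simp
  show "fps_nth (g * f) j = fps_nth g j * y + (if j = 0 then 0 else fps_nth g (j - 1) * x)"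
    unfolding 2 by (simp del: fps_const_mult_left)
qed

text \<open>
  The derivative of \<open>(t x + y)\<^sup>p\<close> with respect to \<open>t\<close> is \<open>ad(t x + y)\<^sup>p\<^sup>-\<^sup>1 (x)\<close> in characteristic \<open>p\<close>, by
  \<open>fps_deriv_pow\<close> and \<open>ad_pow_prime\<close>. Comparing coefficients of \<open>t\<^sup>j\<^sup>-\<^sup>1\<close> gives \<open>j c\<^sub>j\<close> for the coefficients \<open>c\<^sub>j\<close> of
  \<open>(t x + y)\<^sup>p\<close>, whose sum is \<open>(x + y)\<^sup>p\<close>.
\<close>

lemma jacobson_formula:
  fixes x y :: "'r::ring_1"
  assumes p: "prime p" "(of_nat p :: 'r) = 0"
  obtains c where "\<And>j. 1 \<le> j \<Longrightarrow> of_nat j * c j = ad_coeff x y (p - 1) (j - 1)"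
    "(x + y) ^ p = x ^ p + y ^ p + (\<Sum>j = 1..p - 1. c j)"
proof -
  define f where "f = fps_const x * fps_X + fps_const y"
  note nth = pencil_nth[where x = x and y = y, folded f_def]
  have "fps_deriv f = fps_const x" unfolding f_def by (simp add: fps_eq_iff)
  have of0: "(of_nat p :: 'r fps) = 0" using p(2) by (simp add: fps_of_nat[symmetric])
  have ad: "fps_nth ((ad f ^^ n) (fps_const x)) j = ad_coeff x y n j" for n j
  proof (induction n arbitrary: j)
    case (Suc n)
    then show ?case by (simp add: ad_def nth)
  qed simp
  have der: "fps_deriv (f ^ p) = (ad f ^^ (p - 1)) (fps_const x)"
    unfolding fps_deriv_pow ad_pow_prime(2)[OF p(1) of0] \<open>fps_deriv f = fps_const x\<close> ..
  define c where "c = fps_nth (f ^ p)"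
  have 1: "of_nat j * c j = ad_coeff x y (p - 1) (j - 1)" if "1 \<le> j" for j
    using arg_cong[OF der, of "\<lambda>g. fps_nth g (j - 1)"] that
    by (simp add: ad c_def)
  have hi: "j > n \<Longrightarrow> fps_nth (f ^ n) j = 0" for n j
    by (induction n arbitrary: j) (auto simp: nth)
  have top: "fps_nth (f ^ n) n = x ^ n" for n
    by (induction n) (auto simp: nth hi)
  have bot: "fps_nth (f ^ n) 0 = y ^ n" for n
    by (induction n) (simp_all add: power_Suc nth del: fps_mult_nth_0)
  have sum: "(\<Sum>j\<le>n. fps_nth (f ^ n) j) = (x + y) ^ n" for n
  proof (induction n)
    case (Suc n)
    have "(\<Sum>j\<le>Suc n. fps_nth (f ^ Suc n) j) =
        y * (\<Sum>j\<le>Suc n. fps_nth (f ^ n) j) + (\<Sum>j\<le>Suc n. if j = 0 then 0 else x * fps_nth (f ^ n) (j - 1))"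
      by (simp only: power_Suc nth sum.distrib sum_distrib_left)
    also have "(\<Sum>j\<le>Suc n. if j = 0 then 0 else x * fps_nth (f ^ n) (j - 1)) = x * (\<Sum>j\<le>n. fps_nth (f ^ n) j)"
      by (subst sum.atMost_Suc_shift) (simp add: sum_distrib_left)
    also have "(\<Sum>j\<le>Suc n. fps_nth (f ^ n) j) = (\<Sum>j\<le>n. fps_nth (f ^ n) j)"
      by (simp add: hi)
    finally show ?case by (simp add: Suc algebra_simps)
  qed simp
  have "p \<ge> 1" using p prime_ge_1_nat by blast
  then have "{..p} = insert 0 (insert p {1..p - 1})" by auto
  then have "(x + y) ^ p = y ^ p + (x ^ p + (\<Sum>j = 1..p - 1. c j))"
    unfolding sum[symmetric] c_def using \<open>p \<ge> 1\<close> by (simp add: top bot)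
  then show thesis using 1 by (intro that[of c]) (auto simp: add_ac)
qed

section \<open>Operators on two copies of the functions on the prime field\<close>

definition proj :: "(bool \<times> 'k::field \<Rightarrow> 'k) \<Rightarrow> bool \<times> 'k \<Rightarrow> 'k" where
  "proj f = (\<lambda>x. if snd x \<in> range of_int then f x else 0)"

text \<open>
  Linear operators on pairs of functions on the prime field. Such a pair is a function on \<open>bool \<times> 'k\<close>; the
  operators only see and produce values on the prime field, which is expressed by \<open>proj\<close>. In this form the operators are a
  ring with identity \<open>proj\<close>, and the positions \<open>a\<close> are elements of \<open>k\<close>, so that translation by \<open>1\<close> has order \<open>p\<close>.
\<close>

typedef (overloaded) 'k eop = "{F :: (bool \<times> 'k::field \<Rightarrow> 'k) \<Rightarrow> bool \<times> 'k \<Rightarrow> 'k.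
    (\<forall>c f g. F (\<lambda>x. c * f x + g x) = (\<lambda>x. c * F f x + F g x)) \<and> (\<forall>f. F (proj f) = F f) \<and> (\<forall>f. proj (F f) = F f)}"
  morphisms app Abs_eop
  by (rule exI[of _ "\<lambda>_ _. 0"]) (simp add: proj_def)

lemma app_lin: "app F (\<lambda>x. c * f x + g x) = (\<lambda>x. c * app F f x + app F g x)"
  and app_proj: "app F (proj f) = app F f" and proj_app: "proj (app F f) = app F f"
  using app[of F] by blast+

lemma eop_eqI: "(\<And>f. app F f = app G f) \<Longrightarrow> F = G"
  by (simp add: app_inject[symmetric] fun_eq_iff)

lemma app_add: "app F (\<lambda>x. f x + g x) = (\<lambda>x. app F f x + app F g x)"
  using app_lin[of F 1 f g] by simp

lemma app_zero: "app F (\<lambda>_. 0) = (\<lambda>_. 0)"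
  using app_lin[of F "-1" "\<lambda>_. 0" "\<lambda>_. 0"] by simp

lemma app_scale: "app F (\<lambda>x. c * f x) = (\<lambda>x. c * app F f x)"
  using app_lin[of F c f "\<lambda>_. 0"] by (simp add: app_zero)

lemma app_sum: "app F (\<lambda>x. \<Sum>i\<in>I. f i x) = (\<lambda>x. \<Sum>i\<in>I. app F (f i) x)"
  by (induction I rule: infinite_finite_induct) (simp_all add: app_zero app_add)

instantiation eop :: (field) ring_1
begin

definition "zero_eop = Abs_eop (\<lambda>_ _. 0)"
definition "one_eop = Abs_eop proj"
definition "plus_eop F G = Abs_eop (\<lambda>f x. app F f x + app G f x)"
definition "uminus_eop F = Abs_eop (\<lambda>f x. - app F f x)"
definition "minus_eop F G = Abs_eop (\<lambda>f x. app F f x - app G f x)"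
definition "times_eop F G = Abs_eop (\<lambda>f. app F (app G f))"

lemma proj_add: "proj (\<lambda>x. f x + g x) = (\<lambda>x. proj f x + proj g x)"
  and proj_minus: "proj (\<lambda>x. - f x) = (\<lambda>x. - proj f x)"
  and proj_diff: "proj (\<lambda>x. f x - g x) = (\<lambda>x. proj f x - proj g x)"
  and proj_scale: "proj (\<lambda>x. c * f x) = (\<lambda>x. c * proj f x)"
  and proj_proj: "proj (proj f) = proj f"
  by (simp_all add: proj_def fun_eq_iff)

lemma app_0: "app 0 f = (\<lambda>_. 0)"
  unfolding zero_eop_def by (subst Abs_eop_inverse) (simp_all add: proj_def)
lemma app_1: "app 1 f = proj f"
  unfolding one_eop_def by (subst Abs_eop_inverse) (simp_all add: proj_add proj_scale proj_proj)
lemma app_plus: "app (F + G) f = (\<lambda>x. app F f x + app G f x)"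
  unfolding plus_eop_def
  by (subst Abs_eop_inverse) (simp_all add: app_lin app_proj proj_add proj_app, simp add: fun_eq_iff algebra_simps)
lemma app_uminus: "app (- F) f = (\<lambda>x. - app F f x)"
  unfolding uminus_eop_def
  by (subst Abs_eop_inverse) (simp_all add: app_lin app_proj proj_minus proj_app)
lemma app_minus: "app (F - G) f = (\<lambda>x. app F f x - app G f x)"
  unfolding minus_eop_def
  by (subst Abs_eop_inverse) (simp_all add: app_lin app_proj proj_diff proj_app, simp add: fun_eq_iff algebra_simps)
lemma app_times: "app (F * G) f = app F (app G f)"
  unfolding times_eop_def by (subst Abs_eop_inverse) (simp_all add: app_lin app_proj proj_app)

lemmas app_simps = app_0 app_1 app_plus app_uminus app_minus app_times

instance
proof
  show "(0 :: 'a eop) \<noteq> 1"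
  proof
    assume "(0 :: 'a eop) = 1"
    from arg_cong[OF this, of "\<lambda>F. app F (\<lambda>_. 1) (True, of_int 0)"] show False
      by (simp only: app_simps proj_def snd_conv rangeI if_True zero_neq_one)
  qed
qed (rule eop_eqI, simp add: app_simps app_add app_proj proj_app fun_eq_iff algebra_simps)+

end

definition scalar_op :: "'k::field \<Rightarrow> 'k eop" where
  "scalar_op c = Abs_eop (\<lambda>f. proj (\<lambda>x. c * f x))"

lemma app_esc: "app (scalar_op c) f = proj (\<lambda>x. c * f x)"
  unfolding scalar_op_def
  by (subst Abs_eop_inverse) (simp_all add: proj_scale proj_proj, simp_all add: proj_def fun_eq_iff algebra_simps)

lemma app_esc_times: "app (scalar_op c * F) f = (\<lambda>x. c * app F f x)"
  by (simp add: app_times app_esc proj_scale proj_app)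

lemma scalar_op_add: "scalar_op (a + b) = scalar_op a + scalar_op b"
  by (rule eop_eqI) (simp add: app_esc app_simps proj_def fun_eq_iff algebra_simps)
lemma scalar_op_mult: "scalar_op (a * b) = scalar_op a * scalar_op b"
  by (rule eop_eqI) (simp add: app_esc app_simps proj_scale proj_proj fun_eq_iff algebra_simps)
lemma scalar_op_1: "scalar_op 1 = 1" by (rule eop_eqI) (simp add: app_esc app_simps)
lemma scalar_op_0: "scalar_op 0 = 0" by (rule eop_eqI) (simp add: app_esc app_simps proj_def)
lemma scalar_op_central: "scalar_op c * F = F * scalar_op c"
  by (rule eop_eqI) (simp add: app_esc app_simps app_scale proj_scale app_proj proj_app)
lemma scalar_op_minus: "scalar_op (- a) = - scalar_op a"
  using scalar_op_add[of a "- a"] by (simp add: scalar_op_0 eq_neg_iff_add_eq_0 add.commute)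
lemma scalar_op_of_nat: "scalar_op (of_nat n) = of_nat n" by (induction n) (simp_all add: scalar_op_0 scalar_op_1 scalar_op_add)
lemma scalar_op_sum: "scalar_op (\<Sum>i\<in>I. f i) = (\<Sum>i\<in>I. scalar_op (f i))"
  by (induction I rule: infinite_finite_induct) (simp_all add: scalar_op_0 scalar_op_add)

definition bas :: "bool \<Rightarrow> 'k::field \<Rightarrow> bool \<times> 'k \<Rightarrow> 'k" where
  "bas b a = (\<lambda>x. if x = (b, a) then 1 else 0)"

text \<open>
  Shift by \<open>s\<close>, with weights \<open>A\<close> on the copy \<open>True\<close>, \<open>M\<close> on the copy \<open>False\<close>, and a map with weights \<open>B\<close> and an
  additional shift by \<open>de\<close> from \<open>False\<close> to \<open>True\<close>.
\<close>

definition shift_op :: "('k::field \<Rightarrow> 'k) \<Rightarrow> ('k \<Rightarrow> 'k) \<Rightarrow> ('k \<Rightarrow> 'k) \<Rightarrow> 'k \<Rightarrow> 'k \<Rightarrow> 'k eop" where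
  "shift_op A M B s de = Abs_eop (\<lambda>f. proj (\<lambda>(b, a). if b then A (a + s) * proj f (True, a + s)
      + B (a + s - de) * proj f (False, a + s - de) else M (a + s) * proj f (False, a + s)))"

lemma app_shift_op: "app (shift_op A M B s de) f = proj (\<lambda>(b, a). if b then A (a + s) * proj f (True, a + s)
      + B (a + s - de) * proj f (False, a + s - de) else M (a + s) * proj f (False, a + s))"
  unfolding shift_op_def
proof (subst Abs_eop_inverse)
  let ?F = "\<lambda>f. proj (\<lambda>(b, a). if b then A (a + s) * proj f (True, a + s)
      + B (a + s - de) * proj f (False, a + s - de) else M (a + s) * proj f (False, a + s))"
  have "\<forall>c f g. ?F (\<lambda>x. c * f x + g x) = (\<lambda>x. c * ?F f x + ?F g x)"
    by (simp add: proj_def fun_eq_iff algebra_simps)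
  moreover have "\<forall>f. ?F (proj f) = ?F f" unfolding proj_proj by simp
  moreover have "\<forall>f. proj (?F f) = ?F f" by (simp add: proj_proj)
  ultimately show "?F \<in> {F. (\<forall>c f g. F (\<lambda>x. c * f x + g x) = (\<lambda>x. c * F f x + F g x)) \<and>
      (\<forall>f. F (proj f) = F f) \<and> (\<forall>f. proj (F f) = F f)}"
    by blast
qed (rule refl)

context witt_char
begin

lemma proj_bas: "a \<in> prime_field \<Longrightarrow> proj (bas b a) = bas b a"
  by (auto simp: proj_def bas_def prime_field_def fun_eq_iff)

lemma app_shift_op_bas:
  assumes "a \<in> prime_field" "s \<in> prime_field" "de \<in> prime_field"
  shows "app (shift_op A M B s de) (bas True a) = (\<lambda>x. A a * bas True (a - s) x)"
    "app (shift_op A M B s de) (bas False a)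
      = (\<lambda>x. M a * bas False (a - s) x + B a * bas True (a + de - s) x)"
proof -
  have "a - s \<in> prime_field" "a + de - s \<in> prime_field"
    using assms by (blast intro: prime_field_closed)+
  then have 1: "proj (bas b (a - s)) = bas b (a - s)" "proj (bas b (a + de - s)) = bas b (a + de - s)"
    "proj (bas b a) = bas b a" for b
    using assms by (simp_all only: proj_bas)
  have 2: "x = a + de - s \<longleftrightarrow> x + s - de = a" "x = a - s \<longleftrightarrow> x + s = a" for x by (auto simp: algebra_simps)
  have "app (shift_op A M B s de) (bas True a) = proj (\<lambda>x. A a * bas True (a - s) x)"
    unfolding app_shift_op 1 by (rule arg_cong[of _ _ proj]) (auto simp: bas_def fun_eq_iff 2)
  then show "app (shift_op A M B s de) (bas True a) = (\<lambda>x. A a * bas True (a - s) x)"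
    by (simp only: proj_scale 1)
  have "app (shift_op A M B s de) (bas False a) = proj (\<lambda>x. M a * bas False (a - s) x + B a * bas True (a + de - s) x)"
    unfolding app_shift_op 1 by (rule arg_cong[of _ _ proj]) (auto simp: bas_def fun_eq_iff 2)
  then show "app (shift_op A M B s de) (bas False a)
      = (\<lambda>x. M a * bas False (a - s) x + B a * bas True (a + de - s) x)"
    by (simp only: proj_scale proj_add 1)
qed

lemma finite_prime_field: "finite prime_field"
proof -
  have "prime_field \<subseteq> of_nat ` {..<p}" using prime_field_cases by (metis image_iff lessThan_iff subsetI)
  then show ?thesis by (rule finite_subset) simp
qed

lemma proj_expand: "proj f = (\<lambda>x. \<Sum>b\<in>UNIV. \<Sum>a\<in>prime_field. f (b, a) * bas b a x)"
proof
  fix x :: "bool \<times> 'k"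
  obtain b' a' where x: "x = (b', a')" by (cases x)
  have "(\<Sum>b\<in>UNIV. \<Sum>a\<in>prime_field. f (b, a) * bas b a x)
      = (\<Sum>b\<in>UNIV. if b = b' then \<Sum>a\<in>prime_field. if a = a' then f (b, a) else 0 else 0)"
    by (intro sum.cong refl) (auto simp: bas_def x intro!: sum.cong sum.neutral)
  also have "\<dots> = proj f x"
    using finite_prime_field by (simp add: x proj_def sum.delta prime_field_def)
  finally show "proj f x = (\<Sum>b\<in>UNIV. \<Sum>a\<in>prime_field. f (b, a) * bas b a x)" ..
qed

lemma eop_basis_eqI:
  fixes F G :: "'k eop"
  assumes "\<And>b a. a \<in> prime_field \<Longrightarrow> app F (bas b a) = app G (bas b a)"
  shows "F = G"
proof (rule eop_eqI)
  fix f
  have *: "app H f = (\<lambda>x. \<Sum>b\<in>UNIV. \<Sum>a\<in>prime_field. f (b, a) * app H (bas b a) x)" for H :: "'k eop"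
    unfolding app_proj[of H f, symmetric] proj_expand app_sum app_scale ..
  show "app F f = app G f" unfolding *[of F] *[of G] using assms by (simp cong: sum.cong)
qed

end

section \<open>The extension defined by a solution\<close>

text \<open>
  The index is moved by one, \<open>n = i + 1\<close>, so that \<open>e\<^sub>-\<^sub>1\<close> is included, with weight \<open>1\<close>.
\<close>

definition Wt :: "'k::field \<Rightarrow> nat \<Rightarrow> 'k \<Rightarrow> 'k" where
  "Wt lam n a = (case n of 0 \<Rightarrow> 1 | Suc i \<Rightarrow> wt lam i a)"

lemma Wt_simps [simp]: "Wt lam 0 a = 1" "Wt lam (Suc i) a = wt lam i a" "Wt lam 1 a = lam - a"
  by (simp_all add: Wt_def)

lemma Wt_shift: "Wt lam n (a + 1) = Wt lam n a - of_nat n * Wt lam (n - 1) a"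
proof (cases n)
  case (Suc m)
  show ?thesis
  proof (cases m)
    case (Suc i)
    define c Y Z where "c = (-1) ^ m * falling a i" and "Y = (a - of_nat i) * ((of_nat m + 1) * lam - a + of_nat m)"
      and "Z = (of_nat m + 1) * ((of_nat i + 1) * lam - a + of_nat i)"
    have "wt lam m (a + 1) = c * ((a + 1) * ((of_nat m + 1) * lam - (a + 1) + of_nat m))"
      by (simp add: wt_def Suc falling_Suc_left c_def)
    also have "(a + 1) * ((of_nat m + 1) * lam - (a + 1) + of_nat m) = Y + Z"
      by (simp add: Suc algebra_simps Y_def Z_def)
    also have "c * (Y + Z) = c * Y + c * Z" by (rule distrib_left)
    also have "c * Y = wt lam m a"
      by (simp add: wt_def Suc falling_Suc c_def Y_def)
    also have "c * Z = - (of_nat n * wt lam i a)"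
      by (simp add: wt_def Suc \<open>n = Suc m\<close> c_def Z_def algebra_simps)
    finally have "wt lam m (a + 1) = wt lam m a - of_nat n * wt lam i a" by simp
    then show ?thesis by (simp add: \<open>n = Suc m\<close> Suc)
  qed (simp add: Suc)
qed simp

lemma Wt_bracket:
  "Wt lam n a * Wt lam m (a + 1 - of_nat n) - Wt lam m a * Wt lam n (a + 1 - of_nat m)
    = (of_nat n - of_nat m) * Wt lam (m + n - 1) a"
proof (cases m)
  case 0
  then show ?thesis using Wt_shift[of lam n a] by (cases n) (simp_all add: algebra_simps)
next
  case m: (Suc i)
  show ?thesis
  proof (cases n)
    case 0
    then show ?thesis using Wt_shift[of lam m a] m by (simp add: algebra_simps)
  next
    case n: (Suc j)
    show ?thesis using wt_bracket[of lam j a i] by (simp add: m n algebra_simps)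
  qed
qed

locale witt_model = witt_char p k_type for p and k_type :: "'k::field itself" +
  fixes lam de :: 'k and d :: "nat \<Rightarrow> 'k"
  assumes lam_pf: "lam \<in> prime_field" and de_pf: "de \<in> prime_field"
    and sol_d: "sol lam de d"
begin

text \<open>
  The weights of the off-diagonal part of \<open>e\<^sub>n\<^sub>-\<^sub>1\<close>. The off-diagonal part of \<open>e\<^sub>-\<^sub>1\<close> being zero, \<open>Bc n (a + 1) - Bc n a\<close>
  is prescribed by \<open>[e\<^sub>-\<^sub>1, e\<^sub>n\<^sub>-\<^sub>1]\<close>, and \<open>Bc n 0 = d (n - 1)\<close>; this is the solution in Newton's form.
\<close>

definition Bc :: "nat \<Rightarrow> 'k \<Rightarrow> 'k" where
  "Bc n a = (if n \<le> p - 1 then \<Sum>k\<le>n. of_nat (n choose k) * (-1) ^ k * d (n - k - 1) * falling a k else 0)"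

lemma d_0: "d 0 = 0" using sol_supp[OF sol_d, of 0] by simp

lemma Bc_0 [simp]: "Bc 0 a = 0" by (simp add: Bc_def d_0)
lemma Bc_1 [simp]: "Bc (Suc 0) a = 0" "Bc 1 a = 0" by (simp_all add: Bc_def d_0)

lemma falling_0_Suc: "falling 0 (Suc k) = 0" by (simp add: falling_Suc_left)

lemma Bc_at_0: "Bc (Suc i) 0 = d i"
proof (cases "Suc i \<le> p - 1")
  case True
  then have "Bc (Suc i) 0 = d i + (\<Sum>k\<le>i. of_nat (Suc i choose Suc k) * (-1) ^ Suc k * d (Suc i - Suc k - 1) * falling 0 (Suc k))"
    unfolding Bc_def by (subst sum.atMost_Suc_shift) simp
  then show ?thesis by (simp add: falling_0_Suc)
next
  case False
  then have "\<not> i \<le> p - 2" using p5 by linarith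
  then show ?thesis using sol_supp[OF sol_d, of i] False by (simp add: Bc_def)
qed

lemma Bc_shift: "Bc n (a + 1) = Bc n a - of_nat n * Bc (n - 1) a"
proof (cases n)
  case (Suc m)
  consider "n \<le> p - 1" | "n = p" | "n > p" by linarith
  then show ?thesis
  proof cases
    case 1
    have b: "(of_nat (n choose Suc k) * of_nat (Suc k) :: 'k) = of_nat n * of_nat (m choose k)" for k
      using Suc_times_binomial[of k m] by (simp only: Suc of_nat_mult[symmetric] mult.commute)
    have "Bc n (a + 1) - Bc n a = (\<Sum>k\<le>n. of_nat (n choose k) * (-1) ^ k * d (n - k - 1) * (falling (a + 1) k - falling a k))"
      using 1 by (simp add: Bc_def sum_subtractf algebra_simps)
    also have "\<dots> = (\<Sum>k\<le>m. of_nat (n choose Suc k) * (-1) ^ Suc k * d (n - Suc k - 1) * (of_nat (Suc k) * falling a k))"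
      unfolding Suc by (subst sum.atMost_Suc_shift) (simp only: falling_shift, simp)
    also have "\<dots> = - of_nat n * (\<Sum>k\<le>m. of_nat (m choose k) * (-1) ^ k * d (m - k - 1) * falling a k)"
      unfolding sum_distrib_left
    proof (intro sum.cong refl)
      fix k
      have "of_nat (n choose Suc k) * (-1) ^ Suc k * d (n - Suc k - 1) * (of_nat (Suc k) * falling a k)
        = (of_nat (n choose Suc k) * of_nat (Suc k)) * (- ((-1) ^ k * d (n - Suc k - 1) * falling a k))"
        by (simp del: of_nat_Suc)
      also have "\<dots> = - of_nat n * (of_nat (m choose k) * (-1) ^ k * d (m - k - 1) * falling a k)"
        unfolding b by (simp add: Suc algebra_simps)
      finally show "of_nat (n choose Suc k) * (-1) ^ Suc k * d (n - Suc k - 1) * (of_nat (Suc k) * falling a k) = \<dots>" .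
    qed
    also have "(\<Sum>k\<le>m. of_nat (m choose k) * (-1) ^ k * d (m - k - 1) * falling a k) = Bc (n - 1) a"
      using 1 by (simp add: Suc Bc_def)
    finally show ?thesis by (simp add: algebra_simps)
  next
    case 2
    then show ?thesis using p5 CHAR_p of_nat_CHAR[where 'a = 'k] by (simp add: Bc_def)
  next
    case 3
    then have "\<not> n - 1 \<le> p - 1" "\<not> n \<le> p - 1" using p5 by linarith+
    then show ?thesis by (simp add: Bc_def)
  qed
qed simp

text \<open>
  The error in the off-diagonal part of the relation for \<open>[e\<^sub>m\<^sub>-\<^sub>1, e\<^sub>n\<^sub>-\<^sub>1]\<close>, at the position \<open>a\<close>. By the
  difference equations of the weights, its differences in \<open>a\<close> are errors with smaller \<open>m + n\<close>; at \<open>a = 0\<close> it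
  is zero because \<open>d\<close> is a solution.
\<close>

definition defect :: "nat \<Rightarrow> nat \<Rightarrow> 'k \<Rightarrow> 'k" where
  "defect m n a = Wt lam m (a + de + 1 - of_nat n) * Bc n a + Bc m (a + 1 - of_nat n) * Wt (lam - de) n a
     - (Wt lam n (a + de + 1 - of_nat m) * Bc m a + Bc n (a + 1 - of_nat m) * Wt (lam - de) m a)
     - (of_nat n - of_nat m) * Bc (m + n - 1) a"

lemma defect_swap: "defect n m a = - defect m n a"
  by (simp add: defect_def algebra_simps)

lemma defect_shift:
  "0 < m \<Longrightarrow> 0 < n \<Longrightarrow> defect m n (a + 1) = defect m n a - of_nat m * defect (m - 1) n a - of_nat n * defect m (n - 1) a"
proof -
  assume "0 < m" "0 < n"
  then obtain i j where mn: "m = Suc i" "n = Suc j" using gr0_conv_Suc by auto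
  have s: "Wt l n (x + 1) = Wt l n x - of_nat n * Wt l (n - 1) x" "Bc n (x + 1) = Bc n x - of_nat n * Bc (n - 1) x" for l n x
    by (rule Wt_shift, rule Bc_shift)
  define x y where "x = a + de + 1 - of_nat n" and "y = a + de + 1 - of_nat m"
  define x' y' where "x' = a + 1 - of_nat n" and "y' = a + 1 - of_nat m"
  have e: "a + 1 + de + 1 - of_nat n = x + 1" "a + 1 + de + 1 - of_nat m = y + 1"
     "a + 1 + 1 - of_nat n = x' + 1" "a + 1 + 1 - of_nat m = y' + 1"
     "a + de + 1 - of_nat (m - 1) = y + 1" "a + 1 - of_nat (m - 1) = y' + 1"
     "a + de + 1 - of_nat (n - 1) = x + 1" "a + 1 - of_nat (n - 1) = x' + 1"
    by (simp_all add: x_def y_def x'_def y'_def mn)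
  have D: "defect m n (a + 1) = Wt lam m (x + 1) * Bc n (a + 1) + Bc m (x' + 1) * Wt (lam - de) n (a + 1)
     - (Wt lam n (y + 1) * Bc m (a + 1) + Bc n (y' + 1) * Wt (lam - de) m (a + 1))
     - (of_nat n - of_nat m) * Bc (m + n - 1) (a + 1)"
    "defect m n a = Wt lam m x * Bc n a + Bc m x' * Wt (lam - de) n a
     - (Wt lam n y * Bc m a + Bc n y' * Wt (lam - de) m a)
     - (of_nat n - of_nat m) * Bc (m + n - 1) a"
    "defect (m - 1) n a = Wt lam (m - 1) x * Bc n a + Bc (m - 1) x' * Wt (lam - de) n a
     - (Wt lam n (y + 1) * Bc (m - 1) a + Bc n (y' + 1) * Wt (lam - de) (m - 1) a)
     - (of_nat n - of_nat (m - 1)) * Bc (m - 1 + n - 1) a"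
    "defect m (n - 1) a = Wt lam m (x + 1) * Bc (n - 1) a + Bc m (x' + 1) * Wt (lam - de) (n - 1) a
     - (Wt lam (n - 1) y * Bc m a + Bc (n - 1) y' * Wt (lam - de) m a)
     - (of_nat (n - 1) - of_nat m) * Bc (m + (n - 1) - 1) a"
    unfolding defect_def e by (simp_all only: x_def y_def x'_def y'_def)
  have "m - 1 + n - 1 = m + n - 2" "m + (n - 1) - 1 = m + n - 2" "m + n - 1 - 1 = m + n - 2"
    using mn by auto
  note D' = D[unfolded this]
  have sB: "Bc (m + n - 1) (a + 1) = Bc (m + n - 1) a - of_nat (m + n - 1) * Bc (m + n - 2) a"
    using s(2)[of "m + n - 1" a] mn by simp
  have n: "of_nat (m + n - 1) = (of_nat i + of_nat j + 1 :: 'k)" "of_nat (m - 1) = (of_nat i :: 'k)"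
    "of_nat (n - 1) = (of_nat j :: 'k)" "of_nat m = (of_nat i + 1 :: 'k)" "of_nat n = (of_nat j + 1 :: 'k)"
    by (simp_all add: mn)
  show ?thesis
    unfolding D' sB s(1)[of _ _ a] s(2)[of _ a] s(1)[of _ _ x] s(1)[of _ _ y] s(2)[of _ x'] s(2)[of _ y'] n
    by (simp add: algebra_simps)
qed

lemma Wt_0_Suc: "0 < i \<Longrightarrow> Wt l (Suc i) 0 = 0"
  by (cases i) (simp_all add: wt_def falling_0_Suc)

lemma defect_0: "defect 0 n a = 0"
  using Bc_shift[of n a] by (simp add: defect_def algebra_simps)

lemma defect_1: "defect 1 n a = 0"
  by (simp add: defect_def algebra_simps)

lemma defect_origin_less:
  assumes "2 \<le> m" "m < n" "n \<le> p - 1" shows "defect m n 0 = 0"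
proof -
  obtain i j where m: "m = Suc i" and n: "n = Suc j" and i: "1 \<le> i" "i < j" "j \<le> p - 2"
    using assms by (cases m; cases n) auto
  have "(of_nat j - of_nat i) * d (i + j) = d j * wt lam i (de - of_nat j) - d i * wt lam j (de - of_nat i)"
    by (rule sol_rel[OF sol_d i])
  then show ?thesis
    unfolding defect_def m n using Wt_0_Suc[of i "lam - de"] Wt_0_Suc[of j "lam - de"] i
    by (simp add: Bc_at_0 algebra_simps)
qed

lemma defect_origin:
  assumes "m \<le> p - 1" "n \<le> p - 1" shows "defect m n 0 = 0"
proof -
  consider "m = 0" | "n = 0" | "m = 1" | "n = 1" | "m = n" | "2 \<le> m" "m < n" | "2 \<le> n" "n < m" by linarith
  then show ?thesis
  proof cases
    case 5
    then show ?thesis by (simp add: defect_def)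
  next
    case 6
    then show ?thesis using defect_origin_less assms by blast
  next
    case 7
    then show ?thesis using defect_origin_less[of n m] assms defect_swap[of m n 0] by simp
  qed (use defect_0 defect_1 defect_swap[of m n 0] in auto)
qed

lemma defect_zero: "m \<le> p - 1 \<Longrightarrow> n \<le> p - 1 \<Longrightarrow> a \<in> prime_field \<Longrightarrow> defect m n a = 0"
proof (induction "m + n" arbitrary: m n a)
  case 0
  then show ?case by (simp add: defect_def)
next
  case (Suc N)
  note prems = Suc.prems and hyps = Suc.hyps
  show ?case
  proof (cases "m = 0 \<or> n = 0")
    case True
    then show ?thesis using defect_0 defect_swap[of n m a] by auto
  next
    case False
    have "defect m n (of_nat q) = 0" for q
    proof (induction q)
      case 0
      show ?case using defect_origin prems by simp
    next
      case (Suc q)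
      have "defect (m - 1) n (of_nat q) = 0" "defect m (n - 1) (of_nat q) = 0"
        using hyps(2) prems False by (auto intro!: hyps(1) prime_field_closed)
      then show ?case using defect_shift[of m n "of_nat q"] False Suc.IH by (simp add: add.commute)
    qed
    then show ?thesis using prime_field_cases[OF prems(3)] by metis
  qed
qed

definition R :: "nat \<Rightarrow> 'k eop" where
  "R n = shift_op (Wt lam n) (Wt (lam - de) n) (Bc n) (of_nat n - 1) de"

lemma R_bas:
  assumes "a \<in> prime_field"
  shows "app (R n) (bas True a) = (\<lambda>x. Wt lam n a * bas True (a + 1 - of_nat n) x)"
    "app (R n) (bas False a) = (\<lambda>x. Wt (lam - de) n a * bas False (a + 1 - of_nat n) x
       + Bc n a * bas True (a + de + 1 - of_nat n) x)"
proof -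
  have "of_nat n - 1 \<in> prime_field" using prime_field_closed by blast
  from app_shift_op_bas[OF assms this de_pf]
  show "app (R n) (bas True a) = (\<lambda>x. Wt lam n a * bas True (a + 1 - of_nat n) x)"
    "app (R n) (bas False a) = (\<lambda>x. Wt (lam - de) n a * bas False (a + 1 - of_nat n) x
       + Bc n a * bas True (a + de + 1 - of_nat n) x)"
    by (simp_all add: R_def algebra_simps)
qed

lemma Wt_ge: "a \<in> prime_field \<Longrightarrow> p \<le> n \<Longrightarrow> Wt l n a = 0"
  using wt_ge[of a "n - 1" l] p5 by (cases n) auto

lemma R_ge: "p \<le> n \<Longrightarrow> R n = 0"
proof -
  assume n: "p \<le> n"
  then have "\<not> n \<le> p - 1" using p5 by linarith
  then have B: "Bc n a = 0" for a by (simp add: Bc_def)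
  show "R n = 0"
  proof (rule eop_basis_eqI)
    fix b and a :: 'k assume a: "a \<in> prime_field"
    show "app (R n) (bas b a) = app 0 (bas b a)"
      by (cases b) (simp_all only: R_bas[OF a] Wt_ge[OF a n] B app_0 mult_zero_left add_0_left)
  qed
qed

lemma R_bracket:
  assumes "m \<le> p - 1" "n \<le> p - 1"
  shows "R m * R n - R n * R m = scalar_op (of_nat n - of_nat m) * R (m + n - 1)"
proof (rule eop_basis_eqI)
  fix b and a :: 'k assume a: "a \<in> prime_field"
  have cl: "a + 1 - of_nat n \<in> prime_field" "a + de + 1 - of_nat n \<in> prime_field" for n
    using a de_pf by (auto intro!: prime_field_closed)
  have c: "a + 1 - of_nat n + 1 - of_nat m = a + 1 - of_nat (m + n - 1)"
    "a + 1 - of_nat m + 1 - of_nat n = a + 1 - of_nat (m + n - 1)"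
    "a + de + 1 - of_nat n + 1 - of_nat m = a + de + 1 - of_nat (m + n - 1)"
    "a + de + 1 - of_nat m + 1 - of_nat n = a + de + 1 - of_nat (m + n - 1)"
    "a + 1 - of_nat n + de + 1 - of_nat m = a + de + 1 - of_nat (m + n - 1)"
    "a + 1 - of_nat m + de + 1 - of_nat n = a + de + 1 - of_nat (m + n - 1)"
    if "m + n \<noteq> 0"
  proof -
    have "of_nat (m + n - 1) = (of_nat m + of_nat n - 1 :: 'k)"
      using that by (cases "m + n") (simp_all flip: of_nat_add)
    then show "a + 1 - of_nat n + 1 - of_nat m = a + 1 - of_nat (m + n - 1)"
      "a + 1 - of_nat m + 1 - of_nat n = a + 1 - of_nat (m + n - 1)"
      "a + de + 1 - of_nat n + 1 - of_nat m = a + de + 1 - of_nat (m + n - 1)"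
      "a + de + 1 - of_nat m + 1 - of_nat n = a + de + 1 - of_nat (m + n - 1)"
      "a + 1 - of_nat n + de + 1 - of_nat m = a + de + 1 - of_nat (m + n - 1)"
      "a + 1 - of_nat m + de + 1 - of_nat n = a + de + 1 - of_nat (m + n - 1)"
      by (simp_all add: algebra_simps)
  qed
  show "app (R m * R n - R n * R m) (bas b a) = app (scalar_op (of_nat n - of_nat m) * R (m + n - 1)) (bas b a)"
  proof (cases "m + n = 0")
    case True
    then show ?thesis by (simp add: app_simps scalar_op_0)
  next
    case nz: False
    show ?thesis
    proof (cases b)
      case True
      then have b: "b = True" by simp
      show ?thesis
        unfolding b app_minus app_esc_times unfolding app_times R_bas[OF a] R_bas[OF cl(1)] app_scale c[OF nz]
        by (rule ext) (simp only: mult.assoc[symmetric] left_diff_distrib[symmetric] Wt_bracket)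
    next
      case False
      then have b: "b = False" by simp
      show ?thesis
        unfolding b app_minus app_esc_times unfolding app_times R_bas[OF a] R_bas[OF cl(1)] R_bas[OF cl(2)] app_lin app_scale c[OF nz]
      proof (rule ext)
        fix x
        define u v where "u = bas False (a + 1 - of_nat (m + n - 1)) x" and "v = bas True (a + de + 1 - of_nat (m + n - 1)) x"
        have "(Wt (lam - de) n a * Wt (lam - de) m (a + 1 - of_nat n) - Wt (lam - de) m a * Wt (lam - de) n (a + 1 - of_nat m)) * u
          = ((of_nat n - of_nat m) * Wt (lam - de) (m + n - 1) a) * u"
          unfolding Wt_bracket ..
        moreover have "defect m n a * v = 0" using defect_zero[OF assms a] by simp
        ultimately show "Wt (lam - de) n a * (Wt (lam - de) m (a + 1 - of_nat n) * u + Bc m (a + 1 - of_nat n) * v)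
            + Bc n a * (Wt lam m (a + de + 1 - of_nat n) * v)
            - (Wt (lam - de) m a * (Wt (lam - de) n (a + 1 - of_nat m) * u + Bc n (a + 1 - of_nat m) * v)
            + Bc m a * (Wt lam n (a + de + 1 - of_nat m) * v))
          = (of_nat n - of_nat m) * (Wt (lam - de) (m + n - 1) a * u + Bc (m + n - 1) a * v)"
          by (simp add: defect_def algebra_simps)
      qed
    qed
  qed
qed

end

lemma frobenius_add:
  fixes x y :: "'k::field"
  assumes p: "prime p" "CHAR('k) = p"
  shows "(x + y) ^ p = x ^ p + y ^ p"
proof -
  have z: "(of_nat p :: 'k) = 0" using p(2) of_nat_CHAR[where 'a = 'k] by simp
  obtain c where c: "\<And>j. 1 \<le> j \<Longrightarrow> of_nat j * c j = ad_coeff x y (p - 1) (j - 1)"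
    "(x + y) ^ p = x ^ p + y ^ p + (\<Sum>j = 1..p - 1. c j)"
    using jacobson_formula[OF p(1) z] by blast
  have ad: "ad u v = 0" for u v :: 'k by (simp add: ad_def)
  have "p \<ge> 2" using p(1) prime_ge_2_nat by blast
  then have "c j = 0" if "j \<in> {1..p - 1}" for j
  proof -
    have "ad_coeff x y (p - 1) (j - 1) = 0"
      using \<open>p \<ge> 2\<close> by (cases "p - 1") (auto simp: ad)
    then have "of_nat j * c j = 0" using c(1)[of j] that by simp
    moreover have "(of_nat j :: 'k) \<noteq> 0"
      using that p(2) of_nat_eq_0_iff_char_dvd[where 'a = 'k, of j] by (auto dest: dvd_imp_le)
    ultimately show ?thesis by simp
  qed
  then show ?thesis using c(2) by simp
qed

lemma app_power_Suc: "app (F ^ Suc n) f = app (F ^ n) (app F f)"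
  by (simp only: power_Suc2 app_times)

context witt_model
begin

lemma prime_field_power_p: "a \<in> prime_field \<Longrightarrow> a ^ p = a"
proof -
  assume "a \<in> prime_field"
  then obtain n where "a = of_nat n" by (rule prime_field_cases)
  moreover have "(of_nat n :: 'k) ^ p = of_nat n" for n
  proof (induction n)
    case 0
    then show ?case using p5 by (simp add: power_0_left)
  next
    case (Suc n)
    then show ?case using frobenius_add[OF prime_p CHAR_p, of 1 "of_nat n"] by simp
  qed
  ultimately show ?thesis by simp
qed

lemma R_0_power: "a \<in> prime_field \<Longrightarrow> app (R 0 ^ k) (bas b a) = bas b (a + of_nat k)"
proof (induction k arbitrary: a)
  case 0
  then show ?case by (simp add: app_1 proj_bas)
next
  case (Suc k)
  have "app (R 0) (bas b a) = bas b (a + 1)" using R_bas[OF Suc.prems, of 0] by (cases b) simp_all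
  moreover have "a + 1 \<in> prime_field" using Suc.prems by (auto intro!: prime_field_closed)
  ultimately show ?case using Suc.IH[of "a + 1"] by (simp only: app_power_Suc of_nat_Suc add_ac)
qed

lemma R_0_power_p: "R 0 ^ p = 1"
  by (rule eop_basis_eqI) (simp add: R_0_power app_1 proj_bas)

lemma R_1_power_p: "R 1 ^ p = R 1"
proof (rule eop_basis_eqI)
  fix b and a :: 'k assume a: "a \<in> prime_field"
  define c where "c = (if b then lam - a else lam - de - a)"
  have c: "c \<in> prime_field" using a lam_pf de_pf by (auto simp: c_def intro!: prime_field_closed)
  have 1: "app (R 1) (bas b a) = (\<lambda>x. c * bas b a x)"
    using R_bas[OF a, of 1] by (cases b) (simp_all add: c_def)
  have "app (R 1 ^ k) (bas b a) = (\<lambda>x. c ^ k * bas b a x)" for k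
  proof (induction k)
    case 0
    then show ?case using a by (simp add: app_1 proj_bas)
  next
    case (Suc k)
    then show ?case by (simp only: app_power_Suc 1 app_scale) (simp add: mult_ac)
  qed
  then show "app (R 1 ^ p) (bas b a) = app (R 1) (bas b a)"
    by (simp only: 1 prime_field_power_p[OF c])
qed

lemma ad_R_power: "n \<ge> 2 \<Longrightarrow> n \<le> p - 1 \<Longrightarrow> \<exists>c. (ad (R n) ^^ k) (R 0) = scalar_op c * R (k * (n - 1))"
proof (induction k)
  case 0
  show ?case by (rule exI[of _ 1]) (simp add: scalar_op_1)
next
  case (Suc k)
  then obtain c where c: "(ad (R n) ^^ k) (R 0) = scalar_op c * R (k * (n - 1))" by blast
  have "ad (R n) (scalar_op c * R (k * (n - 1))) = scalar_op c * ad (R n) (R (k * (n - 1)))"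
    by (simp add: ad_def right_diff_distrib mult.assoc) (metis scalar_op_central mult.assoc)
  moreover have "\<exists>c'. ad (R n) (R (k * (n - 1))) = scalar_op c' * R (Suc k * (n - 1))"
  proof (cases "k * (n - 1) \<le> p - 1")
    case True
    have "n + k * (n - 1) - 1 = Suc k * (n - 1)" using Suc.prems by auto
    then show ?thesis using R_bracket[OF Suc.prems(2) True] by (auto simp only: ad_def)
  next
    case False
    then have "R (k * (n - 1)) = 0" by (intro R_ge) linarith
    then show ?thesis by (intro exI[of _ 0]) (simp add: ad_def scalar_op_0)
  qed
  ultimately show ?case by (auto simp: c mult.assoc[symmetric] scalar_op_mult[symmetric])
qed

text \<open>
  \<open>de - i, de - 2 i, \<dots>, de - (p - 1) i\<close> are all elements of the prime field other than \<open>de\<close>.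
\<close>

lemma wt_root_progression:
  assumes i: "1 \<le> i" "i < p" and r: "r \<in> prime_field" "r \<noteq> de"
  obtains t where "t < p - 1" "r = de - of_nat i - of_nat t * of_nat i"
proof -
  have "coprime i p" using prime_p i by (metis coprime_commute nat_dvd_not_less prime_imp_coprime not_one_le_zero gr0I)
  then obtain u where "[i * u = Suc 0] (mod p)" using cong_solve_coprime_nat by blast
  then have iu: "(of_nat i * of_nat u :: 'k) = 1"
    using of_nat_eq_iff_cong_CHAR[where 'a = 'k, of "i * u" "Suc 0"] CHAR_p by simp
  have "de - r \<in> prime_field" using de_pf r by (auto intro!: prime_field_closed)
  then have "(de - r) * of_nat u \<in> prime_field" unfolding prime_field_def
    by (metis imageE of_int_mult of_int_of_nat_eq rangeI)
  then obtain t where t: "t < p" "(de - r) * of_nat u = of_nat t" by (rule prime_field_cases)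
  have "of_nat t * of_nat i = (de - r) * (of_nat i * of_nat u)" unfolding t(2)[symmetric] by (simp only: mult_ac)
  then have e: "of_nat t * of_nat i = de - r" by (simp add: iu)
  have "t \<noteq> 0"
  proof
    assume "t = 0"
    with e have "de - r = 0" by simp
    with r show False by simp
  qed
  then obtain t' where t': "t = Suc t'" by (cases t) auto
  show thesis using t t' e by (intro that[of t']) (auto simp: algebra_simps)
qed

lemma R_True_power:
  assumes "n = Suc i" "a \<in> prime_field"
  shows "app (R n ^ k) (bas True a)
    = (\<lambda>x. (\<Prod>t<k. wt lam i (a - of_nat t * of_nat i)) * bas True (a - of_nat k * of_nat i) x)"
  using assms(2)
proof (induction k arbitrary: a)
  case 0
  then show ?case by (simp add: app_1 proj_bas)
next
  case (Suc k)
  have a': "a - of_nat i \<in> prime_field" using Suc.prems by (auto intro!: prime_field_closed)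
  have 1: "app (R n) (bas True a) = (\<lambda>x. wt lam i a * bas True (a - of_nat i) x)"
    using R_bas(1)[OF Suc.prems, of n] assms(1) by (simp add: algebra_simps)
  have 2: "(\<Prod>t<Suc k. wt lam i (a - of_nat t * of_nat i))
      = wt lam i a * (\<Prod>t<k. wt lam i (a - of_nat i - of_nat t * of_nat i))"
    by (subst prod.lessThan_Suc_shift) (simp add: algebra_simps)
  have 3: "a - of_nat (Suc k) * of_nat i = a - of_nat i - of_nat k * of_nat i" by (simp add: algebra_simps)
  show ?case unfolding app_power_Suc 1 app_scale Suc.IH[OF a'] 2 3 by (simp add: mult_ac)
qed

text \<open>
  For \<open>n \<ge> 2\<close>, \<open>ad(e\<^sub>n\<^sub>-\<^sub>1)\<^sup>p (e\<^sub>-\<^sub>1) = 0\<close>, so \<open>R n ^ p\<close> commutes with the translation \<open>R 0\<close> and is determined by its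
  values at the position \<open>0\<close>. It kills \<open>1\<^sub>0\<close> in the first copy since \<open>R n\<close> does. In the second copy, the value is
  \<open>d (n - 1)\<close> times the product of the weights at all positions except \<open>de\<close>, and one of these weights is zero:
  for \<open>n = 2\<close> the zeros of the weight are \<open>0\<close> and \<open>2 lam + 1\<close>, which is where the assumption enters; for \<open>n > 2\<close>
  they include \<open>0\<close> and \<open>1\<close>.
\<close>

lemma R_power_p_zero:
  assumes exc: "de \<noteq> 0 \<or> lam = 0 \<or> d 1 = 0" and n: "2 \<le> n" "n \<le> p - 1"
  shows "R n ^ p = 0"
proof (rule eop_basis_eqI)
  obtain i where i: "n = Suc i" "1 \<le> i" using n by (cases n) auto
  have ip: "i < p" using i n by auto
  have pz: "(of_nat p :: 'k eop) = 0" using scalar_op_of_nat[where 'a = 'k, of p] by (simp add: scalar_op_0)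
  have pS: "p = Suc (p - 1)" using p5 by simp
  have "ad (R n ^ p) (R 0) = 0"
  proof -
    obtain c where "(ad (R n) ^^ p) (R 0) = scalar_op c * R (p * (n - 1))" using ad_R_power[OF n] by blast
    moreover have "R (p * (n - 1)) = 0" using n by (intro R_ge) (cases "n - 1"; simp)
    ultimately show ?thesis using ad_pow_prime(1)[OF prime_p pz] by simp
  qed
  then have com: "R n ^ p * R 0 = R 0 * R n ^ p" by (simp add: ad_def)
  have com': "R n ^ p * R 0 ^ k = R 0 ^ k * R n ^ p" for k
    by (induction k) (simp_all add: com mult.assoc[symmetric], simp add: com mult.assoc)
  have "app (R n ^ p) (bas b 0) = (\<lambda>_. 0)" for b
  proof (cases b)
    case True
    have "app (R n) (bas b 0) = (\<lambda>_. 0)"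
      using R_bas(1)[of 0 n] i True Wt_0_Suc[of i lam] by (simp add: prime_field_closed)
    then show ?thesis by (subst pS) (simp only: app_power_Suc app_zero)
  next
    case False
    define a where "a = de - of_nat i"
    have a: "a \<in> prime_field" using de_pf by (auto simp: a_def intro!: prime_field_closed)
    have 1: "app (R n) (bas b 0) = (\<lambda>x. d i * bas True a x)"
      using R_bas(2)[of 0 n] i False Wt_0_Suc[of i "lam - de"] by (simp add: prime_field_closed a_def Bc_at_0)
    show ?thesis
    proof (cases "d i = 0")
      case True
      then show ?thesis by (subst pS) (simp only: app_power_Suc 1 mult_zero_left app_zero)
    next
      case di: False
    obtain r where r: "r \<in> prime_field" "r \<noteq> de" "wt lam i r = 0"
    proof (cases "de = 0")
      case True
      have "wt lam i 1 = 0"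
      proof (cases "i = 1")
        case i1: True
        then have "lam = 0" using exc True di by simp
        then show ?thesis by (simp add: wt_def i1)
      next
        case False
        then show ?thesis using i wt_of_nat_zero[of 1 i lam] by simp
      qed
      then show thesis using True by (intro that[of 1]) (auto intro: prime_field_closed)
    next
      case False
      then show thesis using wt_of_nat_zero[of 0 i lam] i by (intro that[of 0]) (auto intro: prime_field_closed)
    qed
    obtain t where t: "t < p - 1" "r = de - of_nat i - of_nat t * of_nat i"
      using wt_root_progression[OF i(2) ip r(1,2)] by blast
    have "(\<Prod>t<p - 1. wt lam i (a - of_nat t * of_nat i)) = 0"
      using t r by (intro prod_zero) (auto simp: a_def)
    then show ?thesis
      by (subst pS) (simp only: app_power_Suc 1 app_scale R_True_power[OF i(1) a] mult_zero_left mult_zero_right)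
    qed
  qed
  note z = this
  fix b and a :: 'k assume "a \<in> prime_field"
  then obtain k where "a = of_nat k" by (rule prime_field_cases)
  then have "bas b a = app (R 0 ^ k) (bas b 0)" by (simp add: R_0_power prime_field_closed)
  then have "app (R n ^ p) (bas b a) = app (R n ^ p * R 0 ^ k) (bas b 0)" by (simp add: app_times)
  also have "\<dots> = (\<lambda>_. 0)" unfolding com' by (simp only: app_times z app_zero)
  finally show "app (R n ^ p) (bas b a) = app 0 (bas b a)" by (simp only: app_0)
qed

end

section \<open>Representations of the Witt algebra and the p-mapping\<close>

lemma witt_simps [simp]:
  "carrier (witt p P) = witt_subspace p (-1)"
  "x \<oplus>\<^bsub>witt p P\<^esub> y = (\<lambda>n. x n + y n)" "c \<odot>\<^bsub>witt p P\<^esub> x = (\<lambda>n. c * x n)"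
  "\<zero>\<^bsub>witt p P\<^esub> = (\<lambda>_. 0)" "pmap (witt p P) = P"
  by (simp_all add: witt_def)

lemma witt_subspace_closed:
  "(\<lambda>_. 0) \<in> witt_subspace p q"
  "x \<in> witt_subspace p q \<Longrightarrow> y \<in> witt_subspace p q \<Longrightarrow> (\<lambda>n. x n + y n) \<in> witt_subspace p q"
  "x \<in> witt_subspace p q \<Longrightarrow> (\<lambda>n. c * x n) \<in> witt_subspace p q"
  "i \<in> {q..int p - 2} \<Longrightarrow> witt_e i \<in> witt_subspace p q"
  by (auto simp: witt_subspace_def witt_e_def)

lemma witt_subspace_antimono: "q \<le> r \<Longrightarrow> witt_subspace p r \<subseteq> witt_subspace p q"
  by (auto simp: witt_subspace_def)

lemma witt_bracket_closed:
  assumes q: "q \<in> {-1, 0}" and x: "x \<in> witt_subspace p q" and y: "y \<in> witt_subspace p q"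
  shows "bracket (witt p P) x y \<in> witt_subspace p q"
proof -
  have "bracket (witt p P) x y n = 0" if n: "n \<notin> {q..int p - 2}" for n
  proof (cases "n \<in> {-1..int p - 2}")
    case True
    then have "n = -1" "q = 0" using q n by auto
    have "(\<Sum>i\<in>{-1..int p - 2}. \<Sum>j\<in>{-1..int p - 2}. if i + j = n then of_int (j - i) * x i * y j else 0) = 0"
    proof (intro sum.neutral ballI)
      fix i j
      show "(if i + j = n then of_int (j - i) * x i * y j else 0) = 0"
        using x y \<open>n = -1\<close> \<open>q = 0\<close> by (cases "i < 0"; cases "j < 0") (auto simp: witt_subspace_def)
    qed
    then show ?thesis using True by (simp add: witt_def)
  next
    case False
    then show ?thesis unfolding witt_def restricted_lie.simps by (simp only: if_False)
  qed
  then show ?thesis by (simp add: witt_subspace_def)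
qed

lemma abelian_group_witt: "abelian_group (witt p P)"
proof (rule abelian_groupI)
  fix x assume "x \<in> carrier (witt p P)"
  then show "\<exists>y\<in>carrier (witt p P). y \<oplus>\<^bsub>witt p P\<^esub> x = \<zero>\<^bsub>witt p P\<^esub>"
    using witt_subspace_closed(3)[of x p "-1" "-1"] by (intro bexI[of _ "\<lambda>n. -1 * x n"]) auto
qed (auto simp: witt_subspace_closed add_ac)

lemma witt_subspace_induct [consumes 1, case_names zero add]:
  fixes Q :: "(int \<Rightarrow> 'k::field) \<Rightarrow> bool"
  assumes x: "x \<in> witt_subspace p q"
    and zero: "Q (\<lambda>_. 0)"
    and add: "\<And>y c i. y \<in> witt_subspace p q \<Longrightarrow> Q y \<Longrightarrow> i \<in> {q..int p - 2} \<Longrightarrow> Q (\<lambda>n. y n + c * witt_e i n)"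
  shows "Q x"
proof -
  have *: "Q (\<lambda>n. if n \<in> I then x n else 0)" if "finite I" "I \<subseteq> {q..int p - 2}" for I
    using that
  proof (induction I rule: finite_induct)
    case (insert i I)
    have "(\<lambda>n. if n \<in> I then x n else 0) \<in> witt_subspace p q" using insert by (auto simp: witt_subspace_def)
    from add[OF this, of i "x i"] have "Q (\<lambda>n. (if n \<in> I then x n else 0) + x i * witt_e i n)"
      using insert by blast
    also have "(\<lambda>n. (if n \<in> I then x n else 0) + x i * witt_e i n) = (\<lambda>n. if n \<in> insert i I then x n else 0)"
      using insert by (auto simp: witt_e_def fun_eq_iff)
    finally show ?case .
  qed (simp add: zero)
  have "(\<lambda>n. if n \<in> {q..int p - 2} then x n else 0) = x" using x by (auto simp: witt_subspace_def fun_eq_iff)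
  then show ?thesis using *[of "{q..int p - 2}"] by simp
qed

locale witt_restricted = witt_char p k_type for p and k_type :: "'k::field itself" +
  fixes P :: "(int \<Rightarrow> 'k) \<Rightarrow> int \<Rightarrow> 'k" and \<chi> :: "(int \<Rightarrow> 'k) \<Rightarrow> 'k"
  assumes p_mapping: "is_p_mapping p (witt p P)"
    and P_e: "\<forall>i\<in>{-1..int p - 2}. P (witt_e i) = (if i = 0 then witt_e i else (\<lambda>_. 0))"
    and \<chi>_linear: "linear_form (witt p P) \<chi>" and \<chi>_height: "height p \<chi> = 0"
begin

lemma \<chi>_add: "x \<in> witt_subspace p (-1) \<Longrightarrow> y \<in> witt_subspace p (-1) \<Longrightarrow> \<chi> (\<lambda>n. x n + y n) = \<chi> x + \<chi> y"
  and \<chi>_scale: "x \<in> witt_subspace p (-1) \<Longrightarrow> \<chi> (\<lambda>n. c * x n) = c * \<chi> x"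
  using \<chi>_linear by (simp_all add: linear_form_def)

lemma \<chi>_zero: "\<chi> (\<lambda>_. 0) = 0"
  using \<chi>_scale[OF witt_subspace_closed(1), of 0] by simp

lemma \<chi>_vanish: "(\<And>i. i \<in> {q..int p - 2} \<Longrightarrow> \<chi> (witt_e i) = 0) \<Longrightarrow> -1 \<le> q \<Longrightarrow> x \<in> witt_subspace p q \<Longrightarrow> \<chi> x = 0"
proof -
  assume e: "\<And>i. i \<in> {q..int p - 2} \<Longrightarrow> \<chi> (witt_e i) = 0" and q: "-1 \<le> q" and x: "x \<in> witt_subspace p q"
  note sub = subsetD[OF witt_subspace_antimono[OF q]]
  show "\<chi> x = 0" using x
  proof (induction rule: witt_subspace_induct)
    case (add y c i)
    have "witt_e i \<in> witt_subspace p (-1)" using add q by (intro witt_subspace_closed) auto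
    then show ?case using add e by (simp add: \<chi>_add \<chi>_scale witt_subspace_closed sub)
  qed (rule \<chi>_zero)
qed

text \<open>
  Height \<open>0\<close> means that \<open>\<chi>\<close> vanishes on \<open>span(e\<^sub>0, e\<^sub>1, \<dots>)\<close> but not on the whole algebra.
\<close>

lemma \<chi>_borel: "x \<in> witt_subspace p 0 \<Longrightarrow> \<chi> x = 0"
  and \<chi>_e_minus_1: "\<chi> (witt_e (-1)) \<noteq> 0"
proof -
  define S where "S = {i \<in> {-1..int p - 2}. \<forall>x\<in>witt_subspace p i. \<chi> x = 0}"
  have top: "\<chi> (witt_e (int p - 2)) = 0" and min: "Min S = 0"
    using \<chi>_height p5 by (auto simp: height_def S_def split: if_splits)
  have fin: "finite S" by (rule finite_subset[of _ "{-1..int p - 2}"]) (auto simp: S_def)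
  have "\<forall>x\<in>witt_subspace p (int p - 2). \<chi> x = 0" using \<chi>_vanish[of "int p - 2"] top p5 by auto
  then have "int p - 2 \<in> S" using p5 by (auto simp: S_def)
  then have "Min S \<in> S" using fin by (intro Min_in) auto
  then have "0 \<in> S" using min by simp
  then show b: "x \<in> witt_subspace p 0 \<Longrightarrow> \<chi> x = 0" for x by (simp add: S_def)
  have "-1 \<notin> S" using Min_le[OF fin, of "-1"] min by auto
  then obtain x where x: "x \<in> witt_subspace p (-1)" "\<chi> x \<noteq> 0" using p5 by (auto simp: S_def)
  show "\<chi> (witt_e (-1)) \<noteq> 0"
  proof
    assume e: "\<chi> (witt_e (-1)) = 0"
    have "\<chi> (witt_e i) = 0" if "i \<in> {-1..int p - 2}" for i
    proof (cases "i = -1")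
      case False
      then show ?thesis using that by (intro b witt_subspace_closed) auto
    qed (simp add: e)
    then show False using \<chi>_vanish[of "-1" x] x by simp
  qed
qed

text \<open>
  Both sides of the conclusion change in the same way under sums, by Jacobson's formula for the
  \<open>p\<close>-mapping on one side and for \<open>p\<close>-th powers on the other, and under scalars. The lemma serves for
  the operators of the extension (\<open>q = -1\<close>) and for the characters of the Borel subalgebra (\<open>q = 0\<close>).
\<close>

lemma p_mapping_from_basis:
  fixes h :: "(int \<Rightarrow> 'k) \<Rightarrow> 'r::ring_1" and \<iota> :: "'k \<Rightarrow> 'r"
  assumes q: "q \<in> {-1, 0}"
    and \<iota>: "\<And>a b. \<iota> (a + b) = \<iota> a + \<iota> b" "\<And>a b. \<iota> (a * b) = \<iota> a * \<iota> b" "\<iota> 1 = 1"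
      and \<iota>_comm: "\<And>c r. \<iota> c * r = r * \<iota> c"
    and h_add: "\<And>x y. x \<in> witt_subspace p q \<Longrightarrow> y \<in> witt_subspace p q \<Longrightarrow> h (\<lambda>n. x n + y n) = h x + h y"
    and h_scale: "\<And>c x. x \<in> witt_subspace p q \<Longrightarrow> h (\<lambda>n. c * x n) = \<iota> c * h x"
    and h_bracket: "\<And>x y. x \<in> witt_subspace p q \<Longrightarrow> y \<in> witt_subspace p q \<Longrightarrow>
      h (bracket (witt p P) x y) = h x * h y - h y * h x"
    and basis: "\<And>i. i \<in> {q..int p - 2} \<Longrightarrow> h (witt_e i) ^ p = h (P (witt_e i)) + \<iota> (\<chi> (witt_e i) ^ p)"
    and x: "x \<in> witt_subspace p q"
  shows "P x \<in> witt_subspace p q \<and> h x ^ p = h (P x) + \<iota> (\<chi> x ^ p)"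
proof -
  let ?S = "witt_subspace p q :: (int \<Rightarrow> 'k) set"
  let ?W = "witt p P"
  interpret W: abelian_group ?W by (rule abelian_group_witt)
  have sub: "?S \<subseteq> carrier ?W" unfolding witt_simps using q by (intro witt_subspace_antimono) auto
  have \<iota>0: "\<iota> 0 = 0" using \<iota>(1)[of 0 0] by simp
  have \<iota>_pow: "\<iota> (a ^ n) = \<iota> a ^ n" for a n by (induction n) (simp_all add: \<iota>)
  have \<iota>_nat: "\<iota> (of_nat n) = of_nat n" for n by (induction n) (simp_all add: \<iota> \<iota>0)
  have pz: "(of_nat p :: 'r) = 0" using \<iota>_nat[of p] by (simp add: \<iota>0)
  have scale_pow: "(\<iota> c * r) ^ n = \<iota> (c ^ n) * r ^ n" for c r n
  proof (induction n)
    case (Suc n)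
    have "\<iota> c * r * (\<iota> (c ^ n) * r ^ n) = \<iota> c * \<iota> (c ^ n) * (r * r ^ n)"
      by (metis \<iota>_comm mult.assoc)
    then show ?case by (simp add: Suc \<iota>(2))
  qed (simp add: \<iota>)
  have h0: "h (\<lambda>_. 0) = 0" using h_scale[OF x, of 0] by (simp add: \<iota>0)
  have \<chi>S: "\<chi> (\<lambda>n. x n + y n) = \<chi> x + \<chi> y" "\<chi> (\<lambda>n. c * x n) = c * \<chi> x" if "x \<in> ?S" "y \<in> ?S" for x y c
    using that sub by (auto intro!: \<chi>_add \<chi>_scale)
  note cl = witt_subspace_closed
  have jac: "jacobson_coeff ?W x y n j \<in> ?S \<and> h (jacobson_coeff ?W x y n j) = ad_coeff (h x) (h y) n j"
    if "x \<in> ?S" "y \<in> ?S" for x y n j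
  proof (induction n arbitrary: j)
    case 0
    then show ?case using that by (simp add: cl h0)
  next
    case (Suc n)
    have 1: "bracket ?W u (jacobson_coeff ?W x y n j) \<in> ?S"
        "h (bracket ?W u (jacobson_coeff ?W x y n j)) = ad (h u) (ad_coeff (h x) (h y) n j)" if "u \<in> ?S" for u j
      using Suc.IH[of j] that by (simp_all add: witt_bracket_closed[OF q] h_bracket ad_def)
    show ?case
    proof (cases "j = 0")
      case True
      then show ?thesis using 1(1)[OF that(2), of 0] 1(2)[OF that(2), of 0] by simp
    next
      case False
      then show ?thesis using 1(1)[OF that(2), of j] 1(2)[OF that(2), of j] 1(1)[OF that(1), of "j - 1"] 1(2)[OF that(1), of "j - 1"]
        by (simp add: h_add cl)
    qed
  qed
  have fs: "finsum ?W f I \<in> ?S \<and> h (finsum ?W f I) = (\<Sum>i\<in>I. h (f i))" if "finite I" "\<And>i. i \<in> I \<Longrightarrow> f i \<in> ?S" for I and f :: "nat \<Rightarrow> int \<Rightarrow> 'k"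
    using that
  proof (induction I rule: finite_induct)
    case empty
    then show ?case using cl(1)[of p q] by (simp add: h0)
  next
    case (insert i I)
    have "finsum ?W f (insert i I) = f i \<oplus>\<^bsub>?W\<^esub> finsum ?W f I"
      using insert sub by (intro W.finsum_insert) auto
    then show ?case using insert by (simp add: cl h_add)
  qed
  define good where "good x \<longleftrightarrow> x \<in> ?S \<and> P x \<in> ?S \<and> h x ^ p = h (P x) + \<iota> (\<chi> x ^ p)" for x
  have good_scale: "good (\<lambda>n. c * x n)" if "good x" for c x
  proof -
    have x: "x \<in> ?S" "P x \<in> ?S" "h x ^ p = h (P x) + \<iota> (\<chi> x ^ p)" using that by (auto simp: good_def)
    have "P (\<lambda>n. c * x n) = (\<lambda>n. c ^ p * P x n)" using p_mapping x(1) sub by (auto simp: is_p_mapping_def)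
    then show ?thesis using x
      by (simp add: good_def cl h_scale scale_pow \<chi>S[OF x(1) x(1)] power_mult_distrib distrib_left \<iota>)
  qed
  have good_add: "good (\<lambda>n. x n + y n)" if "good x" "good y" for x y
  proof -
    have x: "x \<in> ?S" "P x \<in> ?S" "h x ^ p = h (P x) + \<iota> (\<chi> x ^ p)" using that by (auto simp: good_def)
    have y: "y \<in> ?S" "P y \<in> ?S" "h y ^ p = h (P y) + \<iota> (\<chi> y ^ p)" using that by (auto simp: good_def)
    define f where "f = (\<lambda>i n. inverse (of_nat i) * jacobson_coeff ?W x y (p - 1) (i - 1) n)"
    have f: "f i \<in> ?S" "h (f i) = \<iota> (inverse (of_nat i)) * ad_coeff (h x) (h y) (p - 1) (i - 1)" for i
      using jac[OF x(1) y(1)] by (simp_all add: f_def cl h_scale)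
    have P: "P (\<lambda>n. x n + y n) = (\<lambda>n. P x n + P y n + finsum ?W f {1..p - 1} n)"
    proof -
      have m: "x \<in> carrier ?W" "y \<in> carrier ?W" using x(1) y(1) sub by auto
      have "pmap ?W (x \<oplus>\<^bsub>?W\<^esub> y) = pmap ?W x \<oplus>\<^bsub>?W\<^esub> pmap ?W y \<oplus>\<^bsub>?W\<^esub>
        (\<Oplus>\<^bsub>?W\<^esub>i\<in>{1..p-1}. inverse (of_nat i) \<odot>\<^bsub>?W\<^esub> jacobson_coeff ?W x y (p - 1) (i - 1))"
        using p_mapping m unfolding is_p_mapping_def by blast
      then show ?thesis by (simp only: witt_simps f_def)
    qed
    obtain c where c: "\<And>j. 1 \<le> j \<Longrightarrow> of_nat j * c j = ad_coeff (h x) (h y) (p - 1) (j - 1)"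
      "(h x + h y) ^ p = h x ^ p + h y ^ p + (\<Sum>j = 1..p - 1. c j)"
      using jacobson_formula[OF prime_p pz] by blast
    have "h (f j) = c j" if "j \<in> {1..p - 1}" for j
    proof -
      have nz: "(of_nat j :: 'k) \<noteq> 0" using that p5 by (intro of_nat_nonzero) auto
      have "h (f j) = \<iota> (inverse (of_nat j)) * (of_nat j * c j)" using that by (simp add: f c)
      also have "\<dots> = \<iota> (inverse (of_nat j) * of_nat j) * c j" by (simp only: \<iota> \<iota>_nat mult.assoc)
      finally show ?thesis using nz by (simp add: \<iota>)
    qed
    then have s: "h (finsum ?W f {1..p - 1}) = (\<Sum>j = 1..p - 1. c j)" "finsum ?W f {1..p - 1} \<in> ?S"
      using fs[of "{1..p - 1}" f] f by auto
    have "h (\<lambda>n. x n + y n) ^ p = h x ^ p + h y ^ p + (\<Sum>j = 1..p - 1. c j)"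
      using x y c(2) by (simp add: h_add)
    also have "\<dots> = h (P (\<lambda>n. x n + y n)) + \<iota> (\<chi> (\<lambda>n. x n + y n) ^ p)"
      unfolding P using x y s by (simp add: h_add cl \<chi>S frobenius_add[OF prime_p CHAR_p] \<iota> add_ac)
    finally show ?thesis unfolding good_def P using x y s by (simp add: cl P)
  qed
  have e: "good (witt_e i)" if "i \<in> {q..int p - 2}" for i
  proof -
    have "i \<in> {-1..int p - 2}" using that q by auto
    then have "P (witt_e i) = (if i = 0 then witt_e i else (\<lambda>_. 0))" using P_e by blast
    then have "P (witt_e i) \<in> ?S" using cl(1)[of p q] cl(4)[OF that] by (cases "i = 0") simp_all
    then show ?thesis using that basis by (simp add: good_def cl)
  qed
  have "good (\<lambda>_. 0)"
  proof -
    have "0 \<in> {q..int p - 2}" using q p5 by auto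
    from good_scale[OF e[OF this], of 0] show ?thesis by simp
  qed
  have "good x" using x
  proof (induction rule: witt_subspace_induct)
    case zero show ?case by fact
  next
    case (add y c i)
    show ?case by (intro good_add good_scale add e)
  qed
  then show ?thesis by (simp add: good_def)
qed

lemma restricted_lie_ops_witt: "restricted_lie_ops (witt p P)"
proof
  show "pmap (witt p P) x \<in> carrier (witt p P)" if "x \<in> carrier (witt p P)" for x
    using p_mapping that by (simp add: is_p_mapping_def)
qed (simp_all add: witt_subspace_closed witt_bracket_closed)

lemma bracket_borel_at_0: "x \<in> witt_subspace p 0 \<Longrightarrow> y \<in> witt_subspace p 0 \<Longrightarrow> bracket (witt p P) x y 0 = 0"
proof -
  assume "x \<in> witt_subspace p 0" "y \<in> witt_subspace p 0"
  then have x: "x i = 0" "y i = 0" if "i < 0" for i using that by (auto simp: witt_subspace_def)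
  have "(\<Sum>i\<in>{-1..int p - 2}. \<Sum>j\<in>{-1..int p - 2}. if i + j = 0 then of_int (j - i) * x i * y j else 0) = 0"
  proof (intro sum.neutral ballI)
    fix i j
    show "(if i + j = 0 then of_int (j - i) * x i * y j else 0) = 0"
      using x(1)[of i] x(2)[of j] by (cases "i < 0"; cases "j < 0"; cases "i = j") auto
  qed
  then show ?thesis by (simp add: witt_def)
qed

text \<open>
  The character \<open>l\<close> of the Borel subalgebra respects the \<open>p\<close>-mapping because \<open>l\<^sup>p = l\<close>.
\<close>

lemma borel_character:
  assumes x: "x \<in> witt_subspace p 0"
  shows "P x \<in> witt_subspace p 0" "of_nat l * P x 0 = (of_nat l * x 0 :: 'k) ^ p"
proof -
  have "P x \<in> witt_subspace p 0 \<and> (of_nat l * x 0 :: 'k) ^ p = of_nat l * P x 0 + \<chi> x ^ p" for l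
  proof (rule p_mapping_from_basis[where \<iota> = "\<lambda>c. c" and h = "\<lambda>x. of_nat l * x 0", of 0, OF _ _ _ _ _ _ _ _ _ x])
    show "of_nat l * bracket (witt p P) x y 0 = (of_nat l * x 0) * (of_nat l * y 0) - (of_nat l * y 0) * (of_nat l * x 0)"
      if "x \<in> witt_subspace p 0" "y \<in> witt_subspace p 0" for x y using bracket_borel_at_0[OF that] by simp
    show "(of_nat l * witt_e i 0) ^ p = of_nat l * P (witt_e i) 0 + \<chi> (witt_e i) ^ p" if i: "i \<in> {0..int p - 2}" for i
    proof -
      have "\<chi> (witt_e i) = 0" using i by (intro \<chi>_borel witt_subspace_closed)
      moreover have "P (witt_e i) = (if i = 0 then witt_e i else (\<lambda>_. 0))" using P_e i by auto
      moreover have "(of_nat l :: 'k) ^ p = of_nat l"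
      proof (induction l)
        case 0
        then show ?case using p5 by (simp add: power_0_left)
      next
        case (Suc n)
        then show ?case using frobenius_add[OF prime_p CHAR_p, of 1 "of_nat n"] by simp
      qed
      ultimately show ?thesis using p5 by (auto simp: witt_e_def power_0_left)
    qed
  qed (simp_all add: algebra_simps)
  then show "P x \<in> witt_subspace p 0" "of_nat l * P x 0 = (of_nat l * x 0 :: 'k) ^ p"
    using \<chi>_borel[OF x] p5 by (simp_all add: power_0_left)
qed

lemma induced_module_borel: "induced_module p (witt p P) \<chi> (witt_subspace p 0) (\<lambda>x. of_nat l * x 0)"
proof -
  interpret W: restricted_lie_ops p "witt p P" \<chi> by (rule restricted_lie_ops_witt)
  interpret B: restricted_lie_ops p "witt p P\<lparr>carrier := witt_subspace p 0\<rparr>" "\<lambda>_. 0"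
  proof
    show "pmap (witt p P\<lparr>carrier := witt_subspace p 0\<rparr>) x \<in> carrier (witt p P\<lparr>carrier := witt_subspace p 0\<rparr>)"
      if "x \<in> carrier (witt p P\<lparr>carrier := witt_subspace p 0\<rparr>)" for x
      using borel_character(1) that by simp
  qed (simp_all add: witt_subspace_closed witt_bracket_closed)
  show ?thesis
  proof
    show "witt_subspace p 0 \<subseteq> carrier (witt p P)" using witt_subspace_antimono[of "-1" 0] by simp
    show "\<chi> x = 0" if "x \<in> witt_subspace p 0" for x using \<chi>_borel that .
  qed (use p5 borel_character in \<open>simp_all add: bracket_borel_at_0 algebra_simps\<close>)
qed

end

context witt_restricted
begin

sublocale L: restricted_lie_ops p "witt p P" \<chi> by (rule restricted_lie_ops_witt)

abbreviation "A \<equiv> red_env_algebra p (witt p P) \<chi>"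

end

section \<open>The extension as a module\<close>

text \<open>
  The assumption makes the \<open>p\<close>-th power of \<open>e\<^sub>1\<close> vanish, see \<open>R_power_p_zero\<close>.
\<close>

locale witt_extension = witt_restricted p k_type P \<chi> + witt_model p k_type lam de d
  for p and k_type :: "'k::field itself" and P \<chi> and lam de :: 'k and d +
  assumes exc: "de \<noteq> 0 \<or> lam = 0 \<or> d 1 = 0"
begin

definition "z = \<chi> (witt_e (-1))"
text \<open>
  The powers of \<open>z\<close> with which \<open>e\<^sub>n\<^sub>-\<^sub>1\<close> acts, \<open>z\<^sup>1\<^sup>-\<^sup>n\<close>; they make \<open>e\<^sub>-\<^sub>1\<^sup>p\<close> equal to \<open>z\<^sup>p = \<chi>(e\<^sub>-\<^sub>1)\<^sup>p\<close>.
\<close>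

definition "cf n = z * inverse z ^ n"

lemma z: "z \<noteq> 0" using \<chi>_e_minus_1 by (simp add: z_def)

lemma cf_nonzero: "cf n \<noteq> 0" using z by (simp add: cf_def)

lemma cf_mult: "m + n \<noteq> 0 \<Longrightarrow> cf m * cf n = cf (m + n - 1)"
proof (cases "m + n")
  case (Suc k)
  have "cf m * cf n = z * z * inverse z ^ (m + n)" by (simp add: cf_def power_add mult_ac)
  also have "\<dots> = z * (z * inverse z) * inverse z ^ k" by (simp only: Suc power_Suc mult_ac)
  also have "\<dots> = cf (m + n - 1)" using z by (simp add: Suc cf_def)
  finally show ?thesis .
qed simp

definition "rho x = (\<Sum>n<p. scalar_op (x (int n - 1) * cf n) * R n)"

lemma rho_add: "rho (\<lambda>n. x n + y n) = rho x + rho y"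
  by (simp add: rho_def distrib_right scalar_op_add sum.distrib)

lemma rho_scale: "rho (\<lambda>n. c * x n) = scalar_op c * rho x"
  by (simp add: rho_def sum_distrib_left scalar_op_mult mult.assoc)

lemma rho_e: "n < p \<Longrightarrow> rho (witt_e (int n - 1)) = scalar_op (cf n) * R n"
proof -
  assume n: "n < p"
  have "rho (witt_e (int n - 1)) = (\<Sum>k<p. if k = n then scalar_op (cf k) * R k else 0)"
    unfolding rho_def by (intro sum.cong refl) (simp add: witt_e_def scalar_op_0)
  also have "\<dots> = scalar_op (cf n) * R n" using n by (simp add: sum.delta)
  finally show ?thesis .
qed

lemma witt_index_sum: "(\<Sum>i\<in>{-1..int p - 2}. f i) = (\<Sum>n<p. f (int n - 1))"
proof (rule sum.reindex_bij_witness[of _ "\<lambda>n. int n - 1" "\<lambda>i. nat (i + 1)"])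
  fix i assume "i \<in> {-1..int p - 2}"
  then show "int (nat (i + 1)) - 1 = i" "nat (i + 1) \<in> {..<p}" "f (int (nat (i + 1)) - 1) = f i" by auto
qed auto

lemma bracket_nth:
  "k < p \<Longrightarrow> bracket (witt p P) x y (int k - 1)
    = (\<Sum>m<p. \<Sum>n<p. if m + n = Suc k then (of_nat n - of_nat m) * x (int m - 1) * y (int n - 1) else 0)"
proof -
  assume k: "k < p"
  have "bracket (witt p P) x y (int k - 1) = (\<Sum>m<p. \<Sum>n<p. if (int m - 1) + (int n - 1) = int k - 1
      then of_int ((int n - 1) - (int m - 1)) * x (int m - 1) * y (int n - 1) else 0)"
  proof -
    have "int k - 1 \<in> {-1..int p - 2}" using k by auto
    then show ?thesis by (simp only: witt_def restricted_lie.simps if_True witt_index_sum)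
  qed
  also have "\<dots> = (\<Sum>m<p. \<Sum>n<p. if m + n = Suc k then (of_nat n - of_nat m) * x (int m - 1) * y (int n - 1) else 0)"
    by (intro sum.cong refl if_cong) auto
  finally show ?thesis .
qed

lemma rho_bracket: "rho (bracket (witt p P) x y) = rho x * rho y - rho y * rho x"
proof -
  define X Y where "X m = x (int m - 1)" and "Y m = y (int m - 1)" for m
  have "rho x * rho y - rho y * rho x = (\<Sum>m<p. \<Sum>n<p. scalar_op (X m * cf m) * R m * (scalar_op (Y n * cf n) * R n))
      - (\<Sum>m<p. \<Sum>n<p. scalar_op (Y n * cf n) * R n * (scalar_op (X m * cf m) * R m))"
    unfolding rho_def sum_product X_def Y_def by (subst (2) sum.swap) (rule refl)
  also have "\<dots> = (\<Sum>m<p. \<Sum>n<p. scalar_op (X m * cf m) * scalar_op (Y n * cf n) * (R m * R n - R n * R m))"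
    unfolding sum_subtractf[symmetric]
  proof (intro sum.cong refl)
    fix m n
    have e: "scalar_op a * F * (scalar_op b * G) = scalar_op a * scalar_op b * (F * G)" "scalar_op b * G * (scalar_op a * F) = scalar_op a * scalar_op b * (G * F)"
      for F G :: "'k eop" and a b
      by (metis scalar_op_central mult.assoc)+
    show "scalar_op (X m * cf m) * R m * (scalar_op (Y n * cf n) * R n) - scalar_op (Y n * cf n) * R n * (scalar_op (X m * cf m) * R m)
      = scalar_op (X m * cf m) * scalar_op (Y n * cf n) * (R m * R n - R n * R m)"
      unfolding e(1)[of "X m * cf m" "R m" "Y n * cf n" "R n"] e(2)[of "Y n * cf n" "R n" "X m * cf m" "R m"]
      by (rule right_diff_distrib[symmetric])
  qed
  also have "\<dots> = (\<Sum>m<p. \<Sum>n<p. \<Sum>k<p. if m + n = Suc k then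
      scalar_op ((of_nat n - of_nat m) * X m * Y n * cf k) * R k else 0)"
  proof (intro sum.cong refl)
    fix m n assume "m \<in> {..<p}" "n \<in> {..<p}"
    then have mn: "m \<le> p - 1" "n \<le> p - 1" by auto
    show "scalar_op (X m * cf m) * scalar_op (Y n * cf n) * (R m * R n - R n * R m)
      = (\<Sum>k<p. if m + n = Suc k then scalar_op ((of_nat n - of_nat m) * X m * Y n * cf k) * R k else 0)"
    proof (cases "m + n = 0")
      case True
      then show ?thesis by simp
    next
      case False
      then have e: "m + n = Suc k \<longleftrightarrow> k = m + n - 1" for k by auto
      have "X m * cf m * (Y n * cf n) * (of_nat n - of_nat m) = (of_nat n - of_nat m) * X m * Y n * (cf m * cf n)"
        by (simp only: mult_ac)
      also have "\<dots> = (of_nat n - of_nat m) * X m * Y n * cf (m + n - 1)"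
        by (simp only: cf_mult[OF False])
      finally have c: "X m * cf m * (Y n * cf n) * (of_nat n - of_nat m) = \<dots>" .
      have "scalar_op (X m * cf m) * scalar_op (Y n * cf n) * (R m * R n - R n * R m)
         = scalar_op ((of_nat n - of_nat m) * X m * Y n * cf (m + n - 1)) * R (m + n - 1)"
        unfolding R_bracket[OF mn] c[symmetric] scalar_op_mult by (simp only: mult.assoc)
      then show ?thesis unfolding e using R_ge[of "m + n - 1"] by (simp add: sum.delta)
    qed
  qed
  also have "\<dots> = (\<Sum>k<p. \<Sum>m<p. \<Sum>n<p. if m + n = Suc k then
      scalar_op ((of_nat n - of_nat m) * X m * Y n * cf k) * R k else 0)"
    by (subst (2) sum.swap, subst sum.swap) (rule refl)
  also have "\<dots> = rho (bracket (witt p P) x y)"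
    unfolding rho_def
  proof (intro sum.cong refl)
    fix k assume "k \<in> {..<p}"
    then have k: "k < p" by simp
    show "(\<Sum>m<p. \<Sum>n<p. if m + n = Suc k then scalar_op ((of_nat n - of_nat m) * X m * Y n * cf k) * R k else 0)
      = scalar_op (bracket (witt p P) x y (int k - 1) * cf k) * R k"
      unfolding bracket_nth[OF k] sum_distrib_right scalar_op_sum X_def Y_def
      by (intro sum.cong refl) (simp add: scalar_op_0)
  qed
  finally show ?thesis ..
qed

lemma scalar_op_times_power: "(scalar_op c * F) ^ n = scalar_op (c ^ n) * F ^ n"
proof (induction n)
  case (Suc n)
  have "scalar_op c * F * (scalar_op (c ^ n) * F ^ n) = scalar_op c * scalar_op (c ^ n) * (F * F ^ n)"
    by (metis scalar_op_central mult.assoc)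
  then show ?case by (simp add: Suc scalar_op_mult)
qed (simp add: scalar_op_1)

lemma rho_pmap: "x \<in> witt_subspace p (-1) \<Longrightarrow> rho x ^ p = rho (P x) + scalar_op (\<chi> x ^ p)"
proof -
  assume x: "x \<in> witt_subspace p (-1)"
  have "rho (witt_e i) ^ p = rho (P (witt_e i)) + scalar_op (\<chi> (witt_e i) ^ p)" if i: "i \<in> {-1..int p - 2}" for i
  proof -
    define n where "n = nat (i + 1)"
    have n: "i = int n - 1" "n < p" using i by (auto simp: n_def)
    have L: "rho (witt_e i) ^ p = scalar_op (cf n ^ p) * R n ^ p"
      unfolding n(1) rho_e[OF n(2)] scalar_op_times_power ..
    have rho0: "rho (\<lambda>_. 0) = 0" using rho_scale[of 0 "\<lambda>_. 0"] by (simp add: scalar_op_0)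
    have Pe: "P (witt_e i) = (if i = 0 then witt_e i else (\<lambda>_. 0))" using P_e i by blast
    consider "n = 0" | "n = 1" | "2 \<le> n" by linarith
    then show ?thesis
    proof cases
      case 1
      then show ?thesis unfolding L Pe using n by (simp add: R_0_power_p rho0 cf_def z_def)
    next
      case 2
      have "\<chi> (witt_e i) = 0" using i n 2 by (intro \<chi>_borel witt_subspace_closed) auto
      moreover have "i = 0" using 2 n by simp
      moreover have "cf 1 = 1" using z by (simp add: cf_def)
      ultimately show ?thesis
        unfolding L Pe using n 2 rho_e[of 1] p5 by (simp add: R_1_power_p power_0_left scalar_op_0)
    next
      case 3
      then have "\<chi> (witt_e i) = 0" using i n by (intro \<chi>_borel witt_subspace_closed) auto
      moreover have "i \<noteq> 0" "n \<le> p - 1" using 3 n by auto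
      ultimately show ?thesis
        unfolding L Pe using R_power_p_zero[OF exc 3] p5 rho0 by (simp add: power_0_left scalar_op_0)
    qed
  qed
  with p_mapping_from_basis[where \<iota> = scalar_op and h = rho and q = "-1", OF _ scalar_op_add scalar_op_mult scalar_op_1 scalar_op_central rho_add rho_scale rho_bracket _ x]
  show ?thesis by blast
qed

lemma central_esc: "central_scalars scalar_op X f"
  by unfold_locales (rule scalar_op_add scalar_op_mult scalar_op_1 scalar_op_central)+

lemma rep_ex: "\<exists>h. h \<in> ring_hom A (class_ring TYPE('k eop)) \<and> (\<forall>f\<in>carrier L.F. h (L.cls f) = word_eval scalar_op rho f)"
proof -
  let ?h = "word_eval scalar_op rho" and ?R = "class_ring TYPE('k eop)"
  note we = central_scalars.word_eval_gen[OF central_esc] central_scalars.word_eval_smult[OF central_esc]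
    central_scalars.word_eval_one[OF central_esc]
  have hom: "?h \<in> ring_hom L.F ?R" by (rule central_scalars.word_eval_ring_hom[OF central_esc])
  have add: "?h (gen (x \<oplus>\<^bsub>witt p P\<^esub> y)) = ?h (gen x) \<oplus>\<^bsub>?R\<^esub> ?h (gen y)" for x y
    by (simp only: we class_ring_simps witt_simps rho_add)
  have smult: "?h (gen (c \<odot>\<^bsub>witt p P\<^esub> x)) = ?h (c \<odot>\<^bsub>L.F\<^esub> gen x)" if x: "x \<in> carrier (witt p P)" for c x
    unfolding we(2)[OF L.gen_in[OF x]] by (simp only: we(1) witt_simps rho_scale)
  have brk: "?h (gen x) \<otimes>\<^bsub>?R\<^esub> ?h (gen y) = ?h (gen y) \<otimes>\<^bsub>?R\<^esub> ?h (gen x) \<oplus>\<^bsub>?R\<^esub> ?h (gen (bracket (witt p P) x y))" for x y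
    by (simp only: we(1) class_ring_simps rho_bracket) simp
  have pow: "?h (gen x) [^]\<^bsub>?R\<^esub> p = ?h (gen (pmap (witt p P) x)) \<oplus>\<^bsub>?R\<^esub> ?h ((\<chi> x ^ p) \<odot>\<^bsub>L.F\<^esub> \<one>\<^bsub>L.F\<^esub>)"
    if "x \<in> carrier (witt p P)" for x
    unfolding we(2)[OF L.F.one_closed] we(3)
    using rho_pmap[of x] that by (simp only: we(1) class_ring_simps class_ring_pow witt_simps mult_1_right)
  show ?thesis
    by (rule L.red_env_universal[OF class_ring_ring hom add smult brk pow]) blast+
qed

definition "rep = (SOME h. h \<in> ring_hom A (class_ring TYPE('k eop)) \<and> (\<forall>f\<in>carrier L.F. h (L.cls f) = word_eval scalar_op rho f))"

lemma rep_hom: "rep \<in> ring_hom A (class_ring TYPE('k eop))"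
  and rep_cls: "f \<in> carrier L.F \<Longrightarrow> rep (L.cls f) = word_eval scalar_op rho f"
  using someI_ex[OF rep_ex, folded rep_def] by blast+

lemma rep_add: "a \<in> carrier A \<Longrightarrow> b \<in> carrier A \<Longrightarrow> rep (a \<oplus>\<^bsub>A\<^esub> b) = rep a + rep b"
  and rep_mult: "a \<in> carrier A \<Longrightarrow> b \<in> carrier A \<Longrightarrow> rep (a \<otimes>\<^bsub>A\<^esub> b) = rep a * rep b"
  and rep_one: "rep \<one>\<^bsub>A\<^esub> = 1"
  using ring_hom_add[OF rep_hom, of a b] ring_hom_mult[OF rep_hom, of a b] ring_hom_one[OF rep_hom]
  by (simp_all only: class_ring_simps)

lemma rep_ge: "x \<in> witt_subspace p (-1) \<Longrightarrow> rep (L.ge x) = rho x"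
  using rep_cls[OF L.gen_in[of x]] central_scalars.word_eval_gen[OF central_esc, of rho x]
  by (simp only: L.ge_def witt_simps)

lemma rep_smult: "a \<in> carrier A \<Longrightarrow> rep (c \<odot>\<^bsub>A\<^esub> a) = scalar_op c * rep a"
proof -
  assume "a \<in> carrier A"
  then obtain f where f: "f \<in> carrier L.F" "a = L.cls f" by (rule L.cls_surj)
  have "rep (c \<odot>\<^bsub>A\<^esub> a) = rep (L.cls (c \<odot>\<^bsub>L.F\<^esub> f))" unfolding f(2) L.cls_smult[OF f(1)] ..
  also have "\<dots> = scalar_op c * rep a"
    unfolding f(2) rep_cls[OF f(1)] rep_cls[OF L.F.smult_closed[OF f(1)]]
    by (rule central_scalars.word_eval_smult[OF central_esc f(1)])
  finally show ?thesis .
qed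

end

section \<open>The modules L(l)\<close>

context witt_restricted
begin

abbreviation (input) "e_n n \<equiv> (witt_e (int n - 1) :: int \<Rightarrow> 'k)"

definition "E n = L.ge (e_n n)"

lemma e_n_in: "n < p \<Longrightarrow> e_n n \<in> witt_subspace p (-1)" "1 \<le> n \<Longrightarrow> n < p \<Longrightarrow> e_n n \<in> witt_subspace p 0"
  by (auto intro!: witt_subspace_closed)

lemma E_in [simp]: "n < p \<Longrightarrow> E n \<in> carrier A"
  unfolding E_def by (rule L.ge_in) (simp add: e_n_in)

lemma E_bracket:
  assumes mn: "m < p" "n < p" "1 \<le> m + n"
  shows "E m \<otimes>\<^bsub>A\<^esub> E n = E n \<otimes>\<^bsub>A\<^esub> E m \<oplus>\<^bsub>A\<^esub> (if m + n \<le> p then (of_nat n - of_nat m) \<odot>\<^bsub>A\<^esub> E (m + n - 1) else \<zero>\<^bsub>A\<^esub>)"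
proof -
  have in1: "int m - 1 \<in> {-1..int p - 2}" "int n - 1 \<in> {-1..int p - 2}" using mn by auto
  have z: "L.ge (\<lambda>_. 0) = \<zero>\<^bsub>A\<^esub>"
    using L.ge_smult[of "e_n 0" 0] e_n_in(1)[of 0] p5 by (simp add: L.A.smult_zero_left)
  have "L.ge (bracket (witt p P) (e_n m) (e_n n)) = (if m + n \<le> p then (of_nat n - of_nat m) \<odot>\<^bsub>A\<^esub> E (m + n - 1) else \<zero>\<^bsub>A\<^esub>)"
  proof (cases "m + n \<le> p")
    case True
    have e: "int m - 1 + (int n - 1) = int (m + n - 1) - 1" using mn by simp
    have i: "int m - 1 + (int n - 1) \<in> {-1..int p - 2}" using True mn by auto
    have "bracket (witt p P) (e_n m) (e_n n) = (of_nat n - of_nat m) \<odot>\<^bsub>witt p P\<^esub> e_n (m + n - 1)"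
      using bracket_witt_e[OF in1, of P] unfolding e using True mn by (cases "m + n") (simp_all add: of_nat_diff)
    moreover have "e_n (m + n - 1) \<in> carrier (witt p P)" using True mn by (simp only: witt_simps(1)) (rule e_n_in, linarith)
    ultimately show ?thesis using True by (simp only: E_def L.ge_smult if_True)
  next
    case False
    then have i: "int m - 1 + (int n - 1) \<notin> {-1..int p - 2}" by auto
    have "bracket (witt p P) (e_n m) (e_n n) = (\<lambda>_. 0)"
      using bracket_witt_e[OF in1, of P] unfolding if_not_P[OF i] by simp
    then show ?thesis using False z by simp
  qed
  then have "E m \<otimes>\<^bsub>A\<^esub> E n \<ominus>\<^bsub>A\<^esub> E n \<otimes>\<^bsub>A\<^esub> E m = (if m + n \<le> p then (of_nat n - of_nat m) \<odot>\<^bsub>A\<^esub> E (m + n - 1) else \<zero>\<^bsub>A\<^esub>)"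
    using L.ge_bracket[of "e_n m" "e_n n"] e_n_in(1) mn by (simp only: E_def witt_simps)
  moreover have "(if m + n \<le> p then (of_nat n - of_nat m) \<odot>\<^bsub>A\<^esub> E (m + n - 1) else \<zero>\<^bsub>A\<^esub>) \<in> carrier A"
    using mn by (auto intro!: L.A.smult_closed E_in)
  moreover have "E m \<otimes>\<^bsub>A\<^esub> E n \<in> carrier A" "E n \<otimes>\<^bsub>A\<^esub> E m \<in> carrier A"
    using mn by (auto intro!: L.A.m_closed E_in)
  ultimately show ?thesis
    by (subst L.A.minus_minus_zero_iff[symmetric]) (auto simp: L.A.minus_eq_zero_iff simp del: if_split)
qed

lemma E_0_pow: "E 0 [^]\<^bsub>A\<^esub> p = (\<chi> (witt_e (-1)) ^ p) \<odot>\<^bsub>A\<^esub> \<one>\<^bsub>A\<^esub>"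
proof -
  have "P (e_n 0) = (\<lambda>_. 0)" using P_e p5 by auto
  moreover have "L.ge (\<lambda>_. 0) = \<zero>\<^bsub>A\<^esub>"
    using L.ge_smult[of "e_n 0" 0] e_n_in(1)[of 0] p5 by (simp add: L.A.smult_zero_left)
  ultimately show ?thesis using L.ge_pow[of "e_n 0"] e_n_in(1)[of 0] p5 by (simp add: E_def)
qed

lemma E_1_pow: "E 1 [^]\<^bsub>A\<^esub> p = E 1"
proof -
  have i: "1 < p" using p5 by simp
  have "P (e_n 1) = e_n 1" using P_e p5 by auto
  moreover have "\<chi> (e_n 1) ^ p = 0" "(0::'k) ^ p = 0" using \<chi>_borel[OF e_n_in(2)[of 1]] p5 by simp_all
  ultimately show ?thesis using L.ge_pow[of "e_n 1"] e_n_in(1)[OF i] E_in[OF i]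
    by (simp add: E_def power_0_left)
qed

text \<open>
  The algebra is generated by the basis vectors of the Lie algebra.
\<close>

lemma A_induct [consumes 1, case_names one ge add smult]:
  assumes a: "a \<in> carrier A"
    and one: "Q \<one>\<^bsub>A\<^esub>"
    and ge: "\<And>n a. n < p \<Longrightarrow> a \<in> carrier A \<Longrightarrow> Q a \<Longrightarrow> Q (E n \<otimes>\<^bsub>A\<^esub> a)"
    and add: "\<And>a b. a \<in> carrier A \<Longrightarrow> b \<in> carrier A \<Longrightarrow> Q a \<Longrightarrow> Q b \<Longrightarrow> Q (a \<oplus>\<^bsub>A\<^esub> b)"
    and smult: "\<And>c a. a \<in> carrier A \<Longrightarrow> Q a \<Longrightarrow> Q (c \<odot>\<^bsub>A\<^esub> a)"
  shows "Q a"
proof -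
  obtain f where f: "f \<in> carrier L.F" "a = L.cls f" using a by (rule L.cls_surj)
  have "Q (L.cls f)" using f(1)
  proof (induction rule: free_algebra_induct)
    case one
    then show ?case using assms(2) by (simp only: L.cls_simps)
  next
    case (gen x f)
    have q: "Q (L.ge x \<otimes>\<^bsub>A\<^esub> L.cls f)" if "x \<in> witt_subspace p (-1)"
      using that
    proof (induction rule: witt_subspace_induct)
      case zero
      have "L.ge (\<lambda>_. 0) \<otimes>\<^bsub>A\<^esub> L.cls f = 0 \<odot>\<^bsub>A\<^esub> L.cls f"
        using L.ge_smult[of "e_n 0" 0] e_n_in(1)[of 0] p5 gen(2) by (simp add: L.A.smult_zero_left)
      then show ?case using smult[OF L.cls_in[OF gen(2)] gen(3), of 0] by simp
    next
      case (add y c i)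
      define n where "n = nat (i + 1)"
      have n: "n < p" "i = int n - 1" using add by (auto simp: n_def)
      have e: "witt_e i \<in> carrier (witt p P)" unfolding n(2) by (simp add: e_n_in n)
      have e': "c \<odot>\<^bsub>witt p P\<^esub> witt_e i \<in> carrier (witt p P)" using e by (rule L.smult_closed)
      have y: "y \<in> carrier (witt p P)" using add by simp
      have "L.ge (\<lambda>n. y n + c * witt_e i n) = L.ge (y \<oplus>\<^bsub>witt p P\<^esub> (c \<odot>\<^bsub>witt p P\<^esub> witt_e i))" by simp
      also have "\<dots> = L.ge y \<oplus>\<^bsub>A\<^esub> c \<odot>\<^bsub>A\<^esub> L.ge (witt_e i)"
        unfolding L.ge_add[OF y e'] L.ge_smult[OF e] ..
      finally have "L.ge (\<lambda>n. y n + c * witt_e i n) \<otimes>\<^bsub>A\<^esub> L.cls f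
          = L.ge y \<otimes>\<^bsub>A\<^esub> L.cls f \<oplus>\<^bsub>A\<^esub> c \<odot>\<^bsub>A\<^esub> (E n \<otimes>\<^bsub>A\<^esub> L.cls f)"
        using L.ge_in[OF y] E_in[OF n(1)] L.cls_in[OF gen(2)]
        by (simp only: n(2) E_def[symmetric] L.A.l_distr L.A.smult_closed L.A.smult_assoc2)
      moreover have "Q \<dots>"
        by (intro assms(4) smult ge n add L.A.m_closed L.A.smult_closed E_in L.ge_in y L.cls_in gen)
      ultimately show ?case by simp
    qed
    have x: "x \<in> carrier (witt p P)" using gen(1) .
    then show ?case using q L.cls_simps(2)[OF L.gen_in[OF x] gen(2)] by (simp add: L.ge_def)
  next
    case (add f g)
    then show ?case using assms(4) by (simp only: L.cls_simps L.cls_in)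
  next
    case (smult c f)
    then show ?case using assms(5) by (simp only: L.cls_smult L.cls_in)
  qed
  then show ?thesis using f by simp
qed

end

locale witt_induced = witt_restricted p k_type P \<chi> for p and k_type :: "'k::field itself" and P \<chi> +
  fixes l :: nat
begin

sublocale I: induced_module p "witt p P" \<chi> "witt_subspace p 0" "\<lambda>x. of_nat l * x 0"
  by (rule induced_module_borel)

abbreviation "T \<equiv> I.T"
abbreviation "w \<equiv> I.w"
definition "wj j = (E 0 [^]\<^bsub>A\<^esub> (j::nat)) \<odot>\<^bsub>T\<^esub> w"

lemma E0: "E 0 \<in> carrier A" using p5 by simp

lemma wj_in [simp]: "wj j \<in> carrier T" by (simp add: wj_def E0)

lemma wj_Suc: "E 0 \<odot>\<^bsub>T\<^esub> wj j = wj (Suc j)"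
proof -
  have "wj (Suc j) = (E 0 \<otimes>\<^bsub>A\<^esub> E 0 [^]\<^bsub>A\<^esub> j) \<odot>\<^bsub>T\<^esub> w"
    using L.A.nat_pow_Suc2[OF E0, of j] by (simp only: wj_def)
  then show ?thesis by (simp add: wj_def I.T.mult_act E0)
qed

lemma E_w: "1 \<le> n \<Longrightarrow> n < p \<Longrightarrow> E n \<odot>\<^bsub>T\<^esub> w = ((if n = 1 then of_nat l else 0) \<odot>\<^bsub>A\<^esub> \<one>\<^bsub>A\<^esub>) \<odot>\<^bsub>T\<^esub> w"
  using I.ge_w[OF e_n_in(2)[of n]] by (auto simp: E_def witt_e_def)

inductive_set Sp where
  zero: "\<zero>\<^bsub>T\<^esub> \<in> Sp"
| step: "t \<in> Sp \<Longrightarrow> j < p \<Longrightarrow> (c \<odot>\<^bsub>A\<^esub> \<one>\<^bsub>A\<^esub>) \<odot>\<^bsub>T\<^esub> wj j \<oplus>\<^bsub>T\<^esub> t \<in> Sp"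

lemma sc_in [simp]: "c \<odot>\<^bsub>A\<^esub> \<one>\<^bsub>A\<^esub> \<in> carrier A" by (rule L.A.smult_closed) simp

lemma Sp_in: "t \<in> Sp \<Longrightarrow> t \<in> carrier T"
  by (induction rule: Sp.induct) auto

lemma Sp_add: "t \<in> Sp \<Longrightarrow> u \<in> Sp \<Longrightarrow> t \<oplus>\<^bsub>T\<^esub> u \<in> Sp"
proof (induction rule: Sp.induct)
  case zero
  then show ?case by (simp add: Sp_in)
next
  case (step t j c)
  have "(c \<odot>\<^bsub>A\<^esub> \<one>\<^bsub>A\<^esub>) \<odot>\<^bsub>T\<^esub> wj j \<oplus>\<^bsub>T\<^esub> (t \<oplus>\<^bsub>T\<^esub> u) \<in> Sp" using step by (intro Sp.step) auto
  then show ?case using step Sp_in by (simp add: I.T.M.a_assoc)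
qed

lemma sc_mult: "(c \<odot>\<^bsub>A\<^esub> \<one>\<^bsub>A\<^esub>) \<otimes>\<^bsub>A\<^esub> (c' \<odot>\<^bsub>A\<^esub> \<one>\<^bsub>A\<^esub>) = (c * c') \<odot>\<^bsub>A\<^esub> \<one>\<^bsub>A\<^esub>"
  by (simp add: L.A.smult_assoc2 L.A.smult_assoc1)

lemma sc_comm: "a \<in> carrier A \<Longrightarrow> a \<otimes>\<^bsub>A\<^esub> (c \<odot>\<^bsub>A\<^esub> \<one>\<^bsub>A\<^esub>) = (c \<odot>\<^bsub>A\<^esub> \<one>\<^bsub>A\<^esub>) \<otimes>\<^bsub>A\<^esub> a"
  by (simp add: L.A.smult_assoc2 L.A.smult_assoc3)

lemma act_sc: "a \<in> carrier A \<Longrightarrow> t \<in> carrier T \<Longrightarrow>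
    a \<odot>\<^bsub>T\<^esub> ((c \<odot>\<^bsub>A\<^esub> \<one>\<^bsub>A\<^esub>) \<odot>\<^bsub>T\<^esub> t) = (c \<odot>\<^bsub>A\<^esub> \<one>\<^bsub>A\<^esub>) \<odot>\<^bsub>T\<^esub> (a \<odot>\<^bsub>T\<^esub> t)"
  by (metis I.T.mult_act sc_comm sc_in)

lemma smult_act: "a \<in> carrier A \<Longrightarrow> t \<in> carrier T \<Longrightarrow> (c \<odot>\<^bsub>A\<^esub> a) \<odot>\<^bsub>T\<^esub> t = (c \<odot>\<^bsub>A\<^esub> \<one>\<^bsub>A\<^esub>) \<odot>\<^bsub>T\<^esub> (a \<odot>\<^bsub>T\<^esub> t)"
  by (subst I.T.mult_act[symmetric]) (simp_all add: L.A.smult_assoc2)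

lemma Sp_sc: "t \<in> Sp \<Longrightarrow> (c \<odot>\<^bsub>A\<^esub> \<one>\<^bsub>A\<^esub>) \<odot>\<^bsub>T\<^esub> t \<in> Sp"
proof (induction rule: Sp.induct)
  case zero
  then show ?case by (simp add: Sp.zero)
next
  case (step t j c')
  have "((c * c') \<odot>\<^bsub>A\<^esub> \<one>\<^bsub>A\<^esub>) \<odot>\<^bsub>T\<^esub> wj j \<oplus>\<^bsub>T\<^esub> (c \<odot>\<^bsub>A\<^esub> \<one>\<^bsub>A\<^esub>) \<odot>\<^bsub>T\<^esub> t \<in> Sp" using step by (intro Sp.step) auto
  then show ?case using step Sp_in by (simp add: I.T.act_add sc_mult[symmetric] I.T.mult_act)
qed

lemma Sp_wj: "j < p \<Longrightarrow> wj j \<in> Sp"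
  using Sp.step[OF Sp.zero, of j 1] L.A.smult_one[of "\<one>\<^bsub>A\<^esub>"] by simp

lemma Sp_E0: "t \<in> Sp \<Longrightarrow> E 0 \<odot>\<^bsub>T\<^esub> t \<in> Sp"
proof (induction rule: Sp.induct)
  case zero
  then show ?case by (simp add: Sp.zero E0)
next
  case (step t j c)
  have "wj (Suc j) \<in> Sp"
  proof (cases "Suc j = p")
    case True
    then have "wj (Suc j) = ((\<chi> (witt_e (-1)) ^ p) \<odot>\<^bsub>A\<^esub> \<one>\<^bsub>A\<^esub>) \<odot>\<^bsub>T\<^esub> wj 0"
      by (simp only: wj_def E_0_pow L.A.nat_pow_0 I.T.one_act I.w_in)
    then show ?thesis using Sp_sc[OF Sp_wj[of 0]] p5 by simp
  qed (use step in \<open>auto intro: Sp_wj\<close>)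
  then have "(c \<odot>\<^bsub>A\<^esub> \<one>\<^bsub>A\<^esub>) \<odot>\<^bsub>T\<^esub> (E 0 \<odot>\<^bsub>T\<^esub> wj j) \<oplus>\<^bsub>T\<^esub> E 0 \<odot>\<^bsub>T\<^esub> t \<in> Sp"
    unfolding wj_Suc using step by (intro Sp_add Sp_sc)
  then show ?case using step Sp_in by (simp add: I.T.act_add act_sc E0)
qed

lemma Sp_E_wj: "n < p \<Longrightarrow> E n \<odot>\<^bsub>T\<^esub> wj j \<in> Sp"
proof (induction j arbitrary: n)
  case 0
  have "wj 0 = w" by (simp add: wj_def)
  show ?case
  proof (cases "n = 0")
    case True
    then show ?thesis using Sp_E0[OF Sp_wj[of 0]] p5 by simp
  next
    case False
    then have "E n \<odot>\<^bsub>T\<^esub> wj 0 = ((if n = 1 then of_nat l else 0) \<odot>\<^bsub>A\<^esub> \<one>\<^bsub>A\<^esub>) \<odot>\<^bsub>T\<^esub> wj 0"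
      using E_w[of n] 0 \<open>wj 0 = w\<close> by simp
    then show ?thesis using Sp_sc[OF Sp_wj[of 0]] p5 by simp
  qed
next
  case (Suc j)
  show ?case
  proof (cases "n = 0")
    case True
    have "0 < p" using p5 by simp
    have "E 0 \<odot>\<^bsub>T\<^esub> (E 0 \<odot>\<^bsub>T\<^esub> wj j) \<in> Sp" by (rule Sp_E0[OF Suc.IH[OF \<open>0 < p\<close>]])
    then show ?thesis by (simp add: True wj_Suc)
  next
    case False
    have "E n \<otimes>\<^bsub>A\<^esub> E 0 = E 0 \<otimes>\<^bsub>A\<^esub> E n \<oplus>\<^bsub>A\<^esub> (of_nat 0 - of_nat n) \<odot>\<^bsub>A\<^esub> E (n - 1)"
      using E_bracket[of n 0] False Suc.prems p5 by simp
    then have "E n \<odot>\<^bsub>T\<^esub> wj (Suc j) = (E 0 \<otimes>\<^bsub>A\<^esub> E n \<oplus>\<^bsub>A\<^esub> (of_nat 0 - of_nat n) \<odot>\<^bsub>A\<^esub> E (n - 1)) \<odot>\<^bsub>T\<^esub> wj j"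
      using Suc.prems E0 by (simp only: wj_Suc[symmetric] I.T.mult_act[symmetric] E_in wj_in)
    also have "\<dots> = E 0 \<odot>\<^bsub>T\<^esub> (E n \<odot>\<^bsub>T\<^esub> wj j) \<oplus>\<^bsub>T\<^esub> ((of_nat 0 - of_nat n) \<odot>\<^bsub>A\<^esub> \<one>\<^bsub>A\<^esub>) \<odot>\<^bsub>T\<^esub> (E (n - 1) \<odot>\<^bsub>T\<^esub> wj j)"
    proof -
      have n: "E n \<in> carrier A" "E (n - 1) \<in> carrier A" using Suc.prems by auto
      show ?thesis
        using I.T.add_act[OF L.A.m_closed[OF E0 n(1)] L.A.smult_closed[OF n(2)] wj_in]
        by (simp only: I.T.mult_act[OF E0 n(1) wj_in] smult_act[OF n(2) wj_in])
    qed
    also have "\<dots> \<in> Sp" using Suc.prems by (intro Sp_add Sp_E0 Sp_sc Suc.IH) auto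
    finally show ?thesis .
  qed
qed

lemma Sp_E: "t \<in> Sp \<Longrightarrow> n < p \<Longrightarrow> E n \<odot>\<^bsub>T\<^esub> t \<in> Sp"
proof (induction rule: Sp.induct)
  case zero
  then show ?case by (simp add: Sp.zero)
next
  case (step t j c)
  have "(c \<odot>\<^bsub>A\<^esub> \<one>\<^bsub>A\<^esub>) \<odot>\<^bsub>T\<^esub> (E n \<odot>\<^bsub>T\<^esub> wj j) \<oplus>\<^bsub>T\<^esub> E n \<odot>\<^bsub>T\<^esub> t \<in> Sp"
    using step by (intro Sp_add Sp_sc Sp_E_wj)
  then show ?case using step Sp_in by (simp add: I.T.act_add act_sc)
qed

text \<open>
  The span of the vectors \<open>e\<^sub>-\<^sub>1\<^sup>j w\<close>, \<open>j < p\<close>, is closed under \<open>e\<^sub>-\<^sub>1\<close> because \<open>e\<^sub>-\<^sub>1\<^sup>p\<close> is a scalar, and under the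
  other \<open>e\<^sub>i\<close> by induction on \<open>j\<close>, moving \<open>e\<^sub>i\<close> to the right past \<open>e\<^sub>-\<^sub>1\<close>.
\<close>

lemma T_span: "t \<in> carrier T \<Longrightarrow> t \<in> Sp"
proof -
  assume "t \<in> carrier T"
  then obtain a where a: "a \<in> carrier A" "t = a \<odot>\<^bsub>T\<^esub> w" using I.w_generates by blast
  have "a \<odot>\<^bsub>T\<^esub> w \<in> Sp" using a(1)
  proof (induction rule: A_induct)
    case one
    then show ?case using Sp_wj[of 0] p5 by (simp add: wj_def)
  next
    case (ge n a)
    show ?case unfolding I.T.mult_act[OF E_in[OF ge(1)] ge(2) I.w_in] by (rule Sp_E[OF ge(3,1)])
  next
    case (add a b)
    show ?case unfolding I.T.add_act[OF add(1,2) I.w_in] by (rule Sp_add[OF add(3,4)])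
  next
    case (smult c a)
    show ?case unfolding smult_act[OF smult(1) I.w_in] by (rule Sp_sc[OF smult(2)])
  qed
  then show ?thesis using a by simp
qed

end

context witt_induced
begin

text \<open>
  The generators \<open>e\<^sub>0 - l\<close> (for \<open>n = 1\<close>) and \<open>e\<^sub>n\<^sub>-\<^sub>1\<close> of the annihilator of \<open>w\<close>.
\<close>

definition "s n = E n \<ominus>\<^bsub>A\<^esub> (if n = 1 then of_nat l else 0) \<odot>\<^bsub>A\<^esub> \<one>\<^bsub>A\<^esub>"

definition "J = left_ideal A I.ann_gens"

lemma s_in [simp]: "n < p \<Longrightarrow> s n \<in> carrier A"
  by (simp add: s_def)

lemma s_eq: "n \<noteq> 1 \<Longrightarrow> n < p \<Longrightarrow> s n = E n"
  by (simp add: s_def L.A.minus_eq)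

lemma J_in: "a \<in> J \<Longrightarrow> a \<in> carrier A"
  unfolding J_def by (rule L.A.left_ideal_carrier[OF I.ann_gens_subset])

lemma J_zero: "\<zero>\<^bsub>A\<^esub> \<in> J" unfolding J_def by (rule left_ideal.zero)
lemma J_add: "a \<in> J \<Longrightarrow> b \<in> J \<Longrightarrow> a \<oplus>\<^bsub>A\<^esub> b \<in> J" unfolding J_def by (rule left_ideal.add)
lemma J_mult: "a \<in> carrier A \<Longrightarrow> b \<in> J \<Longrightarrow> a \<otimes>\<^bsub>A\<^esub> b \<in> J"
  unfolding J_def by (rule L.A.left_ideal_mult[OF I.ann_gens_subset])

lemma s_J: "1 \<le> n \<Longrightarrow> n < p \<Longrightarrow> s n \<in> J"
  unfolding J_def
proof (rule L.A.left_ideal_gen[OF I.ann_gens_subset])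
  assume n: "1 \<le> n" "n < p"
  have "s n = L.ge (e_n n) \<ominus>\<^bsub>A\<^esub> (of_nat l * (e_n n) 0) \<odot>\<^bsub>A\<^esub> \<one>\<^bsub>A\<^esub>"
    by (cases "n = 1") (simp_all add: s_def E_def witt_e_def)
  then show "s n \<in> I.ann_gens" unfolding I.ann_gens_def using e_n_in(2)[OF n] by (rule image_eqI)
qed

lemma J_induct [consumes 1, case_names zero s add mult]:
  assumes a: "a \<in> J" and zero: "Q \<zero>\<^bsub>A\<^esub>"
    and s: "\<And>n. 1 \<le> n \<Longrightarrow> n < p \<Longrightarrow> Q (s n)"
    and add: "\<And>a b. a \<in> J \<Longrightarrow> b \<in> J \<Longrightarrow> Q a \<Longrightarrow> Q b \<Longrightarrow> Q (a \<oplus>\<^bsub>A\<^esub> b)"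
    and mult: "\<And>a b. a \<in> carrier A \<Longrightarrow> b \<in> J \<Longrightarrow> Q b \<Longrightarrow> Q (a \<otimes>\<^bsub>A\<^esub> b)"
  shows "Q a"
proof -
  define \<sigma> where "\<sigma> x = L.ge x \<ominus>\<^bsub>A\<^esub> (of_nat l * x 0) \<odot>\<^bsub>A\<^esub> \<one>\<^bsub>A\<^esub>" for x
  have sub: "x \<in> carrier (witt p P)" if "x \<in> witt_subspace p 0" for x
    using that witt_subspace_antimono[of "-1" 0 p] by auto
  have \<sigma>J: "\<sigma> x \<in> J" if "x \<in> witt_subspace p 0" for x
    unfolding J_def
  proof (rule L.A.left_ideal_gen[OF I.ann_gens_subset])
    show "\<sigma> x \<in> I.ann_gens" unfolding I.ann_gens_def using \<sigma>_def that by (rule image_eqI)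
  qed
  have \<sigma>: "Q (\<sigma> x)" if "x \<in> witt_subspace p 0" for x
    using that
  proof (induction rule: witt_subspace_induct)
    case zero
    have "L.ge (\<lambda>_. 0) = \<zero>\<^bsub>A\<^esub>"
      using L.ge_smult[of "e_n 0" 0] e_n_in(1)[of 0] p5 by simp
    then have "\<sigma> (\<lambda>_. 0) = \<zero>\<^bsub>A\<^esub>" by (simp add: \<sigma>_def L.A.minus_eq)
    then show ?case using assms(2) by simp
  next
    case (add y c i)
    define n where "n = nat (i + 1)"
    have n: "n < p" "i = int n - 1" "1 \<le> n" using add by (auto simp: n_def)
    have e: "witt_e i \<in> carrier (witt p P)" unfolding n(2) by (simp add: e_n_in n)
    have e': "c \<odot>\<^bsub>witt p P\<^esub> witt_e i \<in> carrier (witt p P)" using e by (rule L.smult_closed)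
    have y: "y \<in> carrier (witt p P)" using add sub by simp
    have "L.ge (\<lambda>n. y n + c * witt_e i n) = L.ge (y \<oplus>\<^bsub>witt p P\<^esub> (c \<odot>\<^bsub>witt p P\<^esub> witt_e i))" by simp
    also have "\<dots> = L.ge y \<oplus>\<^bsub>A\<^esub> c \<odot>\<^bsub>A\<^esub> E n"
      unfolding L.ge_add[OF y e'] L.ge_smult[OF e] by (simp only: E_def n(2))
    finally have g: "L.ge (\<lambda>n. y n + c * witt_e i n) = L.ge y \<oplus>\<^bsub>A\<^esub> c \<odot>\<^bsub>A\<^esub> E n" .
    define u where "u = (if n = 1 then of_nat l else 0 :: 'k)"
    have u: "of_nat l * (y 0 + c * witt_e i 0) = of_nat l * y 0 + c * u"
      using n by (auto simp: u_def witt_e_def algebra_simps)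
    have sn: "s n = E n \<ominus>\<^bsub>A\<^esub> u \<odot>\<^bsub>A\<^esub> \<one>\<^bsub>A\<^esub>" by (simp add: s_def u_def)
    have neg: "\<ominus>\<^bsub>A\<^esub> (c \<odot>\<^bsub>A\<^esub> x) = c \<odot>\<^bsub>A\<^esub> (\<ominus>\<^bsub>A\<^esub> x)" if "x \<in> carrier A" for c x
      using that by (simp add: L.A.smult_minus_one[symmetric] L.A.smult_assoc1[symmetric] mult.commute)
    have "\<sigma> (\<lambda>n. y n + c * witt_e i n) = (L.ge y \<oplus>\<^bsub>A\<^esub> c \<odot>\<^bsub>A\<^esub> E n) \<ominus>\<^bsub>A\<^esub> (of_nat l * y 0 + c * u) \<odot>\<^bsub>A\<^esub> \<one>\<^bsub>A\<^esub>"
      unfolding \<sigma>_def g u ..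
    also have "\<dots> = (L.ge y \<ominus>\<^bsub>A\<^esub> (of_nat l * y 0) \<odot>\<^bsub>A\<^esub> \<one>\<^bsub>A\<^esub>) \<oplus>\<^bsub>A\<^esub> (c \<odot>\<^bsub>A\<^esub> (E n \<oplus>\<^bsub>A\<^esub> (\<ominus>\<^bsub>A\<^esub> (u \<odot>\<^bsub>A\<^esub> \<one>\<^bsub>A\<^esub>))))"
      using L.ge_in[OF y] E_in[OF n(1)]
      by (simp add: L.A.minus_eq L.A.smult_l_distr L.A.smult_r_distr L.A.minus_add L.A.smult_assoc1 neg[symmetric] L.A.a_ac)
    also have "c \<odot>\<^bsub>A\<^esub> (E n \<oplus>\<^bsub>A\<^esub> (\<ominus>\<^bsub>A\<^esub> (u \<odot>\<^bsub>A\<^esub> \<one>\<^bsub>A\<^esub>))) = (c \<odot>\<^bsub>A\<^esub> \<one>\<^bsub>A\<^esub>) \<otimes>\<^bsub>A\<^esub> s n"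
      using E_in[OF n(1)] by (simp add: sn L.A.minus_eq L.A.smult_assoc2)
    finally have "\<sigma> (\<lambda>n. y n + c * witt_e i n) = \<sigma> y \<oplus>\<^bsub>A\<^esub> (c \<odot>\<^bsub>A\<^esub> \<one>\<^bsub>A\<^esub>) \<otimes>\<^bsub>A\<^esub> s n" by (simp only: \<sigma>_def)
    moreover have "Q (\<sigma> y \<oplus>\<^bsub>A\<^esub> (c \<odot>\<^bsub>A\<^esub> \<one>\<^bsub>A\<^esub>) \<otimes>\<^bsub>A\<^esub> s n)"
      by (intro assms(4) mult \<sigma>J add J_mult sc_in s s_J n)
    ultimately show ?case by simp
  qed
  have "a \<in> J \<and> Q a" using a unfolding J_def
  proof (induction rule: left_ideal.induct)
    case zero
    then show ?case using assms(2) left_ideal.zero by blast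
  next
    case (mult b g)
    obtain x where x: "x \<in> witt_subspace p 0" "g = \<sigma> x" using mult(2) unfolding I.ann_gens_def \<sigma>_def by blast
    have "Q (b \<otimes>\<^bsub>A\<^esub> g)" unfolding x(2) by (rule assms(5)[OF mult(1) \<sigma>J[OF x(1)] \<sigma>[OF x(1)]])
    then show ?case using left_ideal.mult[OF mult] by blast
  next
    case (add x y)
    have xy: "x \<in> J" "y \<in> J" "Q x" "Q y" using add.IH by (auto simp: J_def)
    show ?case using J_add[OF xy(1,2)] assms(4)[OF xy] unfolding J_def by (rule conjI)
  qed
  then show ?thesis ..
qed

lemma s_bracket:
  assumes mn: "2 \<le> m + n" "1 \<le> m" "2 \<le> n" "m < p" "n < p"
  shows "s m \<otimes>\<^bsub>A\<^esub> s n = s n \<otimes>\<^bsub>A\<^esub> s m \<oplus>\<^bsub>A\<^esub>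
    (if m + n \<le> p then ((of_nat n - of_nat m) \<odot>\<^bsub>A\<^esub> \<one>\<^bsub>A\<^esub>) \<otimes>\<^bsub>A\<^esub> s (m + n - 1) else \<zero>\<^bsub>A\<^esub>)"
proof -
  define u where "u = (if m = 1 then of_nat l else 0 :: 'k)"
  define B where "B = (if m + n \<le> p then (of_nat n - of_nat m) \<odot>\<^bsub>A\<^esub> E (m + n - 1) else \<zero>\<^bsub>A\<^esub>)"
  have sm: "s m = E m \<ominus>\<^bsub>A\<^esub> u \<odot>\<^bsub>A\<^esub> \<one>\<^bsub>A\<^esub>" by (simp add: s_def u_def)
  have sn: "s n = E n" using mn by (intro s_eq) auto
  have c: "E m \<in> carrier A" "E n \<in> carrier A" "B \<in> carrier A" using mn by (auto simp: B_def)
  have EE: "E m \<otimes>\<^bsub>A\<^esub> E n = E n \<otimes>\<^bsub>A\<^esub> E m \<oplus>\<^bsub>A\<^esub> B" unfolding B_def using mn by (intro E_bracket) auto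
  have "s m \<otimes>\<^bsub>A\<^esub> s n = E m \<otimes>\<^bsub>A\<^esub> E n \<ominus>\<^bsub>A\<^esub> u \<odot>\<^bsub>A\<^esub> E n"
    unfolding sm sn using c by (simp add: L.A.minus_eq L.A.l_distr L.A.l_minus L.A.smult_assoc2)
  also have "\<dots> = (E n \<otimes>\<^bsub>A\<^esub> E m \<ominus>\<^bsub>A\<^esub> u \<odot>\<^bsub>A\<^esub> E n) \<oplus>\<^bsub>A\<^esub> B"
    unfolding EE using c by (simp add: L.A.minus_eq L.A.a_ac)
  also have "E n \<otimes>\<^bsub>A\<^esub> E m \<ominus>\<^bsub>A\<^esub> u \<odot>\<^bsub>A\<^esub> E n = s n \<otimes>\<^bsub>A\<^esub> s m"
    unfolding sm sn using c by (simp add: L.A.minus_eq L.A.r_distr L.A.r_minus L.A.smult_assoc3)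
  also have "B = (if m + n \<le> p then ((of_nat n - of_nat m) \<odot>\<^bsub>A\<^esub> \<one>\<^bsub>A\<^esub>) \<otimes>\<^bsub>A\<^esub> s (m + n - 1) else \<zero>\<^bsub>A\<^esub>)"
  proof (cases "m + n \<le> p")
    case True
    then have "s (m + n - 1) = E (m + n - 1)" "m + n - 1 < p" using mn by (auto intro!: s_eq)
    then show ?thesis using True by (simp add: B_def L.A.smult_assoc2)
  qed (simp add: B_def)
  finally show ?thesis .
qed

end

section \<open>A model of L(l) inside the extension\<close>

locale witt_pair = witt_extension p k_type P \<chi> lam de d
  for p and k_type :: "'k::field itself" and P \<chi> and lam de :: 'k and d +
  fixes l m :: nat
  assumes lam_l: "lam = of_nat l" and mu_m: "lam - de = of_nat m"
begin

sublocale N: witt_induced p k_type P \<chi> l by unfold_locales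
sublocale M: witt_induced p k_type P \<chi> m by unfold_locales

text \<open>
  The functions on the first copy form a submodule of the extension, on which the operators do not involve
  \<open>d\<close>; it will be identified with \<open>L(l)\<close>.
\<close>

definition "V = {f :: bool \<times> 'k \<Rightarrow> 'k. proj f = f \<and> (\<forall>a. f (False, a) = 0)}"

lemma V_add: "f \<in> V \<Longrightarrow> g \<in> V \<Longrightarrow> (\<lambda>x. f x + g x) \<in> V"
  and V_scale: "f \<in> V \<Longrightarrow> (\<lambda>x. c * f x) \<in> V"
  and V_zero: "(\<lambda>_. 0) \<in> V"
  by (simp_all add: V_def proj_add proj_scale) (simp add: proj_def)

lemma V_bas: "a \<in> prime_field \<Longrightarrow> bas True a \<in> V"
  by (simp add: V_def proj_bas) (simp add: bas_def)

lemma V_eqI: "f \<in> V \<Longrightarrow> g \<in> V \<Longrightarrow> (\<And>a. a \<in> prime_field \<Longrightarrow> f (True, a) = g (True, a)) \<Longrightarrow> f = g"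
proof
  fix x :: "bool \<times> 'k" assume f: "f \<in> V" and g: "g \<in> V" and e: "\<And>a. a \<in> prime_field \<Longrightarrow> f (True, a) = g (True, a)"
  obtain b a where x: "x = (b, a)" by (cases x)
  have pf: "proj f x = f x" "proj g x = g x" using f g by (simp_all add: V_def)
  consider "\<not> b" | "b" "a \<in> prime_field" | "a \<notin> prime_field" by blast
  then show "f x = g x"
  proof cases
    case 1
    then show ?thesis using f g by (simp add: V_def x)
  next
    case 2
    then show ?thesis using e[of a] by (simp add: x)
  next
    case 3
    then have "proj f x = 0" "proj g x = 0" by (simp_all add: proj_def x prime_field_def)
    then show ?thesis using pf by simp
  qed
qed

lemma rep_minus: "a \<in> carrier A \<Longrightarrow> b \<in> carrier A \<Longrightarrow> rep (a \<ominus>\<^bsub>A\<^esub> b) = rep a - rep b"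
proof -
  assume ab: "a \<in> carrier A" "b \<in> carrier A"
  have "a \<ominus>\<^bsub>A\<^esub> b = a \<oplus>\<^bsub>A\<^esub> (-1) \<odot>\<^bsub>A\<^esub> b" using ab by (simp add: L.A.minus_eq L.A.smult_minus_one)
  then show ?thesis using ab by (simp add: rep_add rep_smult scalar_op_minus scalar_op_1)
qed

lemma rep_sc: "rep (c \<odot>\<^bsub>A\<^esub> \<one>\<^bsub>A\<^esub>) = scalar_op c" by (simp add: rep_smult rep_one)

lemma rep_zero: "rep \<zero>\<^bsub>A\<^esub> = 0"
  using rep_smult[of "\<one>\<^bsub>A\<^esub>" 0] by (simp add: scalar_op_0)

lemma rep_E: "n < p \<Longrightarrow> rep (E n) = scalar_op (cf n) * R n"
  unfolding E_def by (simp add: rep_ge e_n_in rho_e)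

lemma R_V: "f \<in> V \<Longrightarrow> app (R n) f \<in> V"
  by (simp add: V_def proj_app) (simp add: R_def app_shift_op proj_def V_def)

lemma rep_V: "a \<in> carrier A \<Longrightarrow> f \<in> V \<Longrightarrow> app (rep a) f \<in> V"
proof (induction rule: A_induct)
  case one
  then show ?case by (simp add: rep_one app_1 V_def)
next
  case (ge n a)
  then show ?case by (simp add: rep_mult rep_E app_times[of "scalar_op _ * _"] app_esc_times V_scale R_V)
next
  case (add a b)
  then show ?case by (simp add: rep_add app_plus V_add)
next
  case (smult c a)
  then show ?case by (simp add: rep_smult app_esc_times V_scale)
qed

lemma rep_E_bas:
  assumes "n < p" "a \<in> prime_field"
  shows "app (rep (E n)) (bas True a) = (\<lambda>x. cf n * (Wt lam n a * bas True (a + 1 - of_nat n) x))"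
    "app (rep (E n)) (bas False a) = (\<lambda>x. cf n * (Wt (lam - de) n a * bas False (a + 1 - of_nat n) x
       + Bc n a * bas True (a + de + 1 - of_nat n) x))"
  by (simp_all only: rep_E[OF assms(1)] app_esc_times R_bas[OF assms(2)])

lemma cf_1: "cf 1 = 1" using z by (simp add: cf_def)

lemma p_gt_1: "1 < p" using p5 by simp

lemma Wt_0: "2 \<le> n \<Longrightarrow> Wt c n 0 = 0"
  using Wt_0_Suc[of "n - 1" c] by (cases n) auto

lemma rep_s: "n < p \<Longrightarrow> app (rep (M.s n)) f = (\<lambda>x. app (rep (E n)) f x - (if n = 1 then of_nat m else 0) * proj f x)"
  by (simp add: M.s_def rep_minus rep_sc app_minus app_esc proj_scale)

text \<open>Hence \<open>a w \<mapsto> a 1\<^sub>0\<close> is well defined on \<open>L(l)\<close>; this is the map \<open>eta\<close> below.\<close>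

lemma highest_weight: "a \<in> N.J \<Longrightarrow> app (rep a) (bas True 0) = (\<lambda>_. 0)"
proof (induction rule: N.J_induct)
  case zero
  then show ?case by (simp add: rep_zero app_0)
next
  case (s n)
  have 0: "app (rep (E n)) (bas True 0) = (\<lambda>x. cf n * (Wt lam n 0 * bas True (1 - of_nat n) x))"
    using rep_E_bas(1)[OF s(2), of 0] by (simp add: prime_field_closed)
  have 1: "app (rep (N.s n)) (bas True 0) = (\<lambda>x. app (rep (E n)) (bas True 0) x - (if n = 1 then of_nat l else 0) * bas True 0 x)"
    using s by (simp add: N.s_def rep_minus rep_sc app_minus app_esc proj_scale proj_bas prime_field_closed)
  show ?case
  proof (cases "n = 1")
    case True
    show ?thesis unfolding 1 0 unfolding True cf_1 by (simp add: lam_l)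
  next
    case False
    then show ?thesis unfolding 1 0 using s Wt_0[of n lam] by simp
  qed
next
  case (add a b)
  then show ?case by (simp add: rep_add app_plus N.J_in)
next
  case (mult a b)
  then show ?case by (simp add: rep_mult app_times app_zero N.J_in)
qed

definition "eta t = app (rep (SOME a. a \<in> carrier A \<and> t = a \<odot>\<^bsub>N.T\<^esub> N.w)) (bas True 0)"

lemma eta: assumes a: "a \<in> carrier A" shows "eta (a \<odot>\<^bsub>N.T\<^esub> N.w) = app (rep a) (bas True 0)"
proof -
  define b where "b = (SOME b. b \<in> carrier A \<and> a \<odot>\<^bsub>N.T\<^esub> N.w = b \<odot>\<^bsub>N.T\<^esub> N.w)"
  have b: "b \<in> carrier A" "a \<odot>\<^bsub>N.T\<^esub> N.w = b \<odot>\<^bsub>N.T\<^esub> N.w"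
    using someI[of "\<lambda>b. b \<in> carrier A \<and> a \<odot>\<^bsub>N.T\<^esub> N.w = b \<odot>\<^bsub>N.T\<^esub> N.w" a] a unfolding b_def by blast+
  have c: "a \<ominus>\<^bsub>A\<^esub> b \<in> carrier A" using a b by simp
  have "(a \<ominus>\<^bsub>A\<^esub> b) \<odot>\<^bsub>N.T\<^esub> N.w = a \<odot>\<^bsub>N.T\<^esub> N.w \<oplus>\<^bsub>N.T\<^esub> (\<ominus>\<^bsub>N.T\<^esub> (b \<odot>\<^bsub>N.T\<^esub> N.w))"
    using a b(1) by (simp add: L.A.minus_eq N.I.T.add_act N.I.T.minus_act)
  also have "\<dots> = \<zero>\<^bsub>N.T\<^esub>" unfolding b(2) using b(1) by (simp add: N.I.T.M.r_neg)
  finally have "a \<ominus>\<^bsub>A\<^esub> b \<in> N.J" unfolding N.J_def using N.I.annihilator_w[OF c] by blast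
  from highest_weight[OF this] have "(\<lambda>x. app (rep a) (bas True 0) x - app (rep b) (bas True 0) x) = (\<lambda>_. 0)"
    using a b by (simp add: rep_minus app_minus)
  then have "app (rep a) (bas True 0) = app (rep b) (bas True 0)" by (simp add: fun_eq_iff)
  then show ?thesis by (simp add: eta_def b_def)
qed

lemma eta_V: "t \<in> carrier N.T \<Longrightarrow> eta t \<in> V"
  using N.I.w_generates[of t] eta by (auto simp: rep_V V_bas prime_field_closed)

lemma eta_add: "t \<in> carrier N.T \<Longrightarrow> u \<in> carrier N.T \<Longrightarrow> eta (t \<oplus>\<^bsub>N.T\<^esub> u) = (\<lambda>x. eta t x + eta u x)"
proof -
  assume "t \<in> carrier N.T" "u \<in> carrier N.T"
  then obtain a b where ab: "a \<in> carrier A" "t = a \<odot>\<^bsub>N.T\<^esub> N.w" "b \<in> carrier A" "u = b \<odot>\<^bsub>N.T\<^esub> N.w"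
    using N.I.w_generates by metis
  have "t \<oplus>\<^bsub>N.T\<^esub> u = (a \<oplus>\<^bsub>A\<^esub> b) \<odot>\<^bsub>N.T\<^esub> N.w" using ab by (simp add: N.I.T.add_act)
  then show ?thesis using ab by (simp add: eta rep_add app_plus)
qed

lemma eta_act: "a \<in> carrier A \<Longrightarrow> t \<in> carrier N.T \<Longrightarrow> eta (a \<odot>\<^bsub>N.T\<^esub> t) = app (rep a) (eta t)"
proof -
  assume a: "a \<in> carrier A" and "t \<in> carrier N.T"
  then obtain b where b: "b \<in> carrier A" "t = b \<odot>\<^bsub>N.T\<^esub> N.w"
    using N.I.w_generates by metis
  have "a \<odot>\<^bsub>N.T\<^esub> t = (a \<otimes>\<^bsub>A\<^esub> b) \<odot>\<^bsub>N.T\<^esub> N.w" using a b by (simp add: N.I.T.mult_act)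
  then show ?thesis using a b by (simp add: eta rep_mult app_times)
qed

lemma eta_zero: "eta \<zero>\<^bsub>N.T\<^esub> = (\<lambda>_. 0)"
  using eta_act[of "\<zero>\<^bsub>A\<^esub>" "\<zero>\<^bsub>N.T\<^esub>"] by (simp add: rep_zero app_0)

lemma eta_sc: "t \<in> carrier N.T \<Longrightarrow> eta ((c \<odot>\<^bsub>A\<^esub> \<one>\<^bsub>A\<^esub>) \<odot>\<^bsub>N.T\<^esub> t) = (\<lambda>x. c * eta t x)"
  using eta_V[of t] by (simp add: eta_act rep_sc app_esc proj_scale V_def)

lemma eta_wj: "eta (N.wj j) = (\<lambda>x. z ^ j * bas True (of_nat j) x)"
proof (induction j)
  case 0
  have "N.wj 0 = \<one>\<^bsub>A\<^esub> \<odot>\<^bsub>N.T\<^esub> N.w" by (simp add: N.wj_def)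
  then show ?case using eta[of "\<one>\<^bsub>A\<^esub>"] by (simp add: rep_one app_1 proj_bas prime_field_closed)
next
  case (Suc j)
  have p: "0 < p" using p5 by simp
  have "eta (N.wj (Suc j)) = app (rep (E 0)) (eta (N.wj j))"
    unfolding N.wj_Suc[symmetric] by (rule eta_act) (simp_all add: p)
  also have "\<dots> = (\<lambda>x. z ^ j * (cf 0 * (Wt lam 0 (of_nat j) * bas True (of_nat j + 1 - of_nat 0) x)))"
    unfolding Suc app_scale rep_E_bas(1)[OF p prime_field_closed(2)] ..
  finally show ?case by (simp add: cf_def mult_ac add_ac)
qed

text \<open>
  The inverse of \<open>eta\<close>, which sends \<open>e\<^sub>-\<^sub>1\<^sup>j w\<close> to \<open>z\<^sup>j 1\<^sub>j\<close>.
\<close>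

definition "psi f = (\<Oplus>\<^bsub>N.T\<^esub>j\<in>{..<p}. ((f (True, of_nat j) / z ^ j) \<odot>\<^bsub>A\<^esub> \<one>\<^bsub>A\<^esub>) \<odot>\<^bsub>N.T\<^esub> N.wj j)"

lemma psi_in: "psi f \<in> carrier N.T"
  unfolding psi_def by (rule N.I.T.M.finsum_closed) auto

lemma psi_add: "psi (\<lambda>x. f x + g x) = psi f \<oplus>\<^bsub>N.T\<^esub> psi g"
  unfolding psi_def
  by (subst N.I.T.M.finsum_addf[symmetric]) (auto simp: add_divide_distrib L.A.smult_l_distr N.I.T.add_act)

lemma psi_bas:
  assumes j: "j < p" shows "psi (\<lambda>x. c * (z ^ j * bas True (of_nat j) x)) = (c \<odot>\<^bsub>A\<^esub> \<one>\<^bsub>A\<^esub>) \<odot>\<^bsub>N.T\<^esub> N.wj j"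
proof -
  have "psi (\<lambda>x. c * (z ^ j * bas True (of_nat j) x))
    = (\<Oplus>\<^bsub>N.T\<^esub>i\<in>{..<p}. if j = i then (c \<odot>\<^bsub>A\<^esub> \<one>\<^bsub>A\<^esub>) \<odot>\<^bsub>N.T\<^esub> N.wj i else \<zero>\<^bsub>N.T\<^esub>)"
    unfolding psi_def
  proof (rule N.I.T.M.finsum_cong')
    fix i assume "i \<in> {..<p}"
    then have "bas True (of_nat j) (True, of_nat i :: 'k) = (if j = i then 1 else 0)"
      using of_nat_inj[of j i] j by (auto simp: bas_def)
    then show "((c * (z ^ j * bas True (of_nat j) (True, of_nat i)) / z ^ i) \<odot>\<^bsub>A\<^esub> \<one>\<^bsub>A\<^esub>) \<odot>\<^bsub>N.T\<^esub> N.wj i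
      = (if j = i then (c \<odot>\<^bsub>A\<^esub> \<one>\<^bsub>A\<^esub>) \<odot>\<^bsub>N.T\<^esub> N.wj i else \<zero>\<^bsub>N.T\<^esub>)"
      using z by auto
  qed auto
  also have "\<dots> = (c \<odot>\<^bsub>A\<^esub> \<one>\<^bsub>A\<^esub>) \<odot>\<^bsub>N.T\<^esub> N.wj j"
    using j by (intro N.I.T.M.finsum_singleton) auto
  finally show ?thesis .
qed

lemma psi_eta: "t \<in> carrier N.T \<Longrightarrow> psi (eta t) = t"
proof -
  assume "t \<in> carrier N.T"
  then have "t \<in> N.Sp" by (rule N.T_span)
  then show ?thesis
  proof (induction rule: N.Sp.induct)
    case zero
    show ?case using psi_bas[of 0 0] p5 by (simp add: eta_zero)
  next
    case (step t j c)
    have t: "t \<in> carrier N.T" using step(1) by (rule N.Sp_in)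
    have "eta ((c \<odot>\<^bsub>A\<^esub> \<one>\<^bsub>A\<^esub>) \<odot>\<^bsub>N.T\<^esub> N.wj j \<oplus>\<^bsub>N.T\<^esub> t) = (\<lambda>x. c * (z ^ j * bas True (of_nat j) x) + eta t x)"
      using t by (subst eta_add) (simp_all add: eta_sc eta_wj)
    then show ?case using psi_bas[OF step(2)] step(3) by (simp add: psi_add)
  qed
qed

lemma eta_surj: "f \<in> V \<Longrightarrow> \<exists>t\<in>carrier N.T. eta t = f"
proof -
  assume f: "f \<in> V"
  have s: "\<exists>t\<in>carrier N.T. eta t = (\<lambda>x. \<Sum>j\<in>I. f (True, of_nat j) * bas True (of_nat j) x)" if "finite I" for I
    using that
  proof (induction I rule: finite_induct)
    case empty
    show ?case using eta_zero by (intro bexI[of _ "\<zero>\<^bsub>N.T\<^esub>"]) auto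
  next
    case (insert j I)
    then obtain t where t: "t \<in> carrier N.T" "eta t = (\<lambda>x. \<Sum>j\<in>I. f (True, of_nat j) * bas True (of_nat j) x)" by blast
    let ?u = "((f (True, of_nat j) / z ^ j) \<odot>\<^bsub>A\<^esub> \<one>\<^bsub>A\<^esub>) \<odot>\<^bsub>N.T\<^esub> N.wj j"
    have u: "?u \<in> carrier N.T" by simp
    have "eta (?u \<oplus>\<^bsub>N.T\<^esub> t) = (\<lambda>x. f (True, of_nat j) * bas True (of_nat j) x + eta t x)"
      unfolding eta_add[OF u t(1)] eta_sc[OF N.wj_in] eta_wj using z by simp
    then show ?case using t u insert by (intro bexI[of _ "?u \<oplus>\<^bsub>N.T\<^esub> t"]) auto
  qed
  obtain t where t: "t \<in> carrier N.T" "eta t = (\<lambda>x. \<Sum>j<p. f (True, of_nat j) * bas True (of_nat j) x)"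
    using s[of "{..<p}"] by auto
  have "eta t = f"
  proof (rule V_eqI[OF eta_V[OF t(1)] f])
    fix a :: 'k assume "a \<in> prime_field"
    then obtain i where i: "i < p" "a = of_nat i" by (rule prime_field_cases)
    have "eta t (True, a) = (\<Sum>j<p. if j = i then f (True, of_nat j) else 0)"
      unfolding t(2) using i of_nat_inj by (intro sum.cong refl) (auto simp: bas_def)
    then show "eta t (True, a) = f (True, a)" using i by (simp add: sum.delta)
  qed
  then show ?thesis using t by blast
qed

end

context witt_pair
begin

section \<open>Homomorphisms on the annihilator and the linear system\<close>

definition "V_hom \<Phi> \<longleftrightarrow> (\<forall>a\<in>M.J. \<Phi> a \<in> V) \<and>
  (\<forall>a\<in>M.J. \<forall>b\<in>M.J. \<Phi> (a \<oplus>\<^bsub>A\<^esub> b) = (\<lambda>x. \<Phi> a x + \<Phi> b x)) \<and>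
  (\<forall>a\<in>carrier A. \<forall>b\<in>M.J. \<Phi> (a \<otimes>\<^bsub>A\<^esub> b) = app (rep a) (\<Phi> b))"

lemma V_hom_simps:
  assumes "V_hom \<Phi>"
  shows "a \<in> M.J \<Longrightarrow> \<Phi> a \<in> V" "a \<in> M.J \<Longrightarrow> b \<in> M.J \<Longrightarrow> \<Phi> (a \<oplus>\<^bsub>A\<^esub> b) = (\<lambda>x. \<Phi> a x + \<Phi> b x)"
    "a \<in> carrier A \<Longrightarrow> b \<in> M.J \<Longrightarrow> \<Phi> (a \<otimes>\<^bsub>A\<^esub> b) = app (rep a) (\<Phi> b)"
  using assms by (simp_all add: V_hom_def)

lemma V_hom_zero: "V_hom \<Phi> \<Longrightarrow> \<Phi> \<zero>\<^bsub>A\<^esub> = (\<lambda>_. 0)"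
  using V_hom_simps(3)[of \<Phi> "\<zero>\<^bsub>A\<^esub>" "\<zero>\<^bsub>A\<^esub>"] M.J_zero by (simp add: rep_zero app_0)

lemma V_hom_eq:
  assumes V: "V_hom \<Phi>" "V_hom \<Psi>" and s: "\<And>n. 1 \<le> n \<Longrightarrow> n < p \<Longrightarrow> \<Phi> (M.s n) = \<Psi> (M.s n)" and a: "a \<in> M.J"
  shows "\<Phi> a = \<Psi> a"
  using a
proof (induction rule: M.J_induct)
  case zero
  show ?case using V by (simp add: V_hom_zero)
next
  case (s n)
  then show ?case by (rule assms(3))
next
  case (add a b)
  then show ?case using V by (simp add: V_hom_simps(2))
next
  case (mult a b)
  then show ?case using V by (simp add: V_hom_simps(3))
qed

lemma V_hom_lin: "V_hom \<Phi> \<Longrightarrow> V_hom \<Psi> \<Longrightarrow> V_hom (\<lambda>a x. c * \<Phi> a x + \<Psi> a x)"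
  unfolding V_hom_def by (simp add: V_add V_scale app_lin) (simp add: algebra_simps)

lemma V_hom_inner: "v \<in> V \<Longrightarrow> V_hom (\<lambda>a. app (rep a) v)"
  unfolding V_hom_def by (simp add: M.J_in rep_V rep_add rep_mult app_plus app_times)

lemma cocycle_s:
  assumes "1 \<le> n" "n < p"
  shows "app (rep (M.s n)) (bas False 0) = (\<lambda>x. cf n * (d (n - 1) * bas True (de + 1 - of_nat n) x))"
proof -
  have 0: "(0 :: 'k) \<in> prime_field" by (rule prime_field_closed)
  show ?thesis
  proof (cases "n = 1")
    case True
    then show ?thesis unfolding rep_s[OF assms(2)] rep_E_bas(2)[OF assms(2) 0] proj_bas[OF 0] unfolding True cf_1
      by (simp add: mu_m d_0)
  next
    case False
    then obtain i where "n = Suc i" using assms by (cases n) auto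
    then show ?thesis unfolding rep_s[OF assms(2)] rep_E_bas(2)[OF assms(2) 0] using False assms Wt_0[of n "lam - de"]
      by (simp add: Bc_at_0 algebra_simps)
  qed
qed

text \<open>
  Modulo \<open>V\<close> the extension is a copy of \<open>L(m)\<close> generated by the class of \<open>(0, 1\<^sub>0)\<close>, so elements of \<open>J\<close> send
  \<open>(0, 1\<^sub>0)\<close> into \<open>V\<close>.
\<close>

lemma V_hom_cocycle: "V_hom (\<lambda>a. app (rep a) (bas False 0))"
proof -
  have "app (rep a) (bas False 0) \<in> V" if "a \<in> M.J" for a
    using that
  proof (induction rule: M.J_induct)
    case zero
    then show ?case by (simp add: rep_zero app_0 V_zero)
  next
    case (s n)
    have "de + 1 - of_nat n \<in> prime_field" using de_pf by (auto intro!: prime_field_closed)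
    then show ?case unfolding cocycle_s[OF s] by (intro V_scale V_bas)
  next
    case (add a b)
    then show ?case by (simp add: M.J_in rep_add app_plus V_add)
  next
    case (mult a b)
    then show ?case by (simp add: M.J_in rep_mult app_times rep_V)
  qed
  then show ?thesis unfolding V_hom_def by (simp add: M.J_in rep_add rep_mult app_plus app_times)
qed

lemma inner_s:
  assumes "1 \<le> n" "n < p"
  shows "app (rep (M.s n)) (bas True de) = (\<lambda>x. cf n * (inn lam de (n - 1) * bas True (de + 1 - of_nat n) x))"
proof (cases "n = 1")
  case True
  show ?thesis unfolding rep_s[OF assms(2)] rep_E_bas(1)[OF assms(2) de_pf] proj_bas[OF de_pf] unfolding True cf_1
    by (simp add: mu_m inn_def)
next
  case False
  then obtain i where i: "n = Suc i" using assms by (cases n) auto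
  have "1 \<le> i" "i \<le> p - 2" using i False assms by auto
  then show ?thesis unfolding rep_s[OF assms(2)] rep_E_bas(1)[OF assms(2) de_pf] using False i
    by (simp add: inn_def)
qed

lemma s_1_weight: "f \<in> V \<Longrightarrow> a \<in> prime_field \<Longrightarrow> app (rep (M.s 1)) f (True, a) = (de - a) * f (True, a)"
proof -
  assume f: "f \<in> V" and a: "a \<in> prime_field"
  have "app (rep (M.s 1)) f = (\<lambda>x. app (R 1) f x - of_nat m * proj f x)"
    unfolding rep_s[OF p_gt_1] rep_E[OF p_gt_1] cf_1 by (simp add: scalar_op_1)
  moreover have "app (R 1) f (True, a) = (lam - a) * f (True, a)"
    using f a unfolding R_def app_shift_op by (simp add: V_def) (simp add: proj_def prime_field_def)
  ultimately show ?thesis using f by (simp add: V_def mu_m[symmetric] algebra_simps)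
qed

text \<open>
  If \<open>g\<close> is the coefficient of \<open>1\<^sub>\<delta>\<close> in \<open>\<Phi>(e\<^sub>0 - m)\<close>, then the coefficient in \<open>\<Phi>(e\<^sub>0\<^sup>j - m\<^sup>j)\<close> is \<open>j m\<^sup>j\<^sup>-\<^sup>1 g\<close>,
  since \<open>e\<^sub>0\<close> acts by \<open>m\<close> on \<open>1\<^sub>\<delta>\<close>. For \<open>j = p\<close> this is zero, while \<open>e\<^sub>0\<^sup>p - m\<^sup>p = e\<^sub>0 - m\<close>.
\<close>

lemma weight_obstruction: "V_hom \<Phi> \<Longrightarrow> \<Phi> (M.s 1) (True, de) = 0"
proof -
  assume V: "V_hom \<Phi>"
  let ?g = "\<Phi> (M.s 1) (True, de)" and ?mu = "of_nat m :: 'k"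
  have E1: "E 1 \<in> carrier A" using p_gt_1 by simp
  have s1: "M.s 1 \<in> M.J" using p_gt_1 by (intro M.s_J) auto
  define aa where "aa j = E 1 [^]\<^bsub>A\<^esub> (j::nat) \<ominus>\<^bsub>A\<^esub> (?mu ^ j) \<odot>\<^bsub>A\<^esub> \<one>\<^bsub>A\<^esub>" for j
  have aa_Suc: "aa (Suc j) = E 1 \<otimes>\<^bsub>A\<^esub> aa j \<oplus>\<^bsub>A\<^esub> ((?mu ^ j) \<odot>\<^bsub>A\<^esub> \<one>\<^bsub>A\<^esub>) \<otimes>\<^bsub>A\<^esub> M.s 1" for j
  proof -
    define x where "x = E 1 \<otimes>\<^bsub>A\<^esub> E 1 [^]\<^bsub>A\<^esub> j"
    define y where "y = (?mu ^ j) \<odot>\<^bsub>A\<^esub> E 1"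
    define u where "u = (?mu ^ Suc j) \<odot>\<^bsub>A\<^esub> \<one>\<^bsub>A\<^esub>"
    have c: "x \<in> carrier A" "y \<in> carrier A" "u \<in> carrier A" using E1 by (simp_all add: x_def y_def u_def)
    have 1: "E 1 \<otimes>\<^bsub>A\<^esub> aa j = x \<ominus>\<^bsub>A\<^esub> y"
      using E1 by (simp add: aa_def x_def y_def L.A.minus_eq L.A.r_distr L.A.r_minus L.A.smult_assoc3)
    have 2: "((?mu ^ j) \<odot>\<^bsub>A\<^esub> \<one>\<^bsub>A\<^esub>) \<otimes>\<^bsub>A\<^esub> M.s 1 = y \<ominus>\<^bsub>A\<^esub> u"
      using E1 by (simp add: M.s_def u_def y_def L.A.minus_eq L.A.r_distr L.A.r_minus L.A.smult_assoc2 L.A.smult_assoc1[symmetric] mult.commute)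
    have 3: "aa (Suc j) = x \<ominus>\<^bsub>A\<^esub> u" using L.A.nat_pow_Suc2[OF E1, of j] by (simp only: aa_def x_def u_def)
    show ?thesis unfolding 1 2 3 using c by (simp add: L.A.minus_eq L.A.a_assoc L.A.r_neg1)
  qed
  have "aa j \<in> M.J \<and> \<Phi> (aa j) (True, de) = of_nat j * ?mu ^ (j - 1) * ?g" for j
  proof (induction j)
    case 0
    have "aa 0 = \<zero>\<^bsub>A\<^esub>" by (simp add: aa_def L.A.minus_eq L.A.r_neg)
    then show ?case using M.J_zero V_hom_zero[OF V] by simp
  next
    case (Suc j)
    have c: "(?mu ^ j) \<odot>\<^bsub>A\<^esub> \<one>\<^bsub>A\<^esub> \<in> carrier A" by simp
    have J: "E 1 \<otimes>\<^bsub>A\<^esub> aa j \<in> M.J" "((?mu ^ j) \<odot>\<^bsub>A\<^esub> \<one>\<^bsub>A\<^esub>) \<otimes>\<^bsub>A\<^esub> M.s 1 \<in> M.J"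
      using Suc by (auto intro!: M.J_mult E1 s1 c)
    have f: "\<Phi> (aa j) \<in> V" "\<Phi> (M.s 1) \<in> V" using V_hom_simps(1)[OF V] Suc s1 by auto
    have "app (rep (E 1)) (\<Phi> (aa j)) (True, de) = ?mu * \<Phi> (aa j) (True, de)"
      using s_1_weight[OF f(1) de_pf] f(1) unfolding rep_s[OF p_gt_1] by (simp add: V_def)
    moreover have "app (rep ((?mu ^ j) \<odot>\<^bsub>A\<^esub> \<one>\<^bsub>A\<^esub>)) (\<Phi> (M.s 1)) (True, de) = ?mu ^ j * ?g"
      using f(2) by (simp add: rep_sc app_esc proj_scale V_def)
    ultimately have "\<Phi> (aa (Suc j)) (True, de) = ?mu * \<Phi> (aa j) (True, de) + ?mu ^ j * ?g"
      unfolding aa_Suc V_hom_simps(2)[OF V J] using Suc V_hom_simps(3)[OF V E1, of "aa j"] V_hom_simps(3)[OF V c s1]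
      by simp
    also have "\<dots> = of_nat (Suc j) * ?mu ^ (Suc j - 1) * ?g"
      using Suc by (cases j) (simp_all add: algebra_simps)
    finally show ?case using J M.J_add by (simp add: aa_Suc)
  qed
  from this[of p] have "\<Phi> (aa p) (True, de) = 0" by simp
  moreover have "aa p = M.s 1"
    using E_1_pow prime_field_power_p[of ?mu] by (simp add: aa_def M.s_def prime_field_closed)
  ultimately show ?thesis by simp
qed

definition "normal_form \<Phi> e v \<longleftrightarrow> (\<forall>n. 1 \<le> n \<longrightarrow> n < p \<longrightarrow> \<Phi> (M.s n)
   = (\<lambda>x. cf n * (e (n - 1) * bas True (de + 1 - of_nat n) x) + app (rep (M.s n)) v x))"

text \<open>
  Subtracting \<open>a \<mapsto> a v\<close> with \<open>v = (e\<^sub>0 - m)\<^sup>-\<^sup>1 \<Phi>(e\<^sub>0 - m)\<close> makes \<open>\<Phi>(e\<^sub>0 - m)\<close> vanish. Then the bracket of \<open>e\<^sub>0\<close>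
  with \<open>e\<^sub>i\<close> shows that \<open>\<Phi>(e\<^sub>i)\<close> is a multiple of \<open>1\<^sub>\<delta>\<^sub>-\<^sub>i\<close>, and the other brackets are the linear system.
\<close>

lemma V_hom_classify:
  assumes V: "V_hom \<Phi>"
  shows "\<exists>v e. v \<in> V \<and> sol lam de e \<and> normal_form \<Phi> e v"
proof -
  define g where "g = \<Phi> (M.s 1)"
  have sJ: "M.s n \<in> M.J" if "1 \<le> n" "n < p" for n using that by (rule M.s_J)
  have gV: "g \<in> V" unfolding g_def using V_hom_simps(1)[OF V] sJ[of 1] p_gt_1 by simp
  have g0: "g (True, de) = 0" unfolding g_def by (rule weight_obstruction[OF V])
  define v where "v = (\<lambda>(b, a). if b \<and> a \<in> prime_field \<and> a \<noteq> de then g (True, a) / (de - a) else 0)"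
  have vV: "v \<in> V" by (auto simp: V_def proj_def v_def prime_field_def fun_eq_iff)
  define \<Psi> where "\<Psi> = (\<lambda>a x. (-1) * app (rep a) v x + \<Phi> a x)"
  have W: "V_hom \<Psi>" unfolding \<Psi>_def by (rule V_hom_lin[OF V_hom_inner[OF vV] V])
  have \<Psi>V: "\<Psi> (M.s n) \<in> V" if "1 \<le> n" "n < p" for n using V_hom_simps(1)[OF W sJ[OF that]] .
  have \<Psi>1: "\<Psi> (M.s 1) = (\<lambda>_. 0)"
  proof (rule V_eqI[OF \<Psi>V V_zero])
    fix a :: 'k assume a: "a \<in> prime_field"
    show "\<Psi> (M.s 1) (True, a) = 0"
      unfolding \<Psi>_def s_1_weight[OF vV a] using g0 a by (auto simp: g_def[symmetric] v_def)
  qed (use p_gt_1 in auto)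
  have one: "M.s 1 \<in> M.J" "1 < p" using sJ[of 1] p_gt_1 by auto
  have weight: "\<Psi> (M.s n) = (\<lambda>x. \<Psi> (M.s n) (True, de + 1 - of_nat n) * bas True (de + 1 - of_nat n) x)" if n: "2 \<le> n" "n < p" for n
  proof (rule V_eqI)
    have pf: "de + 1 - of_nat n \<in> prime_field" using de_pf by (auto intro!: prime_field_closed)
    then show "(\<lambda>x. \<Psi> (M.s n) (True, de + 1 - of_nat n) * bas True (de + 1 - of_nat n) x) \<in> V" by (intro V_scale V_bas)
    show nV: "\<Psi> (M.s n) \<in> V" using n by (intro \<Psi>V) auto
    have nJ: "M.s n \<in> M.J" using n by (intro sJ) auto
    have c: "((of_nat n - of_nat 1) \<odot>\<^bsub>A\<^esub> \<one>\<^bsub>A\<^esub>) \<in> carrier A" by simp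
    have nA: "M.s n \<in> carrier A" "M.s 1 \<in> carrier A" using n one by auto
    have "M.s 1 \<otimes>\<^bsub>A\<^esub> M.s n = M.s n \<otimes>\<^bsub>A\<^esub> M.s 1 \<oplus>\<^bsub>A\<^esub> ((of_nat n - of_nat 1) \<odot>\<^bsub>A\<^esub> \<one>\<^bsub>A\<^esub>) \<otimes>\<^bsub>A\<^esub> M.s n"
      using M.s_bracket[of 1 n] n one by simp
    from arg_cong[OF this, of \<Psi>]
    have "app (rep (M.s 1)) (\<Psi> (M.s n)) = (\<lambda>x. app (rep (M.s n)) (\<Psi> (M.s 1)) x
        + app (rep ((of_nat n - of_nat 1) \<odot>\<^bsub>A\<^esub> \<one>\<^bsub>A\<^esub>)) (\<Psi> (M.s n)) x)"
      unfolding V_hom_simps(2)[OF W M.J_mult[OF nA(1) one(1)] M.J_mult[OF c nJ]]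
        V_hom_simps(3)[OF W nA(2) nJ] V_hom_simps(3)[OF W nA(1) one(1)] V_hom_simps(3)[OF W c nJ] .
    then have h: "app (rep (M.s 1)) (\<Psi> (M.s n)) = (\<lambda>x. (of_nat n - 1) * \<Psi> (M.s n) x)"
      using nV by (simp add: \<Psi>1 app_zero rep_sc app_esc proj_scale V_def)
    have e: "(de - a) * \<Psi> (M.s n) (True, a) = (of_nat n - 1) * \<Psi> (M.s n) (True, a)" if "a \<in> prime_field" for a
      unfolding s_1_weight[OF nV that, symmetric] h ..
    fix a :: 'k assume "a \<in> prime_field"
    have "(de + 1 - of_nat n - a) * \<Psi> (M.s n) (True, a)
        = (de - a) * \<Psi> (M.s n) (True, a) - (of_nat n - 1) * \<Psi> (M.s n) (True, a)"
      by (simp add: algebra_simps)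
    then have "(de + 1 - of_nat n - a) * \<Psi> (M.s n) (True, a) = 0" using e[OF \<open>a \<in> prime_field\<close>] by simp
    then show "\<Psi> (M.s n) (True, a) = \<Psi> (M.s n) (True, de + 1 - of_nat n) * bas True (de + 1 - of_nat n) (True, a)"
      by (auto simp: bas_def)
  qed
  define e where "e i = (if i \<in> {1..p - 2} then \<Psi> (M.s (Suc i)) (True, de - of_nat i) / cf (Suc i) else 0)" for i
  have val: "\<Psi> (M.s n) = (\<lambda>x. cf n * (e (n - 1) * bas True (de + 1 - of_nat n) x))" if n: "1 \<le> n" "n < p" for n
  proof (cases "n = 1")
    case True
    then show ?thesis using \<Psi>1 by (simp add: e_def)
  next
    case False
    then obtain i where i: "n = Suc i" using n by (cases n) auto
    have "i \<in> {1..p - 2}" "2 \<le> n" using i False n by auto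
    then show ?thesis using weight[of n] n cf_nonzero[of n] i by (simp add: e_def)
  qed
  have "sol lam de e"
    unfolding sol_def
  proof (intro conjI allI impI)
    fix i j :: nat assume ij: "1 \<le> i" "i < j" "j \<le> p - 2"
    define m' n' where "m' = Suc i" and "n' = Suc j"
    have mn: "2 \<le> m'" "2 \<le> n'" "m' < p" "n' < p" "1 \<le> m'" "1 \<le> n'" using ij p5 by (auto simp: m'_def n'_def)
    have J: "M.s m' \<in> M.J" "M.s n' \<in> M.J" using mn by (auto intro!: sJ)
    have A: "M.s m' \<in> carrier A" "M.s n' \<in> carrier A" using mn by auto
    have E: "M.s m' = E m'" "M.s n' = E n'" using mn by (auto intro!: M.s_eq)
    have pf: "de + 1 - of_nat n' \<in> prime_field" "de + 1 - of_nat m' \<in> prime_field"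
      using de_pf by (auto intro!: prime_field_closed)
    let ?y = "(True, de + 1 - of_nat n' + 1 - of_nat m')"
    have y: "de + 1 - of_nat m' + 1 - of_nat n' = de + 1 - of_nat n' + 1 - of_nat m'" by simp
    define K where "K = (if m' + n' \<le> p then ((of_nat n' - of_nat m') \<odot>\<^bsub>A\<^esub> \<one>\<^bsub>A\<^esub>) \<otimes>\<^bsub>A\<^esub> M.s (m' + n' - 1) else \<zero>\<^bsub>A\<^esub>)"
    have KJ: "K \<in> M.J" unfolding K_def using mn by (auto intro!: M.J_mult M.J_zero sJ)
    have "\<Psi> K ?y = cf m' * cf n' * ((of_nat n' - of_nat m') * e (i + j))"
    proof (cases "m' + n' \<le> p")
      case True
      define q where "q = m' + n' - 1"
      have q: "1 \<le> q" "q < p" "q - 1 = i + j" using True mn by (auto simp: q_def m'_def n'_def)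
      have yq: "de + 1 - of_nat q = de + 1 - of_nat n' + 1 - of_nat m'"
        by (simp add: q_def m'_def n'_def algebra_simps)
      have "\<Psi> K = (\<lambda>x. (of_nat n' - of_nat m') * \<Psi> (M.s q) x)"
        using True V_hom_simps(3)[OF W M.sc_in sJ[OF q(1,2)]] \<Psi>V[OF q(1,2)]
        by (simp add: K_def q_def[symmetric] rep_sc app_esc proj_scale V_def)
      then show ?thesis
        unfolding val[OF q(1,2)] q(3) yq using cf_mult[of m' n'] mn by (simp add: bas_def q_def)
    next
      case False
      then have "e (i + j) = 0" by (auto simp: e_def m'_def n'_def)
      then show ?thesis using False by (simp add: K_def V_hom_zero[OF W])
    qed
    moreover have "\<Psi> K ?y = app (rep (M.s m')) (\<Psi> (M.s n')) ?y - app (rep (M.s n')) (\<Psi> (M.s m')) ?y"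
    proof -
      have "M.s m' \<otimes>\<^bsub>A\<^esub> M.s n' = M.s n' \<otimes>\<^bsub>A\<^esub> M.s m' \<oplus>\<^bsub>A\<^esub> K"
        unfolding K_def using mn by (intro M.s_bracket) auto
      from arg_cong[OF this, of \<Psi>] show ?thesis
        unfolding V_hom_simps(2)[OF W M.J_mult[OF A(2) J(1)] KJ] V_hom_simps(3)[OF W A(1) J(2)] V_hom_simps(3)[OF W A(2) J(1)]
        by (simp add: fun_eq_iff)
    qed
    moreover have "app (rep (M.s m')) (\<Psi> (M.s n')) ?y = cf m' * cf n' * (e j * wt lam i (de - of_nat j))"
      unfolding val[OF mn(6,4)] app_scale unfolding E rep_E_bas(1)[OF mn(3) pf(1)]
      by (simp add: bas_def m'_def n'_def)
    moreover have "app (rep (M.s n')) (\<Psi> (M.s m')) ?y = cf m' * cf n' * (e i * wt lam j (de - of_nat i))"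
      unfolding val[OF mn(5,3)] app_scale unfolding E rep_E_bas(1)[OF mn(4) pf(2)] y
      by (simp add: bas_def m'_def n'_def)
    ultimately have "cf m' * cf n' * ((of_nat n' - of_nat m') * e (i + j))
        = cf m' * cf n' * (e j * wt lam i (de - of_nat j) - e i * wt lam j (de - of_nat i))"
      by (simp add: right_diff_distrib)
    then show "(of_nat j - of_nat i) * e (i + j) = e j * wt lam i (de - of_nat j) - e i * wt lam j (de - of_nat i)"
      using cf_nonzero by (simp add: m'_def n'_def)
  qed (auto simp: e_def)
  moreover have "normal_form \<Phi> e v"
    unfolding normal_form_def
  proof (intro allI impI ext)
    fix n x assume n: "1 \<le> n" "n < p"
    have "\<Psi> (M.s n) x = cf n * (e (n - 1) * bas True (de + 1 - of_nat n) x)"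
      unfolding val[OF n] ..
    then show "\<Phi> (M.s n) x = cf n * (e (n - 1) * bas True (de + 1 - of_nat n) x) + app (rep (M.s n)) v x"
      by (simp add: \<Psi>_def diff_eq_eq)
  qed
  ultimately have "v \<in> V \<and> sol lam de e \<and> normal_form \<Phi> e v" using vV by (intro conjI)
  then show ?thesis by (rule exI[of _ v, OF exI[of _ e]])
qed

end

section \<open>The first Ext groups of the modules L(l)\<close>

context witt_pair
begin

lemma cyclic_ext: "cyclic_ext A M.T N.T M.w"
proof -
  have "cyclic_ext_axioms A M.T M.w"
    by (rule cyclic_ext_axioms.intro) (rule M.I.w_in, rule M.I.w_generates)
  then show "cyclic_ext A M.T N.T M.w"
    by (rule cyclic_ext.intro[OF M.I.T_left_module N.I.T_left_module])
qed

abbreviation "C_J \<equiv> cyclic_ext.J A M.T M.w"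
abbreviation "C_J_hom \<equiv> cyclic_ext.J_hom A M.T N.T M.w"
lemmas C_J_def = cyclic_ext.J_def[OF cyclic_ext]
lemmas C_J_hom_def = cyclic_ext.J_hom_def[OF cyclic_ext]

lemma C_J_eq: "C_J = M.J"
proof (rule Set.set_eqI)
  fix a
  show "a \<in> C_J \<longleftrightarrow> a \<in> M.J"
  proof (cases "a \<in> carrier A")
    case True
    have "a \<in> C_J \<longleftrightarrow> a \<odot>\<^bsub>M.T\<^esub> M.w = \<zero>\<^bsub>M.T\<^esub>" 
      unfolding C_J_def mem_Collect_eq by (simp only: True simp_thms)
    then show ?thesis unfolding M.J_def M.I.annihilator_w[OF True] .
  next
    case False
    then have "a \<notin> C_J" unfolding C_J_def mem_Collect_eq by (rule contrapos_nn) (erule conjunct1)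
    moreover have "a \<notin> M.J" using False by (rule contrapos_nn) (rule M.J_in)
    ultimately show ?thesis by (simp only: simp_thms)
  qed
qed

lemma eta_psi: "f \<in> V \<Longrightarrow> eta (psi f) = f"
proof -
  assume "f \<in> V"
  from eta_surj[OF this] obtain t where t: "t \<in> carrier N.T" "eta t = f" by (elim bexE)
  show ?thesis using psi_eta[OF t(1)] unfolding t(2) by (simp only: t(2))
qed

lemma eta_inj: "t \<in> carrier N.T \<Longrightarrow> u \<in> carrier N.T \<Longrightarrow> eta t = eta u \<Longrightarrow> t = u"
  by (rule trans[OF psi_eta[symmetric] trans[OF arg_cong[of _ _ psi] psi_eta]])

lemma J_hom_eta:
  assumes \<phi>: "C_J_hom \<phi>" shows "V_hom (\<lambda>a. eta (\<phi> a))"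
proof -
  have c: "\<phi> a \<in> carrier N.T" if "a \<in> M.J" for a
    using \<phi> that unfolding C_J_hom_def C_J_eq by (elim conjE) (rule bspec)
  have 1: "\<phi> (a \<oplus>\<^bsub>A\<^esub> b) = \<phi> a \<oplus>\<^bsub>N.T\<^esub> \<phi> b" if "a \<in> M.J" "b \<in> M.J" for a b
    using \<phi> that unfolding C_J_hom_def C_J_eq by (elim conjE) (drule (1) bspec, drule (1) bspec, assumption)
  have 2: "\<phi> (a \<otimes>\<^bsub>A\<^esub> b) = a \<odot>\<^bsub>N.T\<^esub> \<phi> b" if "a \<in> carrier A" "b \<in> M.J" for a b
    using \<phi> that unfolding C_J_hom_def C_J_eq by (elim conjE) (drule (1) bspec, drule (1) bspec, assumption)
  show ?thesis
    unfolding V_hom_def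
  proof (intro conjI ballI)
    show "eta (\<phi> a) \<in> V" if "a \<in> M.J" for a by (rule eta_V[OF c[OF that]])
    show "eta (\<phi> (a \<oplus>\<^bsub>A\<^esub> b)) = (\<lambda>x. eta (\<phi> a) x + eta (\<phi> b) x)" if "a \<in> M.J" "b \<in> M.J" for a b
      unfolding 1[OF that] by (rule eta_add[OF c[OF that(1)] c[OF that(2)]])
    show "eta (\<phi> (a \<otimes>\<^bsub>A\<^esub> b)) = app (rep a) (eta (\<phi> b))" if "a \<in> carrier A" "b \<in> M.J" for a b
      unfolding 2[OF that] by (rule eta_act[OF that(1) c[OF that(2)]])
  qed
qed

lemma psi_inner: "a \<in> carrier A \<Longrightarrow> v \<in> V \<Longrightarrow> psi (app (rep a) v) = a \<odot>\<^bsub>N.T\<^esub> psi v"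
proof (rule eta_inj)
  assume a: "a \<in> carrier A" and v: "v \<in> V"
  show "a \<odot>\<^bsub>N.T\<^esub> psi v \<in> carrier N.T" using a psi_in by (rule N.I.T.act_closed)
  show "eta (psi (app (rep a) v)) = eta (a \<odot>\<^bsub>N.T\<^esub> psi v)"
    unfolding eta_act[OF a psi_in] eta_psi[OF v] eta_psi[OF rep_V[OF a v]] ..
qed (rule psi_in)

lemma J_hom_psi:
  assumes V: "V_hom \<Phi>" shows "C_J_hom (\<lambda>a. psi (\<Phi> a))"
proof -
  note s = V_hom_simps[OF V]
  have 1: "psi (\<Phi> (a \<oplus>\<^bsub>A\<^esub> b)) = psi (\<Phi> a) \<oplus>\<^bsub>N.T\<^esub> psi (\<Phi> b)" if "a \<in> M.J" "b \<in> M.J" for a b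
    unfolding s(2)[OF that] by (rule psi_add)
  have 2: "psi (\<Phi> (a \<otimes>\<^bsub>A\<^esub> b)) = a \<odot>\<^bsub>N.T\<^esub> psi (\<Phi> b)" if "a \<in> carrier A" "b \<in> M.J" for a b
    unfolding s(3)[OF that] by (rule psi_inner[OF that(1) s(1)[OF that(2)]])
  show ?thesis
    unfolding C_J_hom_def C_J_eq
    by (intro conjI ballI) (rule psi_in, erule (1) 1, erule (1) 2)
qed

theorem Ext1_rigid:
  assumes "rigid lam de" shows "is_zero_space (Ext1 A M.T N.T)"
proof (rule cyclic_ext.Ext1_zero_if[OF cyclic_ext])
  fix \<phi> assume \<phi>: "C_J_hom \<phi>"
  have V: "V_hom (\<lambda>a. eta (\<phi> a))" by (rule J_hom_eta[OF \<phi>])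
  obtain v e where v: "v \<in> V" and e: "sol lam de e" and nf: "normal_form (\<lambda>a. eta (\<phi> a)) e v"
  proof -
    obtain v where "\<exists>e. v \<in> V \<and> sol lam de e \<and> normal_form (\<lambda>a. eta (\<phi> a)) e v"
      using V_hom_classify[OF V] by (rule exE)
    then obtain e where "v \<in> V \<and> sol lam de e \<and> normal_form (\<lambda>a. eta (\<phi> a)) e v" by (rule exE)
    then show thesis using that by blast
  qed
  note val = nf[unfolded normal_form_def, rule_format]
  obtain c where c: "\<And>n. e n = c * inn lam de n" using assms e unfolding rigid_def by blast
  define u where "u = (\<lambda>x. c * bas True de x + v x)"
  have u: "u \<in> V" unfolding u_def by (intro V_add V_scale V_bas de_pf v)
  show "\<exists>n\<in>carrier N.T. \<forall>a\<in>C_J. \<phi> a = a \<odot>\<^bsub>N.T\<^esub> n"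
  proof (intro bexI ballI)
    fix a assume "a \<in> C_J"
    then have a: "a \<in> M.J" "a \<in> carrier A" using M.J_in by (auto simp: C_J_eq)
    have \<phi>a: "\<phi> a \<in> carrier N.T" using \<phi> \<open>a \<in> C_J\<close> unfolding C_J_hom_def by (elim conjE) (rule bspec)
    have "eta (\<phi> a) = app (rep a) u"
    proof (rule V_hom_eq[OF V V_hom_inner[OF u] _ a(1)])
      fix n assume n: "1 \<le> n" "n < p"
      show "eta (\<phi> (M.s n)) = app (rep (M.s n)) u"
        unfolding val[OF n] u_def app_lin inner_s[OF n] c by (simp add: algebra_simps)
    qed
    then show "\<phi> a = a \<odot>\<^bsub>N.T\<^esub> psi u" using psi_eta[OF \<phi>a] psi_inner[OF a(2) u] by simp
  qed (rule psi_in)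
qed

theorem Ext1_flexible:
  assumes non: "\<nexists>c. \<forall>n. d n = c * inn lam de n"
    and span: "\<And>e. sol lam de e \<Longrightarrow> \<exists>b c. \<forall>n. e n = b * d n + c * inn lam de n"
  shows "iso_to_ground_field (Ext1 A M.T N.T)"
proof (rule cyclic_ext.Ext1_ground_field_if[OF cyclic_ext])
  define \<phi>0 where "\<phi>0 = (\<lambda>a. psi (app (rep a) (bas False 0)))"
  show "C_J_hom \<phi>0" unfolding \<phi>0_def by (rule J_hom_psi[OF V_hom_cocycle])
  have eta0: "eta (\<phi>0 a) = app (rep a) (bas False 0)" if "a \<in> M.J" for a
    unfolding \<phi>0_def using V_hom_simps(1)[OF V_hom_cocycle that] by (rule eta_psi)
  show "\<not> (\<exists>n\<in>carrier N.T. \<forall>a\<in>C_J. \<phi>0 a = a \<odot>\<^bsub>N.T\<^esub> n)"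
  proof
    assume "\<exists>n\<in>carrier N.T. \<forall>a\<in>C_J. \<phi>0 a = a \<odot>\<^bsub>N.T\<^esub> n"
    then obtain t where t: "t \<in> carrier N.T" "\<And>a. a \<in> M.J \<Longrightarrow> \<phi>0 a = a \<odot>\<^bsub>N.T\<^esub> t" unfolding C_J_eq by blast
    define v where "v = eta t"
    have v: "v \<in> V" unfolding v_def using t(1) by (rule eta_V)
    have eq: "app (rep (M.s n)) (bas False 0) = app (rep (M.s n)) v" if n: "1 \<le> n" "n < p" for n
    proof -
      have J: "M.s n \<in> M.J" using n by (rule M.s_J)
      show ?thesis using eta0[OF J] eta_act[OF M.J_in[OF J] t(1)] t(2)[OF J] by (simp add: v_def)
    qed
    have "v = (\<lambda>x. v (True, de) * bas True de x)"
    proof (rule V_eqI[OF v V_scale[OF V_bas[OF de_pf]]])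
      fix a :: 'k assume a: "a \<in> prime_field"
      have "app (rep (M.s 1)) v = (\<lambda>_. 0)"
        using eq[of 1] cocycle_s[of 1] p_gt_1 by (simp add: d_0)
      then have "(de - a) * v (True, a) = 0" using s_1_weight[OF v a] by simp
      then show "v (True, a) = v (True, de) * bas True de (True, a)" by (auto simp: bas_def)
    qed
    then obtain c where c: "v = (\<lambda>x. c * bas True de x)" by blast
    have "d n = c * inn lam de n" for n
    proof (cases "n \<in> {1..p - 2}")
      case True
      then have n: "1 \<le> Suc n" "Suc n < p" by auto
      have "cf (Suc n) * d n = cf (Suc n) * (c * inn lam de n)"
        using fun_cong[OF eq[OF n], of "(True, de + 1 - of_nat (Suc n))"]
        unfolding cocycle_s[OF n] c app_scale inner_s[OF n] by (simp add: bas_def)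
      then show ?thesis using cf_nonzero by simp
    next
      case False
      then show ?thesis using sol_supp[OF sol_d False] unfolding inn_def by (simp only: if_False) simp
    qed
    then show False using non by blast
  qed
  fix \<phi> assume \<phi>: "C_J_hom \<phi>"
  have V: "V_hom (\<lambda>a. eta (\<phi> a))" by (rule J_hom_eta[OF \<phi>])
  obtain v e where v: "v \<in> V" and e: "sol lam de e" and nf: "normal_form (\<lambda>a. eta (\<phi> a)) e v"
  proof -
    obtain v where "\<exists>e. v \<in> V \<and> sol lam de e \<and> normal_form (\<lambda>a. eta (\<phi> a)) e v"
      using V_hom_classify[OF V] by (rule exE)
    then obtain e where "v \<in> V \<and> sol lam de e \<and> normal_form (\<lambda>a. eta (\<phi> a)) e v" by (rule exE)
    then show thesis using that by blast
  qed
  note val = nf[unfolded normal_form_def, rule_format]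
  obtain b c where bc: "\<And>n. e n = b * d n + c * inn lam de n" using span[OF e] by blast
  define u where "u = (\<lambda>x. c * bas True de x + v x)"
  have u: "u \<in> V" unfolding u_def by (intro V_add V_scale V_bas de_pf v)
  show "\<exists>c. \<exists>n\<in>carrier N.T. \<forall>a\<in>C_J. \<phi> a = (c \<odot>\<^bsub>A\<^esub> \<one>\<^bsub>A\<^esub>) \<odot>\<^bsub>N.T\<^esub> \<phi>0 a \<oplus>\<^bsub>N.T\<^esub> a \<odot>\<^bsub>N.T\<^esub> n"
  proof (intro exI bexI ballI)
    fix a assume "a \<in> C_J"
    then have a: "a \<in> M.J" "a \<in> carrier A" using M.J_in by (auto simp: C_J_eq)
    have \<phi>a: "\<phi> a \<in> carrier N.T" using \<phi> \<open>a \<in> C_J\<close> unfolding C_J_hom_def by (elim conjE) (rule bspec)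
    have "eta (\<phi> a) = (\<lambda>x. b * app (rep a) (bas False 0) x + app (rep a) u x)"
    proof (rule V_hom_eq[OF V V_hom_lin[OF V_hom_cocycle V_hom_inner[OF u]] _ a(1)])
      fix n assume n: "1 \<le> n" "n < p"
      show "eta (\<phi> (M.s n)) = (\<lambda>x. b * app (rep (M.s n)) (bas False 0) x + app (rep (M.s n)) u x)"
        unfolding val[OF n] u_def app_lin inner_s[OF n] cocycle_s[OF n] bc by (simp add: algebra_simps)
    qed
    moreover have p0: "\<phi>0 a \<in> carrier N.T" unfolding \<phi>0_def by (rule psi_in)
    have "eta ((b \<odot>\<^bsub>A\<^esub> \<one>\<^bsub>A\<^esub>) \<odot>\<^bsub>N.T\<^esub> \<phi>0 a \<oplus>\<^bsub>N.T\<^esub> a \<odot>\<^bsub>N.T\<^esub> psi u)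
        = (\<lambda>x. b * app (rep a) (bas False 0) x + app (rep a) u x)"
      unfolding eta_add[OF N.I.T.act_closed[OF N.sc_in p0] N.I.T.act_closed[OF a(2) psi_in]]
        eta_sc[OF p0] eta0[OF a(1)] eta_act[OF a(2) psi_in] eta_psi[OF u] ..
    ultimately show "\<phi> a = (b \<odot>\<^bsub>A\<^esub> \<one>\<^bsub>A\<^esub>) \<odot>\<^bsub>N.T\<^esub> \<phi>0 a \<oplus>\<^bsub>N.T\<^esub> a \<odot>\<^bsub>N.T\<^esub> psi u"
      using \<phi>a N.I.T.M.a_closed[OF N.I.T.act_closed[OF N.sc_in p0] N.I.T.act_closed[OF a(2) psi_in]]
      by (intro eta_inj) (simp_all only:)
  qed (rule psi_in)
qed

lemma witt_Ext1_eq: "witt_Ext1 p P \<chi> m l = Ext1 A M.T N.T"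
  by (simp add: witt_Ext1_def witt_L_def witt_borel_def)

end

context witt_restricted
begin

text \<open>
  The trivial extension \<open>d = 0\<close> provides the model of \<open>L(l)\<close>.
\<close>

lemma witt_Ext1_rigid:
  assumes "rigid (of_nat l :: 'k) (of_nat l - of_nat m)"
  shows "is_zero_space (witt_Ext1 p P \<chi> m l)"
proof -
  interpret witt_pair p k_type P \<chi> "of_nat l" "of_nat l - of_nat m" "\<lambda>_. 0" l m
    by unfold_locales (auto intro!: prime_field_closed simp: sol_def)
  show ?thesis unfolding witt_Ext1_eq by (rule Ext1_rigid[OF assms])
qed

lemma witt_Ext1_flexible:
  assumes flex: "flexible (of_nat l :: 'k) (of_nat l - of_nat m)" and "(of_nat l :: 'k) \<noteq> of_nat m \<or> l = 0"
  shows "iso_to_ground_field (witt_Ext1 p P \<chi> m l)"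
proof -
  obtain d0 :: "nat \<Rightarrow> 'k" where d0: "sol (of_nat l) (of_nat l - of_nat m) d0"
    "\<nexists>c. \<forall>n. d0 n = c * inn (of_nat l) (of_nat l - of_nat m) n"
    "\<And>d. sol (of_nat l) (of_nat l - of_nat m) d \<Longrightarrow> \<exists>b c. \<forall>n. d n = b * d0 n + c * inn (of_nat l) (of_nat l - of_nat m) n"
    using flex unfolding flexible_def by blast
  interpret witt_pair p k_type P \<chi> "of_nat l" "of_nat l - of_nat m" d0 l m
    by unfold_locales (use assms(2) d0(1) in \<open>auto intro!: prime_field_closed\<close>)
  show ?thesis unfolding witt_Ext1_eq by (rule Ext1_flexible[OF d0(2,3)])
qed

end

theorem theorem4p1:
  fixes p :: nat
    and P :: "(int \<Rightarrow> 'k::alg_closed_field) \<Rightarrow> (int \<Rightarrow> 'k)"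
    and \<chi> :: "(int \<Rightarrow> 'k) \<Rightarrow> 'k"
    and l m :: nat
  assumes "CHAR('k) = p" and "5 \<le> p"
    and "is_p_mapping p (witt p P)"
    and "\<forall>i\<in>{-1..int p - 2}. P (witt_e i) = (if i = 0 then witt_e i else (\<lambda>_. 0))"
    and "linear_form (witt p P) \<chi>" and "height p \<chi> = 0"
    and "l \<le> p - 2" and "m \<le> p - 2"
  shows
    "(p = 5 \<longrightarrow>
       (if [int l - int m = 2] (mod int p) \<or> [int l - int m = 3] (mod int p) \<or>
           (m, l) \<in> {(0, 0), (1, 0), (0, 1)}
        then iso_to_ground_field (witt_Ext1 p P \<chi> m l)
        else is_zero_space (witt_Ext1 p P \<chi> m l))) \<and>
     (7 \<le> p \<longrightarrow>
       (if [int l - int m = 2] (mod int p) \<or> [int l - int m = 3] (mod int p) \<or>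
           [int l - int m = 4] (mod int p) \<or>
           (m = 0 \<and> l = 0) \<or> (m = 0 \<and> l = 1) \<or> ([int m = -5] (mod int p) \<and> l = 0) \<or>
           ([2 * (int l)\<^sup>2 - 10 * int l + 3 = 0] (mod int p) \<and> [int l - int m = 6] (mod int p))
        then iso_to_ground_field (witt_Ext1 p P \<chi> m l)
        else is_zero_space (witt_Ext1 p P \<chi> m l)))"
proof -
  interpret witt_restricted p "TYPE('k)" P \<chi>
    by unfold_locales (rule assms)+
  have c: "[a = b] (mod int p) \<longleftrightarrow> (of_int a :: 'k) = of_int b" for a b
    using of_int_eq_iff_cong_CHAR[where 'a = 'k, of a b] assms(1) by simp
  have lm: "l = m" if "(of_nat l :: 'k) = of_nat m"
    using that assms(2,7,8) by (intro of_nat_inj) auto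
  have diff: "[int l - int m = b] (mod int p) \<longleftrightarrow> (of_nat l - of_nat m :: 'k) = of_int b" for b
    by (simp add: c)
  have nc: "\<not> [0 = b] (mod int p)" if "0 < b" "b < int p" for b
    using that by (simp add: cong_def)
  show ?thesis
  proof (intro conjI impI)
    assume p: "p = 5"
    let ?C = "[int l - int m = 2] (mod int p) \<or> [int l - int m = 3] (mod int p) \<or>
           (m, l) \<in> {(0, 0), (1, 0), (0, 1)}"
    let ?D = "(of_nat l - of_nat m :: 'k) = 2 \<or> (of_nat l - of_nat m :: 'k) = 3 \<or> (m, l) \<in> {(0, 0), (1, 0), (0, 1)}"
    have C: "?C \<longleftrightarrow> ?D"
      unfolding diff by simp
    have nz: "(of_nat l :: 'k) \<noteq> of_nat m \<or> l = 0" if ?C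
    proof (rule ccontr)
      assume "\<not> ((of_nat l :: 'k) \<noteq> of_nat m \<or> l = 0)"
      then have e: "l = m" using lm by blast
      then have "m \<noteq> 0" using \<open>\<not> ((of_nat l :: 'k) \<noteq> of_nat m \<or> l = 0)\<close> by simp
      have z: "int l - int m = 0" using e by simp
      have "\<not> [int l - int m = 2] (mod int p)" "\<not> [int l - int m = 3] (mod int p)"
        unfolding z using p by (intro nc; simp)+
      moreover have "(m, l) \<notin> {(0, 0), (1, 0), (0, 1)}" using e \<open>m \<noteq> 0\<close> by simp
      ultimately show False using that by blast
    qed
    show "if ?C then iso_to_ground_field (witt_Ext1 p P \<chi> m l) else is_zero_space (witt_Ext1 p P \<chi> m l)"
    proof (cases ?C)
      case True
      show ?thesis unfolding if_P[OF True]
        by (rule witt_Ext1_flexible[OF classification_5(1)[OF p assms(7,8) iffD1[OF C True]] nz[OF True]])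
    next
      case False
      have "\<not> ?D" using False iffD2[OF C] by (rule contrapos_nn)
      then show ?thesis unfolding if_not_P[OF False]
        by (rule witt_Ext1_rigid[OF classification_5(2)[OF p assms(7,8)]])
    qed
  next
    assume p: "7 \<le> p"
    let ?C = "[int l - int m = 2] (mod int p) \<or> [int l - int m = 3] (mod int p) \<or>
           [int l - int m = 4] (mod int p) \<or>
           (m = 0 \<and> l = 0) \<or> (m = 0 \<and> l = 1) \<or> ([int m = -5] (mod int p) \<and> l = 0) \<or>
           ([2 * (int l)\<^sup>2 - 10 * int l + 3 = 0] (mod int p) \<and> [int l - int m = 6] (mod int p))"
    let ?D = "(of_nat l - of_nat m :: 'k) = 2 \<or> (of_nat l - of_nat m :: 'k) = 3 \<or> (of_nat l - of_nat m :: 'k) = 4 \<or>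
           (m = 0 \<and> l = 0) \<or> (m = 0 \<and> l = 1) \<or> (of_nat m = (-5 :: 'k) \<and> l = 0) \<or>
           (2 * (of_nat l)\<^sup>2 - 10 * of_nat l + 3 = (0 :: 'k) \<and> (of_nat l - of_nat m :: 'k) = 6)"
    have C: "?C \<longleftrightarrow> ?D"
      unfolding diff unfolding c by simp
    have nz: "(of_nat l :: 'k) \<noteq> of_nat m \<or> l = 0" if ?C
    proof (rule ccontr)
      assume "\<not> ((of_nat l :: 'k) \<noteq> of_nat m \<or> l = 0)"
      then have e: "l = m" using lm by blast
      then have "m \<noteq> 0" using \<open>\<not> ((of_nat l :: 'k) \<noteq> of_nat m \<or> l = 0)\<close> by simp
      have z: "int l - int m = 0" using e by simp
      have "\<not> [int l - int m = 2] (mod int p)" "\<not> [int l - int m = 3] (mod int p)"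
        "\<not> [int l - int m = 4] (mod int p)" "\<not> [int l - int m = 6] (mod int p)"
        unfolding z using p by (intro nc; simp)+
      then show False using that e \<open>m \<noteq> 0\<close> by blast
    qed
    show "if ?C then iso_to_ground_field (witt_Ext1 p P \<chi> m l) else is_zero_space (witt_Ext1 p P \<chi> m l)"
    proof (cases ?C)
      case True
      show ?thesis unfolding if_P[OF True]
        by (rule witt_Ext1_flexible[OF classification_7(1)[OF p assms(7,8) iffD1[OF C True]] nz[OF True]])
    next
      case False
      have "\<not> ?D" using False iffD2[OF C] by (rule contrapos_nn)
      then show ?thesis unfolding if_not_P[OF False]
        by (rule witt_Ext1_rigid[OF classification_7(2)[OF p assms(7,8)]])
    qed
  qed
qed

end
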